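(* Let $\nu>0$, let $H:\mathbb{R}^2\to\mathbb{R}$ and $u:\mathbb{R}^2\times\mathbb{S}^1\to\mathbb{R}^2$ be analytic, let $J=\begin{pmatrix}0&1\\-1&0\end{pmatrix}$, and consider, for a small parameter $\epsilon$, the system $$\dot{x}=J\,\mathrm{D}H(x)+\epsilon u(x,\phi),\qquad \dot\phi=\nu,\qquad (x,\phi)\in\mathbb{R}^2\times\mathbb{S}^1 ,$$ i.e. $\dot x=J\,\mathrm{D}H(x)+\epsilon u(x,\nu t)$ made autonomous. Assume that the unperturbed system $\dot x=J\,\mathrm{D}H(x)$ has a one-parameter family of periodic orbits $x^\alpha(t)$, $\alpha\in(\alpha_1,\alpha_2)$ with $\alpha_1<\alpha_2$, of period $T^\alpha>0$, and that $x^\alpha(t)$ is analytic with respect to $\alpha\in(\alpha_1,\alpha_2)$. Let $l,n>0$ be relatively prime integers and suppose that at $\alpha=\alpha^{l/n}\in(\alpha_1,\alpha_2)$ the resonance condition $$\frac{2\pi}{T^\alpha}=\frac{n}{l}\,\nu$$ holds. Suppose that at $\alpha=\alpha^{l/n}$ one has $\mathrm{d}T^\alpha/\mathrm{d}\alpha\neq0$, and that for some $\phi=\phi_0\in\mathbb{S}^1$ there exists a closed loop $\gamma_{\phi}$ in a domain in $\mathbb{C}$ including $(0,2\pi l/\nu)$ such that $\gamma_\phi\cap\bigl(i\mathbb{R}\cup(2\pi l/\nu+i\mathbb{R})\bigr)=\emptyset$ and $$\hat{\mathscr{I}}(\phi)=\int_{\gamma_\phi}\mathrm{D}H(x^\alpha(\tau))\cdot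 u\bigl(x^\alpha(\tau),\nu\tau+\phi\bigr)\,\mathrm{d}\tau\neq0 .$$ Then, for any domain $\hat\Gamma$ in $\mathbb{C}/(2\pi l/\nu)\mathbb{Z}$ containing $\mathbb{R}/(2\pi l/\nu)\mathbb{Z}$ and $\gamma_{\phi_0}$, the system is not meromorphically integrable in the Bogoyavlenskij sense near the resonant periodic orbit $(x,\phi)=(x^\alpha(\tau),\nu\tau+\phi_0)$, $\tau\in\hat\Gamma$, $\alpha=\alpha^{l/n}$, in such a way that the first integrals and commutative vector fields also depend meromorphically on $\epsilon$ near $\epsilon=0$. Moreover, if there is a dense set $\hat\Delta\subset\mathbb{S}^1$ such that for every $\phi\in\hat\Delta$ there is such a loop $\gamma_\phi$ with $\hat{\mathscr{I}}(\phi)\neq0$, and $\hat\Gamma$ contains $\mathbb{R}/(2\pi l/\nu)\mathbb{Z}$ and the loops $\gamma_\phi$, $\phi\in\hat\Delta$, then the same conclusion holds near any periodic orbit on the resonant torus $$\mathscr{T}^\ast=\{(x^\alpha(\tau),\nu\tau+\phi)\mid\tau\in\hat\Gamma,\ \phi\in\mathbb{S}^1,\ \alpha=\alpha^{l/n}\}.$$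
   Context: Complexification: time $t$ is extended to a domain of $\mathbb{C}$ including $\mathbb{R}$, the state variables $(x,\phi)$ are extended correspondingly to $\mathbb{C}^2\times(\mathbb{C}/2\pi\mathbb{Z})$, and $H$, $u$, $x^\alpha$ denote the analytic continuations of the real-analytic objects. The loop $\gamma_\phi$ is such that the integrand is analytic along it, and it is regarded in $\mathbb{C}/(2\pi l/\nu)\mathbb{Z}$ by projection. The dot "$\cdot$" is the (bilinear) inner product. $\mathbb{S}^1=\mathbb{R}/2\pi\mathbb{Z}$. Bogoyavlenskij integrability: an $N$-dimensional system $\dot y=f(y)$ is $(q,N-q)$-integrable, or simply integrable, if there are $q$ vector fields $f_1:=f,f_2,\dots,f_q$ and $N-q$ scalar functions $F_1,\dots,F_{N-q}$ such that (i) $f_1,\dots,f_q$ are linearly independent almost everywhere and commute, $[f_j,f_k]=\mathrm{D}f_k\,f_j-\mathrm{D}f_j\,f_k\equiv0$; (ii) $\mathrm{D}F_1,\dots,\mathrm{D}F_{N-q}$ are linearly independent almost everywhere and $\mathrm{D}F_k\cdot f_j\equiv0$ for all $j,k$. It is meromorphically integrable if the $f_j$ and $F_k$ are meromorphic. For a family $\dot y=f(y;\epsilon)$, "not meromorphically integrable near an orbit $\mathcal{O}$ such that the first integrals and commutative vector fields also depend meromorphically on $\epsilon$ near $\epsilon=0$" means: for no $q\in\{1,\dots,N\}$ and no neighborhood of $\mathcal{O}\times\{\epsilon=0\}$ in the complexified (state, parameter) space do there exist $f_1=f(\cdot;\epsilon),f_2,\dots,f_q$ and $F_1,\dots,F_{N-q}$,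 meromorphic in $(y,\epsilon)$ on that neighborhood, satisfying (i) and (ii) (brackets and derivatives taken in $y$, identities holding identically in $(y,\epsilon)$, independence almost everywhere). Here $N=3$, $y=(x,\phi)$, and $\mathcal{O}=\{(x^\alpha(\tau),\nu\tau+\phi_0)\mid\tau\in\hat\Gamma\}$ (at those $\tau$ where $x^\alpha$ is finite).
   Formalization: The "Moreover" claim is false for arbitrary neighborhoods of one orbit; it is proved for neighborhoods that also contain the nearby orbits of the resonant torus, and for arbitrary neighborhoods when the loops for phases near the given one stay in a compact part of Γ̂ where x^α is finite. *)

theory Defs
  imports "HOL-Complex_Analysis.Complex_Analysis"
begin

unbundle no fps_syntax

section \<open>Analytic and meromorphic functions of several variables\<close>

text \<open>
  For \<open>'a = real\<close> this is real analyticity and for \<open>'a = complex\<close> it is holomorphy; the sum ranges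
  over all multi-indices \<open>k :: 'n \<Rightarrow> nat\<close>.
\<close>
definition multi_analytic_on ::
    "('a::{real_normed_field, banach}^'n \<Rightarrow> 'a) \<Rightarrow> ('a^'n) set \<Rightarrow> bool" where
  "multi_analytic_on f S \<longleftrightarrow>
     (\<forall>a\<in>S. \<exists>r>0. \<exists>c. \<forall>y\<in>ball a r.
        ((\<lambda>k. c k * (\<Prod>i\<in>UNIV. (y $ i - a $ i) ^ k i)) has_sum f y) UNIV)"

text \<open>
  Locally a quotient of analytic functions with denominator not identically zero. The value of \<open>f\<close>
  at a zero of the denominator is arbitrary, so an identity between meromorphic functions
  has to be read at the points where the functions involved are analytic; these are open and dense.
\<close>
definition multi_meromorphic_on :: "(complex^'n \<Rightarrow> complex) \<Rightarrow> (complex^'n) set \<Rightarrow> bool" where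
  "multi_meromorphic_on f U \<longleftrightarrow>
     (\<forall>a\<in>U. \<exists>B g h. open B \<and> connected B \<and> a \<in> B \<and> B \<subseteq> U \<and>
        multi_analytic_on g B \<and> multi_analytic_on h B \<and> (\<exists>z\<in>B. h z \<noteq> 0) \<and>
        (\<forall>z\<in>B. h z \<noteq> 0 \<longrightarrow> f z = g z / h z))"

definition partial_deriv ::
    "('a::real_normed_field^'n \<Rightarrow> 'a) \<Rightarrow> 'n \<Rightarrow> 'a^'n \<Rightarrow> 'a" where
  "partial_deriv f i y = deriv (\<lambda>s. f (y + axis i s)) 0"

definition grad :: "('a::real_normed_field^'n \<Rightarrow> 'a) \<Rightarrow> 'a^'n \<Rightarrow> 'a^'n" where
  "grad f y = (\<chi> i. partial_deriv f i y)"

text \<open>Unlike \<open>inner\<close>, this product is bilinear over \<open>'a\<close>.\<close>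
definition bdot :: "'a::comm_semiring_0^'n \<Rightarrow> 'a^'n \<Rightarrow> 'a" where
  "bdot v w = (\<Sum>i\<in>UNIV. v $ i * w $ i)"

definition complexify :: "real^'n \<Rightarrow> complex^'n" where
  "complexify x = (\<chi> i. complex_of_real (x $ i))"

definition analytic_continuation ::
    "(complex^'n) set \<Rightarrow> (complex^'n \<Rightarrow> complex) \<Rightarrow> (real^'n \<Rightarrow> real) \<Rightarrow> bool" where
  "analytic_continuation W fc f \<longleftrightarrow>
     open W \<and> connected W \<and> multi_analytic_on fc W \<and>
     (\<forall>x. complexify x \<in> W \<and> fc (complexify x) = complex_of_real (f x))"


section \<open>Bogoyavlenskij integrability of a family of vector fields\<close>

text \<open>
  A pair \<open>(y, \<epsilon>)\<close> of a state and a parameter is a vector indexed by \<open>'n option\<close>: the component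
  \<open>Some i\<close> is \<open>y\<^sub>i\<close> and the component \<open>None\<close> is \<open>\<epsilon>\<close>.
\<close>
definition with_param :: "'a^'n \<Rightarrow> 'a \<Rightarrow> 'a^('n::finite option)" where
  "with_param y e = (\<chi> k. case k of None \<Rightarrow> e | Some i \<Rightarrow> y $ i)"

definition state :: "'a^('n::finite option) \<Rightarrow> 'a^'n" where
  "state p = (\<chi> i. p $ Some i)"

definition param :: "'a^('n::finite option) \<Rightarrow> 'a" where
  "param p = p $ None"

definition state_grad ::
    "(complex^('n::finite option) \<Rightarrow> complex) \<Rightarrow> complex^('n::finite option) \<Rightarrow> complex^'n" where
  "state_grad F p = (\<chi> i. partial_deriv F (Some i) p)"

definition state_bracket ::
    "(complex^('n::finite option) \<Rightarrow> complex^'n) \<Rightarrow> (complex^('n::finite option) \<Rightarrow> complex^'n) \<Rightarrow>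
     complex^('n::finite option) \<Rightarrow> complex^'n" where
  "state_bracket f g p =
     (\<chi> i. bdot (state_grad (\<lambda>p. g p $ i) p) (f p) - bdot (state_grad (\<lambda>p. f p $ i) p) (g p))"

definition lin_indep_family :: "nat \<Rightarrow> (nat \<Rightarrow> complex^'n) \<Rightarrow> bool" where
  "lin_indep_family m v \<longleftrightarrow>
     (\<forall>c. (\<Sum>j<m. c j *s v j) = 0 \<longrightarrow> (\<forall>j<m. c j = 0))"

definition field_analytic_at ::
    "(complex^('n::finite option) \<Rightarrow> complex^'n) \<Rightarrow> complex^('n::finite option) \<Rightarrow> bool" where
  "field_analytic_at f p \<longleftrightarrow> (\<forall>i. multi_analytic_on (\<lambda>p. f p $ i) {p})"

text \<open>
  The state space is \<open>\<complex>\<^sup>N\<close> modulo the translation by \<open>w\<close>; its open subsets and the functions on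
  them are given by \<open>w\<close>-invariant open subsets of \<open>\<complex>\<^sup>N\<close> and \<open>w\<close>-invariant functions. The vector field
  \<open>f\<close> is given on the set \<open>E\<close> of pairs \<open>(y, \<epsilon>)\<close> only, so \<open>g 0\<close> is a meromorphic
  continuation of it to \<open>U\<close>. The fields \<open>f\<^sub>1, \<dots>, f\<^sub>q\<close> are \<open>g 0, \<dots>, g (q - 1)\<close>.
\<close>
definition meromorphically_integrable_near ::
    "complex^'n \<Rightarrow> (complex^('n::finite option)) set \<Rightarrow> (complex^('n::finite option) \<Rightarrow> complex^'n) \<Rightarrow>
     (complex^'n) set \<Rightarrow> bool" where
  "meromorphically_integrable_near w E f S \<longleftrightarrow>
     (\<exists>q\<in>{1..CARD('n)}. \<exists>U g F.
        open U \<and> (\<forall>y\<in>S. with_param y 0 \<in> U) \<and>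
        (\<forall>p. p + with_param w 0 \<in> U \<longleftrightarrow> p \<in> U) \<and>
        (\<forall>j<q. (\<forall>i. multi_meromorphic_on (\<lambda>p. g j p $ i) U) \<and>
               (\<forall>p\<in>U. g j (p + with_param w 0) = g j p)) \<and>
        (\<forall>k<CARD('n) - q. multi_meromorphic_on (F k) U \<and>
               (\<forall>p\<in>U. F k (p + with_param w 0) = F k p)) \<and>
        (\<forall>p\<in>U \<inter> E. g 0 p = f p) \<and>
        negligible {p\<in>U. \<not> lin_indep_family q (\<lambda>j. g j p)} \<and>
        (\<forall>j<q. \<forall>k<q. \<forall>p\<in>U. field_analytic_at (g j) p \<and> field_analytic_at (g k) p \<longrightarrow>
               state_bracket (g j) (g k) p = 0) \<and>
        negligible {p\<in>U. \<not> lin_indep_family (CARD('n) - q) (\<lambda>k. state_grad (F k) p)} \<and>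
        (\<forall>j<q. \<forall>k<CARD('n) - q. \<forall>p\<in>U.
               field_analytic_at (g j) p \<and> multi_analytic_on (F k) {p} \<longrightarrow>
               bdot (state_grad (F k) p) (g j p) = 0))"


section \<open>Time-periodic perturbations of planar Hamiltonian systems\<close>

definition Jmat :: "'a::comm_ring_1^2^2" where
  "Jmat = vector [vector [0, 1], vector [- 1, 0]]"

definition point :: "'a::zero^2 \<Rightarrow> 'a \<Rightarrow> 'a^3" where
  "point x \<phi> = vector [x $ 1, x $ 2, \<phi>]"

definition position :: "'a::zero^3 \<Rightarrow> 'a^2" where
  "position y = vector [y $ 1, y $ 2]"

text \<open>The angle \<open>\<phi>\<close> is the third coordinate, taken modulo this vector.\<close>
definition angle_period :: "'a::real_normed_field^3" where
  "angle_period = axis 3 (of_real (2 * pi))"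

definition perturbed_field ::
    "(complex^2 \<Rightarrow> complex) \<Rightarrow> (complex^3 \<Rightarrow> complex^2) \<Rightarrow> real \<Rightarrow>
     complex^(3 option) \<Rightarrow> complex^3" where
  "perturbed_field H u \<nu> p =
     point (Jmat *v grad H (position (state p)) + param p *s u (state p)) (of_real \<nu>)"

definition finite_at :: "(complex \<Rightarrow> complex^2) \<Rightarrow> complex \<Rightarrow> bool" where
  "finite_at x \<tau> \<longleftrightarrow> (\<forall>i. (\<lambda>z. x z $ i) analytic_on {\<tau>})"

definition complex_orbit ::
    "real \<Rightarrow> (complex \<Rightarrow> complex^2) \<Rightarrow> complex set \<Rightarrow> real \<Rightarrow> (complex^3) set" where
  "complex_orbit \<nu> x G \<phi> =
     {point (x \<tau>) (of_real \<nu> * \<tau> + of_real \<phi>) | \<tau>. \<tau> \<in> G \<and> finite_at x \<tau>}"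

text \<open>
  The domains of \<open>\<complex>/P\<int>\<close> containing \<open>\<real>/P\<int>\<close> correspond, by taking the preimage, to the \<open>P\<close>-periodic
  domains of \<open>\<complex>\<close> containing \<open>\<real>\<close> (the preimage is connected because it contains \<open>\<real>\<close>).
\<close>
definition periodic_domain :: "real \<Rightarrow> complex set \<Rightarrow> bool" where
  "periodic_domain P G \<longleftrightarrow>
     open G \<and> connected G \<and> (\<forall>\<tau>. \<tau> + of_real P \<in> G \<longleftrightarrow> \<tau> \<in> G) \<and> range complex_of_real \<subseteq> G"

text \<open>
  \<open>\<Theta>\<close> is the complex time domain of \<open>x\<close>, and \<open>W\<close>, \<open>V\<close> are the domains of the continued \<open>H\<close>, \<open>u\<close>.
  The last condition makes the integrand of \<open>melnikov_integral\<close> analytic along the loop.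
\<close>
definition admissible_loop ::
    "real \<Rightarrow> real \<Rightarrow> complex set \<Rightarrow> (complex^2) set \<Rightarrow> (complex^3) set \<Rightarrow>
     (complex \<Rightarrow> complex^2) \<Rightarrow> real \<Rightarrow> (real \<Rightarrow> complex) \<Rightarrow> bool" where
  "admissible_loop \<nu> P \<Theta> W V x \<phi> \<gamma> \<longleftrightarrow>
     valid_path \<gamma> \<and> pathfinish \<gamma> = pathstart \<gamma> \<and>
     (\<exists>D. open D \<and> connected D \<and> D \<subseteq> \<Theta> \<and> complex_of_real ` {0<..<P} \<subseteq> D \<and> path_image \<gamma> \<subseteq> D) \<and>
     path_image \<gamma> \<inter> {\<tau>. Re \<tau> = 0 \<or> Re \<tau> = P} = {} \<and>
     (\<forall>\<tau>\<in>path_image \<gamma>. finite_at x \<tau> \<and> x \<tau> \<in> W \<and>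
        point (x \<tau>) (of_real \<nu> * \<tau> + of_real \<phi>) \<in> V)"

definition melnikov_integral ::
    "(complex^2 \<Rightarrow> complex) \<Rightarrow> (complex^3 \<Rightarrow> complex^2) \<Rightarrow> real \<Rightarrow> (complex \<Rightarrow> complex^2) \<Rightarrow>
     real \<Rightarrow> (real \<Rightarrow> complex) \<Rightarrow> complex" where
  "melnikov_integral H u \<nu> x \<phi> \<gamma> =
     contour_integral \<gamma>
       (\<lambda>\<tau>. bdot (grad H (x \<tau>)) (u (point (x \<tau>) (of_real \<nu> * \<tau> + of_real \<phi>))))"

end

theory Submission
  imports Defs
begin

no_notation fps_nth (infixl \<open>$\<close> 75)
hide_const (open) Infinite_Set_Sum.abs_summable_on

text \<open>
 A first integral gives an exact 1-form annihilating the vector field; three commuting fields give two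
 independent closed ones, from the dual coframe. Pull such a form back to coordinates \<open>(b, \<tau>, s, \<epsilon>)\<close>
 in which the unperturbed flow is \<open>\<partial>\<^sub>\<tau>\<close>, and divide by powers of \<open>\<epsilon>\<close> until its limit
 at \<open>\<epsilon> = 0\<close> is nonzero. The limit is \<open>p db + q ds\<close> with \<open>p\<close>, \<open>q\<close> independent of \<open>\<tau>\<close>.
 Going once around a real orbit shifts \<open>s\<close> by a nonconstant \<open>c(b)\<close>, as \<open>dT/d\<alpha> \<noteq> 0\<close>; this forces
 \<open>q = 0\<close>. At the next order, the integral along \<open>\<gamma>\<close> shows that \<open>p\<close> times the Melnikov integral is a
 constant. The constant is 0 for an exact form, a contradiction. Two closed forms have proportional
 limits, so subtracting multiples with coefficients in \<open>\<epsilon>\<close> raises the order of vanishing of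
 their wedge product indefinitely.
\<close>

text \<open>Two obstacles shape the argument. The forms are only meromorphic and may be singular
  along the whole orbit, so nothing is evaluated at \<open>b = 0\<close>. Once powers of the
  parameter are cleared, for small \<open>b \<noteq> 0\<close> and \<open>s\<close> near a generic
  \<open>s0\<close> the singular times at parameter 0 are countable. A connected open plane set
  stays connected without a countable set, so continuation in \<tau> still works, and a power
  \<open>b ^ J\<close> absorbs the pole at \<open>b = 0\<close>. Moreover, between real time and the
  loop the orbit may leave the domains of the continued \<open>H\<close> and \<open>u\<close>. There
  the system is known only through the given meromorphic vector field, which has to carry the
  unperturbed equation over to the loop. That \<open>q\<close> vanishes has two cases. The loop
  first makes \<open>p * M + q * N\<close> constant, where \<open>M\<close> and \<open>N\<close> are
  the loop integrals belonging to \<open>db\<close> and \<open>ds\<close>; closedness with monodromy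
  makes \<open>c * q\<close> constant. If \<open>q\<close> is bounded at \<open>b = 0\<close>, then
  \<open>c \<rightarrow> 0\<close> makes the latter constant 0. If \<open>q\<close> has a pole, then
  \<open>p\<close> has slope \<open>q'\<close> in \<open>s\<close>, with a pole one order higher,
  which \<open>p * M + q * N\<close> cannot balance because \<open>M \<noteq> 0\<close>.\<close>

abbreviation "pd \<equiv> partial_deriv"

section \<open>Holomorphic functions of several variables\<close>

text \<open>\<open>bdot G\<close> is complex linear, so a real Frechet derivative of this form is
  complex differentiability, with the gradient \<open>G\<close> as witness.\<close>

definition has_cgrad :: "(complex^'n => complex) => complex^'n => complex^'n => bool" where
 "has_cgrad f G p \<longleftrightarrow> (f has_derivative bdot G) (at p)"

definition holo :: "(complex^'n => complex) => (complex^'n) set => bool" where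
 "holo f S \<longleftrightarrow> open S & (\<forall>p\<in>S. \<exists>G. has_cgrad f G p)"

lemma bdot_add_left: "bdot (a + b) v = bdot a v + bdot b (v::'a::comm_ring_1^'n)" by (simp add: bdot_def sum.distrib algebra_simps)

lemma bdot_scale_left: "bdot (c *s a) v = c * bdot a (v::'a::comm_ring_1^'n)" by (simp add: bdot_def sum_distrib_left algebra_simps)

lemma bdot_axis [simp]: "bdot G (axis i c) = G $ i * (c::'a::comm_ring_1)" by (simp add: bdot_def axis_def if_distrib [of "%x. _ * x"] cong: if_cong)

lemma bdot_axis_left [simp]: "bdot (axis i c) v = c * (v $ i :: 'a::comm_ring_1)"
 by (simp add: bdot_def axis_def if_distrib [of "%x. x * _"] cong: if_cong)

lemma bdot_sum_left: "bdot (\<Sum>i\<in>I. g i) v = (\<Sum>i\<in>I. bdot (g i) (v::'a::comm_ring_1^'n))"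
 by (simp add: bdot_def sum_distrib_right) (rule sum.swap)

lemma axis_0 [simp]: "axis i 0 = (0::'a::zero^'n)" by (simp add: vec_eq_iff axis_def)

lemma has_cgrad_imp_cont: "has_cgrad f G p ==> isCont f p" by (simp add: has_cgrad_def has_derivative_continuous)

lemma has_cgrad_const: "has_cgrad (%p. c) 0 (p::complex^'n)"
proof -
 have "bdot (0::complex^'n) = (%_. 0)" by (simp add: bdot_def fun_eq_iff)
 then show ?thesis by (simp add: has_cgrad_def)
qed

lemma has_cgrad_nth: "has_cgrad (%p. p $ i) (axis i 1) (p::complex^'n)"
proof -
 have "bdot (axis i 1) = (%v::complex^'n. v $ i)" by (simp add: fun_eq_iff)
 then show ?thesis using bounded_linear.has_derivative[OF bounded_linear_vec_nth has_derivative_ident] by (simp add: has_cgrad_def)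
qed

lemma has_cgrad_add: "has_cgrad f F p ==> has_cgrad g G p ==> has_cgrad (%p. f p + g p) (F + G) p" unfolding has_cgrad_def
 by (erule (1) has_derivative_eq_rhs[OF has_derivative_add]) (simp add: fun_eq_iff bdot_add_left)

lemma has_cgrad_mult:
 "has_cgrad f F p ==> has_cgrad g G p ==> has_cgrad (%p. f p * g p) (f p *s G + g p *s F) p" unfolding has_cgrad_def
 by (erule (1) has_derivative_eq_rhs[OF has_derivative_mult]) (simp add: fun_eq_iff bdot_add_left bdot_scale_left)

lemma has_cgrad_inverse:
 assumes "has_cgrad f F p" "f p ~= 0"
 shows "has_cgrad (%p. inverse (f p)) ((- (inverse (f p) ^ 2)) *s F) p" using assms unfolding has_cgrad_def
 by (intro has_derivative_eq_rhs[OF Deriv.has_derivative_inverse])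
  (auto simp: fun_eq_iff bdot_scale_left power2_eq_square bdot_def sum_distrib_left sum_negf mult_ac)

lemma has_derivative_vec_componentwise:
 fixes f :: "'a::real_normed_vector => complex^'m"
 assumes "!!i. ((%x. f x $ i) has_derivative (%h. f' h $ i)) F"
 shows "(f has_derivative f') F"
proof -
 have "f = (%x. \<Sum>i\<in>UNIV. axis i (f x $ i))" "f' = (%x. \<Sum>i\<in>UNIV. axis i (f' x $ i))"
  by (auto simp: fun_eq_iff vec_eq_iff axis_def if_distrib cong: if_cong)
 moreover have ax: "bounded_linear (axis i :: complex => complex^'m)" for i unfolding linear_conv_bounded_linear[symmetric]
  by (rule linearI) (auto simp: vec_eq_iff axis_def)
 have "((%x. \<Sum>i\<in>UNIV. axis i (f x $ i) :: complex^'m) has_derivative (%x. \<Sum>i\<in>UNIV. axis i (f' x $ i))) F"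
  by (intro has_derivative_sum bounded_linear.has_derivative[OF ax] assms)
 ultimately show ?thesis by simp
qed

lemma has_cgrad_line:
 assumes f: "has_cgrad f G (c z)"
  and c: "!!i. ((%z. c z $ i) has_field_derivative c' $ i) (at z)" shows "((%z. f (c z)) has_field_derivative bdot G c') (at z)"
proof -
 have "(c has_derivative (%h. h *s c')) (at z)"
 proof (rule has_derivative_vec_componentwise)
  fix i
  have "(%h. (h *s c') $ i) = (*) (c' $ i)" by (simp add: fun_eq_iff mult.commute)
  then show "((%z. c z $ i) has_derivative (%h. (h *s c') $ i)) (at z)" using c[of i] by (simp add: has_field_derivative_def)
 qed
 from has_derivative_compose[OF this f[unfolded has_cgrad_def]]
 have "((%x. f (c x)) has_derivative (%h. bdot G (h *s c'))) (at z)" .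
 moreover have "(%h. bdot G (h *s c')) = (*) (bdot G c')" by (simp add: bdot_def fun_eq_iff sum_distrib_left mult_ac)
 ultimately show ?thesis by (simp add: has_field_derivative_def)
qed

lemma has_cgrad_compose:
 fixes f :: "complex^'m => complex" and \<Phi> :: "complex^'n => complex^'m"
 assumes f: "has_cgrad f G (\<Phi> p)" and \<Phi>: "!!i. has_cgrad (%p. \<Phi> p $ i) (D i) p"
 shows "has_cgrad (%p. f (\<Phi> p)) (\<Sum>i\<in>UNIV. G $ i *s D i) p"
proof -
 have "(\<Phi> has_derivative (%h. \<chi> i. bdot (D i) h)) (at p)"
  using \<Phi> by (intro has_derivative_vec_componentwise) (simp add: has_cgrad_def)
 from has_derivative_compose[OF this f[unfolded has_cgrad_def]]
 have "((%x. f (\<Phi> x)) has_derivative (%x. bdot G (\<chi> i. bdot (D i) x))) (at p)" .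
 moreover have "(%x. bdot G (\<chi> i. bdot (D i) x)) = bdot (\<Sum>i\<in>UNIV. G $ i *s D i)"
  by (simp add: fun_eq_iff bdot_sum_left bdot_scale_left) (simp add: bdot_def)
 ultimately show ?thesis by (simp add: has_cgrad_def)
qed

lemma line_axis_deriv: "((%z. (p + axis i z) $ j) has_field_derivative axis i 1 $ j) (at (z::complex))"
 by (cases "i = j") (auto simp: axis_def intro!: derivative_eq_intros)

lemma has_cgrad_partial:
 assumes "has_cgrad f G p"
 shows "((%z. f (p + axis i z)) has_field_derivative G $ i) (at 0)"
  and "pd f i p = G $ i"
proof -
 show 1: "((%z. f (p + axis i z)) has_field_derivative G $ i) (at 0)"
 proof -
  have "has_cgrad f G (p + axis i 0)" using assms by (simp only: axis_0 add_0_right)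
  from has_cgrad_line[OF this line_axis_deriv] show ?thesis by (simp only: bdot_axis mult_1_right)
 qed
 then show "pd f i p = G $ i" by (simp add: partial_deriv_def DERIV_imp_deriv)
qed

lemma has_cgrad_imp_grad: "has_cgrad f G p ==> grad f p = G" by (simp add: grad_def vec_eq_iff has_cgrad_partial(2))

lemma holo_has_cgrad: "holo f S ==> p \<in> S ==> has_cgrad f (grad f p) p" by (auto simp: holo_def dest: has_cgrad_imp_grad)

lemma holoI: "open S ==> (!!p. p \<in> S ==> has_cgrad f (G p) p) ==> holo f S" by (auto simp: holo_def)

lemma holo_open: "holo f S ==> open S" by (simp add: holo_def)

lemma holo_subset: "holo f S ==> open T ==> T \<subseteq> S ==> holo f T" by (auto simp: holo_def)

lemma holo_cont: "holo f S ==> continuous_on S f" by (meson continuous_at_imp_continuous_on has_cgrad_imp_cont holo_has_cgrad)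

lemma holo_const: "open S ==> holo (%_. c) S" by (auto simp: holo_def intro: has_cgrad_const)

lemma holo_nth: "open S ==> holo (%p. p $ i) S" by (auto simp: holo_def intro: has_cgrad_nth)

lemma holo_add: "holo f S ==> holo g S ==> holo (%p. f p + g p) S" unfolding holo_def by (blast intro: has_cgrad_add)

lemma holo_mult: "holo f S ==> holo g S ==> holo (%p. f p * g p) S" unfolding holo_def by (blast intro: has_cgrad_mult)

lemma holo_uminus: "holo f S ==> holo (%p. - f p) S" using holo_mult[OF holo_const[of S "-1"], of f] by (simp add: holo_open)

lemma holo_diff: "holo f S ==> holo g S ==> holo (%p. f p - g p) S" using holo_add[OF _ holo_uminus, of f S g] by simp

lemma holo_inverse: "holo f S ==> (!!p. p \<in> S ==> f p ~= 0) ==> holo (%p. inverse (f p)) S" unfolding holo_def by (blast intro: has_cgrad_inverse)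

lemma holo_divide: "holo f S ==> holo g S ==> (!!p. p \<in> S ==> g p ~= 0) ==> holo (%p. f p / g p) S"
 using holo_mult[OF _ holo_inverse, of f S g] by (simp add: divide_inverse)

lemma holo_power: "holo f S ==> holo (%p. f p ^ n) S" by (induction n) (auto intro: holo_const holo_open holo_mult)

lemma holo_sum: "open S ==> (!!i. i \<in> I ==> holo (f i) S) ==> holo (%p. \<Sum>i\<in>I. f i p) S"
 by (induction I rule: infinite_finite_induct) (auto intro: holo_const holo_add)

lemma holo_prod: "open S ==> (!!i. i \<in> I ==> holo (f i) S) ==> holo (%p. \<Prod>i\<in>I. f i p) S"
 by (induction I rule: infinite_finite_induct) (auto intro: holo_const holo_mult)

lemma holo_compose:
 assumes "holo f T" "open S" "!!i. holo (%p. \<Phi> p $ i) S" "!!p. p \<in> S ==> \<Phi> p \<in> T"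
 shows "holo (%p. f (\<Phi> p)) S"
proof (rule holoI[OF assms(2)])
 fix p assume p: "p \<in> S"
 show "has_cgrad (%p. f (\<Phi> p)) (\<Sum>i\<in>UNIV. grad f (\<Phi> p) $ i *s grad (%p. \<Phi> p $ i) p) p"
  using assms p by (intro has_cgrad_compose holo_has_cgrad) auto
qed

lemma holo_cong:
 assumes "holo f S" "!!p. p \<in> S ==> f p = g p"
 shows "holo g S"
proof (rule holoI)
 show "open S" using assms(1) by (rule holo_open)
 fix p assume p: "p \<in> S"
 show "has_cgrad g (grad f p) p" using has_derivative_transform_within_open[OF holo_has_cgrad[OF assms(1) p, unfolded has_cgrad_def]
    \<open>open S\<close> p assms(2)] by (simp add: has_cgrad_def)
qed

lemma holo_local:
 assumes "open S" "!!p. p \<in> S ==> \<exists>B. p \<in> B & holo f B"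
 shows "holo f S" using assms unfolding holo_def by meson

lemma holo_slice:
 assumes "holo f S" "open X" "!!i. (%z. c z $ i) holomorphic_on X" "!!z. z \<in> X ==> c z \<in> S"
 shows "(%z. f (c z)) holomorphic_on X"
proof -
 have "((%z. f (c z)) has_field_derivative bdot (grad f (c z)) (\<chi> i. deriv (%z. c z $ i) z)) (at z)" if "z \<in> X" for z
  using assms that by (intro has_cgrad_line holo_has_cgrad) (auto intro: holomorphic_derivI)
 then show ?thesis unfolding holomorphic_on_open[OF assms(2)] by blast
qed

lemma holo_slice_deriv:
 assumes "holo f S" "p + axis i z \<in> S"
 shows "((%z. f (p + axis i z)) has_field_derivative pd f i (p + axis i z)) (at z)" using has_cgrad_line[OF holo_has_cgrad[OF assms] line_axis_deriv]
 by (simp add: grad_def)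

lemma partial_deriv_cong:
 assumes "open S" "p \<in> S" "!!q. q \<in> S ==> f q = g q"
 shows "pd f i p = pd g i (p::complex^'n)"
proof -
 have "continuous (at 0) (%z. p + axis i (z::complex))"
 proof -
  have "(%z. (p + axis i z) $ j) \<midarrow>0\<rightarrow> (p + axis i (0::complex)) $ j" for j
   using DERIV_isCont[OF line_axis_deriv[of p i j 0]] by (simp only: isCont_def)
  then show ?thesis unfolding isCont_def by (rule vec_tendstoI)
 qed
 then have "((%z. p + axis i (z::complex)) \<longlongrightarrow> p) (nhds 0)"
  using tendsto_at_iff_tendsto_nhds[of "%z. p + axis i (z::complex)" 0] by (simp only: isCont_def axis_0 add_0_right)
 then have "\<forall>\<^sub>F z in nhds 0. p + axis i z \<in> S" using assms topological_tendstoD by blast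
 then have "\<forall>\<^sub>F z in nhds 0. f (p + axis i z) = g (p + axis i z)" by eventually_elim (use assms in auto)
 then show ?thesis unfolding partial_deriv_def by (intro deriv_cong_ev) auto
qed

section \<open>Osgood's lemma and Cauchy integrals with parameters\<close>

lemma norm_axis [simp]: "norm (axis i z :: complex^'n) = norm z"
proof -
 have "(\<Sum>j\<in>UNIV. (norm (if j = i then z else 0))\<^sup>2) = (\<Sum>j\<in>UNIV. if j = i then (norm z)\<^sup>2 else 0)"
  by (rule sum.cong) auto
 then show ?thesis by (simp add: norm_vec_def L2_set_def axis_def)
qed

lemma axis_add: "axis i (z + w) = axis i z + (axis i w :: complex^'n)" by (simp add: vec_eq_iff axis_def)

lemma sep_shift:
 "((%w. f (p + axis i z + axis i w)) has_field_derivative d) (at 0) \<longleftrightarrow>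
 ((%z. f (p + axis i (z::complex) :: complex^'n)) has_field_derivative d) (at z)" using DERIV_shift[of "%z. f (p + axis i z)" d 0 z]
 by (simp add: axis_add add_ac)

lemma bounded_linear_bdot: "bounded_linear (bdot (G::complex^'n))" unfolding linear_conv_bounded_linear[symmetric]
 by (rule linearI) (simp_all add: bdot_def sum.distrib algebra_simps scaleR_sum_right)

lemma continuous_on_axis [continuous_intros]:
 assumes "continuous_on A g"
 shows "continuous_on A (%x. axis i (g x) :: complex^'n)"
proof -
 have "continuous_on A (%x. if j = i then g x else 0)" for j using assms by (cases "j = i") auto
 then show ?thesis unfolding axis_def by (rule continuous_on_vec_lambda)
qed

text \<open>The increment is split along the coordinates: \<open>V J\<close> keeps the coordinates
  of \<open>y - p\<close> in \<open>J\<close> and sets the others to 0, so that passing from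
  \<open>J\<close> to \<open>insert j J\<close> changes one complex variable, where the mean value
  bound applies. The tolerance \<open>e\<close> is shared among the \<open>CARD('n)\<close>
  steps.\<close>

lemma C1_imp_has_cgrad:
 fixes f :: "complex^'n => complex"
 assumes "open S" "p \<in> S"
  and der: "!!q i. q \<in> S ==> ((%z. f (q + axis i z)) has_field_derivative d i q) (at 0)"
  and cont: "!!i. isCont (d i) p" shows "has_cgrad f (\<chi> i. d i p) p" unfolding has_cgrad_def has_derivative_at_alt
proof (intro conjI allI impI)
 show "bounded_linear (bdot (\<chi> i. d i p))" by (rule bounded_linear_bdot)
next
 fix e :: real assume "e > 0"
 define e' where "e' = e / real CARD('n)"
 have "e' > 0" using \<open>e > 0\<close> by (simp add: e'_def)
 have "\<forall>\<^sub>F q in nhds p. \<forall>i. dist (d i q) (d i p) < e'"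
  using cont[unfolded isCont_def tendsto_at_iff_tendsto_nhds] \<open>e' > 0\<close> by (auto intro!: eventually_all_finite dest: tendstoD)
 moreover have "\<forall>\<^sub>F q in nhds p. q \<in> S" using assms by (auto intro: eventually_nhds_in_open)
 ultimately have "\<forall>\<^sub>F q in nhds p. q \<in> S & (\<forall>i. dist (d i q) (d i p) < e')" by eventually_elim auto
 then obtain \<delta> where \<delta>: "\<delta> > 0" "!!q. dist q p < \<delta> ==> q \<in> S & (\<forall>i. dist (d i q) (d i p) < e')"
  unfolding eventually_nhds_metric by blast
 show "\<exists>\<delta>>0. \<forall>y. norm (y - p) < \<delta> -->
   norm (f y - f p - bdot (\<chi> i. d i p) (y - p)) <= e * norm (y - p)"
 proof (intro exI conjI allI impI)
  fix y assume y: "norm (y - p) < \<delta>"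
  define v where "v = y - p"
  define V where "V J = (\<chi> j. if j \<in> J then v $ j else 0)" for J
  have "norm (f (p + V J) - f p - (\<Sum>j\<in>J. v $ j * d j p)) <= (\<Sum>j\<in>J. e' * norm (v $ j))"
   if "finite J" for J using that
  proof (induction J rule: finite_induct)
   case empty
   have "V {} = 0" by (simp add: V_def vec_eq_iff)
   then show ?case by simp
  next
   case (insert j J)
   define g where "g z = f (p + V J + axis j z) - z * d j p" for z :: complex
   have small: "norm (V J + axis j z) <= norm v" if "norm z <= norm (v $ j)" for z :: complex using that insert.hyps
    by (intro norm_le_componentwise_cart) (auto simp: V_def axis_def)
   have "norm (g (v $ j) - g 0) <= e' * norm (v $ j - 0)"
   proof (rule field_differentiable_bound[of "cball 0 (norm (v $ j))" g "%z. d j (p + V J + axis j z) - d j p"])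
    fix z :: complex assume z: "z \<in> cball 0 (norm (v $ j))"
    have nr: "dist (p + V J + axis j z) p < \<delta>" using small[of z] z y by (simp add: dist_norm v_def add.assoc)
    then have "((%z. f (p + V J + axis j z)) has_field_derivative d j (p + V J + axis j z)) (at z)"
     by (intro iffD1[OF sep_shift der[OF conjunct1[OF \<delta>(2)]]])
    then have "(g has_field_derivative d j (p + V J + axis j z) - d j p) (at z)" unfolding g_def by (auto intro!: derivative_eq_intros)
    then show "(g has_field_derivative d j (p + V J + axis j z) - d j p) (at z within cball 0 (norm (v $ j)))"
     by (rule has_field_derivative_at_within)
    show "norm (d j (p + V J + axis j z) - d j p) <= e'" using \<delta>(2)[OF nr] by (simp add: dist_norm less_imp_le)
   qed auto
   moreover have "V J + axis j (v $ j) = V (insert j J)" using insert.hyps by (auto simp: V_def vec_eq_iff axis_def)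
   ultimately have "norm (f (p + V (insert j J)) - v $ j * d j p - f (p + V J)) <= e' * norm (v $ j)" by (simp add: g_def add.assoc)
   then have "norm ((f (p + V J) - f p - (\<Sum>j\<in>J. v $ j * d j p)) +
     (f (p + V (insert j J)) - v $ j * d j p - f (p + V J))) <= (\<Sum>j\<in>J. e' * norm (v $ j)) + e' * norm (v $ j)"
    using insert.IH by (intro norm_triangle_le add_mono)
   then show ?case using insert.hyps by (simp add: algebra_simps)
  qed
  from this[of UNIV] have "norm (f (p + v) - f p - (\<Sum>j\<in>UNIV. v $ j * d j p)) <= (\<Sum>j\<in>UNIV. e' * norm (v $ j))" by (simp add: V_def)
  also have "\<dots> <= (\<Sum>j\<in>(UNIV::'n set). e' * norm v)"
   using \<open>e' > 0\<close> by (intro sum_mono mult_left_mono Finite_Cartesian_Product.norm_nth_le) auto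
  also have "\<dots> = e * norm v" by (simp add: e'_def)
  finally show "norm (f y - f p - bdot (\<chi> i. d i p) (y - p)) <= e * norm (y - p)" by (simp add: v_def bdot_def mult.commute)
 qed (use \<delta> in auto)
qed

definition circ :: "real => real => complex" where
 "circ r u = of_real r * exp (2 * of_real pi * \<i> * of_real u)"

lemma norm_circ [simp]: "norm (circ r u) = \<bar>r\<bar>" by (simp add: circ_def norm_mult)

lemma circ_nonzero [simp]: "r ~= 0 ==> circ r u ~= 0" by (simp add: circ_def)

lemma continuous_on_circ [continuous_intros]: "continuous_on A g ==> continuous_on A (%x. circ r (g x))"
 unfolding circ_def by (intro continuous_intros)

text \<open>Cauchy's formula for the first derivative. The factor 2 pi i cancels against the
  derivative of the parametrisation; what remains is an ordinary integral over the unit interval,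
  open to continuity and differentiation in parameters.\<close>

lemma deriv_circ_integral:
 assumes "\<phi> holomorphic_on ball 0 R" "0 < r" "r < R"
 shows "deriv \<phi> 0 = integral {0..1} (%u. \<phi> (circ r u) / circ r u)"
proof -
 have sub: "cball 0 r \<subseteq> ball 0 R" using assms by auto
 have "((%u. \<phi> u / (u - 0) ^ Suc 1) has_contour_integral
   (2 * pi * \<i>) / fact 1 * (deriv ^^ 1) \<phi> 0) (circlepath 0 r)" using assms sub
  by (intro Cauchy_has_contour_integral_higher_derivative_circlepath) (auto intro: holomorphic_on_imp_continuous_on holomorphic_on_subset)
 moreover have "vector_derivative (circlepath 0 r) (at x) = 2 * pi * \<i> * circ r x" for x
  by (simp add: vector_derivative_circlepath circ_def mult_ac)
 moreover have "circlepath 0 r x = circ r x" for x by (simp add: circlepath circ_def)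
 ultimately have "((%x. \<phi> (circ r x) / (circ r x)^2 * (2 * pi * \<i> * circ r x)) has_integral 2 * pi * \<i> * deriv \<phi> 0) {0..1}"
  by (simp add: has_contour_integral numeral_2_eq_2)
 then have "((%x. (1 / (2 * pi * \<i>)) * (\<phi> (circ r x) / (circ r x)^2 * (2 * pi * \<i> * circ r x))) has_integral
   (1 / (2 * pi * \<i>)) * (2 * pi * \<i> * deriv \<phi> 0)) {0..1}" by (rule has_integral_mult_right)
 then have "((%x. \<phi> (circ r x) / circ r x) has_integral deriv \<phi> 0) {0..1}" using \<open>0 < r\<close> by (simp add: power2_eq_square)
 then show ?thesis by (simp add: integral_unique)
qed

lemma sep_holomorphic:
 fixes f :: "complex^'n => complex"
 assumes "!!q. q \<in> S ==> (%z. f (q + axis i z)) field_differentiable at 0" "ball p r \<subseteq> S"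
 shows "(%z. f (p + axis i z)) holomorphic_on ball 0 r" unfolding holomorphic_on_open[OF open_ball]
proof
 fix z :: complex assume "z \<in> ball 0 r"
 then have "p + axis i z \<in> S" using assms(2) by (auto simp: subset_iff dist_norm)
 from assms(1)[OF this] show "\<exists>f'. ((%z. f (p + axis i z)) has_field_derivative f') (at z)"
  by (auto simp: field_differentiable_def sep_shift)
qed

text \<open>By Cauchy's formula a partial derivative is an integral over a small circle of
  \<open>K\<close> itself, so joint continuity of \<open>K\<close> passes to it.\<close>

lemma cont_partial_param:
 fixes K :: "complex^'n => 't::metric_space => complex"
 assumes "open S" and cont: "continuous_on (S \<times> T) (%(p, t). K p t)"
  and sep: "!!p t. p \<in> S ==> t \<in> T ==> (%z. K (p + axis i z) t) field_differentiable at 0"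
 shows "continuous_on (S \<times> T) (%(p, t). pd (%q. K q t) i p)" unfolding continuous_on_eq_continuous_within
proof safe
 fix p0 t0 assume p0: "p0 \<in> S" "t0 \<in> T"
 obtain R where R: "R > 0" "ball p0 R \<subseteq> S" using \<open>open S\<close> p0 openE by blast
 define r where "r = R / 2"
 have r: "r > 0" "R = r + r" using R by (auto simp: r_def)
 have in_S: "p + axis i z \<in> S" if "p \<in> ball p0 r" "norm z < r" for p and z :: complex
 proof -
  have "dist p0 (p + axis i z) <= dist p0 p + dist p (p + axis i z)" by (rule dist_triangle)
  also have "\<dots> < R" using that r by (simp add: dist_norm)
  finally show ?thesis using R by auto
 qed
 have eq: "pd (%q. K q t) i p =
   integral {0..1} (%u. K (p + axis i (circ (r/2) u)) t / circ (r/2) u)"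
  if "p \<in> ball p0 r" "t \<in> T" for p t unfolding partial_deriv_def
 proof (rule deriv_circ_integral)
  show "(%s. K (p + axis i s) t) holomorphic_on ball 0 r"
  proof (rule sep_holomorphic)
   show "ball p r \<subseteq> S"
   proof
    fix x assume "x \<in> ball p r"
    moreover have "dist p0 x <= dist p0 p + dist p x" by (rule dist_triangle)
    ultimately have "dist p0 x < R" using that r by simp
    then show "x \<in> S" using R by auto
   qed
  qed (use sep that in auto)
 qed (use r in auto)
 have "continuous_on (ball p0 r \<times> T) (%x. integral (cbox 0 1) (%u. K (fst x + axis i (circ (r/2) u)) (snd x) / circ (r/2) u))"
 proof (rule integral_continuous_on_param)
  have "continuous_on ((ball p0 r \<times> T) \<times> cbox 0 1)
   (%x. (%(p, t). K p t) (fst (fst x) + axis i (circ (r/2) (snd x)), snd (fst x)) / circ (r/2) (snd x))" using r in_S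
   by (intro continuous_intros continuous_on_compose2[OF cont]) auto
  then show "continuous_on ((ball p0 r \<times> T) \<times> cbox 0 1)
   (%(x, u). K (fst x + axis i (circ (r/2) u)) (snd x) / circ (r/2) u)" by (simp add: case_prod_unfold)
 qed
 then have "continuous_on (ball p0 r \<times> T) (%(p, t). pd (%q. K q t) i p)" by (rule continuous_on_eq) (auto simp: eq)
 then have "continuous (at (p0, t0) within ball p0 r \<times> T) (%(p, t). pd (%q. K q t) i p)"
  using p0 r by (auto simp: continuous_on_eq_continuous_within)
 moreover have "at (p0, t0) within ball p0 r \<times> T = at (p0, t0) within S \<times> T"
  using p0 r R by (intro at_within_nhd[of _ "ball p0 r \<times> UNIV"]) (auto intro: open_Times)
 ultimately show "continuous (at (p0, t0) within S \<times> T) (%(p, t). pd (%q. K q t) i p)" by simp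
qed

text \<open>Separate holomorphy provides the partial derivatives, Cauchy's formula their continuity,
  so \<open>f\<close> is continuously differentiable.\<close>

lemma osgood:
 fixes f :: "complex^'n => complex"
 assumes "open S" "continuous_on S f"
  and sep: "!!p i. p \<in> S ==> (%z. f (p + axis i z)) field_differentiable at 0" shows "holo f S"
proof (rule holoI[OF \<open>open S\<close>])
 fix p assume p: "p \<in> S"
 show "has_cgrad f (\<chi> i. pd f i p) p"
 proof (rule C1_imp_has_cgrad[OF \<open>open S\<close> p])
  show "((%z. f (q + axis i z)) has_field_derivative pd f i q) (at 0)" if "q \<in> S" for q i
   using sep[OF that, of i] unfolding partial_deriv_def by (simp add: field_differentiable_derivI)
  fix i
  \<comment> \<open>The one-point parameter set specialises the statement with parameters.\<close>
  have "continuous_on (S \<times> {0::real}) (%(p, t). pd f i p)"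
  proof (rule cont_partial_param[OF \<open>open S\<close>])
   have "continuous_on (S \<times> {0::real}) (%x. f (fst x))" by (rule continuous_on_compose2[OF assms(2)]) (auto intro: continuous_intros)
   then show "continuous_on (S \<times> {0::real}) (%(p, t). f p)" by (simp add: case_prod_unfold)
  qed (use sep in auto)
  then have "continuous_on S (%p. (%(p, t). pd f i p) (p, 0::real))" by (rule continuous_on_compose2) (auto intro: continuous_intros)
  then show "isCont (pd f i) p" using p \<open>open S\<close> by (simp add: continuous_on_eq_continuous_at)
 qed
qed

lemma holo_sep: "holo f S ==> p \<in> S ==> (%z. f (p + axis i z)) field_differentiable at 0"
 unfolding field_differentiable_def by (rule exI, rule has_cgrad_partial(1), rule holo_has_cgrad)

lemma holo_integral_aux:
 fixes K :: "complex^'n => real => complex"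
 assumes "open S" and hol: "!!t. t \<in> {0..1} ==> holo (%p. K p t) S"
  and cont: "continuous_on (S \<times> {0..1}) (%(p, t). K p t)" and p: "p \<in> S"
 shows "((%z. integral {0..1} (K (p + axis i z))) has_field_derivative
     integral {0..1} (%t. pd (%q. K q t) i p)) (at 0)"
proof -
 obtain R where R: "R > 0" "ball p R \<subseteq> S" using \<open>open S\<close> p openE by blast
 have in_S: "p + axis i z \<in> S" if "norm z < R" for z :: complex using that R by (auto simp: subset_iff dist_norm)
 have cK: "continuous_on {0..1} (K q)" if "q \<in> S" for q
 proof -
  have "continuous_on {0..1} (%t. (%(p, t). K p t) (q, t))"
   by (rule continuous_on_compose2[OF cont]) (use that in \<open>auto intro!: continuous_intros\<close>)
  then show ?thesis by simp
 qed
 have "((%z. integral (cbox 0 1) (K (p + axis i z))) has_field_derivative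
   integral (cbox 0 1) (%t. pd (%q. K q t) i (p + axis i 0))) (at 0 within ball 0 R)"
 proof (rule leibniz_rule_field_derivative)
  fix z t assume z: "z \<in> ball (0::complex) R" and t: "t \<in> cbox (0::real) 1"
  show "((%z. K (p + axis i z) t) has_field_derivative pd (%q. K q t) i (p + axis i z)) (at z within ball 0 R)"
   by (rule has_field_derivative_at_within, rule holo_slice_deriv[of "%p. K p t" S]) (use hol[of t] z t in_S in auto)
 next
  fix z assume z: "z \<in> ball (0::complex) R"
  then show "K (p + axis i z) integrable_on cbox 0 1" using in_S cK by (intro integrable_continuous) auto
 next
  have c: "continuous_on (S \<times> {0..1}) (%(p, t). pd (%q. K q t) i p)"
   by (rule cont_partial_param[OF \<open>open S\<close> cont]) (rule holo_sep[OF hol])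
  have "continuous_on (ball 0 R \<times> cbox 0 1) (%x. (%(p, t). pd (%q. K q t) i p) (p + axis i (fst x), snd x))"
   by (intro continuous_on_compose2[OF c] continuous_intros) (auto simp: in_S)
  then show "continuous_on (ball 0 R \<times> cbox 0 1) (%(z, t). pd (%q. K q t) i (p + axis i z))" by (simp add: case_prod_unfold)
 qed (use R in auto)
 then show ?thesis using R at_within_open[of "0::complex" "ball 0 R"] by simp
qed

lemma
 fixes K :: "complex^'n => real => complex"
 assumes "open S" and hol: "!!t. t \<in> {0..1} ==> holo (%p. K p t) S"
  and cont: "continuous_on (S \<times> {0..1}) (%(p, t). K p t)" shows holo_integral: "holo (%p. integral {0..1} (K p)) S"
  and partial_deriv_integral: "p \<in> S ==> pd (%p. integral {0..1} (K p)) i p =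
     integral {0..1} (%t. pd (%q. K q t) i p)"
proof -
 have "continuous_on S (%p. integral (cbox 0 1) (K p))" using cont by (intro integral_continuous_on_param) simp
 then show "holo (%p. integral {0..1} (K p)) S" using holo_integral_aux[OF assms]
  by (intro osgood[OF \<open>open S\<close>]) (auto simp: field_differentiable_def)
 show "pd (%p. integral {0..1} (K p)) i p =
   integral {0..1} (%t. pd (%q. K q t) i p)" if "p \<in> S"
  using holo_integral_aux[OF assms that] unfolding partial_deriv_def[of "%p. integral {0..1} (K p)"] by (rule DERIV_imp_deriv)
qed

lemma holo_translate:
 assumes "holo f S" "open T" "!!p. p \<in> T ==> p + a \<in> S"
 shows "holo (%p. f (p + a)) T"
proof (rule holo_compose[OF assms(1,2)])
 show "holo (%p. (p + a) $ i) T" for i using holo_add[OF holo_nth[OF assms(2)] holo_const[OF assms(2)]] by simp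
qed (use assms in auto)

lemma partial_deriv_scaled_shift:
 assumes "holo f S" "p + a \<in> S"
 shows "pd (%q. f (q + a) / c) i p = pd f i (p + a) / c"
proof -
 have "((%z. f (p + a + axis i z)) has_field_derivative pd f i (p + a)) (at 0)" using has_cgrad_partial[OF holo_has_cgrad[OF assms]] by simp
 then have "((%z. f (p + axis i z + a) / c) has_field_derivative pd f i (p + a) / c) (at 0)" by (simp add: add_ac DERIV_cdivide)
 then show ?thesis unfolding partial_deriv_def[of _ i p] by (rule DERIV_imp_deriv)
qed

text \<open>One radius works for all base points near \<open>p0\<close> and for every
  \<open>g\<close> holomorphic on \<open>S\<close>. A partial derivative is thereby replaced by an
  integral of translates, which can be differentiated under the integral sign.\<close>

lemma holo_circ_formula:
 fixes f :: "complex^'n => complex"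
 assumes "holo f S" "p0 \<in> S"
 obtains r where "r > 0" "ball p0 r \<subseteq> S"
  "!!p u. p \<in> ball p0 r ==> p + axis i (circ r u) \<in> S"
  "!!g p. holo g S ==> p \<in> ball p0 r ==>
   pd g i p = integral {0..1} (%u. g (p + axis i (circ r u)) / circ r u)"
  "continuous_on (ball p0 r \<times> {0..1}) (%(p, u). f (p + axis i (circ r u)) / circ r u)"
proof -
 obtain R where R: "R > 0" "ball p0 R \<subseteq> S" using assms holo_open openE by blast
 \<comment> \<open>A point at distance less than \<open>r\<close> from \<open>p0\<close> carries a
   ball of radius \<open>2 * r\<close> inside \<open>ball p0 R\<close>, hence also the circle of
   radius \<open>r\<close>.\<close>
 define r where "r = R / 3"
 have r: "r > 0" "R = 3 * r" using R by (auto simp: r_def)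
 have sub: "ball p (2 * r) \<subseteq> S" if "p \<in> ball p0 r" for p
 proof
  fix x assume "x \<in> ball p (2 * r)"
  moreover have "dist p0 x <= dist p0 p + dist p x" by (rule dist_triangle)
  ultimately have "dist p0 x < R" using that r by simp
  then show "x \<in> S" using R by auto
 qed
 show thesis
 proof (rule that[of r])
  show "r > 0" using r by simp
  show "ball p0 r \<subseteq> S" using r R by auto
  show inS: "p + axis i (circ r u) \<in> S" if "p \<in> ball p0 r" for p u using sub[OF that] r by (auto simp: subset_iff dist_norm)
  show "pd g i p = integral {0..1} (%u. g (p + axis i (circ r u)) / circ r u)"
   if "holo g S" "p \<in> ball p0 r" for g p unfolding partial_deriv_def using that r sub[OF that(2)] holo_sep
   by (intro deriv_circ_integral[of _ "2 * r"] sep_holomorphic[of S]) auto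
  have "continuous_on (ball p0 r \<times> {0..1}) (%x. f (fst x + axis i (circ r (snd x))) / circ r (snd x))"
   using r inS by (intro continuous_intros continuous_on_compose2[OF holo_cont[OF assms(1)]]) auto
  then show "continuous_on (ball p0 r \<times> {0..1}) (%(p, u). f (p + axis i (circ r u)) / circ r u)" by (simp add: case_prod_unfold)
 qed
qed

lemma holo_partial_deriv:
 fixes f :: "complex^'n => complex"
 assumes "holo f S"
 shows "holo (pd f i) S"
proof (rule holo_local)
 show "open S" using assms by (rule holo_open)
 fix p0 assume p0: "p0 \<in> S"
 obtain r where r: "r > 0" "ball p0 r \<subseteq> S"
  "!!p u. p \<in> ball p0 r ==> p + axis i (circ r u) \<in> S"
  "!!g p. holo g S ==> p \<in> ball p0 r ==>
   pd g i p = integral {0..1} (%u. g (p + axis i (circ r u)) / circ r u)"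
  "continuous_on (ball p0 r \<times> {0..1}) (%(p, u). f (p + axis i (circ r u)) / circ r u)" using holo_circ_formula[OF assms p0] by blast
 have "holo (%p. integral {0..1} (%u. f (p + axis i (circ r u)) / circ r u)) (ball p0 r)"
  using r by (intro holo_integral holo_divide holo_translate[OF assms] holo_const) auto
 then have "holo (pd f i) (ball p0 r)" by (rule holo_cong) (simp add: r(4)[OF assms])
 then show "\<exists>B. p0 \<in> B & holo (pd f i) B" using r(1) centre_in_ball by blast
qed

text \<open>One of the two derivatives is written as a Cauchy integral of translates of
  \<open>f\<close>; the other passes under the integral sign.\<close>

lemma partial_deriv_commute:
 fixes f :: "complex^'n => complex"
 assumes "holo f S" "p0 \<in> S"
 shows "pd (pd f i) j p0 = pd (pd f j) i p0"
proof -
 obtain r where r: "r > 0" "ball p0 r \<subseteq> S"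
  "!!p u. p \<in> ball p0 r ==> p + axis i (circ r u) \<in> S"
  "!!g p. holo g S ==> p \<in> ball p0 r ==>
   pd g i p = integral {0..1} (%u. g (p + axis i (circ r u)) / circ r u)"
  "continuous_on (ball p0 r \<times> {0..1}) (%(p, u). f (p + axis i (circ r u)) / circ r u)" using holo_circ_formula[OF assms] by blast
 have p0: "p0 \<in> ball p0 r" using r by simp
 have "pd (pd f i) j p0 =
   pd (%p. integral {0..1} (%u. f (p + axis i (circ r u)) / circ r u)) j p0"
  using r(4)[OF assms(1)] by (intro partial_deriv_cong[OF open_ball p0]) simp
 also have "\<dots> = integral {0..1} (%u. pd (%p. f (p + axis i (circ r u)) / circ r u) j p0)"
  using r p0 by (intro partial_deriv_integral[of "ball p0 r"] holo_divide holo_translate[OF assms(1)] holo_const) auto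
 also have "\<dots> = integral {0..1} (%u. pd f j (p0 + axis i (circ r u)) / circ r u)"
  using partial_deriv_scaled_shift[OF assms(1)] r(3)[OF p0] by simp
 also have "\<dots> = pd (pd f j) i p0" using r(4)[OF holo_partial_deriv[OF assms(1)] p0] by simp
 finally show ?thesis .
qed

section \<open>The identity theorem and common non-zeros\<close>

lemma holo_identity_convex:
 fixes f :: "complex^'n => complex"
 assumes f: "holo f S" and "convex S" "open B" "b \<in> B" "B \<subseteq> S" "!!q. q \<in> B ==> f q = 0" and p: "p \<in> S"
 shows "f p = 0"
proof -
 \<comment> \<open>The complex line through \<open>b\<close> and \<open>p\<close>. It meets a convex
   set in a convex, hence connected, set of parameters, so the identity theorem in one variable
   applies.\<close>
 define c where "c z = b + z *s (p - b)" for z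
 have hol_c: "(%z. c z $ i) holomorphic_on X" for i X unfolding c_def by (auto intro!: holomorphic_intros)
 have cont_c: "continuous_on UNIV c"
 proof -
  have "c = (%z. \<chi> i. c z $ i)" by (simp add: vec_eq_iff)
  moreover have "continuous_on UNIV (%z. \<chi> i. c z $ i)" by (intro continuous_on_vec_lambda holomorphic_on_imp_continuous_on hol_c)
  ultimately show ?thesis by simp
 qed
 have "open (c -` S)" "open (c -` B)" using cont_c assms(3) holo_open[OF f] by (auto intro: open_vimage)
 have "convex (c -` S)"
 proof (rule convexI)
  fix x y and u v :: real assume *: "x \<in> c -` S" "y \<in> c -` S" "0 <= u" "0 <= v" "u + v = 1"
  have v: "v = 1 - u" using * by simp
  have "c (u *\<^sub>R x + v *\<^sub>R y) $ i = (u *\<^sub>R c x + v *\<^sub>R c y) $ i" for i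
   unfolding c_def v vector_add_component vector_scaleR_component vector_smult_component unfolding scaleR_conv_of_real of_real_diff of_real_1
   by (simp add: algebra_simps)
  then have "c (u *\<^sub>R x + v *\<^sub>R y) = u *\<^sub>R c x + v *\<^sub>R c y" by (simp add: vec_eq_iff)
  then show "u *\<^sub>R x + v *\<^sub>R y \<in> c -` S" using * \<open>convex S\<close> by (simp add: convex_def)
 qed
 have "f (c 1) = 0"
 proof (rule analytic_continuation_open[of "c -` B" "c -` S" "%z. f (c z)" "%_. 0"])
  show "c -` B ~= {}" using assms(4) by (metis (no_types, lifting) add.right_neutral c_def empty_iff vector_smult_lzero vimageI2)
  show "connected (c -` S)" using \<open>convex (c -` S)\<close> by (rule convex_connected)
  show "(%z. f (c z)) holomorphic_on c -` S" using f \<open>open (c -` S)\<close> hol_c by (rule holo_slice) auto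
  show "1 \<in> c -` S" using p by (simp add: c_def)
 qed (use \<open>open (c -` S)\<close> \<open>open (c -` B)\<close> assms in auto)
 then show ?thesis by (simp add: c_def)
qed

text \<open>The set where \<open>f\<close> vanishes locally is open by definition and relatively
  closed in \<open>S\<close> by the convex case on balls.\<close>

lemma holo_identity:
 fixes f :: "complex^'n => complex"
 assumes f: "holo f S" and "connected S" "open B" "b \<in> B" "B \<subseteq> S" "!!q. q \<in> B ==> f q = 0" and p: "p \<in> S"
 shows "f p = 0"
proof -
 define Z where "Z = {p \<in> S. \<exists>T. open T & p \<in> T & T \<subseteq> S & (\<forall>q\<in>T. f q = 0)}"
 have "Z = \<Union>{T. open T & T \<subseteq> S & (\<forall>q\<in>T. f q = 0)}" by (auto simp: Z_def)
 then have "open Z" by auto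
 have "open (S - Z)" unfolding open_contains_ball
 proof
  fix x assume x: "x \<in> S - Z"
  then obtain r where r: "r > 0" "ball x r \<subseteq> S" using holo_open[OF f] openE by blast
  have "ball x r Int Z = {}"
  proof (rule ccontr)
   assume "ball x r Int Z ~= {}"
   then obtain y T where y: "y \<in> ball x r" "open T" "y \<in> T" "\<forall>q\<in>T. f q = 0" by (auto simp: Z_def)
   have "holo f (ball x r)" by (rule holo_subset[OF f]) (use r in auto)
   then have "f q = 0" if "q \<in> ball x r" for q by (rule holo_identity_convex[where B = "T Int ball x r" and b = y]) (use y that in auto)
   then have "x \<in> Z" unfolding Z_def using x r by (intro CollectI conjI exI[of _ "ball x r"]) auto
   then show False using x by blast
  qed
  then have "ball x r \<subseteq> S - Z" using r by blast
  then show "\<exists>e>0. ball x e \<subseteq> S - Z" using r(1) by blast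
 qed
 moreover have "S \<subseteq> Z Un (S - Z)" "Z Int (S - Z) Int S = {}" by (auto simp: Z_def)
 moreover have "b \<in> Z Int S" using assms by (auto simp: Z_def)
 ultimately have "(S - Z) Int S = {}" using connectedD[OF \<open>connected S\<close> \<open>open Z\<close> \<open>open (S - Z)\<close>] by blast
 then have "p \<in> Z" using p by auto
 then show ?thesis by (auto simp: Z_def)
qed

text \<open>Induction over \<open>I\<close>: the product of the earlier functions is non-zero on a
  non-empty open subset of \<open>B\<close>, and the next function cannot vanish on all of
  it.\<close>

lemma holo_common_nonzero:
 fixes f :: "'i => complex^'n => complex"
 assumes "finite I" and "connected S" and f: "!!i. i \<in> I ==> holo (f i) S"
  and nz: "!!i. i \<in> I ==> \<exists>p\<in>S. f i p ~= 0" and B: "open B" "B ~= {}" "B \<subseteq> S"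
 shows "\<exists>p\<in>B. \<forall>i\<in>I. f i p ~= 0" using assms(1) f nz
proof (induction I rule: finite_induct)
 case empty
 then show ?case using B by auto
next
 case (insert j I)
 define P where "P q = (\<Prod>i\<in>I. f i q)" for q
 obtain p where p: "p \<in> B" "\<forall>i\<in>I. f i p ~= 0" using insert by auto
 have "holo P B" unfolding P_def by (rule holo_prod[OF B(1)]) (use insert.prems(1) B in \<open>auto intro: holo_subset\<close>)
 then have op: "open (B Int P -` (- {0}))" using B by (intro continuous_open_preimage holo_cont) auto
 show ?case
 proof (rule ccontr)
  assume neg: "~ ?thesis"
  have "f j q = 0" if "q \<in> B Int P -` (- {0})" for q using that neg insert.hyps(1) by (auto simp: P_def)
  moreover have "p \<in> B Int P -` (- {0})" using p insert.hyps(1) by (simp add: P_def)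
  ultimately have "f j q = 0" if "q \<in> S" for q using holo_identity[OF insert.prems(1)[of j] assms(2) op] B that by blast
  then show False using insert.prems(2)[of j] by auto
 qed
qed

lemma holo_zero_dense:
 fixes f :: "complex^'n => complex"
 assumes "open S" "continuous_on S f" "!!q. q \<in> S ==> q $ i ~= 0 ==> f q = 0" "p \<in> S"
 shows "f p = 0"
proof (cases "p $ i = 0")
 case True
 have c: "isCont (%z. p + axis i (z::complex)) 0" using continuous_on_axis[of UNIV "%z::complex. z" i]
  by (intro continuous_intros) (simp add: continuous_on_eq_continuous_at)
 have lim: "((%z. p + axis i (z::complex)) \<longlongrightarrow> p) (at 0)" using c unfolding isCont_def by simp
 have "isCont f p" using assms by (simp add: continuous_on_eq_continuous_at)
 then have "((%z. f (p + axis i (z::complex))) \<longlongrightarrow> f p) (at 0)" using isCont_tendsto_compose lim by blast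
 moreover have "\<forall>\<^sub>F z in at 0. f (p + axis i (z::complex)) = 0"
 proof -
  have "\<forall>\<^sub>F z in at 0. p + axis i (z::complex) \<in> S" using lim assms topological_tendstoD by blast
  moreover have "\<forall>\<^sub>F z in at (0::complex). z ~= 0" by (simp add: eventually_at_filter)
  ultimately show ?thesis by eventually_elim (use assms True in \<open>auto simp: axis_def\<close>)
 qed
 ultimately show ?thesis using tendsto_unique[of "at (0::complex)"] tendsto_eventually at_neq_bot by metis
qed (use assms in auto)

section \<open>Division by powers of a coordinate\<close>

definition coord_star :: "'n => (complex^'n) set => bool" where
 "coord_star i S \<longleftrightarrow> (\<forall>p\<in>S. \<forall>t\<in>{0..1::real}. p + axis i ((of_real t - 1) * p $ i) \<in> S)"

lemma axis_mult_nth: "axis i (c * x) $ j = axis i c $ j * (x::complex)" by (simp add: axis_def)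

text \<open>Hadamard's lemma: the fundamental theorem of calculus on the segment that scales the
  \<open>i\<close>-th coordinate from 0 to its value gives \<open>g\<close> as that coordinate times
  an average of the partial derivative.\<close>

lemma holo_divide_coord:
 fixes g :: "complex^'n => complex"
 assumes g: "holo g S" and S: "coord_star i S" and z: "!!p. p \<in> S ==> p $ i = 0 ==> g p = 0"
 obtains g1 where "holo g1 S" "!!p. p \<in> S ==> g p = p $ i * g1 p"
proof -
 have opS: "open S" using g by (rule holo_open)
 define K where "K p t = pd g i (p + axis i ((of_real t - 1) * p $ i))" for p and t :: real
 have inS: "p + axis i ((of_real t - 1) * p $ i) \<in> S" if "p \<in> S" "t \<in> {0..1}" for p and t :: real
  using S that unfolding coord_star_def by blast
 have "holo (%p. integral {0..1} (K p)) S"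
 proof (rule holo_integral[OF opS])
  fix t :: real assume t: "t \<in> {0..1}"
  show "holo (%p. K p t) S" unfolding K_def
  proof (rule holo_compose[OF holo_partial_deriv[OF g] opS])
   show "holo (%p. (p + axis i ((of_real t - 1) * p $ i)) $ j) S" for j unfolding vector_add_component axis_mult_nth
    by (rule holo_add[OF holo_nth[OF opS] holo_mult[OF holo_const[OF opS] holo_nth[OF opS]]])
  qed (use inS t in auto)
 next
  have "continuous_on (S \<times> {0..1}) (%x. K (fst x) (snd x))" unfolding K_def using inS
   by (intro continuous_on_compose2[OF holo_cont[OF holo_partial_deriv[OF g]]] continuous_intros) auto
  then show "continuous_on (S \<times> {0..1}) (%(p, t). K p t)" by (simp add: case_prod_unfold)
 qed
 moreover have "g p = p $ i * integral {0..1} (K p)" if p: "p \<in> S" for p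
 proof -
  have "((%t. p $ i * K p t) has_integral g (p + axis i ((of_real 1 - 1) * p $ i)) - g (p + axis i ((of_real 0 - 1) * p $ i))) {0..1::real}"
  proof (rule fundamental_theorem_of_calculus)
   fix t :: real assume t: "t \<in> {0..1}"
   have 1: "((%t::real. (of_real t - 1) * p $ i) has_vector_derivative p $ i) (at t)" unfolding has_vector_derivative_def
    by (auto intro!: derivative_eq_intros simp: scaleR_conv_of_real)
   have "((%z. g (p + axis i z)) \<circ> (%t::real. (of_real t - 1) * p $ i) has_vector_derivative p $ i * K p t) (at t)" unfolding K_def
    by (rule field_vector_diff_chain_at[OF 1 holo_slice_deriv[OF g inS[OF p t]]])
   then show "((%t::real. g (p + axis i ((of_real t - 1) * p $ i))) has_vector_derivative p $ i * K p t) (at t within {0..1})"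
    by (simp add: o_def has_vector_derivative_at_within)
  qed simp
  moreover have "g (p + axis i ((of_real 0 - 1) * p $ i)) = 0" by (rule z) (use inS[OF p, of 0] in \<open>auto simp: axis_def\<close>)
  ultimately have "((%t. p $ i * K p t) has_integral g p) {0..1::real}" by simp
  then have "integral {0..1} (%t. p $ i * K p t) = g p" by (rule integral_unique)
  then show ?thesis by simp
 qed
 ultimately show thesis using that by blast
qed

lemma coord_star_0: "coord_star i S ==> p \<in> S ==> p + axis i (0 - p $ i) \<in> S"
proof -
 assume "coord_star i S" "p \<in> S"
 then have "p + axis i ((of_real 0 - 1) * p $ i) \<in> S" unfolding coord_star_def by (metis atLeastAtMost_iff order_refl zero_le_one)
 then show ?thesis by simp
qed

lemma continuous_axis_shift: "isCont (%z. p + axis i (z - c) :: complex^'n) z0"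
proof -
 have "continuous_on UNIV (%z. p + axis i (z - c) :: complex^'n)" by (intro continuous_intros)
 then show ?thesis by (simp add: continuous_on_eq_continuous_at)
qed

text \<open>As long as the whole family vanishes on the hyperplane it is divided by the coordinate.
  Each division lowers the order \<open>n\<close> of the chosen slice of \<open>A k0\<close>, so at
  most \<open>n\<close> divisions are possible.\<close>

lemma holo_order_aux:
 fixes A :: "'k => complex^'n => complex"
 assumes "coord_star i S" "p \<in> S" "isCont v 0" "v 0 ~= 0"
  and "!!k. holo (A k) S" "r > 0"
  and "!!z. z \<in> ball 0 r - {0} ==> A k0 (p + axis i (z - p $ i)) = z ^ n * v z"
 shows "\<exists>m A'. (\<forall>k. holo (A' k) S) & (\<forall>k. \<forall>q\<in>S. A k q = q $ i ^ m * A' k q) &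
   (\<exists>k. \<exists>q\<in>S. q $ i = 0 & A' k q ~= 0)" using assms(5-)
proof (induction n arbitrary: A r)
 case 0
 have p0: "p + axis i (0 - p $ i) \<in> S" by (rule coord_star_0) fact+
 have "isCont (A k0) (p + axis i (0 - p $ i))" using p0 holo_cont[OF 0(1)] holo_open[OF 0(1)] by (simp add: continuous_on_eq_continuous_at)
 then have lim: "((%z. A k0 (p + axis i (z - p $ i))) \<longlongrightarrow> A k0 (p + axis i (0 - p $ i))) (at 0)"
  by (rule isCont_tendsto_compose) (rule continuous_axis_shift[unfolded isCont_def])
 have "((%z. A k0 (p + axis i (z - p $ i))) \<longlongrightarrow> v 0) (at 0)"
 proof (rule Lim_transform_within[of v])
  show "v \<midarrow>0\<rightarrow> v 0" using assms(3) by (simp add: isCont_def)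
  show "0 < r" by fact
 qed (use 0 in \<open>auto simp: dist_norm\<close>)
 then have "A k0 (p + axis i (0 - p $ i)) = v 0" using tendsto_unique[OF _ lim] by auto
 then have "A k0 (p + axis i (0 - p $ i)) ~= 0" using assms(4) by simp
 moreover have "(p + axis i (0 - p $ i)) $ i = 0" by (simp add: axis_def)
 ultimately have "\<exists>k. \<exists>q\<in>S. q $ i = 0 & A k q ~= 0" using p0 by blast
 then show ?case using 0(1) by (intro exI[of _ 0] exI[of _ A]) auto
next
 case (Suc n)
 show ?case
 proof (cases "\<exists>k. \<exists>q\<in>S. q $ i = 0 & A k q ~= 0")
  case True
  then show ?thesis using Suc.prems(1) by (intro exI[of _ 0] exI[of _ A]) auto
 next
  case False
  have "\<exists>g1. holo g1 S & (\<forall>q\<in>S. A k q = q $ i * g1 q)" for k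
   using holo_divide_coord[OF Suc.prems(1)[of k] assms(1)] False by metis
  then obtain B where B: "!!k. holo (B k) S" "!!k q. q \<in> S ==> A k q = q $ i * B k q" by metis
  have "((%z. p + axis i (z - p $ i)) \<longlongrightarrow> p + axis i (0 - p $ i)) (nhds 0)"
   using continuous_axis_shift[where p = p and i = i and c = "p $ i" and ?z0.0 = 0]
    tendsto_at_iff_tendsto_nhds[of "%z. p + axis i (z - p $ i)" 0] unfolding isCont_def by blast
  then have "\<forall>\<^sub>F z in nhds 0. p + axis i (z - p $ i) \<in> S"
   using holo_open[OF B(1)] coord_star_0[OF assms(1,2)] topological_tendstoD by blast
  then obtain d where d: "d > 0" "!!z. dist z 0 < d ==> p + axis i (z - p $ i) \<in> S" unfolding eventually_nhds_metric by blast
  have "B k0 (p + axis i (z - p $ i)) = z ^ n * v z" if z: "z \<in> ball 0 (min r d) - {0}" for z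
  proof -
   have "A k0 (p + axis i (z - p $ i)) = (p + axis i (z - p $ i)) $ i * B k0 (p + axis i (z - p $ i))" using z d(2)[of z] by (intro B(2)) auto
   moreover have "(p + axis i (z - p $ i)) $ i = z" by (simp add: axis_def)
   ultimately have "z * B k0 (p + axis i (z - p $ i)) = z * (z ^ n * v z)" using Suc.prems(3)[of z] z by (simp add: mult_ac)
   then show ?thesis using z by simp
  qed
  then obtain m A' where
   "\<forall>k. holo (A' k) S" "\<forall>k. \<forall>q\<in>S. B k q = q $ i ^ m * A' k q"
   "\<exists>k. \<exists>q\<in>S. q $ i = 0 & A' k q ~= 0"
   using Suc.IH[where A = B and r = "min r d", OF B(1)] d(1) Suc.prems(2) by (auto elim!: exE conjE)
  then show ?thesis using B(2) by (intro exI[of _ "Suc m"] exI[of _ A']) (auto simp: mult_ac)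
 qed
qed

text \<open>The largest power of a coordinate common to a whole family. It is finite because
  \<open>A k0\<close> is not zero at \<open>p\<close>: on the line through \<open>p\<close> in
  direction \<open>i\<close> it vanishes to finite order at the hyperplane.\<close>

lemma holo_order:
 fixes A :: "'k => complex^'n => complex"
 assumes A: "!!k. holo (A k) S" and S: "coord_star i S" "convex S" and p: "p \<in> S" "A k0 p ~= 0"
 obtains m A' where "!!k. holo (A' k) S" "!!k q. q \<in> S ==> A k q = q $ i ^ m * A' k q"
   "\<exists>k. \<exists>q\<in>S. q $ i = 0 & A' k q ~= 0"
proof -
 define X where "X = (%z. p + axis i (z - p $ i)) -` S"
 define \<phi> where "\<phi> z = A k0 (p + axis i (z - p $ i))" for z
 have "open X" unfolding X_def using holo_open[OF A] by (intro open_vimage continuous_intros) auto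
 have "convex X"
 proof (rule convexI)
  fix x y and u v :: real assume *: "x \<in> X" "y \<in> X" "0 <= u" "0 <= v" "u + v = 1"
  have v: "v = 1 - u" using * by simp
  have "(p + axis i (u *\<^sub>R x + v *\<^sub>R y - p $ i)) $ j =
    (u *\<^sub>R (p + axis i (x - p $ i)) + v *\<^sub>R (p + axis i (y - p $ i))) $ j" for j
   unfolding v vector_add_component vector_scaleR_component unfolding scaleR_conv_of_real of_real_diff of_real_1
   by (simp add: axis_def algebra_simps)
  then have "p + axis i (u *\<^sub>R x + v *\<^sub>R y - p $ i) =
    u *\<^sub>R (p + axis i (x - p $ i)) + v *\<^sub>R (p + axis i (y - p $ i))" by (simp add: vec_eq_iff)
  then show "u *\<^sub>R x + v *\<^sub>R y \<in> X" using * \<open>convex S\<close> by (simp add: convex_def X_def)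
 qed
 have "0 \<in> X" using coord_star_0[OF S(1) p(1)] by (simp add: X_def)
 have "p $ i \<in> X" using p by (simp add: X_def)
 have "\<phi> holomorphic_on X" unfolding \<phi>_def using A[of k0] \<open>open X\<close>
 proof (rule holo_slice)
  have "(%z. (p + axis i (z - p $ i)) $ j) = (%z. p $ j + axis i 1 $ j * (z - p $ i))" for j by (auto simp: axis_def)
  then show "(%z. (p + axis i (z - p $ i)) $ j) holomorphic_on X" for j by (auto intro!: holomorphic_intros)
 qed (simp add: X_def)
 have "\<exists>r n v. r > 0 & isCont v 0 & v 0 ~= 0 & (\<forall>z\<in>ball 0 r. \<phi> z = z ^ n * v z)"
 proof (cases "\<phi> 0 = 0")
  case True
  have "~ \<phi> constant_on X"
  proof
   assume "\<phi> constant_on X"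
   then have "\<phi> (p $ i) = \<phi> 0" using \<open>0 \<in> X\<close> \<open>p $ i \<in> X\<close> unfolding constant_on_def by metis
   then show False using True p by (simp add: \<phi>_def)
  qed
  then obtain g r n where "0 < (n::nat)" "0 < r" "g holomorphic_on ball 0 r"
    "!!w. w \<in> ball 0 r ==> \<phi> w = (w - 0) ^ n * g w" "!!w. w \<in> ball 0 r ==> g w ~= 0"
   using holomorphic_factor_zero_nonconstant[OF \<open>\<phi> holomorphic_on X\<close> \<open>open X\<close>
     convex_connected[OF \<open>convex X\<close>] \<open>0 \<in> X\<close> True] by metis
  moreover from this have "isCont g 0" using holomorphic_on_imp_continuous_on[of g "ball 0 r"] by (simp add: continuous_on_eq_continuous_at)
  ultimately show ?thesis by (intro exI[of _ r] exI[of _ n] exI[of _ g]) auto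
 next
  case False
  have "isCont \<phi> 0"
   using holomorphic_on_imp_continuous_on[OF \<open>\<phi> holomorphic_on X\<close>] \<open>open X\<close> \<open>0 \<in> X\<close>
   by (simp add: continuous_on_eq_continuous_at)
  then show ?thesis using False by (intro exI[of _ 1] exI[of _ 0] exI[of _ \<phi>]) auto
 qed
 then obtain r n v where rnv: "r > 0" "isCont v 0" "v 0 ~= 0" "!!z. z \<in> ball 0 r ==> \<phi> z = z ^ n * v z" by blast
 have sl: "A k0 (p + axis i (z - p $ i)) = z ^ n * v z" if "z \<in> ball 0 r - {0}" for z using rnv(4)[of z] that by (simp add: \<phi>_def)
 have "\<exists>m A'. (\<forall>k. holo (A' k) S) & (\<forall>k. \<forall>q\<in>S. A k q = q $ i ^ m * A' k q) &
   (\<exists>k. \<exists>q\<in>S. q $ i = 0 & A' k q ~= 0)"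
  by (rule holo_order_aux[where A = A and v = v and r = r and n = n and p = p and ?k0.0 = k0, OF S(1) p(1) rnv(2,3) A rnv(1) sl])
 then obtain m A' where "(\<forall>k. holo (A' k) S) & (\<forall>k. \<forall>q\<in>S. A k q = q $ i ^ m * A' k q) &
   (\<exists>k. \<exists>q\<in>S. q $ i = 0 & A' k q ~= 0)" by (elim exE)
 then show thesis by (intro that[of A' m]) simp_all
qed

section \<open>Multivariate power series\<close>

definition msize :: "('n::finite => nat) => nat" where "msize k = (\<Sum>i\<in>UNIV. k i)"

definition mpow :: "'a::comm_monoid_mult^'n => ('n => nat) => 'a" where
 "mpow y k = (\<Prod>i\<in>UNIV. y $ i ^ k i)"

text \<open>Polydiscs replace balls because the monomials attain their bound
  \<open>rho ^ msize k\<close> at the corner point, so that one weighted sum controls the whole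
  polydisc.\<close>

definition power_rep :: "complex^'n => real => (complex^'n => complex) => (('n => nat) => complex) => bool" where
 "power_rep a rho f c \<longleftrightarrow> rho > 0 & (%k. norm (c k) * rho ^ msize k) summable_on UNIV &
  (\<forall>y. (\<forall>i. norm (y $ i - a $ i) <= rho) --> ((%k. c k * mpow (y - a) k) has_sum f y) UNIV)"

text \<open>A weighted l1-norm of the coefficients. It is submultiplicative for Cauchy products,
  which makes geometric series of expansions available.\<close>

definition wnorm :: "real => (('n::finite => nat) => complex) => real" where
 "wnorm rho c = (\<Sum>\<^sub>\<infinity>k. norm (c k) * rho ^ msize k)"

lemma mpow_const: "mpow (\<chi> i. x) k = (x::'a::comm_semiring_1) ^ msize k" by (simp add: mpow_def msize_def power_sum)

lemma norm_mpow_le: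
 fixes y :: "complex^'n"
 assumes "!!i. norm (y $ i) <= rho"
 shows "norm (mpow y k) <= rho ^ msize k"
proof -
 have "norm (mpow y k) = (\<Prod>i\<in>UNIV. norm (y $ i) ^ k i)" by (simp add: mpow_def prod_norm[symmetric] norm_power)
 also have "\<dots> <= (\<Prod>i\<in>UNIV. rho ^ k i)" using assms by (intro prod_mono) (auto intro: power_mono)
 finally show ?thesis by (simp add: msize_def power_sum)
qed

lemma norm_le_coords:
 fixes y :: "complex^'n"
 assumes "!!i. norm (y $ i) <= rho"
 shows "norm y <= of_nat CARD('n) * rho"
proof -
 have "norm y <= (\<Sum>i\<in>UNIV. norm (y $ i))" unfolding norm_vec_def by (rule L2_set_le_sum) simp
 also have "\<dots> <= (\<Sum>i\<in>(UNIV::'n set). rho)" using assms by (intro sum_mono) auto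
 finally show ?thesis by simp
qed

text \<open>Unordered summability of complex numbers is absolute; applied at the point with all
  coordinates shifted by \<open>rho\<close> it yields the weighted sum.\<close>

lemma multi_analytic_imp_power_rep:
 fixes f :: "complex^'n => complex"
 assumes "multi_analytic_on f {a}"
 obtains rho0 c where "rho0 > 0" "!!rho. 0 < rho ==> rho <= rho0 ==> power_rep a rho f c"
proof -
 obtain r c where r: "r > 0" and c': "\<forall>y\<in>ball a r. ((%k. c k * (\<Prod>i\<in>UNIV. (y $ i - a $ i) ^ k i)) has_sum f y) UNIV"
  using assms unfolding multi_analytic_on_def by blast
 have c: "((%k. c k * mpow (y - a) k) has_sum f y) UNIV" if "y \<in> ball a r" for y using c' that unfolding mpow_def vector_minus_component by blast
 \<comment> \<open>Coordinates of size at most \<open>rho0\<close> keep the Euclidean norm at or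
   below \<open>r / 2\<close>.\<close>
 define rho0 where "rho0 = r / (2 * of_nat CARD('n))"
 have "rho0 > 0" using r by (simp add: rho0_def)
 have inb: "y \<in> ball a r" if "!!i. norm (y $ i - a $ i) <= rho0" for y
 proof -
  have "norm (y - a) <= of_nat CARD('n) * rho0" using that by (intro norm_le_coords) simp
  also have "\<dots> < r" using r by (simp add: rho0_def)
  finally show ?thesis by (simp add: dist_norm norm_minus_commute)
 qed
 have "power_rep a rho f c" if rho: "0 < rho" "rho <= rho0" for rho unfolding power_rep_def
 proof (intro conjI allI impI)
  define y where "y = a + (\<chi> i. of_real rho)"
  have "y \<in> ball a r" using rho by (intro inb) (simp add: y_def)
  from c[OF this] have "(%k. c k * of_real rho ^ msize k) summable_on UNIV" unfolding y_def by (auto simp: mpow_const summable_on_def)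
  then have "(%k. norm (c k * of_real rho ^ msize k)) summable_on UNIV" by (simp only: summable_on_iff_abs_summable_on_complex[symmetric])
  then show "(%k. norm (c k) * rho ^ msize k) summable_on UNIV" using rho by (simp add: norm_mult norm_power)
 next
  fix y assume "\<forall>i. norm (y $ i - a $ i) <= rho"
  then have "norm (y $ i - a $ i) <= rho0" for i using rho order_trans by blast
  then show "((%k. c k * mpow (y - a) k) has_sum f y) UNIV" by (intro c inb)
 qed (use rho in auto)
 then show thesis using that \<open>rho0 > 0\<close> by blast
qed

lemma power_rep_imp_multi_analytic: "power_rep a rho f c ==> multi_analytic_on f {a}" unfolding multi_analytic_on_def
proof (intro ballI exI conjI)
 fix b y assume f: "power_rep a rho f c" and b: "b \<in> {a}" and y: "y \<in> ball b rho"
 have "norm (y $ i - a $ i) <= rho" for i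
 proof -
  have "norm (y $ i - a $ i) <= norm (y - a)" by (metis vector_minus_component Finite_Cartesian_Product.norm_nth_le)
  then show ?thesis using b y by (simp add: dist_norm norm_minus_commute)
 qed
 then show "((%k. c k * (\<Prod>i\<in>UNIV. (y $ i - b $ i) ^ k i)) has_sum f y) UNIV" using f b unfolding power_rep_def mpow_def by auto
qed (auto simp: power_rep_def)

lemma multi_analytic_cong:
 fixes f :: "complex^'n => complex"
 assumes "multi_analytic_on f {a}" "open B" "a \<in> B" "!!z. z \<in> B ==> f z = g z"
 shows "multi_analytic_on g {a}"
proof -
 obtain r c where r: "r > 0" and
  c: "\<forall>y\<in>ball a r. ((%k. c k * (\<Prod>i\<in>UNIV. (y $ i - a $ i) ^ k i)) has_sum f y) UNIV"
  using assms(1) unfolding multi_analytic_on_def by blast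
 obtain s where s: "s > 0" "ball a s \<subseteq> B" using assms openE by blast
 show ?thesis unfolding multi_analytic_on_def
 proof (intro ballI exI conjI)
  fix b y assume "b \<in> {a}" and y: "y \<in> ball b (min r s)"
  then have "y \<in> ball a r" "y \<in> B" "b = a" using s by auto
  then show "((%k. c k * (\<Prod>i\<in>UNIV. (y $ i - b $ i) ^ k i)) has_sum g y) UNIV" using c assms(4) by force
 qed (use r s in auto)
qed

lemma holomorphic_axis_line: "(%z. (p + axis i (z::complex)) $ j) holomorphic_on X" unfolding vector_add_component axis_def
 by (cases "j = i") (auto intro!: holomorphic_intros)

text \<open>The weighted sum majorises the series on the polydisc, so the partial sums converge
  uniformly. The limit is continuous and separately holomorphic, and Osgood's lemma applies.\<close>

lemma multi_analytic_imp_holo: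
 fixes f :: "complex^'n => complex"
 assumes "multi_analytic_on f {a}"
 obtains r where "r > 0" "holo f (ball a r)"
proof -
 obtain rho c where rep: "power_rep a rho f c" using multi_analytic_imp_power_rep[OF assms] by (metis order_refl)
 then have rho: "rho > 0" "(%k. norm (c k) * rho ^ msize k) summable_on UNIV"
  "!!y. (!!i. norm (y $ i - a $ i) <= rho) ==> ((%k. c k * mpow (y - a) k) has_sum f y) UNIV" unfolding power_rep_def by auto
 have sm: "norm (y $ i - a $ i) <= rho" if "y \<in> ball a rho" for y i
 proof -
  have "norm (y $ i - a $ i) <= norm (y - a)" by (metis vector_minus_component Finite_Cartesian_Product.norm_nth_le)
  then show ?thesis using that by (simp add: dist_norm norm_minus_commute)
 qed
 define s where "s X y = (\<Sum>k\<in>X. c k * mpow (y - a) k)" for X y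
 have lim: "uniform_limit (ball a rho) s f (finite_subsets_at_top UNIV)" unfolding s_def
 proof (rule Weierstrass_m_test_general')
  show "norm (c k * mpow (y - a) k) <= norm (c k) * rho ^ msize k" if "y \<in> ball a rho" for k y unfolding norm_mult using sm[OF that]
   by (intro mult_left_mono norm_mpow_le) auto
  show "((%k. c k * mpow (y - a) k) has_sum f y) UNIV" if "y \<in> ball a rho" for y by (intro rho(3) sm that)
 qed (rule rho(2))
 have "holo (%y. y $ i - a $ i) UNIV" for i by (rule holo_diff[OF holo_nth holo_const]) auto
 then have hs: "holo (s X) UNIV" for X unfolding s_def mpow_def vector_minus_component
  by (intro holo_sum holo_mult holo_prod holo_power holo_const) auto
 have "holo f (ball a rho)"
 proof (rule osgood)
  show "continuous_on (ball a rho) f" by (rule uniform_limit_theorem[OF _ lim])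
    (use hs in \<open>auto intro!: always_eventually continuous_on_subset[OF holo_cont]\<close>)
  fix p i assume p: "p \<in> ball a rho"
  obtain e where e: "e > 0" "cball p e \<subseteq> ball a rho" using p by (meson open_ball open_contains_cball)
  have inb: "p + axis i z \<in> ball a rho" if "z \<in> cball 0 e" for z :: complex using e(2) that by (auto simp: subset_iff dist_norm)
  have "uniform_limit (cball 0 e) (%X z. s X (p + axis i z)) (%z. f (p + axis i z)) (finite_subsets_at_top UNIV)"
   using lim inb unfolding uniform_limit_iff by (auto elim!: eventually_mono)
  moreover have hol: "(%z. s X (p + axis i z)) holomorphic_on UNIV" for X by (rule holo_slice[OF hs open_UNIV holomorphic_axis_line UNIV_I])
  moreover have "\<forall>\<^sub>F X in finite_subsets_at_top UNIV. continuous_on (cball 0 e) (%z. s X (p + axis i z)) &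
    (%z. s X (p + axis i z)) holomorphic_on ball 0 e"
  proof (rule always_eventually, rule allI, rule conjI)
   show "continuous_on (cball 0 e) (%z. s X (p + axis i z))" for X by (rule continuous_on_subset[OF holomorphic_on_imp_continuous_on[OF hol]]) simp
   show "(%z. s X (p + axis i z)) holomorphic_on ball 0 e" for X by (rule holomorphic_on_subset[OF hol]) simp
  qed
  ultimately have "(%z. f (p + axis i z)) holomorphic_on ball 0 e"
   using holomorphic_uniform_limit[where f = "%X z. s X (p + axis i z)" and F = "finite_subsets_at_top UNIV"
     and z = 0 and r = e and g = "%z. f (p + axis i z)"] finite_subsets_at_top_neq_bot by blast
  then show "(%z. f (p + axis i z)) field_differentiable at 0" using e(1) by (auto simp: holomorphic_on_def at_within_open[of _ "ball 0 e"])
 qed simp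
 then show thesis using that rho(1) by blast
qed

section \<open>Cauchy products and reciprocals of power series\<close>

definition mconv :: "(('n::finite => nat) => 'a::comm_semiring_0) => (('n => nat) => 'a) => ('n => nat) => 'a" where
 "mconv c d m = (\<Sum>k\<in>{k. \<forall>i. k i <= m i}. c k * d (%i. m i - k i))"

lemma finite_below: "finite {k::'n::finite => nat. \<forall>i. k i <= m i}"
proof -
 have "{k. \<forall>i. k i <= m i} = PiE UNIV (%i. {..m i})" by (auto simp: PiE_UNIV_domain)
 then show ?thesis by (simp add: finite_PiE)
qed

lemma has_sum_mconv:
 fixes N M :: "('n::finite => nat) => 'a::{real_normed_field, banach}"
 assumes N: "(N has_sum s) UNIV" "(%k. norm (N k)) summable_on UNIV"
  and M: "(M has_sum t) UNIV" "(%k. norm (M k)) summable_on UNIV" shows "(mconv N M has_sum s * t) UNIV"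
proof -
 have "(%x. case x of (k, l) => norm (N k) * norm (M l)) summable_on Sigma UNIV (%_. UNIV)"
 proof (rule summable_on_SigmaI)
  show "((%y. case (x, y) of (k, l) => norm (N k) * norm (M l)) has_sum norm (N x) * infsum (%l. norm (M l)) UNIV) UNIV" for x
   using has_sum_infsum[OF M(2)] by (simp add: has_sum_cmult_right)
  show "(%x. norm (N x) * infsum (%l. norm (M l)) UNIV) summable_on UNIV" using N(2) by (rule summable_on_cmult_left)
 qed auto
 then have "(%x. norm (case x of (k, l) => N k * M l)) summable_on UNIV \<times> UNIV" by (simp add: case_prod_unfold norm_mult)
 then have sm: "(%x. case x of (k, l) => N k * M l) summable_on UNIV \<times> UNIV" by (rule abs_summable_summable)
 have "((%x. case x of (k, l) => N k * M l) has_sum s * t) (UNIV \<times> UNIV)"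
 proof (rule has_sum_SigmaI[OF _ _ sm])
  show "((%y. case (x, y) of (k, l) => N k * M l) has_sum N x * t) UNIV" for x using M(1) by (simp add: has_sum_cmult_right)
  show "((%x. N x * t) has_sum s * t) UNIV" using N(1) by (rule has_sum_cmult_left)
 qed
 \<comment> \<open>Pairs \<open>(k, l)\<close> are regrouped by their sum \<open>m\<close>, with
   \<open>k\<close> kept; for each \<open>m\<close> only finitely many \<open>k\<close>
   remain.\<close>
 also have "?this \<longleftrightarrow> ((%(m, k). N k * M (%i. m i - k i)) has_sum s * t) (Sigma UNIV (%m. {k. \<forall>i. k i <= m i}))"
  by (rule has_sum_reindex_bij_witness[where i = "%(m, k). (k, %i. m i - k i)" and j = "%(k, l). (%i. k i + l i, k)"]) (auto simp: fun_eq_iff)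
 finally show ?thesis unfolding mconv_def by (rule has_sum_SigmaD) (use finite_below in \<open>auto intro!: has_sum_finite\<close>)
qed

lemma mconv_mpow: "mconv (%k. c k * mpow y k) (%k. d k * mpow y k) m = mconv c d m * mpow y (m::'n::finite => nat)" for y :: "'a::comm_semiring_1^'n"
 unfolding mconv_def sum_distrib_right
proof (rule sum.cong[OF refl])
 fix k assume "k \<in> {k. \<forall>i. k i <= m i}"
 then have "mpow y k * mpow y (%i. m i - k i) = mpow y m" unfolding mpow_def prod.distrib[symmetric] power_add[symmetric] by simp
 then show "c k * mpow y k * (d (%i. m i - k i) * mpow y (%i. m i - k i)) = c k * d (%i. m i - k i) * mpow y m"
  by (metis (no_types, lifting) mult.assoc mult.left_commute)
qed

lemma power_rep_terms:
 assumes "power_rep a rho f c" "!!i. norm (y $ i - a $ i) <= rho"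
 shows "((%k. c k * mpow (y - a) k) has_sum f y) UNIV"
  and "(%k. norm (c k * mpow (y - a) k)) summable_on UNIV"
proof -
 show "((%k. c k * mpow (y - a) k) has_sum f y) UNIV" using assms by (auto simp: power_rep_def)
 then show "(%k. norm (c k * mpow (y - a) k)) summable_on UNIV"
  unfolding summable_on_iff_abs_summable_on_complex[symmetric] by (auto simp: summable_on_def)
qed

lemma power_rep_mult:
 fixes c d :: "('n::finite => nat) => complex"
 assumes f: "power_rep a rho f c" and g: "power_rep a rho g d"
 shows "power_rep a rho (%y. f y * g y) (mconv c d)" "wnorm rho (mconv c d) <= wnorm rho c * wnorm rho d"
proof -
 have rho: "rho > 0" using f by (simp add: power_rep_def)
 define N where "N = (%k. norm (c k) * mpow (\<chi> i. rho) k)"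
 define M where "M = (%k. norm (d k) * mpow (\<chi> i. rho) k)"
 have NM: "N summable_on UNIV" "M summable_on UNIV" "!!k. N k \<ge> 0" "!!k. M k \<ge> 0"
  using f g rho by (auto simp: N_def M_def mpow_const power_rep_def)
 have s: "(mconv N M has_sum infsum N UNIV * infsum M UNIV) UNIV" using NM by (intro has_sum_mconv) (auto intro: has_sum_infsum)
 have le: "norm (mconv c d m) * rho ^ msize m <= mconv N M m" for m
 proof -
  have "norm (mconv c d m) <= mconv (%k. norm (c k)) (%k. norm (d k)) m"
   unfolding mconv_def by (rule order_trans[OF norm_sum]) (simp add: norm_mult)
  then have "norm (mconv c d m) * rho ^ msize m <= mconv (%k. norm (c k)) (%k. norm (d k)) m * mpow (\<chi> i. rho) m"
   using rho by (simp add: mpow_const mult_right_mono)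
  then show ?thesis by (simp add: N_def M_def mconv_mpow)
 qed
 have sm: "(%m. norm (mconv c d m) * rho ^ msize m) summable_on UNIV"
 proof (rule summable_on_comparison_test)
  show "mconv N M summable_on UNIV" using s by (auto simp: summable_on_def)
 qed (use le rho in auto)
 have "wnorm rho (mconv c d) <= infsum (mconv N M) UNIV" unfolding wnorm_def using s le sm by (intro infsum_mono) (auto simp: summable_on_def)
 also have "\<dots> = wnorm rho c * wnorm rho d" using s by (simp add: infsumI wnorm_def N_def M_def mpow_const)
 finally show "wnorm rho (mconv c d) <= wnorm rho c * wnorm rho d" .
 show "power_rep a rho (%y. f y * g y) (mconv c d)" unfolding power_rep_def
 proof (intro conjI allI impI rho sm)
  fix y assume y: "\<forall>i. norm (y $ i - a $ i) <= rho"
  have "(mconv (%k. c k * mpow (y - a) k) (%k. d k * mpow (y - a) k) has_sum f y * g y) UNIV"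
   using y by (intro has_sum_mconv power_rep_terms[OF f] power_rep_terms[OF g]) auto
  then show "((%k. mconv c d k * mpow (y - a) k) has_sum f y * g y) UNIV" by (simp add: mconv_mpow[abs_def] cong: has_sum_cong)
 qed
qed

lemma power_rep_one: "rho > 0 ==> power_rep a rho (%_. 1) (%k. if k = (%_. 0) then 1 else 0)"
 and wnorm_one: "wnorm rho (%k. if k = (%_. 0) then 1 else 0) = 1"
proof -
 have 1: "((%k. norm (if k = (%_. 0) then 1 else 0 :: complex) * rho ^ msize k) has_sum 1) UNIV" for rho
  by (rule has_sum_finite_neutralI[of "{%_. 0}"]) (auto simp: msize_def)
 then show "wnorm rho (%k. if k = (%_. 0) then 1 else 0) = 1" unfolding wnorm_def by (rule infsumI)
 show "power_rep a rho (%_. 1) (%k. if k = (%_. 0) then 1 else 0)" if "rho > 0" unfolding power_rep_def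
 proof (intro conjI allI impI that)
  show "(%k. norm (if k = (%_. 0) then 1 else 0 :: complex) * rho ^ msize k) summable_on UNIV" using 1 by (auto simp: summable_on_def)
  show "((%k. (if k = (%_. 0) then 1 else 0) * mpow (y - a) k) has_sum 1) UNIV" for y
   by (rule has_sum_finite_neutralI[of "{%_. 0}"]) (auto simp: mpow_def)
 qed
qed

text \<open>Neumann series. \<open>ep j\<close> are the coefficients of the \<open>j\<close>-th
  power of \<kappa>, of norm at most \<open>(1 / 2) ^ j\<close>. The double series over
  \<open>j\<close> and the multi-index converges absolutely, and summing over \<open>j\<close> first
  gives the coefficients \<open>b\<close> of the reciprocal.\<close>

lemma power_rep_geometric:
 fixes e :: "('n::finite => nat) => complex"
 assumes e: "power_rep a rho \<kappa> e" "wnorm rho e <= 1 / 2"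
 shows "multi_analytic_on (%y. 1 / (1 - \<kappa> y)) {a}"
proof -
 define ep where "ep j = ((mconv e) ^^ j) (%k. if k = (%_. 0) then 1 else 0)" for j
 have rho: "rho > 0" using e by (simp add: power_rep_def)
 have wn: "wnorm rho c \<ge> 0" for c :: "('n => nat) => complex" unfolding wnorm_def using rho by (intro infsum_nonneg) auto
 have ep: "power_rep a rho (%y. \<kappa> y ^ j) (ep j) & wnorm rho (ep j) <= (1 / 2) ^ j" for j
 proof (induction j)
  case 0
  then show ?case using power_rep_one[OF rho] by (simp add: ep_def wnorm_one)
 next
  case (Suc j)
  have "ep (Suc j) = mconv e (ep j)" by (simp add: ep_def)
  moreover have "wnorm rho e * wnorm rho (ep j) <= (1 / 2) * (1 / 2) ^ j" using Suc e(2) wn by (intro mult_mono) auto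
  ultimately show ?case using power_rep_mult[OF e(1), of "%y. \<kappa> y ^ j" "ep j"] Suc by auto
 qed
 define b where "b k = (\<Sum>\<^sub>\<infinity>j. ep j k)" for k
 have main: "((%k. b k * mpow (y - a) k) has_sum 1 / (1 - \<kappa> y)) UNIV" if y: "!!i. norm (y $ i - a $ i) <= rho" for y
 proof -
  define t where "t = (%(j, k). ep j k * mpow (y - a) k)"
  have mp: "norm (mpow (y - a) k) <= rho ^ msize k" for k using y by (intro norm_mpow_le) simp
  have nle: "norm (t (j, k)) <= norm (ep j k) * rho ^ msize k" for j k using mp by (simp add: t_def norm_mult mult_left_mono)
  have "(%(j, k). norm (ep j k) * rho ^ msize k) summable_on Sigma UNIV (%_. UNIV)"
  proof (rule summable_on_SigmaI)
   show "((%k. case (j, k) of (j, k) => norm (ep j k) * rho ^ msize k) has_sum wnorm rho (ep j)) UNIV" for j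
    using ep[of j] unfolding wnorm_def power_rep_def by (simp add: has_sum_infsum)
   have "(%j. (1 / 2 :: real) ^ j) summable_on UNIV" by (intro norm_summable_imp_summable_on) (simp add: norm_power summable_geometric)
   then show "(%j. wnorm rho (ep j)) summable_on UNIV" by (rule summable_on_comparison_test) (use ep wn in auto)
  qed (use rho in auto)
  then have "(%x. norm (t x)) summable_on Sigma UNIV (%_. UNIV)" by (rule summable_on_comparison_test) (use nle in auto)
  then have sm: "t summable_on UNIV \<times> UNIV" by (rule abs_summable_summable)
  have ky: "norm (\<kappa> y) <= 1 / 2"
  proof -
   have "norm (\<kappa> y) = norm (\<Sum>\<^sub>\<infinity>k. e k * mpow (y - a) k)" using power_rep_terms(1)[OF e(1) y] by (simp add: infsumI)
   also have "\<dots> <= (\<Sum>\<^sub>\<infinity>k. norm (e k * mpow (y - a) k))" by (rule norm_infsum_bound) (rule power_rep_terms(2)[OF e(1) y])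
   also have "\<dots> <= wnorm rho e" unfolding wnorm_def using power_rep_terms(2)[OF e(1) y] e(1) mp
    by (intro infsum_mono) (auto simp: power_rep_def norm_mult mult_left_mono)
   finally show ?thesis using e(2) by simp
  qed
  have "((%j. \<kappa> y ^ j) has_sum 1 / (1 - \<kappa> y)) UNIV"
   using ky by (intro norm_summable_imp_has_sum geometric_sums) (auto simp: norm_power summable_geometric)
  then have "(t has_sum 1 / (1 - \<kappa> y)) (UNIV \<times> UNIV)"
   by (intro has_sum_SigmaI[OF _ _ sm]) (use power_rep_terms(1)[OF conjunct1[OF ep] y] in \<open>auto simp: t_def\<close>)
  then have sw: "((%(k, j). t (j, k)) has_sum 1 / (1 - \<kappa> y)) (UNIV \<times> UNIV)" by (subst (asm) has_sum_swap) simp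
  have col: "(%j. norm (ep j k)) summable_on UNIV" for k
  proof (rule summable_on_comparison_test)
   have "(%j. (1 / 2 :: real) ^ j) summable_on UNIV" by (intro norm_summable_imp_summable_on) (simp add: norm_power summable_geometric)
   then show "(%j. (1 / 2 :: real) ^ j * (1 / rho ^ msize k)) summable_on UNIV" by (rule summable_on_cmult_left)
   show "norm (ep j k) <= (1 / 2) ^ j * (1 / rho ^ msize k)" for j
   proof -
    have "norm (ep j k) * rho ^ msize k = (\<Sum>\<^sub>\<infinity>k\<in>{k}. norm (ep j k) * rho ^ msize k)" by simp
    also have "\<dots> <= wnorm rho (ep j)" unfolding wnorm_def using ep[of j] rho by (intro infsum_mono_neutral) (auto simp: power_rep_def)
    also have "\<dots> <= (1 / 2) ^ j" using ep by blast
    finally show ?thesis using rho by (simp add: field_simps)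
   qed
  qed auto
  show ?thesis using sw
  proof (rule has_sum_SigmaD)
   fix k
   have "((%j. ep j k) has_sum b k) UNIV" unfolding b_def using abs_summable_summable[OF col] by (rule has_sum_infsum)
   then show "((%j. case (k, j) of (k, j) => t (j, k)) has_sum b k * mpow (y - a) k) UNIV" by (simp add: t_def has_sum_cmult_left)
  qed
 qed
 show ?thesis unfolding multi_analytic_on_def
 proof (intro ballI exI conjI)
  fix a' y assume b: "a' \<in> {a}" and y: "y \<in> ball a' rho"
  have "norm (y $ i - a $ i) <= rho" for i
  proof -
   have "norm (y $ i - a $ i) <= norm (y - a)" by (metis vector_minus_component Finite_Cartesian_Product.norm_nth_le)
   then show ?thesis using b y by (simp add: dist_norm norm_minus_commute)
  qed
  then show "((%k. b k * (\<Prod>i\<in>UNIV. (y $ i - a' $ i) ^ k i)) has_sum 1 / (1 - \<kappa> y)) UNIV" using main[of y] b by (simp add: mpow_def)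
 qed (use rho in auto)
qed

lemma multi_analytic_mult:
 fixes f g :: "complex^'n => complex"
 assumes "multi_analytic_on f {a}" "multi_analytic_on g {a}"
 shows "multi_analytic_on (%y. f y * g y) {a}"
proof -
 obtain r c where c: "r > 0" "!!rho. 0 < rho ==> rho <= r ==> power_rep a rho f c" using multi_analytic_imp_power_rep[OF assms(1)] by blast
 obtain s d where d: "s > 0" "!!rho. 0 < rho ==> rho <= s ==> power_rep a rho g d" using multi_analytic_imp_power_rep[OF assms(2)] by blast
 have "power_rep a (min r s) (%y. f y * g y) (mconv c d)" using c d by (intro power_rep_mult(1)) auto
 then show ?thesis by (rule power_rep_imp_multi_analytic)
qed

text \<open>Write \<open>h = h a * (1 - \<kappa>)\<close> with \<kappa> vanishing at
  \<open>a\<close>. Without a constant term the weighted norm of \<kappa> shrinks at least linearly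
  with the radius, so a smaller polydisc brings it below 1/2 and the geometric series
  applies.\<close>

lemma multi_analytic_inverse:
 fixes h :: "complex^'n => complex"
 assumes h: "multi_analytic_on h {a}" and nz: "h a ~= 0"
 shows "multi_analytic_on (%y. 1 / h y) {a}"
proof -
 obtain r c where c: "r > 0" "!!rho. 0 < rho ==> rho <= r ==> power_rep a rho h c" using multi_analytic_imp_power_rep[OF h] by blast
 define e where "e k = (if k = (%_. 0) then 0 else - c k / h a)" for k
 have c0: "c (%_. 0) = h a"
 proof -
  have "((%k. c k * mpow (a - a) k) has_sum h a) UNIV" using c(1) by (intro power_rep_terms(1)[OF c(2)[of r]]) auto
  moreover have "((%k. c k * mpow (a - a) k) has_sum c (%_. 0)) UNIV"
  proof (rule has_sum_finite_neutralI[of "{%_. 0}"])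
   fix k :: "'n => nat" assume "k \<in> UNIV - {%_. 0}"
   then obtain i where "k i ~= 0" by (auto simp: fun_eq_iff)
   then show "c k * mpow (a - a) k = 0" by (auto simp: mpow_def power_0_left intro!: bexI[of _ i])
  qed (auto simp: mpow_def)
  ultimately show ?thesis using has_sum_unique by blast
 qed
 have rep: "power_rep a rho (%y. 1 - h y / h a) e" if "0 < rho" "rho <= r" for rho unfolding power_rep_def
 proof (intro conjI allI impI that(1))
  have "(%k. norm (c k) * rho ^ msize k * (1 / norm (h a))) summable_on UNIV"
   using c(2)[OF that] unfolding power_rep_def by (intro summable_on_cmult_left) auto
  then show "(%k. norm (e k) * rho ^ msize k) summable_on UNIV"
   by (rule summable_on_comparison_test) (use that in \<open>auto simp: e_def norm_divide\<close>)
  fix y assume y: "\<forall>i. norm (y $ i - a $ i) <= rho"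
  have "((%k. (if k = (%_. 0) then 1 else 0) * mpow (y - a) k + (- 1 / h a) * (c k * mpow (y - a) k)) has_sum
    1 + (- 1 / h a) * h y) UNIV" using y by (intro has_sum_add has_sum_cmult_right power_rep_terms(1)[OF power_rep_one[OF that(1)]]
     power_rep_terms(1)[OF c(2)[OF that]]) auto
  moreover have "(if k = (%_. 0) then 1 else 0) * mpow (y - a) k + (- 1 / h a) * (c k * mpow (y - a) k) = e k * mpow (y - a) k" for k
   using nz c0 by (simp add: e_def)
  ultimately show "((%k. e k * mpow (y - a) k) has_sum 1 - h y / h a) UNIV" by simp
 qed
 \<comment> \<open>The factor by which the radius is shrunk: \<theta> times the old norm is at most
   1/2, and \<open>\<theta> ^ msize k \<le> \<theta>\<close> for every non-zero multi-index.\<close>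
 define \<theta> where "\<theta> = min 1 (1 / (2 * (wnorm r e + 1)))"
 have wr: "wnorm r e \<ge> 0" unfolding wnorm_def using c by (intro infsum_nonneg) auto
 have \<theta>: "0 < \<theta>" "\<theta> <= 1" "\<theta> * wnorm r e <= 1 / 2"
 proof -
  show "0 < \<theta>" "\<theta> <= 1" using wr by (auto simp: \<theta>_def)
  have "\<theta> * wnorm r e <= 1 / (2 * (wnorm r e + 1)) * wnorm r e" using wr by (intro mult_right_mono) (auto simp: \<theta>_def)
  also have "\<dots> <= 1 / 2" using wr by (simp add: field_simps)
  finally show "\<theta> * wnorm r e <= 1 / 2" .
 qed
 have re: "(%k. norm (e k) * r ^ msize k) summable_on UNIV" "(%k. norm (e k) * (\<theta> * r) ^ msize k) summable_on UNIV"
  using rep[of r] rep[of "\<theta> * r"] c \<theta> by (auto simp: power_rep_def mult_left_le_one_le)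
 have "wnorm (\<theta> * r) e <= (\<Sum>\<^sub>\<infinity>k. \<theta> * (norm (e k) * r ^ msize k))" unfolding wnorm_def
 proof (rule infsum_mono[OF re(2) summable_on_cmult_right[OF re(1)]])
  fix k :: "'n => nat"
  show "norm (e k) * (\<theta> * r) ^ msize k <= \<theta> * (norm (e k) * r ^ msize k)"
  proof (cases "k = (%_. 0)")
   case False
   then obtain i where "k i > 0" by (auto simp: fun_eq_iff)
   then have "msize k > 0" unfolding msize_def by (intro sum_pos2[of UNIV i]) auto
   then obtain m where "msize k = Suc m" using gr0_implies_Suc by blast
   then have "\<theta> ^ msize k <= \<theta>" using \<theta> by (simp add: mult_left_le power_le_one)
   then have "\<theta> ^ msize k * (norm (e k) * r ^ msize k) <= \<theta> * (norm (e k) * r ^ msize k)" using c(1) by (intro mult_right_mono) auto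
   then show ?thesis by (simp add: power_mult_distrib mult_ac)
  qed (simp add: e_def)
 qed
 also have "\<dots> = \<theta> * wnorm r e" unfolding wnorm_def using re(1) by (intro infsum_cmult_right) auto
 finally have "wnorm (\<theta> * r) e <= 1 / 2" using \<theta> by simp
 then have "multi_analytic_on (%y. 1 / (1 - (1 - h y / h a))) {a}"
  using c(1) \<theta> by (intro power_rep_geometric[OF rep]) (auto simp: mult_left_le_one_le)
 moreover have "multi_analytic_on (%_. 1 / h a) {a}" unfolding multi_analytic_on_def
 proof (intro ballI exI conjI)
  show "((%k. (if k = (%_. 0) then 1 / h a else 0) * (\<Prod>i\<in>UNIV. (y $ i - b $ i) ^ k i)) has_sum 1 / h a) UNIV" for b y :: "complex^'n"
   by (rule has_sum_finite_neutralI[of "{%_. 0}"]) auto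
 qed (rule zero_less_one)
 ultimately have "multi_analytic_on (%y. 1 / (1 - (1 - h y / h a)) * (1 / h a)) {a}" by (rule multi_analytic_mult)
 then show ?thesis using nz by simp
qed

text \<open>The brackets and first integrals of an integrable family are controlled only at points
  of analyticity in the power series sense. This supplies such points: those where a denominator
  does not vanish.\<close>

lemma multi_analytic_divide:
 fixes g h :: "complex^'n => complex"
 assumes "multi_analytic_on g {a}" "multi_analytic_on h {a}" "h a ~= 0"
 shows "multi_analytic_on (%y. g y / h y) {a}" using multi_analytic_mult[OF assms(1) multi_analytic_inverse[OF assms(2,3)]] by simp

section \<open>Quotients on a tube of boxes\<close>

text \<open>The coordinates are the shift \<open>b\<close> of the family parameter, the time \<open>t\<close>, the shift \<open>s\<close> of the phase and the perturbation parameter \<open>e\<close>.\<close>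
definition pt :: "complex => complex => complex => complex => complex^4" where
 "pt b t s e = (\<chi> i. if i = 1 then b else if i = 2 then t else if i = 3 then s else e)"

lemma pt_nth [simp]: "pt b t s e $ 1 = b" "pt b t s e $ 2 = t" "pt b t s e $ 3 = s" "pt b t s e $ 4 = e" by (simp_all add: pt_def)

lemma pt_eta [simp]: "pt (p $ 1) (p $ 2) (p $ 3) (p $ 4) = p" by (simp add: vec_eq_iff forall_4)

text \<open>Only the time has its own centre and radius. The other three coordinates share one
  radius around 0, which can then be made the same for all boxes.\<close>

definition tbox :: "complex => real => real => (complex^4) set" where
 "tbox t R r = {p. norm (p $ 1) < r & norm (p $ 2 - t) < R & norm (p $ 3) < r & norm (p $ 4) < r}"

lemma pt_in_tbox [simp]: "pt b \<tau> s e \<in> tbox t R r \<longleftrightarrow> norm b < r & norm (\<tau> - t) < R & norm s < r & norm e < r"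
 by (simp add: tbox_def)

lemma open_tbox [simp]: "open (tbox t R r)" unfolding tbox_def by (intro open_Collect_conj open_Collect_less continuous_intros)

lemma convex_tbox [simp]: "convex (tbox t R r)"
proof -
 have "tbox t R r = (%p. p $ 1) -` ball 0 r Int (%p. p $ 2) -` ball t R Int (%p. p $ 3) -` ball 0 r Int (%p. p $ 4) -` ball 0 r"
  by (auto simp: tbox_def dist_norm norm_minus_commute)
 moreover have "linear (%p::complex^4. p $ i)" for i by (rule linearI) auto
 ultimately show ?thesis by (auto intro!: convex_Int convex_linear_vimage)
qed

text \<open>The time coordinate is excluded because its disc is centred at \<open>t\<close>, not at
  0.\<close>

lemma coord_star_tbox: "i ~= 2 ==> coord_star i (tbox t R r)" unfolding coord_star_def
proof safe
 fix p and s :: real assume i: "i ~= 2" and p: "p \<in> tbox t R r" and s: "s \<in> {0..1}"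
 have "norm ((p + axis i ((of_real s - 1) * p $ i)) $ j) <= norm (p $ j)" if "j ~= 2" for j
 proof (cases "j = i")
  case True
  then have "(p + axis i ((of_real s - 1) * p $ i)) $ j = of_real s * p $ j" by (simp add: axis_def algebra_simps)
  then show ?thesis using s by (simp add: norm_mult mult_left_le_one_le)
 qed (simp add: axis_def)
 from this[of 1] this[of 3] this[of 4] show "p + axis i ((of_real s - 1) * p $ i) \<in> tbox t R r" using p i by (auto simp: tbox_def axis_def)
qed

lemma holo_pt_compose:
 assumes f: "holo f T" and "open S"
  and "holo b S" "holo t S" "holo s S" "holo e S" "!!p. p \<in> S ==> pt (b p) (t p) (s p) (e p) \<in> T"
 shows "holo (%p. f (pt (b p) (t p) (s p) (e p))) S"
proof (rule holo_compose[OF f \<open>open S\<close>])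
 have "\<forall>i. holo (%p. pt (b p) (t p) (s p) (e p) $ i) S" unfolding forall_4 using assms by simp
 then show "holo (%p. pt (b p) (t p) (s p) (e p) $ i) S" for i by blast
qed fact

lemma holomorphic_pt:
 assumes f: "holo f T" and "open S"
  and "b holomorphic_on S" "t holomorphic_on S" "s holomorphic_on S" "e holomorphic_on S"
  "!!z. z \<in> S ==> pt (b z) (t z) (s z) (e z) \<in> T" shows "(%z. f (pt (b z) (t z) (s z) (e z))) holomorphic_on S"
proof (rule holo_slice[OF f \<open>open S\<close>])
 have "\<forall>i. (%z. pt (b z) (t z) (s z) (e z) $ i) holomorphic_on S" unfolding forall_4 using assms by simp
 then show "(%z. pt (b z) (t z) (s z) (e z) $ i) holomorphic_on S" for i by blast
qed fact

lemma continuous_on_pt [continuous_intros]: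
 assumes "continuous_on S b" "continuous_on S t" "continuous_on S s" "continuous_on S e"
 shows "continuous_on S (%x. pt (b x) (t x) (s x) (e x))"
proof -
 have "continuous_on S (%x. if i = 1 then b x else if i = 2 then t x else if i = 3 then s x else e x)" for i :: 4
  using assms by (cases "i = 1"; cases "i = 2"; cases "i = 3") simp_all
 then show ?thesis unfolding pt_def by (rule continuous_on_vec_lambda)
qed

lemma holo_order1:
 fixes f :: "complex^'n => complex"
 assumes f: "holo f S" and S: "coord_star i S" "convex S" and p: "p \<in> S" "f p ~= 0"
 obtains m f' where "holo f' S" "!!q. q \<in> S ==> f q = q $ i ^ m * f' q"
   "\<exists>q\<in>S. q $ i = 0 & f' q ~= 0"
proof -
 obtain m and A' :: "unit => complex^'n => complex" where
  A': "!!k. holo (A' k) S" "!!k q. q \<in> S ==> f q = q $ i ^ m * A' k q"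
   "\<exists>k. \<exists>q\<in>S. q $ i = 0 & A' k q ~= 0" by (rule holo_order[where A = "%_::unit. f" and ?k0.0 = "()", OF f S p]) blast
 show thesis
 proof (rule that[OF A'(1,2)])
  show "\<exists>q\<in>S. q $ i = 0 & A' () q ~= 0" using A'(3) by auto
 qed
qed

text \<open>Local quotients are made uniform over a compact set of times. Compactness leaves
  finitely many boxes; the radii transverse to time are cut to a common \<open>r\<close>, and each
  denominator is divided by its largest power of \<open>p $ 4\<close>, so that it no longer vanishes
  identically at parameter 0.\<close>

lemma finite_boxes:
 fixes G :: "nat => complex^4 => complex^3"
 assumes K: "compact K" "K ~= {}" and r1: "r1 > 0"
  and loc: "!!t. t \<in> K ==> \<exists>rho>0. \<exists>A h. tbox t rho rho \<subseteq> \<Omega> & (\<forall>j i. holo (%p. A j p $ i) (tbox t rho rho)) &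
    holo h (tbox t rho rho) & (\<exists>p\<in>tbox t rho rho. h p ~= 0) &
    (\<forall>p\<in>tbox t rho rho. h p ~= 0 --> (\<forall>j. h p *s G j p = A j p) & Q p)"
 obtains C R r m A h where "finite C" "C \<subseteq> K" "C ~= {}" "K \<subseteq> (\<Union>t\<in>C. ball t (R t))" "0 < r" "r <= r1"
  "!!t. t \<in> C ==> R t > 0" "!!t. t \<in> C ==> tbox t (R t) r \<subseteq> \<Omega>"
  "!!t. t \<in> C ==> holo (h t) (tbox t (R t) r)" "!!t. t \<in> C ==> \<exists>p\<in>tbox t (R t) r. p $ 4 = 0 & h t p ~= 0"
  "!!t j i. t \<in> C ==> holo (%p. A t j p $ i) (tbox t (R t) r)"
  "!!t p. t \<in> C ==> p \<in> tbox t (R t) r ==> p $ 4 ~= 0 ==> h t p ~= 0 ==>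
   Q p & (\<forall>j. h t p *s (p $ 4 ^ m *s G j p) = A t j p)"
proof -
 define P where "P t rho A h \<longleftrightarrow> tbox t rho rho \<subseteq> \<Omega> & (\<forall>j i. holo (%p. A j p $ i) (tbox t rho rho)) &
    holo h (tbox t rho rho) & (\<exists>p\<in>tbox t rho rho. h p ~= 0) &
    (\<forall>p\<in>tbox t rho rho. h p ~= 0 --> (\<forall>j. h p *s G j p = A j p) & Q p)" for t rho A h
 have "\<forall>t\<in>K. \<exists>rho A h. rho > 0 & P t rho A h" using loc unfolding P_def by blast
 then obtain R A h where RAh: "!!t. t \<in> K ==> R t > 0 & P t (R t) (A t) (h t)" by metis
 obtain C where C: "finite C" "C \<subseteq> K" "K \<subseteq> (\<Union>t\<in>C. ball t (R t))"
 proof (rule compactE_image[OF K(1), of K "%t. ball t (R t)"])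
  show "K \<subseteq> (\<Union>t\<in>K. ball t (R t))" using RAh by force
 qed (use that in auto)
 have "C ~= {}" using C K by auto
 define r where "r = min r1 (Min (R ` C))"
 have r: "0 < r" "r <= r1" "!!t. t \<in> C ==> r <= R t" using C \<open>C ~= {}\<close> r1 RAh by (auto simp: r_def min_le_iff_disj)
 have sub: "tbox t (R t) r \<subseteq> tbox t (R t) (R t)" if "t \<in> C" for t using r(3)[OF that] by (auto simp: tbox_def)
 have "\<exists>m h'. holo h' (tbox t (R t) r) & (\<forall>p\<in>tbox t (R t) r. h t p = p $ 4 ^ m * h' p) &
   (\<exists>p\<in>tbox t (R t) r. p $ 4 = 0 & h' p ~= 0)" if t: "t \<in> C" for t
 proof -
  have Pt: "P t (R t) (A t) (h t)" "R t > 0" using RAh t C by auto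
  then have hh: "holo (h t) (tbox t (R t) (R t))" by (simp add: P_def)
  \<comment> \<open>Cutting down the transverse radius cannot lose all non-zeros of
    \<open>h t\<close>, by the identity theorem on the larger box.\<close>
  have "\<exists>p\<in>tbox t (R t) r. h t p ~= 0"
  proof (rule ccontr)
   assume "~ ?thesis"
   then have "h t p = 0" if "p \<in> tbox t (R t) (R t)" for p
    using holo_identity_convex[OF hh convex_tbox open_tbox, of "pt 0 t 0 0" t "R t" r p] that sub[OF t] r(1) Pt(2) by auto
   then show False using Pt by (auto simp: P_def)
  qed
  then obtain p where p: "p \<in> tbox t (R t) r" "h t p ~= 0" by blast
  have hsub: "holo (h t) (tbox t (R t) r)" using hh sub[OF t] by (auto intro: holo_subset)
  obtain m h' where "holo h' (tbox t (R t) r)" "!!q. q \<in> tbox t (R t) r ==> h t q = q $ 4 ^ m * h' q"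
   "\<exists>q\<in>tbox t (R t) r. q $ 4 = 0 & h' q ~= 0" by (rule holo_order1[OF hsub coord_star_tbox convex_tbox p, of 4]) auto
  then show ?thesis by blast
 qed
 then obtain m h' where mh: "!!t. t \<in> C ==> holo (h' t) (tbox t (R t) r)"
  "!!t p. t \<in> C ==> p\<in>tbox t (R t) r ==> h t p = p $ 4 ^ m t * h' t p"
  "!!t. t \<in> C ==> \<exists>p\<in>tbox t (R t) r. p $ 4 = 0 & h' t p ~= 0" by metis
 \<comment> \<open>One exponent for all boxes: the largest power removed from a denominator. A box
   that lost only \<open>m t\<close> powers gets the missing \<open>M - m t\<close> in its
   numerators.\<close>
 define M where "M = Max (m ` C)"
 have mM: "m t <= M" if "t \<in> C" for t using that C by (simp add: M_def)
 show thesis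
 proof (rule that[of C R r h' "%t j p. p $ 4 ^ (M - m t) *s A t j p" M])
  fix t j i assume t: "t \<in> C"
  then have "holo (%p. A t j p $ i) (tbox t (R t) (R t))" using RAh C by (auto simp: P_def)
  then have "holo (%p. A t j p $ i) (tbox t (R t) r)" using sub[OF t] by (auto intro: holo_subset)
  then show "holo (%p. (p $ 4 ^ (M - m t) *s A t j p) $ i) (tbox t (R t) r)" by (simp add: holo_mult holo_power holo_nth)
 next
  fix t p assume t: "t \<in> C" and p: "p \<in> tbox t (R t) r" "p $ 4 ~= 0" "h' t p ~= 0"
  have "h t p ~= 0" using mh(2)[OF t p(1)] p by simp
  then have *: "Q p" "!!j. h t p *s G j p = A t j p" using RAh[of t] t C(2) sub[OF t] p(1) unfolding P_def by blast+
  have "h' t p *s (p $ 4 ^ M *s G j p) = p $ 4 ^ (M - m t) *s A t j p" for j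
  proof -
   have "p $ 4 ^ M = p $ 4 ^ (M - m t) * p $ 4 ^ m t" using mM[OF t] by (simp add: power_add[symmetric])
   then show ?thesis unfolding *(2)[symmetric] mh(2)[OF t p(1)] by (simp add: vec_eq_iff)
  qed
  then show "Q p & (\<forall>j. h' t p *s (p $ 4 ^ M *s G j p) = p $ 4 ^ (M - m t) *s A t j p)" using *(1) by blast
 next
  fix t assume t: "t \<in> C"
  then show "tbox t (R t) r \<subseteq> \<Omega>" using sub[OF t] RAh[of t] C(2) unfolding P_def by blast
  show "R t > 0" using RAh t C by auto
 qed (use C r mh \<open>C ~= {}\<close> in auto)
qed

section \<open>The generic parameter region and the regular times\<close>

lemma fsigma_open_ball: "fsigma (ball (a::complex) e)"
proof -
 obtain F :: "nat => complex set" where F: "!!n. compact (F n)" "(\<Union>n. F n) = ball a e"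
  by (rule open_Union_compact_subsets[OF open_ball, of a e]) blast
 have "fsigma (\<Union>(F ` UNIV))" by (rule fsigma.intros) (use F(1) compact_imp_closed in blast)
 then show ?thesis using F(2) by simp
qed

locale tube =
 fixes C :: "complex set" and R :: "complex => real" and r :: real
  and h :: "complex => complex^4 => complex" and N :: "complex set"
 assumes finC: "finite C" and C_ne: "C ~= {}" and N_eq: "N = (\<Union>t\<in>C. ball t (R t))"
  and connN: "connected N" and R_pos: "t \<in> C ==> R t > 0" and r_pos: "r > 0"
  and holo_h: "t \<in> C ==> holo (h t) (tbox t (R t) r)"
  and h_nz: "t \<in> C ==> \<exists>p\<in>tbox t (R t) r. p $ 4 = 0 & h t p ~= 0"
begin

lemma openN: "open N" unfolding N_eq by (intro open_UN ballI open_ball)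

end

definition pol :: "real => complex => real => (complex^2) set" where
 "pol rho c d = {q. norm (q $ 1) < rho & norm (q $ 2 - c) < d}"

lemma open_pol [simp]: "open (pol rho c d)" unfolding pol_def by (intro open_Collect_conj open_Collect_less continuous_intros)

lemma convex_pol [simp]: "convex (pol rho c d)"
proof -
 have "pol rho c d = (%p. p $ 1) -` ball 0 rho Int (%p. p $ 2) -` ball c d" by (auto simp: pol_def dist_norm norm_minus_commute)
 moreover have "linear (%p::complex^2. p $ i)" for i by (rule linearI) auto
 ultimately show ?thesis by (auto intro!: convex_Int convex_linear_vimage)
qed

lemma vector2_in_pol [simp]: "vector [b, s] \<in> pol rho c d \<longleftrightarrow> norm b < rho & norm (s - c) < d" by (simp add: pol_def)

lemma coord_star_pol: "coord_star 1 (pol rho c d)" unfolding coord_star_def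
proof safe
 fix p and s :: real assume p: "p \<in> pol rho c d" and s: "s \<in> {0..1}"
 have "(p + axis 1 ((of_real s - 1) * p $ 1)) $ 1 = of_real s * p $ 1" by (simp add: axis_def algebra_simps)
 then have "norm ((p + axis 1 ((of_real s - 1) * p $ 1)) $ 1) <= norm (p $ 1)" using s by (simp add: norm_mult mult_left_le_one_le)
 then show "p + axis 1 ((of_real s - 1) * p $ 1) \<in> pol rho c d" using p unfolding pol_def by (simp add: axis_def)
qed

text \<open>For small \<open>b \<noteq> 0\<close> and \<open>s\<close> near \<open>s0\<close>, every
  box has a time \<open>\<sigma> t\<close> at which its denominator is non-zero at parameter 0.
  \<open>D t\<close> is the reciprocal of the denominator at that time, multiplied by
  \<open>b ^ J\<close> to become holomorphic across \<open>b = 0\<close>.\<close>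

locale tube_region = tube +
 fixes s0 :: complex and rho :: real and \<sigma> :: "complex => complex" and J :: nat
  and D :: "complex => complex^2 => complex"
 assumes rho_pos: "rho > 0" and rho_r: "rho + norm s0 <= r"
  and sigma: "t \<in> C ==> \<sigma> t \<in> ball t (R t)"
  and region_nz: "t \<in> C ==> 0 < norm b ==> norm b < rho ==> norm (s - s0) < rho ==> h t (pt b (\<sigma> t) s 0) ~= 0"
  and holo_D: "t \<in> C ==> holo (D t) (pol rho s0 rho)"
  and region_inv: "t \<in> C ==> 0 < norm b ==> norm b < rho ==> norm (s - s0) < rho ==>
    D t (vector [b, s]) = b ^ J * inverse (h t (pt b (\<sigma> t) s 0))"

text \<open>The slices of the denominators at suitable times are not identically zero, hence neither
  is their product. After the largest power \<open>b ^ J\<close> is extracted, the cofactor is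
  non-zero at some point \<open>(0, s0)\<close> and around it, so there no slice vanishes for
  \<open>b \<noteq> 0\<close>.\<close>

lemma (in tube) region_exists: "\<exists>s0 rho \<sigma> J D. tube_region C R r h N s0 rho \<sigma> J D"
proof -
 obtain P where P: "!!t. t \<in> C ==> P t \<in> tbox t (R t) r & P t $ 4 = 0 & h t (P t) ~= 0" using h_nz by metis
 define \<sigma> where "\<sigma> t = P t $ 2" for t
 define \<eta> where "\<eta> t q = h t (pt (q $ 1) (\<sigma> t) (q $ 2) 0)" for t and q :: "complex^2"
 define S where "S = pol r 0 r"
 have \<sigma>: "\<sigma> t \<in> ball t (R t)" if "t \<in> C" for t
  using P[OF that] by (simp add: tbox_def \<sigma>_def dist_norm norm_minus_commute)
 have holo_e: "holo (\<eta> t) S" if t: "t \<in> C" for t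
 proof -
  have "\<forall>i. holo (%q. pt (q $ 1) (\<sigma> t) (q $ 2) 0 $ i) S" unfolding forall_4 by (simp add: holo_nth holo_const S_def)
  moreover have "pt (q $ 1) (\<sigma> t) (q $ 2) 0 \<in> tbox t (R t) r" if "q \<in> S" for q
   using that \<sigma>[OF t] r_pos by (simp add: S_def pol_def dist_norm norm_minus_commute)
  ultimately show ?thesis unfolding \<eta>_def by (intro holo_compose[OF holo_h[OF t]]) (auto simp: S_def)
 qed
 have nz: "\<exists>q\<in>S. \<eta> t q ~= 0" if t: "t \<in> C" for t
 proof (rule bexI)
  have "pt (P t $ 1) (P t $ 2) (P t $ 3) 0 = P t" using P[OF t] pt_eta[of "P t"] by simp
  then show "\<eta> t (vector [P t $ 1, P t $ 3]) ~= 0" using P[OF t] by (simp add: \<eta>_def \<sigma>_def)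
  show "vector [P t $ 1, P t $ 3] \<in> S" using P[OF t] by (simp add: S_def tbox_def)
 qed
 have S: "open S" "S ~= {}" "connected S" using r_pos vector2_in_pol[of 0 0 r 0 r] by (auto simp: S_def convex_connected simp del: vector2_in_pol)
 obtain q0 where q0: "q0 \<in> S" "\<forall>t\<in>C. \<eta> t q0 ~= 0"
  using holo_common_nonzero[where f = \<eta> and I = C and S = S and B = S] finC S holo_e nz by blast
 define pr where "pr q = (\<Prod>t\<in>C. \<eta> t q)" for q
 have "holo pr S" unfolding pr_def by (rule holo_prod[OF S(1) holo_e])
 moreover have "pr q0 ~= 0" using q0 finC by (simp add: pr_def)
 ultimately obtain J pr' where J: "holo pr' S" "!!q. q \<in> S ==> pr q = q $ 1 ^ J * pr' q"
   "\<exists>q\<in>S. q $ 1 = 0 & pr' q ~= 0" using holo_order1[of pr S 1 q0] q0(1) coord_star_pol convex_pol unfolding S_def by metis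
 then obtain q1 where q1: "q1 \<in> S" "q1 $ 1 = 0" "pr' q1 ~= 0" by blast
 define s0 where "s0 = q1 $ 2"
 have "open (S Int pr' -` (- {0}))" using S J(1) by (intro continuous_open_preimage holo_cont) auto
 moreover have "q1 \<in> S Int pr' -` (- {0})" using q1 by simp
 ultimately obtain d where d: "d > 0" "ball q1 d \<subseteq> S Int pr' -` (- {0})" using openE by blast
 have "norm s0 < r" using q1(1) by (simp add: S_def pol_def s0_def)
 define rho where "rho = min (d / 2) (r - norm s0)"
 have rho: "rho > 0" "rho <= d / 2" "rho + norm s0 <= r" using d(1) \<open>norm s0 < r\<close> by (simp_all add: rho_def min_def)
 have sub: "q \<in> S & pr' q ~= 0" if "q \<in> pol rho s0 rho" for q
 proof -
  have "norm (q - q1) <= (\<Sum>i\<in>UNIV. norm ((q - q1) $ i))" unfolding norm_vec_def by (rule L2_set_le_sum) simp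
  also have "\<dots> < rho + rho" using that q1(2) by (simp add: sum_2 pol_def s0_def add_strict_mono)
  finally have "q \<in> ball q1 d" using rho(2) by (simp add: dist_norm norm_minus_commute)
  then show ?thesis using d by auto
 qed
 \<comment> \<open>The reciprocal of one slice, times \<open>b ^ J\<close>, is the product of the
   other slices divided by the cofactor \<open>pr'\<close>, which has no zero here.\<close>
 define D where "D t q = (\<Prod>t'\<in>C - {t}. \<eta> t' q) / pr' q" for t q
 have nz\<eta>: "\<eta> t q ~= 0" if "q \<in> pol rho s0 rho" "q $ 1 ~= 0" "t \<in> C" for t q
 proof -
  have "pr q ~= 0" using J(2)[of q] sub[OF that(1)] that(2) by simp
  then show ?thesis using finC that(3) by (auto simp: pr_def)
 qed
 have "tube_region C R r h N s0 rho \<sigma> J D"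
 proof unfold_locales
  show "rho > 0" "rho + norm s0 <= r" by fact+
  show "\<sigma> t \<in> ball t (R t)" if "t \<in> C" for t using \<sigma> that .
  show "h t (pt b (\<sigma> t) s 0) ~= 0" if "t \<in> C" "0 < norm b" "norm b < rho" "norm (s - s0) < rho" for t b s
   using nz\<eta>[of "vector [b, s]" t] that by (simp add: \<eta>_def)
  show "holo (D t) (pol rho s0 rho)" if "t \<in> C" for t
  proof -
   have sub': "pol rho s0 rho \<subseteq> S" using sub by blast
   show ?thesis unfolding D_def
   proof (rule holo_divide)
    show "holo (%q. \<Prod>t'\<in>C - {t}. \<eta> t' q) (pol rho s0 rho)"
     by (rule holo_prod[OF open_pol], rule holo_subset[OF holo_e open_pol sub']) auto
    show "holo pr' (pol rho s0 rho)" by (rule holo_subset[OF J(1) open_pol sub'])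
   qed (use sub in auto)
  qed
  show "D t (vector [b, s]) = b ^ J * inverse (h t (pt b (\<sigma> t) s 0))"
   if "t \<in> C" "0 < norm b" "norm b < rho" "norm (s - s0) < rho" for t b s
  proof -
   define q :: "complex^2" where "q = vector [b, s]"
   have q: "q \<in> pol rho s0 rho" "q $ 1 = b" "b ~= 0" using that by (auto simp: q_def)
   have 1: "pr q = \<eta> t q * (\<Prod>t'\<in>C - {t}. \<eta> t' q)" unfolding pr_def using finC that(1) by (rule prod.remove)
   have 2: "pr q = b ^ J * pr' q" using J(2)[of q] sub[OF q(1)] q(2) by simp
   have 3: "\<eta> t q ~= 0" "pr' q ~= 0" using nz\<eta>[OF q(1) _ that(1)] q sub[OF q(1)] by auto
   have "D t q = b ^ J * inverse (\<eta> t q)" using 1 2 3 by (simp add: D_def field_simps)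
   then show ?thesis by (simp add: q_def \<eta>_def)
  qed
 qed
 then show ?thesis by blast
qed

context tube_region
begin

definition dom4 :: "(complex^4) set" where
 "dom4 = {p. \<exists>t\<in>C. p \<in> tbox t (R t) r & h t p ~= 0}"

text \<open>The regular times: some box represents the functions at parameter 0 with a non-zero
  denominator.\<close>

definition good :: "complex => complex => complex set" where
 "good b s = {\<tau> \<in> N. pt b \<tau> s 0 \<in> dom4}"

definition reg :: "complex => complex => bool" where
 "reg b s \<longleftrightarrow> 0 < norm b & norm b < rho & norm (s - s0) < rho"

lemma reg_small: "reg b s ==> norm b < r & norm s < r"
proof -
 assume "reg b s"
 moreover have "norm s <= norm (s - s0) + norm s0" by (metis diff_add_cancel norm_triangle_ineq)
 moreover have "norm s0 \<ge> 0" by simp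
 ultimately show ?thesis using rho_r unfolding reg_def by linarith
qed

lemma open_dom4_part: "t \<in> C ==> open {p \<in> tbox t (R t) r. h t p ~= 0}"
proof -
 assume t: "t \<in> C"
 have "open (tbox t (R t) r Int h t -` (- {0}))" using holo_h[OF t] by (intro continuous_open_preimage holo_cont) auto
 then show ?thesis by (simp add: vimage_def Int_def)
qed

lemma open_dom4: "open dom4"
proof -
 have "dom4 = (\<Union>t\<in>C. {p \<in> tbox t (R t) r. h t p ~= 0})" by (auto simp: dom4_def)
 then show ?thesis using open_dom4_part by auto
qed

lemma in_N: "t \<in> C ==> norm (\<tau> - t) < R t ==> \<tau> \<in> N" by (auto simp: N_eq dist_norm norm_minus_commute)

lemma sigma_good: "t \<in> C ==> reg b s ==> \<sigma> t \<in> good b s"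
 using region_nz[of t b s] sigma[of t] reg_small[of b s] r_pos in_N[of t "\<sigma> t"]
 by (auto simp: good_def dom4_def reg_def dist_norm norm_minus_commute intro!: bexI[of _ t])

lemma countable_bad_part:
 assumes t: "t \<in> C" and bs: "reg b s"
 shows "countable {\<tau> \<in> ball t (R t). h t (pt b \<tau> s 0) = 0}"
proof -
 have hol: "(%\<tau>. h t (pt b \<tau> s 0)) holomorphic_on ball t (R t)" using reg_small[OF bs] r_pos
  by (intro holomorphic_pt[OF holo_h[OF t]]) (auto simp: dist_norm norm_minus_commute)
 have nz: "h t (pt b (\<sigma> t) s 0) ~= 0" using region_nz[OF t] bs by (simp add: reg_def)
 show ?thesis
 proof (cases "(%\<tau>. h t (pt b \<tau> s 0)) constant_on ball t (R t)")
  case True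
  then have "{\<tau> \<in> ball t (R t). h t (pt b \<tau> s 0) = 0} = {}" using nz sigma[OF t] unfolding constant_on_def by force
  then show ?thesis by (simp only: countable_empty)
 next
  case False
  then show ?thesis using hol by (intro holomorphic_countable_zeros fsigma_open_ball) auto
 qed
qed

lemma countable_bad: "reg b s ==> countable (N - good b s)"
proof -
 assume bs: "reg b s"
 have "N - good b s \<subseteq> (\<Union>t\<in>C. {\<tau> \<in> ball t (R t). h t (pt b \<tau> s 0) = 0})"
 proof
  fix \<tau> assume \<tau>: "\<tau> \<in> N - good b s"
  then obtain t where t: "t \<in> C" "\<tau> \<in> ball t (R t)" by (auto simp: N_eq)
  then have "pt b \<tau> s 0 \<in> tbox t (R t) r" using reg_small[OF bs] r_pos by (simp add: dist_norm norm_minus_commute)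
  then have "h t (pt b \<tau> s 0) = 0" using \<tau> t(1) by (auto simp: good_def dom4_def)
  then show "\<tau> \<in> (\<Union>t\<in>C. {\<tau> \<in> ball t (R t). h t (pt b \<tau> s 0) = 0})" using t by blast
 qed
 moreover have "countable (\<Union>t\<in>C. {\<tau> \<in> ball t (R t). h t (pt b \<tau> s 0) = 0})"
  using finC countable_bad_part[OF _ bs] by (intro countable_UN) (auto intro: countable_finite)
 ultimately show ?thesis using countable_subset by blast
qed

lemma open_good: "open (good b s)"
proof -
 have "good b s = N Int (%\<tau>. pt b \<tau> s 0) -` dom4" by (auto simp: good_def)
 moreover have "open ((%\<tau>. pt b \<tau> s 0) -` dom4)" by (intro open_vimage open_dom4 continuous_intros)
 ultimately show ?thesis using openN by auto
qed

text \<open>A connected open subset of the plane stays connected when a countable set is removed.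
  Continuation in time therefore reaches every regular time.\<close>

lemma connected_good: "reg b s ==> connected (good b s)"
proof -
 assume bs: "reg b s"
 have "connected (N - (N - good b s))" by (rule connected_open_diff_countable[OF _ openN connN countable_bad[OF bs]]) simp
 moreover have "N - (N - good b s) = good b s" by (auto simp: good_def)
 ultimately show ?thesis by simp
qed

lemma good_dense:
 assumes "reg b s" "open N1" "N1 ~= {}" "N1 \<subseteq> N"
 shows "good b s Int N1 ~= {}"
proof
 assume "good b s Int N1 = {}"
 then have "N1 \<subseteq> N - good b s" using assms by auto
 then have "countable N1" using countable_bad[OF assms(1)] countable_subset by blast
 moreover obtain x e where "e > 0" "ball x e \<subseteq> N1" using assms openE by (metis all_not_in_conv)
 ultimately show False using uncountable_ball countable_subset by blast
qed

lemma slice_zero: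
 assumes "reg b s" "f holomorphic_on good b s" "open N1" "N1 ~= {}" "N1 \<subseteq> N"
  and "!!\<tau>. \<tau> \<in> good b s ==> \<tau> \<in> N1 ==> f \<tau> = 0" and "\<tau> \<in> good b s" shows "f \<tau> = 0"
 by (rule analytic_continuation_open[of "good b s Int N1" "good b s" f "%_. 0"])
  (use assms open_good connected_good[OF assms(1)] good_dense[OF assms(1,3,4,5)] in auto)

end

section \<open>Functions given by quotients on the boxes\<close>

lemma pt_axis:
 "pt b \<tau> s e + axis 1 z = pt (b + z) \<tau> s e" "pt b \<tau> s e + axis 2 z = pt b (\<tau> + z) s e"
 "pt b \<tau> s e + axis 3 z = pt b \<tau> (s + z) e" "pt b \<tau> s e + axis 4 z = pt b \<tau> s (e + z)"
 by (simp_all add: vec_eq_iff forall_4 axis_def)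

lemma pt_slice_deriv:
 assumes "holo f S" "pt b \<tau> s e \<in> S"
 shows "((%z. f (pt z \<tau> s e)) has_field_derivative pd f 1 (pt b \<tau> s e)) (at b)"
  and "((%z. f (pt b z s e)) has_field_derivative pd f 2 (pt b \<tau> s e)) (at \<tau>)"
  and "((%z. f (pt b \<tau> z e)) has_field_derivative pd f 3 (pt b \<tau> s e)) (at s)"
  and "((%z. f (pt b \<tau> s z)) has_field_derivative pd f 4 (pt b \<tau> s e)) (at e)"
 using holo_slice_deriv[of f S "pt 0 \<tau> s e" 1 b] holo_slice_deriv[of f S "pt b 0 s e" 2 \<tau>]
  holo_slice_deriv[of f S "pt b \<tau> 0 e" 3 s] holo_slice_deriv[of f S "pt b \<tau> s 0" 4 e] assms by (simp_all add: pt_axis)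

context tube_region
begin

abbreviation "bx t \<equiv> tbox t (R t) r"

text \<open>One function with a numerator in each box over the fixed denominators; a box says
  nothing about its values where the denominator vanishes.\<close>

definition trep :: "(complex => complex^4 => complex) => (complex^4 => complex) => bool" where
 "trep A X \<longleftrightarrow> (\<forall>t\<in>C. holo (A t) (bx t) &
  (\<forall>p\<in>bx t. h t p ~= 0 --> h t p * X p = A t p))"

lemma trepD:
 assumes "trep A X" "t \<in> C"
 shows "holo (A t) (bx t)" and "p \<in> bx t ==> h t p ~= 0 ==> X p = A t p / h t p" using assms by (auto simp: trep_def field_simps)

lemma trep_holo:
 assumes "trep A X"
 shows "holo X dom4"
proof (rule holo_local[OF open_dom4])
 fix p assume "p \<in> dom4"
 then obtain t where t: "t \<in> C" "p \<in> bx t" "h t p ~= 0" by (auto simp: dom4_def)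
 let ?B = "{p \<in> bx t. h t p ~= 0}"
 have sub: "?B \<subseteq> bx t" by auto
 have "holo (%p. A t p / h t p) ?B" by (rule holo_divide[OF holo_subset[OF trepD(1)[OF assms t(1)] open_dom4_part[OF t(1)] sub]
     holo_subset[OF holo_h[OF t(1)] open_dom4_part[OF t(1)] sub]]) simp
 then have "holo X ?B" by (rule holo_cong) (use trepD(2)[OF assms t(1)] in auto)
 then show "\<exists>B. p \<in> B & holo X B" using t by (intro exI[of _ ?B]) simp
qed

text \<open>\<open>G\<close> matters off parameter 0 only. On the overlap of two boxes the cross
  products of numerators and denominators agree off parameter 0 and by continuity also there, so the
  quotient assigned at parameter 0 does not depend on the box.\<close>

lemma trep_extend:
 assumes A: "!!t. t \<in> C ==> holo (A t) (bx t)"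
  and G: "!!t p. t \<in> C ==> p \<in> bx t ==> p $ 4 ~= 0 ==> h t p ~= 0 ==> h t p * G p = A t p"
 obtains X where "trep A X" "!!p. p $ 4 ~= 0 ==> X p = G p"
proof -
 define w where "w p = (SOME t. t \<in> C & p \<in> bx t & h t p ~= 0)" for p
 define X where "X p = (if p $ 4 ~= 0 then G p else A (w p) p / h (w p) p)" for p
 have "h t p * X p = A t p" if t: "t \<in> C" "p \<in> bx t" "h t p ~= 0" for t p
 proof (cases "p $ 4 = 0")
  case False
  then show ?thesis using G t by (simp add: X_def)
 next
  case True
  have w: "w p \<in> C & p \<in> tbox (w p) (R (w p)) r & h (w p) p ~= 0" unfolding w_def by (rule someI[of _ t]) (use t in blast)
  define t' where "t' = w p"
  have t': "t' \<in> C" "p \<in> tbox t' (R t') r" "h t' p ~= 0" using w by (auto simp: t'_def)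
  let ?S = "{p \<in> bx t. h t p ~= 0} Int {p \<in> tbox t' (R t') r. h t' p ~= 0}"
  have op: "open ?S" using open_dom4_part t(1) t'(1) by blast
  have "A t p * h t' p - A t' p * h t p = 0"
  proof (rule holo_zero_dense[OF op, of _ 4])
   have s: "?S \<subseteq> bx t" "?S \<subseteq> tbox t' (R t') r" by auto
   show "continuous_on ?S (%p. A t p * h t' p - A t' p * h t p)" using A[OF t(1)] A[OF t'(1)] holo_h[OF t(1)] holo_h[OF t'(1)] s
    by (intro continuous_intros) (auto intro: continuous_on_subset[OF holo_cont])
   show "A t q * h t' q - A t' q * h t q = 0" if q: "q \<in> ?S" "q $ 4 ~= 0" for q
   proof -
    have "h t q * G q = A t q" "h t' q * G q = A t' q" using q G t(1) t'(1) by auto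
    then show ?thesis by (simp flip: \<open>h t q * G q = A t q\<close> \<open>h t' q * G q = A t' q\<close>)
   qed
  qed (use t t' in auto)
  then show ?thesis using True t t' by (simp add: X_def t'_def field_simps)
 qed
 then have "trep A X" using A by (simp add: trep_def)
 then show thesis using that by (auto simp: X_def)
qed

lemma reg_dom4: "reg b s ==> \<tau> \<in> good b s ==> pt b \<tau> s 0 \<in> dom4" by (simp add: good_def)

lemma slice_holomorphic: "holo f dom4 ==> (%\<tau>. f (pt b \<tau> s 0)) holomorphic_on good b s"
 by (rule holomorphic_pt[OF _ open_good]) (auto simp: good_def)

text \<open>Two continuations: in time through the connected set of regular times, from
  \<open>N1\<close> to all of \<open>N\<close>; then in \<open>b\<close> and \<open>s\<close>, from
  the generic region to the whole box at parameter 0. The second is carried out for the numerator,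
  which is holomorphic throughout the box.\<close>

lemma trep_vanish:
 assumes X: "trep A X" and N1: "open N1" "N1 ~= {}" "N1 \<subseteq> N"
  and z: "!!b s \<tau>. reg b s ==> \<tau> \<in> good b s ==> \<tau> \<in> N1 ==> X (pt b \<tau> s 0) = 0"
  and t: "t \<in> C" and p: "p \<in> bx t" "p $ 4 = 0" shows "A t p = 0"
proof -
 have 1: "A t (pt b \<tau> s 0) = 0" if bs: "reg b s" and \<tau>: "\<tau> \<in> ball t (R t)" for b s \<tau>
 proof -
  have "X (pt b \<tau> s 0) = 0" if "\<tau> \<in> good b s" for \<tau>
   by (rule slice_zero[OF bs slice_holomorphic[OF trep_holo[OF X]] N1]) (use z bs that in auto)
  note X0 = this
  have hol: "(%\<tau>. A t (pt b \<tau> s 0)) holomorphic_on ball t (R t)" using reg_small[OF bs] r_pos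
   by (intro holomorphic_pt[OF trepD(1)[OF X t]]) (auto simp: dist_norm norm_minus_commute)
  define U where "U = {\<tau> \<in> ball t (R t). h t (pt b \<tau> s 0) ~= 0}"
  have "(%\<tau>. h t (pt b \<tau> s 0)) holomorphic_on ball t (R t)" using reg_small[OF bs] r_pos
   by (intro holomorphic_pt[OF holo_h[OF t]]) (auto simp: dist_norm norm_minus_commute)
  then have "open (ball t (R t) Int (%\<tau>. h t (pt b \<tau> s 0)) -` (- {0}))"
   by (intro continuous_open_preimage holomorphic_on_imp_continuous_on) auto
  then have U: "open U" by (simp add: U_def vimage_def Int_def)
  show ?thesis
  proof (rule analytic_continuation_open[OF U open_ball _ _ _ hol, of "%_. 0"])
   show "U ~= {}" using sigma[OF t] region_nz[OF t] bs by (auto simp: U_def reg_def)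
   show "A t (pt b \<tau> s 0) = 0" if "\<tau> \<in> U" for \<tau>
   proof -
    have *: "pt b \<tau> s 0 \<in> bx t" "h t (pt b \<tau> s 0) ~= 0"
     using that reg_small[OF bs] r_pos by (auto simp: U_def dist_norm norm_minus_commute)
    then have "\<tau> \<in> good b s" using t in_N[OF t, of \<tau>] by (auto simp: good_def dom4_def)
    then show ?thesis using X0 trepD(2)[OF X t *] *(2) by simp
   qed
  qed (use \<tau> in \<open>auto simp: U_def\<close>)
 qed
 define B where "B p = A t (pt (p $ 1) (p $ 2) (p $ 3) 0)" for p :: "complex^4"
 let ?T = "{p \<in> bx t. p $ 1 ~= 0 & norm (p $ 1) < rho & norm (p $ 3 - s0) < rho}"
 have "?T = bx t Int {p. p $ 1 ~= 0 & norm (p $ 1) < rho & norm (p $ 3 - s0) < rho}" by auto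
 moreover have "open {p::complex^4. p $ 1 ~= 0 & norm (p $ 1) < rho & norm (p $ 3 - s0) < rho}"
  by (intro open_Collect_conj open_Collect_less open_Collect_neq continuous_intros)
 ultimately have opT: "open ?T" by auto
 have hB: "holo B (bx t)" unfolding B_def by (rule holo_pt_compose[OF trepD(1)[OF X t] open_tbox holo_nth[OF open_tbox] holo_nth[OF open_tbox]
     holo_nth[OF open_tbox] holo_const[OF open_tbox]]) (use r_pos in \<open>auto simp: tbox_def\<close>)
 have "B p = 0"
 proof (rule holo_identity_convex[OF hB convex_tbox opT])
  have "reg (of_real (rho / 2)) s0" using rho_pos by (simp add: reg_def)
  then show "pt (of_real (rho / 2)) t s0 0 \<in> ?T" using reg_small[of "of_real (rho / 2)" s0] rho_pos r_pos R_pos[OF t] by simp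
  show "B q = 0" if "q \<in> ?T" for q
   unfolding B_def by (rule 1) (use that in \<open>auto simp: reg_def tbox_def dist_norm norm_minus_commute\<close>)
 qed (use p in auto)
 moreover have "pt (p $ 1) (p $ 2) (p $ 3) 0 = p" using pt_eta[of p] p(2) by simp
 ultimately show ?thesis by (simp add: B_def)
qed

lemma trep_divide:
 assumes X: "trep A X" and z: "!!t p. t \<in> C ==> p \<in> bx t ==> p $ 4 = 0 ==> A t p = 0"
 obtains A' X' where "trep A' X'" "!!t p. t \<in> C ==> p \<in> bx t ==> A t p = p $ 4 * A' t p"
  "!!p. p \<in> dom4 | p $ 4 ~= 0 ==> X p = p $ 4 * X' p"
proof -
 have "\<exists>g1. holo g1 (bx t) & (\<forall>p\<in>bx t. A t p = p $ 4 * g1 p)" if t: "t \<in> C" for t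
  by (rule holo_divide_coord[OF trepD(1)[OF X t] coord_star_tbox[of 4] z[OF t]]) auto
 then obtain A' where A': "!!t. t \<in> C ==> holo (A' t) (bx t)"
  "!!t p. t \<in> C ==> p \<in> bx t ==> A t p = p $ 4 * A' t p" by metis
 obtain X' where X': "trep A' X'" "!!p. p $ 4 ~= 0 ==> X' p = X p / p $ 4"
 proof (rule trep_extend[of A' "%p. X p / p $ 4"])
  show "h t p * (X p / p $ 4) = A' t p" if "t \<in> C" "p \<in> bx t" "p $ 4 ~= 0" "h t p ~= 0" for t p
   using trepD(2)[OF X that(1,2,4)] A'(2)[OF that(1,2)] that by (simp add: field_simps)
 qed (use A' in auto)
 show thesis
 proof (rule that[OF X'(1) A'(2)])
  fix p assume p: "p \<in> dom4 | p $ 4 ~= 0"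
  show "X p = p $ 4 * X' p"
  proof (cases "p $ 4 = 0")
   case True
   then obtain t where t: "t \<in> C" "p \<in> bx t" "h t p ~= 0" using p by (auto simp: dom4_def)
   then show ?thesis using True trepD(2)[OF X t] z[OF t(1,2)] by simp
  qed (simp add: X')
 qed
qed

lemma dom4_zero_dense:
 assumes "holo f T" "!!q. q \<in> T ==> q $ 4 ~= 0 ==> f q = 0" "p \<in> T"
 shows "f p = 0" using holo_zero_dense[OF holo_open[OF assms(1)] holo_cont[OF assms(1)] assms(2,3)] by simp

text \<open>The loop may meet singular times of \<open>f\<close>, but \<open>w\<close> is
  holomorphic there. On a disc \<open>f\<close> differs from a primitive of \<open>w\<close> by a
  constant, since the disc minus a countable set is connected; so the limits of \<open>f\<close>
  form a primitive of \<open>w\<close> on \<open>N1\<close>.\<close>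

lemma primitive_along_loop:
 assumes bs: "reg b s" and f: "f holomorphic_on good b s" and w: "w holomorphic_on N1"
  and N1: "open N1" "N1 \<subseteq> N" and d: "!!\<tau>. \<tau> \<in> good b s ==> \<tau> \<in> N1 ==> (f has_field_derivative w \<tau>) (at \<tau>)"
  and \<gamma>: "valid_path \<gamma>" "pathfinish \<gamma> = pathstart \<gamma>" "path_image \<gamma> \<subseteq> N1"
 shows "contour_integral \<gamma> w = 0"
proof -
 \<comment> \<open>The extension of \<open>f\<close> to singular times by its limit.\<close>
 define F where "F z = Lim (at z within good b s) f" for z
 have "(F has_field_derivative w z) (at z)" if z: "z \<in> N1" for z
 proof -
  obtain e where e: "e > 0" "ball z e \<subseteq> N1" using N1 z openE by blast
  have "w holomorphic_on ball z e" using w e holomorphic_on_subset by blast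
  then obtain g where g: "!!x. x \<in> ball z e ==> (g has_field_derivative w x) (at x within ball z e)"
   using holomorphic_convex_primitive'[of "ball z e" w] by (metis convex_ball open_ball)
  then have g': "(g has_field_derivative w x) (at x)" if "x \<in> ball z e" for x using that by (metis at_within_open open_ball)
  define B where "B = good b s Int ball z e"
  have "ball z e - (N - good b s) = B" using e N1 by (auto simp: B_def)
  moreover have "connected (ball z e - (N - good b s))" by (rule connected_open_diff_countable[OF _ open_ball _ countable_bad[OF bs]]) simp_all
  ultimately have "connected B" by simp
  have "open B" using open_good by (auto simp: B_def)
  have sub: "x \<in> good b s" "x \<in> N1" "x \<in> ball z e" if "x \<in> B" for x using that e(2) by (auto simp: B_def)
  have dd: "((%x. f x - g x) has_field_derivative 0) (at x)" if "x \<in> B" for x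
   using DERIV_diff[OF d[OF sub(1,2)[OF that]] g'[OF sub(3)[OF that]]] by simp
  obtain c where "!!x. x \<in> B ==> f x - g x = c"
  proof (rule DERIV_zero_connected_constant[OF \<open>connected B\<close> \<open>open B\<close> finite.emptyI, of "%x. f x - g x"])
   show "continuous_on B (%x. f x - g x)" using dd DERIV_isCont continuous_at_imp_continuous_on by blast
  qed (use dd in auto)
  then have c: "f x = g x + c" if "x \<in> B" for x using that by (metis diff_add_cancel add.commute)
  have F: "F x = g x + c" if x: "x \<in> ball z e" for x
  proof -
   have "x islimpt good b s" unfolding islimpt_def
   proof (intro allI impI)
    fix T assume T: "x \<in> T" "open T"
    then obtain e' where e': "e' > 0" "ball x e' \<subseteq> T Int ball z e" using x open_Int[OF T(2) open_ball] openE by blast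
    have "good b s Int (ball x e' - {x}) ~= {}"
    proof (rule good_dense[OF bs])
     show "ball x e' - {x} ~= {}"
     proof
     assume "ball x e' - {x} = {}"
     then have "ball x e' \<subseteq> {x}" by blast
     then show False using uncountable_ball[OF e'(1), of x] countable_subset by blast
    qed
     show "ball x e' - {x} \<subseteq> N" using e' e N1 by blast
    qed auto
    then show "\<exists>y\<in>good b s. y \<in> T & y ~= x" using e' by blast
   qed
   then have nt: "at x within good b s ~= bot" by (simp add: trivial_limit_within)
   have "((%y. g y + c) \<longlongrightarrow> g x + c) (at x within good b s)"
   proof -
    have "(g \<longlongrightarrow> g x) (at x within good b s)"
     using DERIV_isCont[OF g'[OF x]] unfolding isCont_def by (rule tendsto_within_subset) simp
    then show ?thesis by (rule tendsto_add[OF _ tendsto_const])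
   qed
   moreover have "\<forall>\<^sub>F y in at x within good b s. g y + c = f y"
   proof -
    have "\<forall>\<^sub>F y in at x within good b s. y \<in> ball z e" using topological_tendstoD[OF tendsto_ident_at open_ball x] .
    moreover have "\<forall>\<^sub>F y in at x within good b s. y \<in> good b s" by (simp add: eventually_at_filter)
    ultimately show ?thesis by eventually_elim (auto simp: c B_def)
   qed
   ultimately have "(f \<longlongrightarrow> g x + c) (at x within good b s)" by (rule Lim_transform_eventually)
   then show ?thesis unfolding F_def by (rule tendsto_Lim[OF nt])
  qed
  have "((%x. g x + c) has_field_derivative w z) (at z)" using g'[of z] e by (auto intro!: derivative_eq_intros)
  then show ?thesis by (rule has_field_derivative_transform_within_open[of _ _ _ "ball z e"]) (use F e in auto)
 qed
 then have "(F has_field_derivative w z) (at z within N1)" if "z \<in> N1" for z using that has_field_derivative_at_within by fast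
 then have "(w has_contour_integral 0) \<gamma>" using Cauchy_theorem_primitive[of N1 F w \<gamma>] \<gamma> by simp
 then show ?thesis by (rule contour_integral_unique)
qed

end

section \<open>The limit of the monodromy relations\<close>

lemma vector2_axis:
 "(vector [b, s] :: complex^2) + axis 1 z = vector [b + z, s]"
 "(vector [b, s] :: complex^2) + axis 2 z = vector [b, s + z]" by (simp_all add: vec_eq_iff forall_2 axis_def)

lemma vector2_eta [simp]: "vector [q $ 1, q $ 2] = (q :: complex^2)" by (simp add: vec_eq_iff forall_2)

lemma vector2_slice_deriv:
 fixes f :: "complex^2 => complex"
 assumes "holo f S" "vector [b, s] \<in> S"
 shows "((%z. f (vector [z, s])) has_field_derivative pd f 1 (vector [b, s])) (at b)"
  and "((%z. f (vector [b, z])) has_field_derivative pd f 2 (vector [b, s])) (at s)"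
 using holo_slice_deriv[of f S "vector [0, s]" 1 b] holo_slice_deriv[of f S "vector [b, 0]" 2 s] assms by (simp_all add: vector2_axis)

lemma DERIV_zero_eq:
 fixes f :: "complex => complex"
 assumes "convex S" "!!x. x \<in> S ==> (f has_field_derivative 0) (at x within S)" "a \<in> S" "b \<in> S"
 shows "f a = f b"
proof -
 have "(*) (0::complex) = (%_. 0)" by (simp add: fun_eq_iff)
 then have "\<exists>c. \<forall>x\<in>S. f x = c" using assms(1,2) by (intro has_derivative_zero_constant) (simp_all add: has_field_derivative_def)
 then show ?thesis using assms(3,4) by auto
qed

lemma pol_near:
 assumes "holo f (pol rho c d)" "z \<in> pol rho c d" "e > 0"
 obtains \<delta> where "\<delta> > 0" "!!b s. norm (b - z $ 1) < \<delta> ==> norm (s - z $ 2) < \<delta> ==>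
  vector [b, s] \<in> pol rho c d & norm (f (vector [b, s]) - f z) < e"
proof -
 have "open (pol rho c d Int f -` ball (f z) e)" using holo_cont[OF assms(1)] by (intro continuous_open_preimage) auto
 moreover have "z \<in> pol rho c d Int f -` ball (f z) e" using assms by simp
 ultimately obtain d' where d': "d' > 0" "ball z d' \<subseteq> pol rho c d Int f -` ball (f z) e" using openE by blast
 show thesis
 proof (rule that[of "d' / 2"])
  fix b s assume bs: "norm (b - z $ 1) < d' / 2" "norm (s - z $ 2) < d' / 2"
  have "norm (vector [b, s] - z) <= (\<Sum>i\<in>UNIV. norm ((vector [b, s] - z) $ i))" unfolding norm_vec_def by (rule L2_set_le_sum) simp
  also have "\<dots> < d' / 2 + d' / 2" using bs by (simp add: sum_2)
  finally have "vector [b, s] \<in> ball z d'" by (simp add: dist_norm norm_minus_commute)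
  then show "vector [b, s] \<in> pol rho c d & norm (f (vector [b, s]) - f z) < e" using d' by (auto simp: dist_norm norm_minus_commute)
 qed (use d' in auto)
qed

text \<open>If the \<open>s\<close>-derivative were not zero, dividing it by its largest power of
  \<open>b\<close> would leave a factor close to some \<open>w \<noteq> 0\<close> near a point with
  \<open>b = 0\<close>. The difference of \<open>B\<close> over the small shift \<open>c x\<close>
  would then be about \<open>x ^ m * w * c x\<close>, which is not 0.\<close>

lemma shift_invariant_imp_const:
 fixes c :: "real => real" and B :: "complex^2 => complex"
 assumes rho: "rho > 0" and B: "holo B (pol rho s0 rho)"
  and c: "!!x. 0 < x ==> x < rho ==> c x ~= 0" "(c \<longlongrightarrow> 0) (at_right 0)"
  and inv: "!!x s. 0 < x ==> x < rho ==> norm (s - s0) < rho ==> norm (s + of_real (c x) - s0) < rho ==>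
   B (vector [of_real x, s + of_real (c x)]) = B (vector [of_real x, s])"
  and b: "norm b < rho" "norm (s - s0) < rho" shows "B (vector [b, s]) = B (vector [b, s0])"
proof -
 let ?P = "pol rho s0 rho"
 define \<phi> where "\<phi> = pd B 2"
 have h\<phi>: "holo \<phi> ?P" unfolding \<phi>_def by (rule holo_partial_deriv[OF B])
 have "\<phi> z = 0" if z: "z \<in> ?P" for z
 proof (rule ccontr)
  assume "\<phi> z ~= 0"
  obtain \<phi>' m where \<phi>': "holo \<phi>' ?P" "!!q. q \<in> ?P ==> \<phi> q = q $ 1 ^ m * \<phi>' q"
    "\<exists>q\<in>?P. q $ 1 = 0 & \<phi>' q ~= 0"
   by (rule holo_order1[OF h\<phi> coord_star_pol convex_pol z \<open>\<phi> z ~= 0\<close>]) (rule that)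
  then obtain z1 where z1: "z1 \<in> ?P" "z1 $ 1 = 0" "\<phi>' z1 ~= 0" by blast
  define w s2 where "w = \<phi>' z1" and "s2 = z1 $ 2"
  have w: "w ~= 0" "norm w / 2 > 0" using z1 by (auto simp: w_def)
  obtain \<delta> where \<delta>: "\<delta> > 0" "!!b s. norm (b - 0) < \<delta> ==> norm (s - s2) < \<delta> ==>
    vector [b, s] \<in> ?P & norm (\<phi>' (vector [b, s]) - w) < norm w / 2"
   using pol_near[OF \<phi>'(1) z1(1) w(2)] unfolding w_def s2_def z1(2) by blast
  have "\<forall>\<^sub>F x in at_right 0. \<bar>c x\<bar> < \<delta>" using tendstoD[OF c(2) \<delta>(1)] by simp
  moreover have "\<forall>\<^sub>F x in at_right 0. 0 < x & x < min \<delta> rho"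
   using \<delta>(1) rho eventually_at_right_less[of "0::real"] by (auto simp: eventually_at_right[of 0 1] intro!: exI[of _ "min \<delta> rho"])
  ultimately have "\<forall>\<^sub>F x in at_right 0. \<bar>c x\<bar> < \<delta> & 0 < x & x < min \<delta> rho" by eventually_elim auto
  then obtain x where x: "\<bar>c x\<bar> < \<delta>" "0 < x" "x < \<delta>" "x < rho" using eventually_happens by fastforce
  \<comment> \<open>\<open>B\<close> minus the linear function of slope \<open>x ^ m * w\<close>;
    the derivative of what remains is at most half of that slope in norm.\<close>
  define g where "g s = B (vector [of_real x, s]) - of_real x ^ m * w * s" for s
  have "norm (g (s2 + of_real (c x)) - g s2) <= (x ^ m * (norm w / 2)) * norm (s2 + of_real (c x) - s2)"
  proof (rule field_differentiable_bound[of "ball s2 \<delta>" g "%s. \<phi> (vector [of_real x, s]) - of_real x ^ m * w"])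
   fix s assume "s \<in> ball s2 \<delta>"
   then have s: "vector [of_real x, s] \<in> ?P" "norm (\<phi>' (vector [of_real x, s]) - w) < norm w / 2"
    using \<delta>(2)[of "of_real x" s] x by (auto simp: dist_norm norm_minus_commute)
   have "(g has_field_derivative \<phi> (vector [of_real x, s]) - of_real x ^ m * w) (at s)" unfolding g_def \<phi>_def
    using DERIV_diff[OF vector2_slice_deriv(2)[OF B s(1)] DERIV_cmult_Id[of "of_real x ^ m * w" s]] by simp
   then show "(g has_field_derivative \<phi> (vector [of_real x, s]) - of_real x ^ m * w) (at s within ball s2 \<delta>)"
    by (rule has_field_derivative_at_within)
   have "\<phi> (vector [of_real x, s]) - of_real x ^ m * w = of_real x ^ m * (\<phi>' (vector [of_real x, s]) - w)"
    using \<phi>'(2)[OF s(1)] by (simp add: algebra_simps)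
   then show "norm (\<phi> (vector [of_real x, s]) - of_real x ^ m * w) <= x ^ m * (norm w / 2)"
    using s(2) x by (simp add: norm_mult norm_power mult_left_mono)
  qed (use \<delta> x in \<open>auto simp: dist_norm\<close>)
  moreover have "g (s2 + of_real (c x)) - g s2 = - (of_real x ^ m * w * of_real (c x))"
  proof -
   have "vector [of_real x, s2] \<in> ?P" using \<delta>(2)[of "of_real x" s2] \<delta>(1) x by simp
   moreover have "vector [of_real x, s2 + of_real (c x)] \<in> ?P" using \<delta>(2)[of "of_real x" "s2 + of_real (c x)"] x by simp
   ultimately have "B (vector [of_real x, s2 + of_real (c x)]) = B (vector [of_real x, s2])" using x by (intro inv) auto
   then show ?thesis by (simp add: g_def algebra_simps)
  qed
  ultimately have "x ^ m * norm w * \<bar>c x\<bar> <= (x ^ m * (norm w / 2)) * \<bar>c x\<bar>" using x by (simp add: norm_mult norm_power)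
  moreover have "x ^ m * norm w * \<bar>c x\<bar> > 0" using x w c(1) by simp
  moreover have "(x ^ m * (norm w / 2)) * \<bar>c x\<bar> = (x ^ m * norm w * \<bar>c x\<bar>) / 2" by simp
  ultimately show False by linarith
 qed
 note \<phi>0 = this
 show ?thesis
 proof (rule DERIV_zero_eq[of "ball s0 rho" "%s. B (vector [b, s])" s s0])
  fix s assume "s \<in> ball s0 rho"
  then have P: "vector [b, s] \<in> ?P" using b by (simp add: dist_norm norm_minus_commute)
  have "((%s. B (vector [b, s])) has_field_derivative 0) (at s)" using vector2_slice_deriv(2)[OF B P] unfolding \<phi>0[OF P, unfolded \<phi>_def] .
  then show "((%s. B (vector [b, s])) has_field_derivative 0) (at s within ball s0 rho)" by (rule has_field_derivative_at_within)
 qed (use b rho in \<open>auto simp: dist_norm norm_minus_commute\<close>)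
qed

lemma holomorphic_vector2:
 assumes "holo f (pol rho s0 d)" "norm (s - s0) < d"
 shows "(%b. f (vector [b, s])) holomorphic_on ball 0 rho" unfolding holomorphic_on_open[OF open_ball]
proof
 fix z :: complex assume "z \<in> ball 0 rho"
 then have "vector [z, s] \<in> pol rho s0 d" using assms(2) by simp
 from vector2_slice_deriv(1)[OF assms(1) this]
 show "\<exists>f'. ((%b. f (vector [b, s])) has_field_derivative f') (at z)" by blast
qed

text \<open>\<open>B1\<close> and \<open>B3\<close> stand for \<open>b ^ J\<close> times the
  components \<open>p\<close> and \<open>q\<close> of the limit form, \<open>c\<close> for the phase
  defect, \<open>M\<close> and \<open>N1\<close> for loop integrals. Shift invariance makes
  \<open>q\<close> a function of \<open>b\<close> alone, closedness makes \<open>p\<close> affine in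
  \<open>s\<close> with slope \<open>q'\<close>, and the monodromy of \<open>p\<close> makes
  \<open>c * q\<close> constant. Comparing \<open>J\<close> with the order \<open>n\<close> of
  \<open>B3\<close> separates a bounded \<open>q\<close> from a pole.\<close>

lemma endgame:
 fixes B1 B3 M N1 :: "complex^2 => complex" and c c' :: "real => real"
 assumes rho: "rho > 0"
  and hol: "holo B1 (pol rho s0 rho)" "holo B3 (pol rho s0 rho)" "holo M (pol rho s0 rho)" "holo N1 (pol rho s0 rho)"
  and M: "!!z. z \<in> pol rho s0 rho ==> M z ~= 0"
  and closed: "!!z. z \<in> pol rho s0 rho ==> z $ 1 ~= 0 ==>
   pd (%z. B1 z / z $ 1 ^ J) 2 z = pd (%z. B3 z / z $ 1 ^ J) 1 z"
  and c: "!!x. 0 < x ==> x < rho ==> c x ~= 0" "(c \<longlongrightarrow> 0) (at_right 0)"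
   "!!x. 0 < x ==> x < rho ==> (c has_real_derivative c' x) (at x)"
  and inv3: "!!x s. 0 < x ==> x < rho ==> norm (s - s0) < rho ==> norm (s + of_real (c x) - s0) < rho ==>
   B3 (vector [of_real x, s + of_real (c x)]) = B3 (vector [of_real x, s])"
  and inv1: "!!x s. 0 < x ==> x < rho ==> norm (s - s0) < rho ==> norm (s + of_real (c x) - s0) < rho ==>
   B1 (vector [of_real x, s]) = B1 (vector [of_real x, s + of_real (c x)]) + of_real (c' x) * B3 (vector [of_real x, s])"
  and loop: "!!z. z \<in> pol rho s0 rho ==> z $ 1 ~= 0 ==> B1 z * M z + B3 z * N1 z = \<kappa> * z $ 1 ^ J"
  and z: "z \<in> pol rho s0 rho" shows "B3 z = 0"
proof -
 let ?P = "pol rho s0 rho"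
 define f where "f b = B3 (vector [b, s0])" for b
 have B3f: "B3 (vector [b, s]) = f b" if "norm b < rho" "norm (s - s0) < rho" for b s
  unfolding f_def by (rule shift_invariant_imp_const[OF rho hol(2) c(1,2) inv3 that])
 have hf: "f holomorphic_on ball 0 rho" unfolding f_def by (rule holomorphic_vector2[OF hol(2)]) (use rho in auto)
 \<comment> \<open>The component \<open>q\<close>, with a possible pole at
   \<open>b = 0\<close>.\<close>
 define Q where "Q b = f b / b ^ J" for b
 have dQ: "(Q has_field_derivative deriv Q b) (at b)" if "b ~= 0" "norm b < rho" for b
 proof -
  have "f field_differentiable at b" using hf that by (simp add: holomorphic_on_def at_within_open[of _ "ball 0 rho"])
  then have "Q field_differentiable at b" unfolding Q_def using that by (intro derivative_intros) auto
  then show ?thesis by (simp add: DERIV_deriv_iff_field_differentiable)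
 qed
 have d2: "pd B1 2 (vector [b, s]) = b ^ J * deriv Q b"
  if b: "b ~= 0" "norm b < rho" and s: "norm (s - s0) < rho" for b s
 proof -
  have zP: "vector [b, s] \<in> ?P" using that by simp
  have "((%t. B1 (vector [b, s + t]) / b ^ J) has_field_derivative pd B1 2 (vector [b, s]) / b ^ J) (at 0)"
   using has_cgrad_partial[OF holo_has_cgrad[OF hol(1) zP], of 2] by (simp add: vector2_axis DERIV_cdivide)
  then have 1: "pd (%z. B1 z / z $ 1 ^ J) 2 (vector [b, s]) = pd B1 2 (vector [b, s]) / b ^ J"
   unfolding partial_deriv_def[of "%z. B1 z / z $ 1 ^ J"] by (simp add: vector2_axis DERIV_imp_deriv)
  have "((%t. Q (b + t)) has_field_derivative deriv Q b) (at 0)" using dQ[OF b] DERIV_shift[of Q "deriv Q b" 0 b] by (simp add: add.commute)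
  then have "((%t. B3 (vector [b + t, s]) / (b + t) ^ J) has_field_derivative deriv Q b) (at 0)"
  proof (rule has_field_derivative_transform_within_open[of _ _ _ "ball 0 (rho - norm b)"])
   fix t :: complex assume "t \<in> ball 0 (rho - norm b)"
   then have "norm (b + t) < rho" using norm_triangle_ineq[of b t] by simp
   then show "Q (b + t) = B3 (vector [b + t, s]) / (b + t) ^ J" using B3f[of "b + t" s] s by (simp add: Q_def)
  qed (use b in auto)
  then have 2: "pd (%z. B3 z / z $ 1 ^ J) 1 (vector [b, s]) = deriv Q b" unfolding partial_deriv_def by (simp add: vector2_axis DERIV_imp_deriv)
  show ?thesis using closed[OF zP] 1 2 b by (simp add: field_simps)
 qed
 have B1f: "B1 (vector [b, s]) = B1 (vector [b, s0]) + (s - s0) * (b ^ J * deriv Q b)"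
  if b: "b ~= 0" "norm b < rho" and s: "norm (s - s0) < rho" for b s
 proof -
  have "B1 (vector [b, s]) - s * (b ^ J * deriv Q b) = B1 (vector [b, s0]) - s0 * (b ^ J * deriv Q b)"
  proof (rule DERIV_zero_eq[of "ball s0 rho" "%s. B1 (vector [b, s]) - s * (b ^ J * deriv Q b)"])
   fix s assume "s \<in> ball s0 rho"
   then have s: "norm (s - s0) < rho" by (simp add: dist_norm norm_minus_commute)
   then have "vector [b, s] \<in> ?P" using b by simp
   from DERIV_diff[OF vector2_slice_deriv(2)[OF hol(1) this] DERIV_cmult_right[OF DERIV_ident, of "b ^ J * deriv Q b"]]
   have "((%s. B1 (vector [b, s]) - s * (b ^ J * deriv Q b)) has_field_derivative 0) (at s)" using d2[OF b s] by simp
   then show "((%s. B1 (vector [b, s]) - s * (b ^ J * deriv Q b)) has_field_derivative 0) (at s within ball s0 rho)"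
    by (rule has_field_derivative_at_within)
  qed (use s rho in \<open>auto simp: dist_norm norm_minus_commute\<close>)
  then show ?thesis by (simp add: algebra_simps)
 qed
 have "\<forall>\<^sub>F x in at_right 0. \<bar>c x\<bar> < rho" using tendstoD[OF c(2) rho] by simp
 then obtain r1 where r1: "r1 > 0" "!!x. 0 < x ==> x < r1 ==> \<bar>c x\<bar> < rho" by (auto simp: eventually_at_right[of 0 1])
 define I where "I = {0<..<min r1 rho}"
 \<comment> \<open>With \<open>B1\<close> affine in \<open>s\<close>, the monodromy relation at
   \<open>s0\<close> reads \<open>c * Q' + c' * Q = 0\<close>.\<close>
 have "\<exists>k. \<forall>x\<in>I. of_real (c x) * Q (of_real x) = k"
 proof (rule has_derivative_zero_constant)
  show "convex I" by (simp add: I_def)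
  fix x assume "x \<in> I"
  then have x: "0 < x" "x < r1" "x < rho" by (auto simp: I_def)
  have "B1 (vector [of_real x, s0]) = B1 (vector [of_real x, s0 + of_real (c x)]) + of_real (c' x) * B3 (vector [of_real x, s0])"
   using x r1(2)[of x] rho by (intro inv1) auto
  moreover have "B1 (vector [of_real x, s0 + of_real (c x)]) =
    B1 (vector [of_real x, s0]) + of_real (c x) * (of_real x ^ J * deriv Q (of_real x))"
   using B1f[of "of_real x" "s0 + of_real (c x)"] x r1(2)[of x] by simp
  ultimately have "of_real (c x) * (of_real x ^ J * deriv Q (of_real x)) + of_real (c' x) * f (of_real x) = 0" by (simp add: f_def)
  then have "of_real x ^ J * (of_real (c x) * deriv Q (of_real x) + of_real (c' x) * Q (of_real x)) = 0" using x by (simp add: Q_def algebra_simps)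
  then have z: "of_real (c' x) * Q (of_real x) + of_real (c x) * deriv Q (of_real x) = 0" using x by (simp add: add.commute)
  have "((%x. complex_of_real (c x)) has_vector_derivative of_real (c' x)) (at x)"
   using c(3)[OF x(1,3)] by (intro has_vector_derivative_of_real) (simp add: has_real_derivative_iff_has_vector_derivative)
  moreover have "((%x. Q (of_real x)) has_vector_derivative deriv Q (of_real x)) (at x)"
  proof -
   have "(of_real has_vector_derivative (1::complex)) (at x)"
    using has_vector_derivative_of_real[of "%x. x" 1 "at x"] by (simp add: has_vector_derivative_id)
   from field_vector_diff_chain_at[OF this, of Q "deriv Q (of_real x)"] dQ[of "of_real x"] x
   show ?thesis by (simp add: o_def)
  qed
  ultimately have "((%x. complex_of_real (c x) * Q (of_real x)) has_vector_derivative
    of_real (c x) * deriv Q (of_real x) + of_real (c' x) * Q (of_real x)) (at x)" by (rule has_vector_derivative_mult)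
  then have "((%x. complex_of_real (c x) * Q (of_real x)) has_vector_derivative 0) (at x)" using z by (simp add: add.commute)
  then show "((%x. complex_of_real (c x) * Q (of_real x)) has_derivative (%h. 0)) (at x within I)"
   unfolding has_vector_derivative_def by (simp add: has_derivative_at_withinI)
 qed
 then obtain k where k: "!!x. x \<in> I ==> of_real (c x) * Q (of_real x) = k" by blast
 have evI: "\<forall>\<^sub>F x in at_right 0. x \<in> I"
  using r1 rho by (auto simp: eventually_at_right[of 0 1] I_def intro!: exI[of _ "min r1 rho"])
 have tor: "((%x. complex_of_real x) \<longlongrightarrow> 0) (at_right 0)" by (auto intro!: tendsto_eq_intros)
 have "f b = 0" if "norm b < rho" for b
 proof (rule ccontr)
  assume nz: "f b ~= 0"
  have "\<exists>r n u. r > 0 & r <= rho & u holomorphic_on ball 0 r & u 0 ~= 0 & (\<forall>z\<in>ball 0 r. f z = z ^ n * u z)"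
  proof (cases "f 0 = 0")
   case True
   have z0: "(0::complex) \<in> ball 0 rho" using rho by simp
   have "~ f constant_on ball 0 rho"
   proof
    assume "f constant_on ball 0 rho"
    then obtain y where y: "!!x. x \<in> ball 0 rho ==> f x = y" unfolding constant_on_def by blast
    have "f b = f 0" using y[of b] y[of 0] that z0 by simp
    then show False using nz True by simp
   qed
   note nc = this
   obtain g r n where "0 < (n::nat)" "0 < r" "ball (0::complex) r \<subseteq> ball 0 rho" "g holomorphic_on ball 0 r"
     "!!w. w \<in> ball 0 r ==> f w = (w - 0) ^ n * g w" "!!w. w \<in> ball 0 r ==> g w ~= 0"
    by (rule holomorphic_factor_zero_nonconstant[OF hf open_ball connected_ball z0 True nc]) (rule that)
   moreover from this have "r <= rho" by (simp add: ball_subset_ball_iff)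
   ultimately show ?thesis by (intro exI[of _ r] exI[of _ n] exI[of _ g]) simp
  next
   case False
   then show ?thesis using hf rho by (intro exI[of _ rho] exI[of _ 0] exI[of _ f]) simp
  qed
  then obtain r n u where r: "r > 0" "r <= rho" and u: "u holomorphic_on ball 0 r" "u 0 ~= 0"
    and fu: "!!z. z \<in> ball 0 r ==> f z = z ^ n * u z" by blast
  have cu: "isCont u 0" using holomorphic_on_imp_continuous_on[OF u(1)] r(1) by (simp add: continuous_on_eq_continuous_at)
  have evr: "\<forall>\<^sub>F x in at_right 0. of_real x \<in> ball (0::complex) r & x > 0"
   using r by (auto simp: eventually_at_right[of 0 1] intro!: exI[of _ r])
  show False
  proof (cases "J <= n")
   \<comment> \<open>Here \<open>Q\<close> is bounded near 0, so \<open>c \<rightarrow> 0\<close>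
     forces the constant to be 0, and \<open>c \<noteq> 0\<close> then gives \<open>Q = 0\<close> on
     an interval.\<close>
   case True
   have "((%x. of_real (c x) * (of_real x ^ (n - J) * u (of_real x))) \<longlongrightarrow> of_real 0 * (0 ^ (n - J) * u 0)) (at_right 0)"
    by (intro tendsto_mult tendsto_of_real c(2) tendsto_power tor isCont_tendsto_compose[OF cu])
   moreover have "\<forall>\<^sub>F x in at_right 0. of_real (c x) * (of_real x ^ (n - J) * u (of_real x)) = k" using evI evr
   proof eventually_elim
    case (elim x)
    then have "Q (of_real x) = of_real x ^ (n - J) * u (of_real x)" using fu[of "of_real x"] True by (auto simp: Q_def power_diff)
    then show ?case using k[OF elim(1)] by simp
   qed
   ultimately have "((%x. k) \<longlongrightarrow> 0) (at_right (0::real))" by (simp add: tendsto_cong)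
   then have "k = 0" by (simp add: tendsto_const_iff)
   have "\<forall>\<^sub>F x in at_right 0. u (complex_of_real x) = 0" using evI evr
   proof eventually_elim
    case (elim x)
    then have "c x ~= 0" using c(1) by (simp add: I_def)
    then have "Q (of_real x) = 0" using k[OF elim(1)] \<open>k = 0\<close> by simp
    then show ?case using fu[of "of_real x"] elim by (auto simp: Q_def)
   qed
   then have "((%x. u (complex_of_real x)) \<longlongrightarrow> 0) (at_right 0)" by (rule tendsto_eventually)
   moreover have "((%x. u (complex_of_real x)) \<longlongrightarrow> u 0) (at_right 0)" by (rule isCont_tendsto_compose[OF cu tor])
   ultimately have "0 = u 0" by (rule tendsto_unique[rotated]) simp
   then show False using u(2) by simp
  next
   case False
   define e where "e = J - n"
   have e: "e > 0" "J = n + e" using False by (auto simp: e_def)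
   define s where "s = s0 + of_real (rho / 2)"
   have s: "norm (s - s0) < rho" "s ~= s0" using rho by (auto simp: s_def)
   have s0: "norm (s0 - s0) < rho" using rho by simp
   \<comment> \<open>The loop relations at \<open>s\<close> and at \<open>s0\<close>, with
     \<open>B1 (vector [b, s0])\<close> eliminated and the result multiplied by \<open>b\<close> and
     divided by \<open>b ^ n\<close>. At \<open>b = 0\<close> only the leading term of
     \<open>Q'\<close>, a pole of order \<open>e + 1\<close>, survives.\<close>
   define \<Psi> where "\<Psi> b = (\<kappa> * b ^ (e + 1) - b * u b * N1 (vector [b, s0])) * M (vector [b, s]) +
    (s - s0) * (b * deriv u b - of_nat e * u b) * M (vector [b, s]) * M (vector [b, s0]) +
    b * u b * N1 (vector [b, s]) * M (vector [b, s0]) - \<kappa> * b ^ (e + 1) * M (vector [b, s0])" for b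
   have hb: "(%b. F (vector [b, s'])) holomorphic_on ball 0 r" if "holo F ?P" "norm (s' - s0) < rho" for F s'
    using holomorphic_vector2[OF that] r(2) by (meson ball_subset_ball_iff holomorphic_on_subset subset_ball)
   have "\<Psi> holomorphic_on ball 0 r" unfolding \<Psi>_def
    by (intro holomorphic_intros hb[OF hol(3) s(1)] hb[OF hol(3) s0] hb[OF hol(4) s(1)] hb[OF hol(4) s0] u(1)
      holomorphic_deriv[OF u(1) open_ball])
   then have c\<Psi>: "isCont \<Psi> 0"
    using holomorphic_on_imp_continuous_on r(1) by (metis centre_in_ball continuous_on_eq_continuous_at open_ball)
   have "\<Psi> b = 0" if b: "b \<in> ball 0 r - {0}" for b
   proof -
    have b': "b ~= 0" "norm b < rho" "norm b < r" using b r by auto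
    have Qb: "Q b = u b / b ^ e" if "b \<in> ball 0 r - {0}" for b using fu[of b] that e(2) by (simp add: Q_def power_add)
    have du: "(u has_field_derivative deriv u b) (at b)" using holomorphic_derivI[OF u(1) open_ball] b by auto
    have "((%b. u b / b ^ e) has_field_derivative (deriv u b * b ^ e - u b * (of_nat e * b ^ (e - 1))) / (b ^ e * b ^ e)) (at b)"
     using b by (intro DERIV_divide[OF du]) (auto intro!: derivative_eq_intros)
    then have "(Q has_field_derivative (deriv u b * b ^ e - u b * (of_nat e * b ^ (e - 1))) / (b ^ e * b ^ e)) (at b)"
     by (rule has_field_derivative_transform_within_open[of _ _ _ "ball 0 r - {0}"]) (use b Qb in auto)
    then have "deriv Q b = (deriv u b * b ^ e - u b * (of_nat e * b ^ (e - 1))) / (b ^ e * b ^ e)" by (rule DERIV_imp_deriv)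
    moreover obtain w where bw: "b ^ e = b * w" "b ^ (e - 1) = w" "w ~= 0" using e(1) b' by (metis power_eq_if power_not_zero not_gr0)
    ultimately have "w * (b * (b * w) * deriv Q b) = w * (b * deriv u b - of_nat e * u b)" using b'(1) by (simp add: field_simps)
    then have "b * (b * w) * deriv Q b = b * deriv u b - of_nat e * u b" using bw(3) by simp
    then have Q': "b ^ (e + 1) * deriv Q b = b * deriv u b - of_nat e * u b" using bw(1) by simp
    have l1: "B1 (vector [b, s]) * M (vector [b, s]) + f b * N1 (vector [b, s]) = \<kappa> * b ^ J"
     using loop[of "vector [b, s]"] B3f[OF b'(2) s(1)] b' s by simp
    have l2: "B1 (vector [b, s0]) * M (vector [b, s0]) + f b * N1 (vector [b, s0]) = \<kappa> * b ^ J"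
     using loop[of "vector [b, s0]"] B3f[OF b'(2) s0] b' s0 by simp
    define X where "X = B1 (vector [b, s0])"
    have l3: "(X + (s - s0) * (b ^ J * deriv Q b)) * M (vector [b, s]) + f b * N1 (vector [b, s]) = \<kappa> * b ^ J"
     using l1 B1f[OF b'(1,2) s(1)] by (simp add: X_def)
    have fb: "f b = b ^ n * u b" using fu b by simp
    have "b ^ n * \<Psi> b = b * (((\<kappa> * b ^ J - f b * N1 (vector [b, s0])) * M (vector [b, s]) +
     (s - s0) * (b ^ J * deriv Q b) * M (vector [b, s]) * M (vector [b, s0]) +
     f b * N1 (vector [b, s]) * M (vector [b, s0]) - \<kappa> * b ^ J * M (vector [b, s0])))"
     unfolding \<Psi>_def Q'[symmetric] fb e(2) by (simp add: algebra_simps power_add)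
    also have "\<dots> = b * (M (vector [b, s0]) * ((X + (s - s0) * (b ^ J * deriv Q b)) * M (vector [b, s]) +
      f b * N1 (vector [b, s]) - \<kappa> * b ^ J) +
      (\<kappa> * b ^ J - f b * N1 (vector [b, s0]) - X * M (vector [b, s0])) * M (vector [b, s]))" by (simp add: algebra_simps)
    also have "\<dots> = 0" using l2 l3 by (simp add: X_def[symmetric] algebra_simps)
    finally show ?thesis using b'(1) by simp
   qed
   then have "\<forall>\<^sub>F b in at 0. \<Psi> b = 0" using r(1) by (auto simp: eventually_at dist_norm intro!: exI[of _ r])
   then have "(\<Psi> \<longlongrightarrow> 0) (at 0)" by (rule tendsto_eventually)
   then have "\<Psi> 0 = 0" using c\<Psi> tendsto_unique[of "at (0::complex)" \<Psi>] by (auto simp: isCont_def)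
   moreover have "\<Psi> 0 = (s - s0) * (- of_nat e * u 0) * M (vector [0, s]) * M (vector [0, s0])" by (simp add: \<Psi>_def)
   ultimately show False using s e u(2) M[of "vector [0, s]"] M[of "vector [0, s0]"] rho by simp
  qed
 qed
 moreover have "B3 z = f (z $ 1)" using B3f[of "z $ 1" "z $ 2"] z by (simp add: pol_def)
 ultimately show ?thesis using z by (simp add: pol_def)
qed

section \<open>Closed forms annihilating the perturbed flow\<close>

text \<open>\<open>fa\<close>, \<open>fb\<close>, \<open>fe\<close> are the components of the perturbation in flow coordinates; \<open>T\<close> is the period and \<open>c\<close> the phase defect after one period.\<close>
locale melnikov_tube = tube_region +
 fixes fa fb fe :: "complex^4 => complex" and Q4 :: "(complex^4) set" and N0 N1 :: "complex set"
  and \<gamma> \<gamma>' :: "real => complex" and c c' d T :: "real => real" and \<delta> :: real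
 assumes holo_f: "holo fa Q4" "holo fb Q4" "holo fe Q4"
  and N0: "open N0" "N0 ~= {}" "N0 \<subseteq> N"
  and N0_Q4: "reg b s ==> \<tau> \<in> N0 ==> pt b \<tau> s 0 \<in> Q4"
  and N1: "open N1" "N1 \<subseteq> N"
  and N1_Q4: "norm b < rho ==> norm (s - s0) < rho ==> \<tau> \<in> N1 ==> pt b \<tau> s 0 \<in> Q4"
  and loop: "valid_path \<gamma>" "pathfinish \<gamma> = pathstart \<gamma>" "path_image \<gamma> \<subseteq> N1"
   "!!u. u \<in> {0..1} ==> (\<gamma> has_vector_derivative \<gamma>' u) (at u)" "continuous_on {0..1} \<gamma>'"
  and M_nz: "norm b < rho ==> norm (s - s0) < rho ==> contour_integral \<gamma> (%\<tau>. fa (pt b \<tau> s 0)) ~= 0"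
  and c: "!!x. 0 < x ==> x < rho ==> c x ~= 0" "(c \<longlongrightarrow> 0) (at_right 0)"
   "!!x. 0 < x ==> x < rho ==> (c has_real_derivative c' x) (at x)"
  and \<delta>: "\<delta> > 0" and real_N: "!!t. \<bar>t\<bar> < \<delta> ==> of_real t \<in> N"
   "!!t x. \<bar>t\<bar> < \<delta> ==> 0 < x ==> x < rho ==> of_real (t + T x) \<in> N"
begin

text \<open>The components along \<open>b\<close>, \<tau> and \<open>s\<close>. The last condition
  is invariance under the identification of \<open>(b, \<tau> + T b, s)\<close> with
  \<open>(b, \<tau>, s + c b)\<close>: \<open>c'\<close> and, in the application, the derivative
  \<open>d\<close> of \<open>T\<close> enter through the pull-back of \<open>ds\<close> and
  \<open>d\<tau>\<close>. Apart from the quotient representation, all conditions are imposed off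
  parameter 0, so that they survive division by the parameter.\<close>

definition is_form :: "(4 => complex => complex^4 => complex) => (4 => complex^4 => complex) => bool" where
 "is_form A X \<longleftrightarrow> (\<forall>i\<in>{1,2,3}. trep (A i) (X i)) &
  (\<forall>p\<in>dom4. p $ 4 ~= 0 --> (\<forall>i\<in>{1,2,3}. \<forall>j\<in>{1,2,3}. pd (X i) j p = pd (X j) i p)) &
  (\<forall>p\<in>dom4 Int Q4. p $ 4 ~= 0 --> X 2 p + p $ 4 * (fa p * X 1 p + fb p * X 2 p + fe p * X 3 p) = 0) &
  (\<forall>x s t \<epsilon>. 0 < x --> x < rho --> norm (s - s0) < rho --> norm (s + of_real (c x) - s0) < rho --> \<bar>t\<bar> < \<delta> -->
    \<epsilon> ~= 0 --> norm \<epsilon> < r -->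
    X 3 (pt (of_real x) (of_real (t + T x)) s \<epsilon>) = X 3 (pt (of_real x) (of_real t) (s + of_real (c x)) \<epsilon>) &
    X 1 (pt (of_real x) (of_real (t + T x)) s \<epsilon>) = X 1 (pt (of_real x) (of_real t) (s + of_real (c x)) \<epsilon>) +
     of_real (c' x) * X 3 (pt (of_real x) (of_real t) (s + of_real (c x)) \<epsilon>) -
     of_real (d x) * X 2 (pt (of_real x) (of_real t) (s + of_real (c x)) \<epsilon>))"

definition melM :: "complex^2 => complex" where
 "melM z = contour_integral \<gamma> (%\<tau>. fa (pt (z $ 1) \<tau> (z $ 2) 0))"

lemma loop_integral: "contour_integral \<gamma> f = integral {0..1} (%u. f (\<gamma> u) * \<gamma>' u)" unfolding contour_integral_integral
 by (rule integral_cong) (use loop(4) in \<open>simp add: vector_derivative_at\<close>)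

lemma gamma_N1: "u \<in> {0..1} ==> \<gamma> u \<in> N1" using loop(3) by (auto simp: path_image_def)

lemma holo_slice2:
 assumes "holo f Q4" "\<tau> \<in> N1"
 shows "holo (%z::complex^2. f (pt (z $ 1) \<tau> (z $ 2) 0)) (pol rho s0 rho)"
proof (rule holo_compose[OF assms(1) open_pol])
 have "\<forall>i. holo (%q. pt (q $ 1) \<tau> (q $ 2) 0 $ i) (pol rho s0 rho)" unfolding forall_4 by (simp add: holo_nth holo_const)
 then show "holo (%q. pt (q $ 1) \<tau> (q $ 2) 0 $ i) (pol rho s0 rho)" for i by blast
qed (use N1_Q4 assms in \<open>auto simp: pol_def\<close>)

lemma partial_slice2:
 "pd (%z::complex^2. f (pt (z $ 1) \<tau> (z $ 2) 0)) 1 z = pd f 1 (pt (z $ 1) \<tau> (z $ 2) 0)"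
 "pd (%z::complex^2. f (pt (z $ 1) \<tau> (z $ 2) 0)) 2 z = pd f 3 (pt (z $ 1) \<tau> (z $ 2) 0)"
 by (simp_all only: partial_deriv_def pt_axis) (simp_all add: axis_def)

lemma cont_loop_integrand:
 assumes "holo f Q4"
 shows "continuous_on (pol rho s0 rho \<times> {0..1}) (%(z, u). f (pt (z $ 1) (\<gamma> u) (z $ 2) 0) * \<gamma>' u)"
proof -
 have cg: "continuous_on {0..1} \<gamma>" using valid_path_imp_path[OF loop(1)] by (simp add: path_def)
 have "continuous_on (pol rho s0 rho \<times> {0..1}) (%x. f (pt (fst x $ 1) (\<gamma> (snd x)) (fst x $ 2) 0) * \<gamma>' (snd x))"
  by (intro continuous_intros continuous_on_compose2[OF holo_cont[OF assms]]
    continuous_on_compose2[OF cg] continuous_on_compose2[OF loop(5)]) (use N1_Q4 gamma_N1 in \<open>auto simp: pol_def\<close>)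
 then show ?thesis by (simp add: case_prod_unfold)
qed

lemma
 assumes f: "holo f Q4"
 shows holo_loop: "holo (%z::complex^2. contour_integral \<gamma> (%\<tau>. f (pt (z $ 1) \<tau> (z $ 2) 0))) (pol rho s0 rho)"
  and loop_deriv1: "z \<in> pol rho s0 rho ==> pd (%z::complex^2. contour_integral \<gamma> (%\<tau>. f (pt (z $ 1) \<tau> (z $ 2) 0))) 1 z =
    contour_integral \<gamma> (%\<tau>. pd f 1 (pt (z $ 1) \<tau> (z $ 2) 0))"
  and loop_deriv2: "z \<in> pol rho s0 rho ==> pd (%z::complex^2. contour_integral \<gamma> (%\<tau>. f (pt (z $ 1) \<tau> (z $ 2) 0))) 2 z =
    contour_integral \<gamma> (%\<tau>. pd f 3 (pt (z $ 1) \<tau> (z $ 2) 0))"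
proof -
 have hK: "holo (%z. f (pt (z $ 1) (\<gamma> u) (z $ 2) 0) * \<gamma>' u) (pol rho s0 rho)" if "u \<in> {0..1}" for u
  by (rule holo_mult[OF holo_slice2[OF f gamma_N1[OF that]] holo_const[OF open_pol]])
 have pK: "pd (%z. f (pt (z $ 1) (\<gamma> u) (z $ 2) 0) * \<gamma>' u) i z =
   pd (%z. f (pt (z $ 1) (\<gamma> u) (z $ 2) 0)) i z * \<gamma>' u" if "u \<in> {0..1}" "z \<in> pol rho s0 rho" for u i z
 proof -
  from has_cgrad_partial(1)[OF holo_has_cgrad[OF holo_slice2[OF f gamma_N1[OF that(1)]] that(2)], of i]
  have "((%s. f (pt ((z + axis i s) $ 1) (\<gamma> u) ((z + axis i s) $ 2) 0) * \<gamma>' u) has_field_derivative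
    grad (%z. f (pt (z $ 1) (\<gamma> u) (z $ 2) 0)) z $ i * \<gamma>' u) (at 0)" by (rule DERIV_cmult_right)
  then have "deriv (%s. f (pt ((z + axis i s) $ 1) (\<gamma> u) ((z + axis i s) $ 2) 0) * \<gamma>' u) 0 =
    grad (%z. f (pt (z $ 1) (\<gamma> u) (z $ 2) 0)) z $ i * \<gamma>' u" by (rule DERIV_imp_deriv)
  then show ?thesis unfolding partial_deriv_def[of "%z. f (pt (z $ 1) (\<gamma> u) (z $ 2) 0) * \<gamma>' u"] by (simp add: grad_def)
 qed
 show "holo (%z::complex^2. contour_integral \<gamma> (%\<tau>. f (pt (z $ 1) \<tau> (z $ 2) 0))) (pol rho s0 rho)"
  unfolding loop_integral by (rule holo_integral[OF open_pol hK cont_loop_integrand[OF f]])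
 have pI: "pd (%z::complex^2. integral {0..1} (%u. f (pt (z $ 1) (\<gamma> u) (z $ 2) 0) * \<gamma>' u)) i z =
   integral {0..1} (%u. pd (%z. f (pt (z $ 1) (\<gamma> u) (z $ 2) 0) * \<gamma>' u) i z)" if "z \<in> pol rho s0 rho" for i z
  by (rule partial_deriv_integral[OF open_pol hK cont_loop_integrand[OF f] that])
 show "pd (%z::complex^2. contour_integral \<gamma> (%\<tau>. f (pt (z $ 1) \<tau> (z $ 2) 0))) 1 z =
    contour_integral \<gamma> (%\<tau>. pd f 1 (pt (z $ 1) \<tau> (z $ 2) 0))" if "z \<in> pol rho s0 rho" unfolding loop_integral pI[OF that]
  by (rule integral_cong) (simp only: pK[OF _ that] partial_slice2)
 show "pd (%z::complex^2. contour_integral \<gamma> (%\<tau>. f (pt (z $ 1) \<tau> (z $ 2) 0))) 2 z =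
    contour_integral \<gamma> (%\<tau>. pd f 3 (pt (z $ 1) \<tau> (z $ 2) 0))" if "z \<in> pol rho s0 rho" unfolding loop_integral pI[OF that]
  by (rule integral_cong) (simp only: pK[OF _ that] partial_slice2)
qed

lemma loop_integrable:
 assumes "holo f Q4" "norm b < rho" "norm (s - s0) < rho"
 shows "(%\<tau>. f (pt b \<tau> s 0)) contour_integrable_on \<gamma>"
 by (rule contour_integrable_holomorphic_simple[OF holomorphic_pt[OF assms(1) N1(1)] N1(1) loop(1,3)]) (use N1_Q4 assms in auto)

end

section \<open>The limit of a closed form at parameter 0\<close>

locale melnikov_form = melnikov_tube +
 fixes A :: "4 => complex => complex^4 => complex" and X :: "4 => complex^4 => complex"
 assumes form: "is_form A X"
begin

lemma tr: "trep (A 1) (X 1)" "trep (A 2) (X 2)" "trep (A 3) (X 3)" using form by (auto simp: is_form_def)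

lemma hX: "holo (X 1) dom4" "holo (X 2) dom4" "holo (X 3) dom4" using tr trep_holo by blast+

lemma closed:
 assumes "p \<in> dom4"
 shows "pd (X 1) 2 p = pd (X 2) 1 p" "pd (X 3) 2 p = pd (X 2) 3 p"
  "pd (X 1) 3 p = pd (X 3) 1 p"
proof -
 have *: "pd (X i) j p - pd (X j) i p = 0" if ij: "i \<in> {1,2,3}" "j \<in> {1,2,3}" for i j
 proof (rule dom4_zero_dense[OF _ _ assms])
  have "holo (X i) dom4" "holo (X j) dom4" using ij hX by auto
  then show "holo (%p. pd (X i) j p - pd (X j) i p) dom4" by (intro holo_diff holo_partial_deriv)
  show "pd (X i) j q - pd (X j) i q = 0" if "q \<in> dom4" "q $ 4 ~= 0" for q
  proof -
   have "pd (X i) j q = pd (X j) i q" using conjunct1[OF conjunct2[OF form[unfolded is_form_def]]] ij that by blast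
   then show ?thesis by simp
  qed
 qed
 show "pd (X 1) 2 p = pd (X 2) 1 p" "pd (X 3) 2 p = pd (X 2) 3 p"
  "pd (X 1) 3 p = pd (X 3) 1 p" using *[of 1 2] *[of 3 2] *[of 1 3] by auto
qed

lemma annihil:
 assumes "p \<in> dom4 Int Q4"
 shows "X 2 p + p $ 4 * (fa p * X 1 p + fb p * X 2 p + fe p * X 3 p) = 0"
proof -
 have op: "open (dom4 Int Q4)" using open_dom4 holo_open[OF holo_f(1)] by blast
 have s: "dom4 Int Q4 \<subseteq> dom4" "dom4 Int Q4 \<subseteq> Q4" by auto
 note h = holo_subset[OF hX(1) op s(1)] holo_subset[OF hX(2) op s(1)] holo_subset[OF hX(3) op s(1)]
  holo_subset[OF holo_f(1) op s(2)] holo_subset[OF holo_f(2) op s(2)] holo_subset[OF holo_f(3) op s(2)]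
 show ?thesis
 proof (rule dom4_zero_dense[OF _ _ assms])
  show "holo (%p. X 2 p + p $ 4 * (fa p * X 1 p + fb p * X 2 p + fe p * X 3 p)) (dom4 Int Q4)" by (intro holo_add holo_mult h holo_nth op)
  show "X 2 q + q $ 4 * (fa q * X 1 q + fb q * X 2 q + fe q * X 3 q) = 0" if "q \<in> dom4 Int Q4" "q $ 4 ~= 0" for q
   using form that unfolding is_form_def by simp
 qed
qed

text \<open>At parameter 0 annihilation says just this, but only where the perturbation is known;
  continuation from \<open>N0\<close> gives all regular times.\<close>

lemma X2_zero:
 assumes bs: "reg b s" and \<tau>: "\<tau> \<in> good b s"
 shows "X 2 (pt b \<tau> s 0) = 0" by (rule slice_zero[OF bs slice_holomorphic[OF hX(2)] N0])
  (use annihil[of "pt b \<tau> s 0" for \<tau>] N0_Q4[OF bs] \<tau> in \<open>auto simp: good_def\<close>)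

lemma ev_reg:
 assumes "reg b s" "i \<in> {1, 3}" "pt b \<tau> s 0 \<in> S" "open S"
 shows "\<forall>\<^sub>F z in nhds 0. pt b \<tau> s 0 + axis i z \<in> S"
  "\<forall>\<^sub>F z in nhds 0. reg (if i = 1 then b + z else b) (if i = 1 then s else s + z)"
proof -
 have t: "((%z. pt b \<tau> s 0 + axis i (z - 0)) \<longlongrightarrow> pt b \<tau> s 0 + axis i (0 - 0)) (nhds 0)"
  using continuous_axis_shift[where p = "pt b \<tau> s 0" and i = i and c = 0 and ?z0.0 = 0]
   tendsto_at_iff_tendsto_nhds[of "%z. pt b \<tau> s 0 + axis i (z - 0)" 0] unfolding isCont_def by blast
 then show "\<forall>\<^sub>F z in nhds 0. pt b \<tau> s 0 + axis i z \<in> S" using topological_tendstoD[OF t assms(4)] assms(3) by simp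
 have o: "open {q::complex^4. 0 < norm (q $ 1) & norm (q $ 1) < rho & norm (q $ 3 - s0) < rho}"
  by (intro open_Collect_conj open_Collect_less continuous_intros)
 have "\<forall>\<^sub>F z in nhds 0. pt b \<tau> s 0 + axis i z \<in> {q. 0 < norm (q $ 1) & norm (q $ 1) < rho & norm (q $ 3 - s0) < rho}"
  using topological_tendstoD[OF t o] assms(1) by (simp add: reg_def)
 then show "\<forall>\<^sub>F z in nhds 0. reg (if i = 1 then b + z else b) (if i = 1 then s else s + z)"
  by eventually_elim (use assms(2) in \<open>auto simp: reg_def axis_def\<close>)
qed

lemma pt_shift13: "i \<in> {1, 3} ==> pt b \<tau> s 0 + axis i z = pt (if i = 1 then b + z else b) \<tau> (if i = 1 then s else s + z) 0"
 by (auto simp: vec_eq_iff forall_4 axis_def)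

lemma X2_deriv_zero:
 assumes bs: "reg b s" and \<tau>: "\<tau> \<in> good b s" and i: "i \<in> {1, 3}"
 shows "pd (X 2) i (pt b \<tau> s 0) = 0"
proof -
 have p: "pt b \<tau> s 0 \<in> dom4" using \<tau> by (simp add: good_def)
 have "\<forall>\<^sub>F z in nhds 0. X 2 (pt b \<tau> s 0 + axis i z) = 0" using ev_reg(1)[OF bs i p open_dom4] ev_reg(2)[OF bs i p open_dom4]
 proof eventually_elim
  case (elim z)
  then show ?case using X2_zero \<tau> by (auto simp: pt_shift13[OF i] good_def)
 qed
 then have "deriv (%z. X 2 (pt b \<tau> s 0 + axis i z)) 0 = deriv (%z. 0) 0" by (intro deriv_cong_ev) auto
 then show ?thesis by (simp add: partial_deriv_def)
qed

text \<open>Closedness equates the time derivative of \<open>X i\<close> with the \<open>b\<close>-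
  or \<open>s\<close>-derivative of \<open>X 2\<close>, which is zero at parameter 0.\<close>

lemma X_const:
 assumes bs: "reg b s" and \<tau>: "\<tau> \<in> good b s" "\<tau>' \<in> good b s" and i: "i \<in> {1, 3}"
 shows "X i (pt b \<tau> s 0) = X i (pt b \<tau>' s 0)"
proof -
 have hi: "holo (X i) dom4" using i hX by auto
 have d: "((%\<tau>. X i (pt b \<tau> s 0)) has_field_derivative 0) (at \<tau>)" if "\<tau> \<in> good b s" for \<tau>
 proof -
  have p: "pt b \<tau> s 0 \<in> dom4" using that by (simp add: good_def)
  have "pd (X i) 2 (pt b \<tau> s 0) = 0" using X2_deriv_zero[OF bs that i] closed[OF p] i by auto
  then show ?thesis using pt_slice_deriv(2)[OF hi p] by simp
 qed
 obtain k where "!!\<tau>. \<tau> \<in> good b s ==> X i (pt b \<tau> s 0) = k"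
 proof (rule DERIV_zero_connected_constant[OF connected_good[OF bs] open_good finite.emptyI, of "%\<tau>. X i (pt b \<tau> s 0)"])
  show "continuous_on (good b s) (%\<tau>. X i (pt b \<tau> s 0))" using d DERIV_isCont continuous_at_imp_continuous_on by blast
 qed (use d in auto)
 then show ?thesis using \<tau> by simp
qed

text \<open>The annihilation identity differentiated once in the parameter; the \<open>fb\<close>
  term disappears with \<open>X 2\<close>.\<close>

lemma X2_first:
 assumes "pt b \<tau> s 0 \<in> dom4 Int Q4" "X 2 (pt b \<tau> s 0) = 0"
 shows "pd (X 2) 4 (pt b \<tau> s 0) = - (fa (pt b \<tau> s 0) * X 1 (pt b \<tau> s 0) + fe (pt b \<tau> s 0) * X 3 (pt b \<tau> s 0))"
proof -
 let ?p = "pt b \<tau> s 0"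
 define W where "W p = fa p * X 1 p + fb p * X 2 p + fe p * X 3 p" for p
 have op: "open (dom4 Int Q4)" using open_dom4 holo_open[OF holo_f(1)] by blast
 have sb: "dom4 Int Q4 \<subseteq> dom4" "dom4 Int Q4 \<subseteq> Q4" by auto
 have hW: "holo W (dom4 Int Q4)" unfolding W_def
  by (intro holo_add holo_mult holo_subset[OF hX(1) op sb(1)] holo_subset[OF hX(2) op sb(1)] holo_subset[OF hX(3) op sb(1)]
   holo_subset[OF holo_f(1) op sb(2)] holo_subset[OF holo_f(2) op sb(2)] holo_subset[OF holo_f(3) op sb(2)])
 have 1: "((%z. X 2 (pt b \<tau> s z)) has_field_derivative pd (X 2) 4 ?p) (at 0)" by (rule pt_slice_deriv(4)[OF hX(2)]) (use assms in auto)
 have 2: "((%z. W (pt b \<tau> s z)) has_field_derivative pd W 4 ?p) (at 0)" by (rule pt_slice_deriv(4)[OF hW assms(1)])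
 have d: "((%z. X 2 (pt b \<tau> s z) + z * W (pt b \<tau> s z)) has_field_derivative pd (X 2) 4 ?p + W ?p) (at 0)"
  using DERIV_add[OF 1 DERIV_mult[OF DERIV_ident 2]] by simp
 have "open ((%z. pt b \<tau> s z) -` (dom4 Int Q4))" by (intro open_vimage op continuous_intros)
 from has_field_derivative_transform_within_open[OF d this, of "%_. 0"]
 have "((%z. 0) has_field_derivative pd (X 2) 4 ?p + W ?p) (at 0)" using assms annihil[of "pt b \<tau> s z" for z] by (simp add: W_def)
 then have "pd (X 2) 4 ?p + W ?p = 0" using DERIV_unique DERIV_const by blast
 then have "pd (X 2) 4 ?p = - W ?p" by (simp only: eq_neg_iff_add_eq_0)
 then show ?thesis using assms(2) by (simp add: W_def)
qed

definition t0 :: complex where "t0 = (SOME t. t \<in> C)"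

lemma t0: "t0 \<in> C" unfolding t0_def using C_ne by (simp add: some_in_eq)

text \<open>A reference point for each \<open>(b, s)\<close>: the time \<open>\<sigma> t0\<close> is
  regular throughout the region, and the limits of \<open>X 1\<close> and \<open>X 3\<close> do not
  depend on the time.\<close>

definition base :: "complex => complex => complex^4" where "base b s = pt b (\<sigma> t0) s 0"

lemma base_good: "reg b s ==> \<sigma> t0 \<in> good b s" by (rule sigma_good[OF t0])

lemma base_dom4: "reg b s ==> base b s \<in> dom4" using base_good by (simp add: base_def good_def)

lemma X_eq_base: "reg b s ==> \<tau> \<in> good b s ==> i \<in> {1, 3} ==> X i (pt b \<tau> s 0) = X i (base b s)"
 unfolding base_def by (rule X_const[OF _ _ base_good])

text \<open>The derivative in \<open>b\<close> (for \<open>i = 1\<close>) or in \<open>s\<close>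
  (for \<open>i = 3\<close>) of \<open>fa * X 1 + fe * X 3\<close>. Since the factors
  \<open>X 1\<close>, \<open>X 3\<close> are taken at the reference point, it is holomorphic in time
  on all of \<open>N1\<close>, singular times included.\<close>

definition loopw :: "4 => complex => complex => complex => complex" where
 "loopw i b s \<tau> = pd fa i (pt b \<tau> s 0) * X 1 (base b s) + fa (pt b \<tau> s 0) * pd (X 1) i (base b s) +
  (pd fe i (pt b \<tau> s 0) * X 3 (base b s) + fe (pt b \<tau> s 0) * pd (X 3) i (base b s))"

lemma X2_second:
 assumes bs: "reg b s" and \<tau>: "\<tau> \<in> good b s" "\<tau> \<in> N1" and i: "i \<in> {1, 3}"
 shows "pd (pd (X 2) 4) i (pt b \<tau> s 0) = - loopw i b s \<tau>"
proof -
 let ?p = "pt b \<tau> s 0" and ?q = "base b s"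
 have p: "?p \<in> dom4 Int Q4" using \<tau> bs N1_Q4 by (auto simp: good_def reg_def)
 have q: "?q \<in> dom4" by (rule base_dom4[OF bs])
 have op: "open (dom4 Int Q4)" using open_dom4 holo_open[OF holo_f(1)] by blast
 have "\<forall>\<^sub>F z in nhds 0. pd (X 2) 4 (?p + axis i z) =
   - (fa (?p + axis i z) * X 1 (?q + axis i z) + fe (?p + axis i z) * X 3 (?q + axis i z))" using ev_reg(1)[OF bs i p op] ev_reg(2)[OF bs i p op]
 proof eventually_elim
  case (elim z)
  let ?b = "if i = 1 then b + z else b" and ?s = "if i = 1 then s else s + z"
  have "\<tau> \<in> good ?b ?s" using elim(1) \<tau> by (auto simp: pt_shift13[OF i] good_def)
  then show ?case using X2_first[of ?b \<tau> ?s] X2_zero[OF elim(2)] X_eq_base[OF elim(2)] elim(1) unfolding base_def pt_shift13[OF i] by simp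
 qed
 then have "deriv (%z. pd (X 2) 4 (?p + axis i z)) 0 =
   deriv (%z. - (fa (?p + axis i z) * X 1 (?q + axis i z) + fe (?p + axis i z) * X 3 (?q + axis i z))) 0" by (intro deriv_cong_ev) auto
 moreover have "((%z. - (fa (?p + axis i z) * X 1 (?q + axis i z) + fe (?p + axis i z) * X 3 (?q + axis i z)))
   has_field_derivative - loopw i b s \<tau>) (at 0)"
 proof -
  have g: "((%z. f (p + axis i z)) has_field_derivative pd f i p) (at 0)" if "holo f S" "p \<in> S" for f S and p :: "complex^4"
   using has_cgrad_partial[OF holo_has_cgrad[OF that], of i] by simp
  have p': "?p \<in> Q4" using p by simp
  from DERIV_minus[OF DERIV_add[OF DERIV_mult[OF g[OF holo_f(1) p'] g[OF hX(1) q]] DERIV_mult[OF g[OF holo_f(3) p'] g[OF hX(3) q]]]]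
  show ?thesis by (simp add: loopw_def mult.commute)
 qed
 ultimately show ?thesis by (simp add: partial_deriv_def DERIV_imp_deriv)
qed

text \<open>Closedness and the symmetry of second derivatives turn the time derivative of the
  parameter derivative of \<open>X i\<close> into \<open>- loopw\<close>. So \<open>loopw\<close>
  has a primitive at the regular times, which suffices along the loop.\<close>

lemma loopw_zero:
 assumes bs: "reg b s" and i: "i \<in> {1, 3}"
 shows "contour_integral \<gamma> (loopw i b s) = 0"
proof -
 have hi: "holo (X i) dom4" using i hX by auto
 have bs': "norm b < rho" "norm (s - s0) < rho" using bs by (auto simp: reg_def)
 show ?thesis
 proof (rule primitive_along_loop[OF bs _ _ N1 _ loop(1,2,3)])
  show "(%\<tau>. - pd (X i) 4 (pt b \<tau> s 0)) holomorphic_on good b s"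
   by (intro holomorphic_intros slice_holomorphic[OF holo_partial_deriv[OF hi]])
  have h: "(%\<tau>. f (pt b \<tau> s 0)) holomorphic_on N1" if "holo f Q4" for f by (rule holomorphic_pt[OF that N1(1)]) (use N1_Q4 bs' in auto)
  show "loopw i b s holomorphic_on N1" unfolding loopw_def by (intro holomorphic_intros h holo_partial_deriv holo_f)
  fix \<tau> assume \<tau>: "\<tau> \<in> good b s" "\<tau> \<in> N1"
  have p: "pt b \<tau> s 0 \<in> dom4" using \<tau> by (simp add: good_def)
  have "pd (pd (X i) 4) 2 (pt b \<tau> s 0) = pd (pd (X i) 2) 4 (pt b \<tau> s 0)" by (rule partial_deriv_commute[OF hi p])
  also have "\<dots> = pd (pd (X 2) i) 4 (pt b \<tau> s 0)" by (rule partial_deriv_cong[OF open_dom4 p]) (use closed i in auto)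
  also have "\<dots> = pd (pd (X 2) 4) i (pt b \<tau> s 0)" by (rule partial_deriv_commute[OF hX(2) p])
  also have "\<dots> = - loopw i b s \<tau>" by (rule X2_second[OF bs \<tau> i])
  finally have e: "pd (pd (X i) 4) 2 (pt b \<tau> s 0) = - loopw i b s \<tau>" .
  show "((%\<tau>. - pd (X i) 4 (pt b \<tau> s 0)) has_field_derivative loopw i b s \<tau>) (at \<tau>)"
   using DERIV_minus[OF pt_slice_deriv(2)[OF holo_partial_deriv[OF hi, of 4] p]] by (simp add: e)
 qed
qed

definition melN :: "complex^2 => complex" where
 "melN z = contour_integral \<gamma> (%\<tau>. fe (pt (z $ 1) \<tau> (z $ 2) 0))"

lemma holo_mel: "holo melM (pol rho s0 rho)" "holo melN (pol rho s0 rho)"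
 unfolding melM_def[abs_def] melN_def[abs_def] by (rule holo_loop, rule holo_f)+

text \<open>The loop integral of the first-order term \<open>fa * X 1 + fe * X 3\<close>. Its two
  partial derivatives are the loop integrals of \<open>loopw\<close>, hence zero.\<close>

definition Theta :: "complex => complex => complex" where
 "Theta b s = X 1 (base b s) * melM (vector [b, s]) + X 3 (base b s) * melN (vector [b, s])"

lemma loopw_eq:
 assumes bs: "reg b s"
 shows "pd (X 1) i (base b s) * melM (vector [b, s]) + contour_integral \<gamma> (%\<tau>. pd fa i (pt b \<tau> s 0)) * X 1 (base b s) +
  (pd (X 3) i (base b s) * melN (vector [b, s]) + contour_integral \<gamma> (%\<tau>. pd fe i (pt b \<tau> s 0)) * X 3 (base b s)) =
  contour_integral \<gamma> (loopw i b s)"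
proof -
 have bs': "norm b < rho" "norm (s - s0) < rho" using bs by (auto simp: reg_def)
 note int = loop_integrable[OF _ bs']
 have ints: "(%\<tau>. fa (pt b \<tau> s 0)) contour_integrable_on \<gamma>" "(%\<tau>. fe (pt b \<tau> s 0)) contour_integrable_on \<gamma>"
  "(%\<tau>. pd fa i (pt b \<tau> s 0)) contour_integrable_on \<gamma>" "(%\<tau>. pd fe i (pt b \<tau> s 0)) contour_integrable_on \<gamma>"
  using int[OF holo_f(1)] int[OF holo_f(3)] int[OF holo_partial_deriv[OF holo_f(1)]] int[OF holo_partial_deriv[OF holo_f(3)]] by auto
 have "loopw i b s = (%\<tau>. (pd fa i (pt b \<tau> s 0) * X 1 (base b s) + fa (pt b \<tau> s 0) * pd (X 1) i (base b s)) +
  (pd fe i (pt b \<tau> s 0) * X 3 (base b s) + fe (pt b \<tau> s 0) * pd (X 3) i (base b s)))" by (simp add: loopw_def fun_eq_iff)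
 then show ?thesis using ints
  by (simp add: contour_integral_add contour_integrable_add contour_integrable_rmul contour_integral_rmul melM_def melN_def)
qed

lemma Theta_deriv:
 assumes bs: "reg b s"
 shows "((%s. Theta b s) has_field_derivative 0) (at s)" "((%b. Theta b s) has_field_derivative 0) (at b)"
proof -
 have P: "vector [b, s] \<in> pol rho s0 rho" using bs by (simp add: reg_def)
 have q: "pt b (\<sigma> t0) s 0 \<in> dom4" using base_dom4[OF bs] by (simp add: base_def)
 note l1 = loop_deriv1[OF holo_f(1) P] loop_deriv1[OF holo_f(3) P]
 note l2 = loop_deriv2[OF holo_f(1) P] loop_deriv2[OF holo_f(3) P]
 from DERIV_add[OF DERIV_mult[OF pt_slice_deriv(3)[OF hX(1) q] vector2_slice_deriv(2)[OF holo_mel(1) P]]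
   DERIV_mult[OF pt_slice_deriv(3)[OF hX(3) q] vector2_slice_deriv(2)[OF holo_mel(2) P]]]
 have "((%s. Theta b s) has_field_derivative contour_integral \<gamma> (loopw 3 b s)) (at s)"
  unfolding loopw_eq[OF bs, of 3, symmetric] Theta_def base_def
  by (rule back_subst[of "%x. ((%s. X 1 (pt b (\<sigma> t0) s 0) * melM (vector [b, s]) + X 3 (pt b (\<sigma> t0) s 0) * melN (vector [b, s])) has_field_derivative x) (at s)"])
   (simp add: l2[folded melM_def[abs_def] melN_def[abs_def]])
 then show "((%s. Theta b s) has_field_derivative 0) (at s)" using loopw_zero[OF bs, of 3] by simp
 from DERIV_add[OF DERIV_mult[OF pt_slice_deriv(1)[OF hX(1) q] vector2_slice_deriv(1)[OF holo_mel(1) P]]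
   DERIV_mult[OF pt_slice_deriv(1)[OF hX(3) q] vector2_slice_deriv(1)[OF holo_mel(2) P]]]
 have "((%b. Theta b s) has_field_derivative contour_integral \<gamma> (loopw 1 b s)) (at b)"
  unfolding loopw_eq[OF bs, of 1, symmetric] Theta_def base_def
  by (rule back_subst[of "%x. ((%b. X 1 (pt b (\<sigma> t0) s 0) * melM (vector [b, s]) + X 3 (pt b (\<sigma> t0) s 0) * melN (vector [b, s])) has_field_derivative x) (at b)"])
   (simp add: l1[folded melM_def[abs_def] melN_def[abs_def]])
 then show "((%b. Theta b s) has_field_derivative 0) (at b)" using loopw_zero[OF bs, of 1] by simp
qed

lemma Theta_const: "\<exists>\<kappa>. \<forall>b s. reg b s --> Theta b s = \<kappa>"
proof -
 have 1: "Theta b s = Theta b s0" if "reg b s" for b s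
 proof (rule DERIV_zero_eq[of "ball s0 rho" "%s. Theta b s"])
  show "((%s. Theta b s) has_field_derivative 0) (at x within ball s0 rho)" if "x \<in> ball s0 rho" for x
   by (rule has_field_derivative_at_within, rule Theta_deriv(1))
    (use that \<open>reg b s\<close> in \<open>auto simp: reg_def dist_norm norm_minus_commute\<close>)
 qed (use that rho_pos in \<open>auto simp: reg_def dist_norm norm_minus_commute\<close>)
 have r: "reg b s0" if "b \<in> ball 0 rho - {0}" for b using that rho_pos by (auto simp: reg_def)
 obtain k where k: "!!b. b \<in> ball 0 rho - {0} ==> Theta b s0 = k"
 proof (rule DERIV_zero_connected_constant[of "ball 0 rho - {0}" "{}" "%b. Theta b s0"])
  show "connected (ball 0 rho - {0::complex})" by (rule connected_open_delete) auto
  show "open (ball 0 rho - {0::complex})" by (rule open_delete) simp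
  show "continuous_on (ball 0 rho - {0}) (%b. Theta b s0)" using Theta_deriv(2)[OF r] DERIV_isCont continuous_at_imp_continuous_on by blast
  show "\<forall>x\<in>ball 0 rho - {0} - {}. ((%b. Theta b s0) has_field_derivative 0) (at x)" using Theta_deriv(2)[OF r] by blast
 qed auto
 show ?thesis
 proof (intro exI allI impI)
  fix b s assume bs: "reg b s"
  then have "b \<in> ball 0 rho - {0}" by (auto simp: reg_def)
  then show "Theta b s = k" using 1[OF bs] k by simp
 qed
qed

end

section \<open>Monodromy at parameter 0 and exact forms\<close>

lemma isCont_zero_punctured:
 fixes g :: "complex => complex"
 assumes "isCont g 0" "r > 0" "!!z. z ~= 0 ==> norm z < r ==> g z = 0"
 shows "g 0 = 0"
proof -
 have "\<forall>\<^sub>F z in at 0. g z = 0" unfolding eventually_at using assms by (auto simp: dist_norm intro!: exI[of _ r])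
 then have "(g \<longlongrightarrow> 0) (at 0)" by (rule tendsto_eventually)
 moreover have "(g \<longlongrightarrow> g 0) (at 0)" using assms(1) by (simp add: isCont_def)
 ultimately show ?thesis using tendsto_unique[of "at (0::complex)"] by force
qed

context melnikov_form
begin

text \<open>An interval of times is uncountable, and only countably many of its members are singular
  before or after the return.\<close>

lemma real_time_exists:
 assumes x: "0 < x" "x < rho" and s: "norm (s - s0) < rho" "norm (s' - s0) < rho"
 obtains t where "\<bar>t\<bar> < \<delta>" "of_real t \<in> good (of_real x) s'" "of_real (t + T x) \<in> good (of_real x) s"
proof -
 have reg: "reg (of_real x) s" "reg (of_real x) s'" using x s by (auto simp: reg_def)
 define B1 where "B1 = {t. \<bar>t\<bar> < \<delta> & complex_of_real t \<in> N - good (of_real x) s'}"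
 define B2 where "B2 = {t. \<bar>t\<bar> < \<delta> & complex_of_real (t + T x) \<in> N - good (of_real x) s}"
 have "countable B1"
 proof (rule countable_image_inj_on[of complex_of_real])
  show "countable (complex_of_real ` B1)" by (rule countable_subset[OF _ countable_bad[OF reg(2)]]) (auto simp: B1_def)
 qed (auto simp: inj_on_def)
 moreover have "countable B2"
 proof (rule countable_image_inj_on[of "%t. complex_of_real (t + T x)"])
  show "countable ((%t. complex_of_real (t + T x)) ` B2)" by (rule countable_subset[OF _ countable_bad[OF reg(1)]]) (auto simp: B2_def)
 qed (auto simp: inj_on_def)
 ultimately have "countable (B1 Un B2)" by simp
 moreover have "uncountable (ball (0::real) \<delta>)" by (rule uncountable_ball[OF \<delta>])
 ultimately have "~ ball 0 \<delta> \<subseteq> B1 Un B2" using countable_subset by blast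
 then obtain t where t: "t \<in> ball 0 \<delta>" "t \<notin> B1" "t \<notin> B2" by blast
 then have t': "\<bar>t\<bar> < \<delta>" by simp
 show thesis
 proof (rule that[OF t'])
  show "of_real t \<in> good (of_real x) s'" using t(2) t' real_N(1)[OF t'] by (simp add: B1_def)
  show "of_real (t + T x) \<in> good (of_real x) s" using t(3) t' real_N(2)[OF t' x] by (simp add: B2_def del: of_real_add)
 qed
qed

text \<open>The relations are given off parameter 0; at a time that is regular before and after the
  return they pass to the limit, where the \<open>X 2\<close> term drops out.\<close>

lemma monodromy_base:
 assumes x: "0 < x" "x < rho" and s: "norm (s - s0) < rho" "norm (s + of_real (c x) - s0) < rho"
 shows "X 3 (base (of_real x) s) = X 3 (base (of_real x) (s + of_real (c x)))"
  "X 1 (base (of_real x) s) = X 1 (base (of_real x) (s + of_real (c x))) +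
   of_real (c' x) * X 3 (base (of_real x) (s + of_real (c x)))"
proof -
 let ?s = "s + of_real (c x)"
 have reg: "reg (of_real x) s" "reg (of_real x) ?s" using x s by (auto simp: reg_def)
 obtain t where t: "\<bar>t\<bar> < \<delta>" "of_real t \<in> good (of_real x) ?s" "of_real (t + T x) \<in> good (of_real x) s"
  using real_time_exists[OF x s] by blast
 have p: "pt (of_real x) (of_real t) ?s 0 \<in> dom4" "pt (of_real x) (of_real (t + T x)) s 0 \<in> dom4" using t by (auto simp: good_def)
 have ic: "isCont (%z. X i (pt b \<tau> s z)) 0" if "pt b \<tau> s 0 \<in> dom4" "i \<in> {1,2,3}" for i b \<tau> s
 proof -
  have "holo (X i) dom4" using hX that by auto
  then show ?thesis using pt_slice_deriv(4)[OF _ that(1)] DERIV_isCont by blast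
 qed
 have m: "X 3 (pt (of_real x) (of_real (t + T x)) s \<epsilon>) = X 3 (pt (of_real x) (of_real t) ?s \<epsilon>)"
  "X 1 (pt (of_real x) (of_real (t + T x)) s \<epsilon>) = X 1 (pt (of_real x) (of_real t) ?s \<epsilon>) +
     of_real (c' x) * X 3 (pt (of_real x) (of_real t) ?s \<epsilon>) -
     of_real (d x) * X 2 (pt (of_real x) (of_real t) ?s \<epsilon>)" if "\<epsilon> ~= 0" "norm \<epsilon> < r" for \<epsilon>
  using form x s t(1) that unfolding is_form_def by blast+
 have "X 3 (pt (of_real x) (of_real (t + T x)) s 0) - X 3 (pt (of_real x) (of_real t) ?s 0) = 0"
  by (rule isCont_zero_punctured[OF _ r_pos]) (intro continuous_intros ic p, simp_all add: m(1) del: of_real_add)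
 then show 3: "X 3 (base (of_real x) s) = X 3 (base (of_real x) ?s)" using X_eq_base[OF reg(1) t(3), of 3] X_eq_base[OF reg(2) t(2), of 3] by simp
 have "X 1 (pt (of_real x) (of_real (t + T x)) s 0) - (X 1 (pt (of_real x) (of_real t) ?s 0) +
     of_real (c' x) * X 3 (pt (of_real x) (of_real t) ?s 0) -
     of_real (d x) * X 2 (pt (of_real x) (of_real t) ?s 0)) = 0"
  by (rule isCont_zero_punctured[OF _ r_pos]) (intro continuous_intros ic p, simp_all add: m(2) del: of_real_add)
 then show "X 1 (base (of_real x) s) = X 1 (base (of_real x) ?s) + of_real (c' x) * X 3 (base (of_real x) ?s)"
  using X_eq_base[OF reg(1) t(3), of 1] X_eq_base[OF reg(2) t(2), of 1] X_eq_base[OF reg(2) t(2), of 3]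
   X2_zero[OF reg(2) t(2)] by simp
qed

text \<open>\<open>b ^ J\<close> times the limit of \<open>X i\<close> at the reference point,
  written with \<open>A\<close> and \<open>D\<close> so as to be holomorphic at \<open>b = 0\<close>
  too.\<close>

definition Bc :: "4 => complex^2 => complex" where
 "Bc i z = A i t0 (base (z $ 1) (z $ 2)) * D t0 z"

lemma holo_Bc: "i \<in> {1, 3} ==> holo (Bc i) (pol rho s0 rho)"
proof -
 assume i: "i \<in> {1, 3}"
 then have "trep (A i) (X i)" using tr by auto
 then have hA: "holo (A i t0) (tbox t0 (R t0) r)" using trepD(1) t0 by blast
 have "holo (%z. A i t0 (base (z $ 1) (z $ 2))) (pol rho s0 rho)" unfolding base_def
 proof (rule holo_compose[OF hA open_pol])
  have "\<forall>j. holo (%q. pt (q $ 1) (\<sigma> t0) (q $ 2) 0 $ j) (pol rho s0 rho)" unfolding forall_4 by (simp add: holo_nth holo_const)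
  then show "holo (%q. pt (q $ 1) (\<sigma> t0) (q $ 2) 0 $ j) (pol rho s0 rho)" for j by blast
  fix z assume z: "z \<in> pol rho s0 rho"
  have "norm (z $ 2) <= norm (z $ 2 - s0) + norm s0" by (metis diff_add_cancel norm_triangle_ineq)
  moreover have "norm s0 \<ge> 0" by simp
  moreover have "norm (z $ 1) < rho" "norm (z $ 2 - s0) < rho" using z by (auto simp: pol_def)
  ultimately have "norm (z $ 1) < r" "norm (z $ 2) < r" using rho_r by linarith+
  then show "pt (z $ 1) (\<sigma> t0) (z $ 2) 0 \<in> tbox t0 (R t0) r" using sigma[OF t0] r_pos by (simp add: dist_norm norm_minus_commute)
 qed
 then show ?thesis unfolding Bc_def by (rule holo_mult[OF _ holo_D[OF t0]])
qed

lemma Bc_eq: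
 assumes bs: "reg b s" and i: "i \<in> {1, 3}"
 shows "Bc i (vector [b, s]) = b ^ J * X i (base b s)"
proof -
 have tri: "trep (A i) (X i)" using tr i by auto
 have nz: "h t0 (base b s) ~= 0" using region_nz[OF t0] bs by (simp add: base_def reg_def)
 have "base b s \<in> tbox t0 (R t0) r" using sigma[OF t0] r_pos reg_small[OF bs] by (simp add: base_def dist_norm norm_minus_commute)
 from trepD(2)[OF tri t0 this nz]
 have "X i (base b s) = A i t0 (base b s) / h t0 (base b s)" .
 moreover have "D t0 (vector [b, s]) = b ^ J * inverse (h t0 (base b s))" using region_inv[OF t0] bs by (simp add: base_def reg_def)
 ultimately show ?thesis by (simp add: Bc_def divide_inverse)
qed

lemma X3_base_zero:
 assumes bs: "reg b s"
 shows "X 3 (base b s) = 0"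
proof -
 obtain \<kappa> where \<kappa>: "!!b s. reg b s ==> Theta b s = \<kappa>" using Theta_const by blast
 let ?P = "pol rho s0 rho"
 have rz: "reg (z $ 1) (z $ 2)" if "z \<in> ?P" "z $ 1 ~= 0" for z using that by (simp add: pol_def reg_def)
 have Bz: "Bc i z = z $ 1 ^ J * X i (base (z $ 1) (z $ 2))" if "z \<in> ?P" "z $ 1 ~= 0" "i \<in> {1, 3}" for i z
  using Bc_eq[OF rz[OF that(1,2)] that(3)] by simp
 have "Bc 3 (vector [b, s]) = 0"
 proof (rule endgame[OF rho_pos holo_Bc holo_Bc holo_mel, where J = J and c = c and c' = c' and \<kappa> = \<kappa>])
  show "melM z ~= 0" if "z \<in> ?P" for z using M_nz that by (simp add: melM_def pol_def)
  show "pd (%z. Bc 1 z / z $ 1 ^ J) 2 z = pd (%z. Bc 3 z / z $ 1 ^ J) 1 z"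
   if z: "z \<in> ?P" "z $ 1 ~= 0" for z
  proof -
   let ?S = "?P Int {z. z $ 1 ~= 0}"
   have op: "open ?S" by (intro open_Int open_pol open_Collect_neq continuous_intros)
   have zS: "z \<in> ?S" using z by simp
   have e: "pd (%z. Bc i z / z $ 1 ^ J) j z = pd (%z. X i (base (z $ 1) (z $ 2))) j z"
    if "i \<in> {1, 3}" for i j by (rule partial_deriv_cong[OF op zS]) (use Bz that in auto)
   have "pd (X 1) 3 (base (z $ 1) (z $ 2)) = pd (X 3) 1 (base (z $ 1) (z $ 2))" by (rule closed(3)[OF base_dom4[OF rz[OF z]]])
   then show ?thesis using e[of 1 2] e[of 3 1] unfolding base_def by (simp add: partial_slice2)
  qed
  show "Bc 3 (vector [of_real x, s + of_real (c x)]) = Bc 3 (vector [of_real x, s])"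
   if "0 < x" "x < rho" "norm (s - s0) < rho" "norm (s + of_real (c x) - s0) < rho" for x s
   using monodromy_base(1)[OF that] Bc_eq[of "of_real x" s 3] Bc_eq[of "of_real x" "s + of_real (c x)" 3] that by (simp add: reg_def)
  show "Bc 1 (vector [of_real x, s]) = Bc 1 (vector [of_real x, s + of_real (c x)]) + of_real (c' x) * Bc 3 (vector [of_real x, s])"
   if "0 < x" "x < rho" "norm (s - s0) < rho" "norm (s + of_real (c x) - s0) < rho" for x s
   using monodromy_base[OF that] Bc_eq[of "of_real x" s 1] Bc_eq[of "of_real x" s 3] Bc_eq[of "of_real x" "s + of_real (c x)" 1] that
   by (simp add: reg_def algebra_simps)
  show "Bc 1 z * melM z + Bc 3 z * melN z = \<kappa> * z $ 1 ^ J" if z: "z \<in> ?P" "z $ 1 ~= 0" for z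
   using \<kappa>[OF rz[OF z]] Bz[OF z, of 1] Bz[OF z, of 3] by (simp add: Theta_def algebra_simps flip: \<kappa>[OF rz[OF z]])
  show "vector [b, s] \<in> ?P" using bs by (simp add: reg_def)
 qed (use c in auto)
 then show ?thesis using Bc_eq[OF bs, of 3] bs by (simp add: reg_def)
qed

theorem leading_form:
 obtains \<kappa> where "!!b s \<tau>. reg b s ==> \<tau> \<in> good b s ==> X 2 (pt b \<tau> s 0) = 0"
  "!!b s \<tau>. reg b s ==> \<tau> \<in> good b s ==> X 3 (pt b \<tau> s 0) = 0"
  "!!b s \<tau>. reg b s ==> \<tau> \<in> good b s ==> X 1 (pt b \<tau> s 0) * melM (vector [b, s]) = \<kappa>"
proof -
 obtain \<kappa> where \<kappa>: "!!b s. reg b s ==> Theta b s = \<kappa>" using Theta_const by blast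
 show thesis
 proof (rule that[of \<kappa>])
  fix b s \<tau> assume bs: "reg b s" "\<tau> \<in> good b s"
  show "X 2 (pt b \<tau> s 0) = 0" by (rule X2_zero[OF bs])
  show "X 3 (pt b \<tau> s 0) = 0" using X_eq_base[OF bs, of 3] X3_base_zero[OF bs(1)] by simp
  show "X 1 (pt b \<tau> s 0) * melM (vector [b, s]) = \<kappa>"
   using X_eq_base[OF bs, of 1] X3_base_zero[OF bs(1)] \<kappa>[OF bs(1)] by (simp add: Theta_def)
 qed
qed

text \<open>\<open>F1\<close> is the coefficient of order \<open>L + 1\<close> of \<open>F\<close>
  in the parameter, up to normalisation: its time derivative is the first-order coefficient of
  \<open>Y\<close>. One differentiation in the parameter lowers \<open>L\<close> by 1.\<close>

lemma exact_reduce: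
 assumes "holo F dom4" "holo Y dom4" "!!p. p \<in> dom4 ==> pd F 2 p = p $ 4 ^ L * Y p"
  and "!!b s \<tau>. reg b s ==> \<tau> \<in> good b s ==> Y (pt b \<tau> s 0) = 0"
 shows "\<exists>F1. holo F1 dom4 & (\<forall>b s \<tau>. reg b s --> \<tau> \<in> good b s -->
  pd F1 2 (pt b \<tau> s 0) = pd Y 4 (pt b \<tau> s 0))" using assms
proof (induction L arbitrary: F Y)
 have step: "pd (pd F 4) 2 p = of_nat L * p $ 4 ^ (L - 1) * Y p + p $ 4 ^ L * pd Y 4 p"
  if F: "holo F dom4" "holo Y dom4" "!!p. p \<in> dom4 ==> pd F 2 p = p $ 4 ^ L * Y p" and p: "p \<in> dom4" for F Y L p
 proof -
  have "pd (pd F 4) 2 p = pd (pd F 2) 4 p" by (rule partial_deriv_commute[OF F(1) p])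
  also have "\<dots> = pd (%p. p $ 4 ^ L * Y p) 4 p" by (rule partial_deriv_cong[OF open_dom4 p]) (rule F(3))
  also have "\<dots> = of_nat L * p $ 4 ^ (L - 1) * Y p + p $ 4 ^ L * pd Y 4 p"
  proof -
   have "((%z. Y (p + axis 4 z)) has_field_derivative pd Y 4 p) (at 0)" using has_cgrad_partial[OF holo_has_cgrad[OF F(2) p], of 4] by simp
   then have "((%z. (p $ 4 + z) ^ L * Y (p + axis 4 z)) has_field_derivative
     of_nat L * p $ 4 ^ (L - 1) * Y p + p $ 4 ^ L * pd Y 4 p) (at 0)" by (auto intro!: derivative_eq_intros)
   then show ?thesis unfolding partial_deriv_def[of "%p. p $ 4 ^ L * Y p"] by (simp add: axis_def DERIV_imp_deriv)
  qed
  finally show ?thesis .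
 qed
 {
  case 0
  show ?case using step[OF 0(1-3)] holo_partial_deriv[OF 0(1)] by (intro exI[of _ "pd F 4"]) (auto simp: good_def)
 next
  case (Suc L)
  \<comment> \<open>The time derivative of \<open>pd F 4\<close> is \<open>p $ 4 ^ L * Y'\<close>.
    At parameter 0 the parameter derivative of \<open>Y'\<close> is \<open>L + 2\<close> times that
    of \<open>Y\<close>, whence the final division.\<close>
  define Y' where "Y' p = of_nat (Suc L) * Y p + p $ 4 * pd Y 4 p" for p
  have hY': "holo Y' dom4" unfolding Y'_def by (intro holo_add holo_mult holo_const holo_nth holo_partial_deriv Suc.prems(2) open_dom4)
  have "pd (pd F 4) 2 p = p $ 4 ^ L * Y' p" if "p \<in> dom4" for p using step[OF Suc.prems(1-3) that] by (simp add: Y'_def algebra_simps)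
  moreover have "Y' (pt b \<tau> s 0) = 0" if "reg b s" "\<tau> \<in> good b s" for b s \<tau> using Suc.prems(4)[OF that] by (simp add: Y'_def)
  ultimately obtain F1 where F1: "holo F1 dom4" "!!b s \<tau>. reg b s ==> \<tau> \<in> good b s ==>
    pd F1 2 (pt b \<tau> s 0) = pd Y' 4 (pt b \<tau> s 0)" using Suc.IH[OF holo_partial_deriv[OF Suc.prems(1), of 4] hY'] by blast
  have Y'd: "pd Y' 4 (pt b \<tau> s 0) = of_nat (L + 2) * pd Y 4 (pt b \<tau> s 0)"
   if "reg b s" "\<tau> \<in> good b s" for b s \<tau>
  proof -
   have p: "pt b \<tau> s 0 \<in> dom4" using that by (simp add: good_def)
   note d1 = pt_slice_deriv(4)[OF Suc.prems(2) p]
   note d2 = pt_slice_deriv(4)[OF holo_partial_deriv[OF Suc.prems(2), of 4] p]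
   from DERIV_add[OF DERIV_cmult[OF d1, of "of_nat (Suc L)"] DERIV_mult[OF DERIV_ident d2]]
   have "((%z. Y' (pt b \<tau> s z)) has_field_derivative of_nat (L + 2) * pd Y 4 (pt b \<tau> s 0)) (at 0)" by (simp add: Y'_def algebra_simps)
   then show ?thesis using pt_slice_deriv(4)[OF hY' p] DERIV_unique by blast
  qed
  have L2: "of_nat (L + 2) ~= (0::complex)" unfolding of_nat_eq_0_iff by simp
  show ?case
  proof (intro exI[of _ "%p. F1 p / of_nat (L + 2)"] conjI allI impI)
   show "holo (%p. F1 p / of_nat (L + 2)) dom4" by (rule holo_divide[OF F1(1) holo_const[OF open_dom4]]) (rule L2)
   fix b s \<tau> assume bs: "reg b s" "\<tau> \<in> good b s"
   have p: "pt b \<tau> s 0 \<in> dom4" using bs by (simp add: good_def)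
   have "pd (%q. F1 (q + 0) / of_nat (L + 2)) 2 (pt b \<tau> s 0) = pd F1 2 (pt b \<tau> s 0 + 0) / of_nat (L + 2)"
    by (rule partial_deriv_scaled_shift[OF F1(1)]) (simp add: p)
   then show "pd (%p. F1 p / of_nat (L + 2)) 2 (pt b \<tau> s 0) = pd Y 4 (pt b \<tau> s 0)"
    using F1(2)[OF bs] Y'd[OF bs] L2 by (simp del: of_nat_add)
  qed
 }
qed

text \<open>For an exact form the integrand \<open>fa * X 1\<close> itself has a primitive along the
  loop, not merely its derivatives in \<open>b\<close> and \<open>s\<close>. So \<open>X 1\<close>
  times the non-zero integral \<open>melM\<close> is 0.\<close>

theorem exact_form_vanishes:
 assumes F: "holo F dom4" "!!p. p \<in> dom4 ==> p $ 4 ~= 0 ==> pd F 2 p = p $ 4 ^ L * X 2 p"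
  and bs: "reg b s" and \<tau>: "\<tau> \<in> good b s" shows "X 1 (pt b \<tau> s 0) = 0"
proof -
 have F2: "pd F 2 p = p $ 4 ^ L * X 2 p" if "p \<in> dom4" for p
 proof -
  have "pd F 2 p - p $ 4 ^ L * X 2 p = 0"
   by (rule dom4_zero_dense[OF holo_diff[OF holo_partial_deriv[OF F(1)] holo_mult[OF holo_power[OF holo_nth[OF open_dom4]] hX(2)]] _ that])
    (simp add: F(2))
  then show ?thesis by simp
 qed
 obtain F1 where F1: "holo F1 dom4" "!!b s \<tau>. reg b s ==> \<tau> \<in> good b s ==>
  pd F1 2 (pt b \<tau> s 0) = pd (X 2) 4 (pt b \<tau> s 0)" using exact_reduce[OF F(1) hX(2) F2 X2_zero] by blast
 have bs': "norm b < rho" "norm (s - s0) < rho" using bs by (auto simp: reg_def)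
 have "contour_integral \<gamma> (%\<tau>. fa (pt b \<tau> s 0) * X 1 (base b s)) = 0"
 proof (rule primitive_along_loop[OF bs _ _ N1 _ loop(1,2,3)])
  show "(%\<tau>. - F1 (pt b \<tau> s 0)) holomorphic_on good b s" by (intro holomorphic_intros slice_holomorphic F1)
  show "(%\<tau>. fa (pt b \<tau> s 0) * X 1 (base b s)) holomorphic_on N1"
   by (intro holomorphic_intros holomorphic_pt[OF holo_f(1) N1(1)]) (use N1_Q4 bs' in auto)
  fix \<tau> assume \<tau>: "\<tau> \<in> good b s" "\<tau> \<in> N1"
  have p: "pt b \<tau> s 0 \<in> dom4 Int Q4" using \<tau> N1_Q4 bs' by (auto simp: good_def)
  have "pd F1 2 (pt b \<tau> s 0) = - (fa (pt b \<tau> s 0) * X 1 (base b s))"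
   using F1(2)[OF bs \<tau>(1)] X2_first[OF p X2_zero[OF bs \<tau>(1)]] X_eq_base[OF bs \<tau>(1), of 1] X_eq_base[OF bs \<tau>(1), of 3]
    X3_base_zero[OF bs] by simp
  then show "((%\<tau>. - F1 (pt b \<tau> s 0)) has_field_derivative fa (pt b \<tau> s 0) * X 1 (base b s)) (at \<tau>)"
   using DERIV_minus[OF pt_slice_deriv(2)[OF F1(1), of b \<tau> s 0]] p by simp
 qed
 then have "melM (vector [b, s]) * X 1 (base b s) = 0" using loop_integrable[OF holo_f(1) bs'] by (simp add: contour_integral_rmul melM_def)
 moreover have "melM (vector [b, s]) ~= 0" using M_nz[OF bs'] by (simp add: melM_def)
 ultimately show ?thesis using X_eq_base[OF bs \<tau>, of 1] by simp
qed

end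

section \<open>Linear combinations of forms and their orders in the parameter\<close>

lemma partial_deriv_diff_cmult:
 assumes "holo f S" "holo g S" "p \<in> S"
 shows "pd (%p. f p - \<mu> * g p) i p = pd f i p - \<mu> * pd g i p"
proof -
 have d: "((%z. f (p + axis i z)) has_field_derivative pd f i p) (at 0)" if "holo f S" for f
  using has_cgrad_partial[OF holo_has_cgrad[OF that assms(3)], of i] by simp
 show ?thesis unfolding partial_deriv_def[of "%p. f p - \<mu> * g p"]
  using DERIV_diff[OF d[OF assms(1)] DERIV_cmult[OF d[OF assms(2)], of \<mu>]] by (rule DERIV_imp_deriv)
qed

context melnikov_tube
begin

lemma is_form_trep: "is_form A X ==> i \<in> {1,2,3} ==> trep (A i) (X i)" unfolding is_form_def by blast

lemma is_form_diff:
 assumes f: "is_form A X" and g: "is_form B Y"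
 shows "is_form (%i t p. A i t p - \<mu> * B i t p) (%i p. X i p - \<mu> * Y i p)"
proof -
 interpret f: melnikov_form C R r h N s0 rho \<sigma> J D fa fb fe Q4 N0 N1 \<gamma> \<gamma>' c c' d T \<delta> A X by unfold_locales (rule f)
 interpret g: melnikov_form C R r h N s0 rho \<sigma> J D fa fb fe Q4 N0 N1 \<gamma> \<gamma>' c c' d T \<delta> B Y by unfold_locales (rule g)
 have hX: "holo (X i) dom4" and hY: "holo (Y i) dom4" if "i \<in> {1,2,3}" for i using that f.hX g.hX by auto
 have 1: "trep (%t p. A i t p - \<mu> * B i t p) (%p. X i p - \<mu> * Y i p)" if i: "i \<in> {1,2,3}" for i
 proof -
  have a: "trep (A i) (X i)" "trep (B i) (Y i)" using i f.tr g.tr by auto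
  show ?thesis unfolding trep_def
  proof (intro ballI conjI impI)
   fix t assume t: "t \<in> C"
   show "holo (%p. A i t p - \<mu> * B i t p) (bx t)" by (intro holo_diff holo_mult holo_const trepD(1)[OF a(1) t] trepD(1)[OF a(2) t] open_tbox)
   fix p assume "p \<in> bx t" "h t p ~= 0"
   then have "h t p * X i p = A i t p" "h t p * Y i p = B i t p" using a t by (auto simp: trep_def)
   then show "h t p * (X i p - \<mu> * Y i p) = A i t p - \<mu> * B i t p" by (simp add: algebra_simps flip: \<open>h t p * Y i p = B i t p\<close>)
  qed
 qed
 have 2: "pd (%p. X i p - \<mu> * Y i p) j p = pd (%p. X j p - \<mu> * Y j p) i p"
  if p: "p \<in> dom4" "p $ 4 ~= 0" and i: "i \<in> {1,2,3}" "j \<in> {1,2,3}" for p i j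
 proof -
  have "pd (X i) j p = pd (X j) i p" "pd (Y i) j p = pd (Y j) i p"
   using conjunct1[OF conjunct2[OF f[unfolded is_form_def]]] conjunct1[OF conjunct2[OF g[unfolded is_form_def]]] i p by blast+
  then show ?thesis unfolding partial_deriv_diff_cmult[OF hX[OF i(1)] hY[OF i(1)] p(1)] partial_deriv_diff_cmult[OF hX[OF i(2)] hY[OF i(2)] p(1)]
   by simp
 qed
 have 3: "X 2 p - \<mu> * Y 2 p + p $ 4 * (fa p * (X 1 p - \<mu> * Y 1 p) + fb p * (X 2 p - \<mu> * Y 2 p) + fe p * (X 3 p - \<mu> * Y 3 p)) = 0"
  if p: "p \<in> dom4 Int Q4" for p
 proof -
  have "X 2 p - \<mu> * Y 2 p + p $ 4 * (fa p * (X 1 p - \<mu> * Y 1 p) + fb p * (X 2 p - \<mu> * Y 2 p) + fe p * (X 3 p - \<mu> * Y 3 p)) =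
   (X 2 p + p $ 4 * (fa p * X 1 p + fb p * X 2 p + fe p * X 3 p)) -
   \<mu> * (Y 2 p + p $ 4 * (fa p * Y 1 p + fb p * Y 2 p + fe p * Y 3 p))" by (simp add: algebra_simps)
  then show ?thesis using f.annihil[OF p] g.annihil[OF p] by simp
 qed
 have m: "!!x s t \<epsilon>. 0 < x ==> x < rho ==> norm (s - s0) < rho ==> norm (s + of_real (c x) - s0) < rho ==> \<bar>t\<bar> < \<delta> ==>
    \<epsilon> ~= 0 ==> norm \<epsilon> < r ==>
    Z 3 (pt (of_real x) (of_real (t + T x)) s \<epsilon>) = Z 3 (pt (of_real x) (of_real t) (s + of_real (c x)) \<epsilon>) &
    Z 1 (pt (of_real x) (of_real (t + T x)) s \<epsilon>) = Z 1 (pt (of_real x) (of_real t) (s + of_real (c x)) \<epsilon>) +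
     of_real (c' x) * Z 3 (pt (of_real x) (of_real t) (s + of_real (c x)) \<epsilon>) -
     of_real (d x) * Z 2 (pt (of_real x) (of_real t) (s + of_real (c x)) \<epsilon>)" if "is_form B Z" for B Z
  using that unfolding is_form_def by blast
 show ?thesis unfolding is_form_def
 proof (intro conjI ballI allI impI)
  fix x t :: real and s \<epsilon> :: complex
  assume a: "0 < x" "x < rho" "norm (s - s0) < rho" "norm (s + of_real (c x) - s0) < rho" "\<bar>t\<bar> < \<delta>"
    "\<epsilon> ~= 0" "norm \<epsilon> < r"
  note mX = m[OF f a] and mY = m[OF g a]
  show "X 3 (pt (of_real x) (of_real (t + T x)) s \<epsilon>) - \<mu> * Y 3 (pt (of_real x) (of_real (t + T x)) s \<epsilon>) =
    X 3 (pt (of_real x) (of_real t) (s + of_real (c x)) \<epsilon>) - \<mu> * Y 3 (pt (of_real x) (of_real t) (s + of_real (c x)) \<epsilon>)"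
   using mX mY by (simp del: of_real_add)
  show "X 1 (pt (of_real x) (of_real (t + T x)) s \<epsilon>) - \<mu> * Y 1 (pt (of_real x) (of_real (t + T x)) s \<epsilon>) =
    X 1 (pt (of_real x) (of_real t) (s + of_real (c x)) \<epsilon>) - \<mu> * Y 1 (pt (of_real x) (of_real t) (s + of_real (c x)) \<epsilon>) +
    of_real (c' x) * (X 3 (pt (of_real x) (of_real t) (s + of_real (c x)) \<epsilon>) - \<mu> * Y 3 (pt (of_real x) (of_real t) (s + of_real (c x)) \<epsilon>)) -
    of_real (d x) * (X 2 (pt (of_real x) (of_real t) (s + of_real (c x)) \<epsilon>) - \<mu> * Y 2 (pt (of_real x) (of_real t) (s + of_real (c x)) \<epsilon>))"
   unfolding conjunct2[OF mX] conjunct2[OF mY] by (simp add: algebra_simps)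
 qed (fact 1 2 3 | rule 1 2 3, assumption+)+
qed

lemma is_form_divide:
 assumes f: "is_form A X"
  and z: "!!i t p. i \<in> {1,2,3} ==> t \<in> C ==> p \<in> bx t ==> p $ 4 = 0 ==> A i t p = 0"
 obtains A' X' where "is_form A' X'" "!!i t p. i \<in> {1,2,3} ==> t \<in> C ==> p \<in> bx t ==> A i t p = p $ 4 * A' i t p"
  "!!i p. i \<in> {1,2,3} ==> p \<in> dom4 | p $ 4 ~= 0 ==> X i p = p $ 4 * X' i p"
proof -
 interpret f: melnikov_form C R r h N s0 rho \<sigma> J D fa fb fe Q4 N0 N1 \<gamma> \<gamma>' c c' d T \<delta> A X by unfold_locales (rule f)
 have "\<forall>i\<in>{1,2,3}. \<exists>A' X'. trep A' X' & (\<forall>t\<in>C. \<forall>p\<in>bx t. A i t p = p $ 4 * A' t p) &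
   (\<forall>p. p \<in> dom4 | p $ 4 ~= 0 --> X i p = p $ 4 * X' p)"
 proof
  fix i :: 4 assume i: "i \<in> {1,2,3}"
  then have ti: "trep (A i) (X i)" using f.tr by auto
  show "\<exists>A' X'. trep A' X' & (\<forall>t\<in>C. \<forall>p\<in>bx t. A i t p = p $ 4 * A' t p) &
   (\<forall>p. p \<in> dom4 | p $ 4 ~= 0 --> X i p = p $ 4 * X' p)" by (rule trep_divide[OF ti z[OF i]]) blast+
 qed
 then obtain A' X' where *: "!!i. i \<in> {1,2,3} ==> trep (A' i) (X' i)"
  "!!i t p. i \<in> {1,2,3} ==> t \<in> C ==> p \<in> bx t ==> A i t p = p $ 4 * A' i t p"
  "!!i p. i \<in> {1,2,3} ==> p \<in> dom4 | p $ 4 ~= 0 ==> X i p = p $ 4 * X' i p" unfolding bchoice_iff by metis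
 have pd: "pd (X i) j p = p $ 4 * pd (X' i) j p"
  if i: "i \<in> {1,2,3}" "j \<in> {1,2,3}" and p: "p \<in> dom4" for i j p
 proof -
  have hi: "holo (X' i) dom4" using *(1)[OF i(1)] by (rule trep_holo)
  have "pd (X i) j p = pd (%p. p $ 4 * X' i p) j p" by (rule partial_deriv_cong[OF open_dom4 p]) (use *(3) i in blast)
  also have "\<dots> = p $ 4 * pd (X' i) j p"
  proof -
   have "((%z. X' i (p + axis j z)) has_field_derivative pd (X' i) j p) (at 0)" using has_cgrad_partial[OF holo_has_cgrad[OF hi p], of j] by simp
   then have "((%z. p $ 4 * X' i (p + axis j z)) has_field_derivative p $ 4 * pd (X' i) j p) (at 0)" by (rule DERIV_cmult)
   moreover have "(p + axis j z) $ 4 = p $ 4" for z using i(2) by (auto simp: axis_def)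
   ultimately show ?thesis unfolding partial_deriv_def[of "%p. p $ 4 * X' i p"] by (simp only: DERIV_imp_deriv)
  qed
  finally show ?thesis .
 qed
 have "is_form A' X'" unfolding is_form_def
 proof (intro conjI ballI allI impI)
  show "trep (A' i) (X' i)" if "i \<in> {1,2,3}" for i using *(1) that .
  show "pd (X' i) j p = pd (X' j) i p"
   if p: "p \<in> dom4" "p $ 4 ~= 0" and i: "i \<in> {1,2,3}" "j \<in> {1,2,3}" for p i j
  proof -
   have "pd (X i) j p = pd (X j) i p" using conjunct1[OF conjunct2[OF f[unfolded is_form_def]]] i p by blast
   then show ?thesis using pd[OF i p(1)] pd[OF i(2,1) p(1)] p(2) by simp
  qed
  show "X' 2 p + p $ 4 * (fa p * X' 1 p + fb p * X' 2 p + fe p * X' 3 p) = 0" if p: "p \<in> dom4 Int Q4" "p $ 4 ~= 0" for p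
  proof -
   have "p $ 4 * (X' 2 p + p $ 4 * (fa p * X' 1 p + fb p * X' 2 p + fe p * X' 3 p)) = 0"
    using f.annihil[OF p(1)] *(3)[of 1 p] *(3)[of 2 p] *(3)[of 3 p] p(2) by (simp add: algebra_simps)
   then show ?thesis using p(2) by simp
  qed
  fix x t :: real and s \<epsilon> :: complex assume a: "0 < x" "x < rho" "norm (s - s0) < rho" "norm (s + of_real (c x) - s0) < rho" "\<bar>t\<bar> < \<delta>"
    "\<epsilon> ~= 0" "norm \<epsilon> < r"
  have m: "X 3 (pt (of_real x) (of_real (t + T x)) s \<epsilon>) = X 3 (pt (of_real x) (of_real t) (s + of_real (c x)) \<epsilon>)"
    "X 1 (pt (of_real x) (of_real (t + T x)) s \<epsilon>) = X 1 (pt (of_real x) (of_real t) (s + of_real (c x)) \<epsilon>) +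
     of_real (c' x) * X 3 (pt (of_real x) (of_real t) (s + of_real (c x)) \<epsilon>) -
     of_real (d x) * X 2 (pt (of_real x) (of_real t) (s + of_real (c x)) \<epsilon>)" using f a unfolding is_form_def by blast+
  have e: "X i (pt u v w \<epsilon>) = \<epsilon> * X' i (pt u v w \<epsilon>)" if "i \<in> {1,2,3}" for i u v w
   using *(3)[OF that, of "pt u v w \<epsilon>"] a(6) by simp
  show "X' 3 (pt (of_real x) (of_real (t + T x)) s \<epsilon>) = X' 3 (pt (of_real x) (of_real t) (s + of_real (c x)) \<epsilon>)"
   using m(1) a(6) by (simp add: e)
  have "\<epsilon> * X' 1 (pt (of_real x) (of_real (t + T x)) s \<epsilon>) = \<epsilon> * (X' 1 (pt (of_real x) (of_real t) (s + of_real (c x)) \<epsilon>) +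
     of_real (c' x) * X' 3 (pt (of_real x) (of_real t) (s + of_real (c x)) \<epsilon>) -
     of_real (d x) * X' 2 (pt (of_real x) (of_real t) (s + of_real (c x)) \<epsilon>))"
   using m(2) by (simp add: e algebra_simps del: of_real_add)
  then show "X' 1 (pt (of_real x) (of_real (t + T x)) s \<epsilon>) = X' 1 (pt (of_real x) (of_real t) (s + of_real (c x)) \<epsilon>) +
     of_real (c' x) * X' 3 (pt (of_real x) (of_real t) (s + of_real (c x)) \<epsilon>) -
     of_real (d x) * X' 2 (pt (of_real x) (of_real t) (s + of_real (c x)) \<epsilon>)" using a(6) by simp
 qed
 then show thesis using that * by blast
qed

text \<open>The three components are divided together; the order \<open>n\<close> of the single
  numerator \<open>A i0 t\<close> bounds the number of divisions.\<close>

lemma is_form_normalize_aux: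
 assumes t: "t \<in> C" and i0: "i0 \<in> {1,2,3}" and B: "holo B (bx t)" "q \<in> bx t" "q $ 4 = 0" "B q ~= 0"
  and "is_form A X" "!!p. p \<in> bx t ==> A i0 t p = p $ 4 ^ n * B p" shows "\<exists>k A' X'. is_form A' X' &
  (\<forall>i\<in>{1,2,3}. \<forall>p. p \<in> dom4 | p $ 4 ~= 0 --> X i p = p $ 4 ^ k * X' i p) &
  (\<forall>i\<in>{1,2,3}. \<forall>t\<in>C. \<forall>p\<in>bx t. A i t p = p $ 4 ^ k * A' i t p) &
  (\<exists>i\<in>{1,2,3}. \<exists>t\<in>C. \<exists>p\<in>bx t. p $ 4 = 0 & A' i t p ~= 0)" using assms(7,8)
proof (induction n arbitrary: A X)
 case 0
 then have "A i0 t q ~= 0" using B by simp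
 then show ?case using 0(1) t i0 B by (intro exI[of _ 0] exI[of _ A] exI[of _ X]) auto
next
 case (Suc n)
 show ?case
 proof (cases "\<exists>i\<in>{1,2,3}. \<exists>t\<in>C. \<exists>p\<in>bx t. p $ 4 = 0 & A i t p ~= 0")
  case True
  then show ?thesis using Suc.prems(1) by (intro exI[of _ 0] exI[of _ A] exI[of _ X]) auto
 next
  case False
  then have z: "A i t p = 0" if "i \<in> {1,2,3}" "t \<in> C" "p \<in> bx t" "p $ 4 = 0" for i t p using that by blast
  obtain A' X' where f': "is_form A' X'" and A': "!!i t p. i \<in> {1,2,3} ==> t \<in> C ==> p \<in> bx t ==> A i t p = p $ 4 * A' i t p"
   and X': "!!i p. i \<in> {1,2,3} ==> p \<in> dom4 | p $ 4 ~= 0 ==> X i p = p $ 4 * X' i p"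
   by (rule is_form_divide[OF Suc.prems(1)], rule z, assumption+) (rule that)
  have hA: "holo (A' i0 t) (bx t)" using f' i0 t trepD(1) unfolding is_form_def by blast
  have "A' i0 t p - p $ 4 ^ n * B p = 0" if p: "p \<in> bx t" for p
  proof (rule dom4_zero_dense[OF _ _ p])
   show "holo (%p. A' i0 t p - p $ 4 ^ n * B p) (bx t)" by (intro holo_diff holo_mult holo_power holo_nth hA B open_tbox)
   show "A' i0 t q - q $ 4 ^ n * B q = 0" if q: "q \<in> bx t" "q $ 4 ~= 0" for q using A'[OF i0 t q(1)] Suc.prems(2)[OF q(1)] q(2) by simp
  qed
  then have "A' i0 t p = p $ 4 ^ n * B p" if "p \<in> bx t" for p using that by simp
  from Suc.IH[OF f' this] obtain k A'' X'' where k: "is_form A'' X''"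
   "!!i p. i \<in> {1,2,3} ==> p \<in> dom4 | p $ 4 ~= 0 ==> X' i p = p $ 4 ^ k * X'' i p"
   "!!i t p. i \<in> {1,2,3} ==> t \<in> C ==> p \<in> bx t ==> A' i t p = p $ 4 ^ k * A'' i t p"
   "\<exists>i\<in>{1,2,3}. \<exists>t\<in>C. \<exists>p\<in>bx t. p $ 4 = 0 & A'' i t p ~= 0" by blast
  show ?thesis
  proof (intro exI[of _ "Suc k"] exI[of _ A''] exI[of _ X''] conjI ballI allI impI k(1,4))
   show "X i p = p $ 4 ^ Suc k * X'' i p" if "i \<in> {1,2,3}" "p \<in> dom4 | p $ 4 ~= 0" for i p using X'[OF that] k(2)[OF that] by simp
   show "A i t p = p $ 4 ^ Suc k * A'' i t p" if "i \<in> {1,2,3}" "t \<in> C" "p \<in> bx t" for i t p using A'[OF that] k(3)[OF that] by simp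
  qed
 qed
qed

lemma is_form_normalize:
 assumes f: "is_form A X" and nz: "t \<in> C" "i0 \<in> {1,2,3}" "p \<in> bx t" "A i0 t p ~= 0"
 obtains k A' X' where "is_form A' X'"
  "!!i p. i \<in> {1,2,3} ==> p \<in> dom4 | p $ 4 ~= 0 ==> X i p = p $ 4 ^ k * X' i p"
  "!!i t p. i \<in> {1,2,3} ==> t \<in> C ==> p \<in> bx t ==> A i t p = p $ 4 ^ k * A' i t p"
  "\<exists>i\<in>{1,2,3}. \<exists>t\<in>C. \<exists>p\<in>bx t. p $ 4 = 0 & A' i t p ~= 0"
proof -
 have hA: "holo (A i0 t) (bx t)" using f nz trepD(1) unfolding is_form_def by blast
 have "(4::4) ~= 2" by simp
 obtain B n where B: "holo B (bx t)" "!!q. q \<in> bx t ==> A i0 t q = q $ 4 ^ n * B q"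
  "\<exists>q\<in>bx t. q $ 4 = 0 & B q ~= 0"
  by (rule holo_order1[OF hA coord_star_tbox[OF \<open>(4::4) ~= 2\<close>] convex_tbox nz(3,4)]) (rule that)
 then obtain q where q: "q \<in> bx t" "q $ 4 = 0" "B q ~= 0" by blast
 from is_form_normalize_aux[OF nz(1,2) B(1) q f B(2)] that show thesis by blast
qed

lemma form_vanishes_imp:
 assumes f: "is_form A X" and z: "!!i b s \<tau>. i \<in> {1,2,3} ==> reg b s ==> \<tau> \<in> good b s ==> X i (pt b \<tau> s 0) = 0"
  and "i \<in> {1,2,3}" "t \<in> C" "p \<in> bx t" "p $ 4 = 0" shows "A i t p = 0"
proof -
 have "trep (A i) (X i)" using f assms(3) unfolding is_form_def by blast
 from trep_vanish[OF this openN _ subset_refl z[OF assms(3)] assms(4-6)] show ?thesis using N0 by blast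
qed

text \<open>After normalisation the limit is not zero. Yet its components along \<tau> and
  \<open>s\<close> vanish as for every form, and the one along \<open>b\<close> vanishes by
  exactness.\<close>

theorem no_exact_form:
 assumes f: "is_form A X" and nz: "t \<in> C" "i0 \<in> {1,2,3}" "p \<in> bx t" "A i0 t p ~= 0"
  and F: "holo F dom4" "!!p. p \<in> dom4 ==> p $ 4 ~= 0 ==> pd F 2 p = p $ 4 ^ L * X 2 p" shows False
proof -
 obtain k A' X' where f': "is_form A' X'" and X': "!!i p. i \<in> {1,2,3} ==> p \<in> dom4 | p $ 4 ~= 0 ==> X i p = p $ 4 ^ k * X' i p"
  and nz': "\<exists>i\<in>{1,2,3}. \<exists>t\<in>C. \<exists>p\<in>bx t. p $ 4 = 0 & A' i t p ~= 0"
  by (rule is_form_normalize[OF f nz]) (rule that)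
 interpret f': melnikov_form C R r h N s0 rho \<sigma> J D fa fb fe Q4 N0 N1 \<gamma> \<gamma>' c c' d T \<delta> A' X' by unfold_locales (rule f')
 have F': "pd F 2 p = p $ 4 ^ (L + k) * X' 2 p" if "p \<in> dom4" "p $ 4 ~= 0" for p using F(2)[OF that] X'[of 2 p] that by (simp add: power_add)
 obtain \<kappa> where lf: "!!b s \<tau>. reg b s ==> \<tau> \<in> good b s ==> X' 2 (pt b \<tau> s 0) = 0"
  "!!b s \<tau>. reg b s ==> \<tau> \<in> good b s ==> X' 3 (pt b \<tau> s 0) = 0" using f'.leading_form by metis
 have "X' i (pt b \<tau> s 0) = 0" if "i \<in> {1,2,3}" "reg b s" "\<tau> \<in> good b s" for i b s \<tau>
  using that lf f'.exact_form_vanishes[OF F(1) F' that(2,3)] by auto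
 from form_vanishes_imp[OF f' this] nz' show False by blast
qed

text \<open>All limits are constant multiples of \<open>db\<close> divided by the loop integral, so
  a multiple of the normalised first form cancels the limit of the second, and the remainder is
  divisible by the parameter. Repetition would make the wedge product vanish to any order.\<close>

theorem no_two_forms:
 assumes f: "is_form A X" and g: "is_form B Z" and t: "t \<in> C" and ij: "i \<in> {1,2,3}" "j \<in> {1,2,3}"
  and p: "p \<in> bx t" and nz: "A i t p * B j t p - A j t p * B i t p ~= 0" shows False
proof -
 have "\<exists>i0\<in>{1,2,3}. A i0 t p ~= 0" using nz ij by force
 then obtain i0 where i0: "i0 \<in> {1,2,3}" "A i0 t p ~= 0" by blast
 obtain k A' Y where f': "is_form A' Y" and A': "!!i t p. i \<in> {1,2,3} ==> t \<in> C ==> p \<in> bx t ==> A i t p = p $ 4 ^ k * A' i t p"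
  and nz': "\<exists>i\<in>{1,2,3}. \<exists>t\<in>C. \<exists>p\<in>bx t. p $ 4 = 0 & A' i t p ~= 0"
  by (rule is_form_normalize[OF f t i0(1) p i0(2)]) (rule that)
 interpret f': melnikov_form C R r h N s0 rho \<sigma> J D fa fb fe Q4 N0 N1 \<gamma> \<gamma>' c c' d T \<delta> A' Y by unfold_locales (rule f')
 obtain \<kappa>2 where lf: "!!b s \<tau>. reg b s ==> \<tau> \<in> good b s ==> Y 2 (pt b \<tau> s 0) = 0"
  "!!b s \<tau>. reg b s ==> \<tau> \<in> good b s ==> Y 3 (pt b \<tau> s 0) = 0"
  "!!b s \<tau>. reg b s ==> \<tau> \<in> good b s ==> Y 1 (pt b \<tau> s 0) * melM (vector [b, s]) = \<kappa>2" using f'.leading_form by metis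
 have M: "melM (vector [b, s]) ~= 0" if "reg b s" for b s using M_nz that by (simp add: melM_def reg_def)
 \<comment> \<open>Otherwise the normalised form would have limit 0.\<close>
 have \<kappa>2: "\<kappa>2 ~= 0"
 proof
  assume "\<kappa>2 = 0"
  have "Y i (pt b \<tau> s 0) = 0" if "i \<in> {1,2,3}" "reg b s" "\<tau> \<in> good b s" for i b s \<tau>
  proof -
   have "Y 1 (pt b \<tau> s 0) = 0" using lf(3)[OF that(2,3)] M[OF that(2)] \<open>\<kappa>2 = 0\<close> by simp
   then show ?thesis using that(1) lf(1,2)[OF that(2,3)] by auto
  qed
  from form_vanishes_imp[OF f' this] nz' show False by blast
 qed
 \<comment> \<open>\<open>lam\<close> collects the multiples subtracted so far, one power of the
   parameter at a time.\<close>
 have claim: "\<exists>lam G U. is_form G U & (\<forall>p. p $ 4 ~= 0 --> (\<forall>i\<in>{1,2,3}. Z i p = lam (p $ 4) * Y i p + p $ 4 ^ n * U i p))" for n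
 proof (induction n)
  case 0
  show ?case using g by (intro exI[of _ "%_. 0"] exI[of _ B] exI[of _ Z]) auto
 next
  case (Suc n)
  then obtain lam G U where G: "is_form G U" and U: "!!p i. p $ 4 ~= 0 ==> i \<in> {1,2,3} ==> Z i p = lam (p $ 4) * Y i p + p $ 4 ^ n * U i p"
   by blast
  interpret G: melnikov_form C R r h N s0 rho \<sigma> J D fa fb fe Q4 N0 N1 \<gamma> \<gamma>' c c' d T \<delta> G U by unfold_locales (rule G)
  obtain \<kappa> where lg: "!!b s \<tau>. reg b s ==> \<tau> \<in> good b s ==> U 2 (pt b \<tau> s 0) = 0"
   "!!b s \<tau>. reg b s ==> \<tau> \<in> good b s ==> U 3 (pt b \<tau> s 0) = 0"
   "!!b s \<tau>. reg b s ==> \<tau> \<in> good b s ==> U 1 (pt b \<tau> s 0) * melM (vector [b, s]) = \<kappa>" using G.leading_form by metis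
  define \<mu> where "\<mu> = \<kappa> / \<kappa>2"
  have "U i (pt b \<tau> s 0) - \<mu> * Y i (pt b \<tau> s 0) = 0" if bs: "i \<in> {1,2,3}" "reg b s" "\<tau> \<in> good b s" for i b s \<tau>
  proof -
   have "(U 1 (pt b \<tau> s 0) - \<mu> * Y 1 (pt b \<tau> s 0)) * melM (vector [b, s]) = \<kappa> - \<mu> * \<kappa>2"
    using lg(3)[OF bs(2,3)] lf(3)[OF bs(2,3)] by (simp add: left_diff_distrib mult.assoc)
   then have "U 1 (pt b \<tau> s 0) - \<mu> * Y 1 (pt b \<tau> s 0) = 0" using \<kappa>2 M[OF bs(2)] by (simp add: \<mu>_def)
   then show ?thesis using bs lg(1,2)[OF bs(2,3)] lf(1,2)[OF bs(2,3)] by auto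
  qed
  note van = this
  note fd = is_form_diff[OF G f', of \<mu>]
  have vz: "G i t p - \<mu> * A' i t p = 0" if "i \<in> {1,2,3}" "t \<in> C" "p \<in> bx t" "p $ 4 = 0" for i t p
   by (rule form_vanishes_imp[OF fd van that])
  obtain G' U' where G': "is_form G' U'" and U': "!!i p. i \<in> {1,2,3} ==> p \<in> dom4 | p $ 4 ~= 0 ==> U i p - \<mu> * Y i p = p $ 4 * U' i p"
   by (rule is_form_divide[OF fd], rule vz, assumption+) (rule that)
  show ?case
  proof (intro exI[of _ "%e. lam e + \<mu> * e ^ n"] exI[of _ G'] exI[of _ U'] conjI G' allI impI ballI)
   fix p :: "complex^4" and i :: 4 assume pi: "p $ 4 ~= 0" "i \<in> {1,2,3}"
   have "U i p = \<mu> * Y i p + p $ 4 * U' i p" using U'[OF pi(2), of p] pi(1) by (simp add: algebra_simps)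
   then show "Z i p = (lam (p $ 4) + \<mu> * p $ 4 ^ n) * Y i p + p $ 4 ^ Suc n * U' i p" using U[OF pi] by (simp add: algebra_simps)
  qed
 qed
 define w where "w q = A' i t q * B j t q - A' j t q * B i t q" for q
 have hol: "holo (A' i t) (bx t)" "holo (B i t) (bx t)" if "i \<in> {1,2,3}" for i
  using trepD(1)[OF is_form_trep[OF f' that] t] trepD(1)[OF is_form_trep[OF g that] t] by blast+
 have hw: "holo w (bx t)" unfolding w_def by (intro holo_diff holo_mult hol ij)
 have "A i t p * B j t p - A j t p * B i t p = p $ 4 ^ k * w p" using A'[OF ij(1) t p] A'[OF ij(2) t p] by (simp add: w_def algebra_simps)
 then have "w p ~= 0" using nz by auto
 have "(4::4) ~= 2" by simp
 obtain w' m where w': "holo w' (bx t)" "!!q. q \<in> bx t ==> w q = q $ 4 ^ m * w' q"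
  "\<exists>q\<in>bx t. q $ 4 = 0 & w' q ~= 0"
  by (rule holo_order1[OF hw coord_star_tbox[OF \<open>(4::4) ~= 2\<close>] convex_tbox p \<open>w p ~= 0\<close>]) (rule that)
 \<comment> \<open>One order more than the wedge product \<open>w\<close> can have.\<close>
 obtain lam G U where G: "is_form G U" and U: "!!p i. p $ 4 ~= 0 ==> i \<in> {1,2,3} ==> Z i p = lam (p $ 4) * Y i p + p $ 4 ^ (Suc m) * U i p"
  using claim[of "Suc m"] by blast
 have hG: "holo (G i t) (bx t)" if "i \<in> {1,2,3}" for i using trepD(1)[OF is_form_trep[OF G that] t] .
 define v where "v q = A' i t q * G j t q - A' j t q * G i t q" for q
 have hv: "holo v (bx t)" unfolding v_def by (intro holo_diff holo_mult hol hG ij)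
 have eq: "w' q - q $ 4 * v q = 0" if q: "q \<in> bx t" "q $ 4 ~= 0" "h t q ~= 0" for q
 proof -
  have b: "B i t q = lam (q $ 4) * A' i t q + q $ 4 ^ Suc m * G i t q" if i: "i \<in> {1,2,3}" for i
  proof -
   have "h t q * Z i q = B i t q" "h t q * Y i q = A' i t q" "h t q * U i q = G i t q"
    using is_form_trep[OF g i] is_form_trep[OF f' i] is_form_trep[OF G i] t q(1,3) unfolding trep_def by blast+
   moreover have "h t q * Z i q = lam (q $ 4) * (h t q * Y i q) + q $ 4 ^ Suc m * (h t q * U i q)" using U[OF q(2) i] by (simp add: algebra_simps)
   ultimately show ?thesis by simp
  qed
  have "w q = q $ 4 ^ Suc m * v q" unfolding w_def v_def b[OF ij(1)] b[OF ij(2)] by (simp add: algebra_simps)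
  then have "q $ 4 ^ m * (w' q - q $ 4 * v q) = 0" using w'(2)[OF q(1)] by (simp add: algebra_simps)
  then show ?thesis using q(2) by simp
 qed
 obtain q0 where q0: "q0 \<in> bx t" "q0 $ 4 ~= 0" "h t q0 ~= 0"
 proof -
  define fs where "fs b = (if b then h t else (%p. p $ 4))" for b
  have "\<exists>p\<in>bx t. \<forall>b\<in>UNIV. fs b p ~= 0"
  proof (rule holo_common_nonzero)
   show "holo (fs b) (bx t)" for b by (cases b) (auto simp: fs_def holo_h[OF t] intro: holo_nth)
   show "\<exists>p\<in>bx t. fs b p ~= 0" for b
   proof (cases b)
    case False
    have "pt 0 t 0 (of_real (r / 2)) \<in> bx t" using r_pos R_pos[OF t] by simp
    then show ?thesis using False r_pos by (intro bexI[of _ "pt 0 t 0 (of_real (r / 2))"]) (auto simp: fs_def)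
   qed (use h_nz[OF t] in \<open>auto simp: fs_def\<close>)
  qed (use p in \<open>auto intro: convex_connected\<close>)
  then obtain p where p: "p \<in> bx t" "!!b. fs b p ~= 0" by blast
  then show thesis using p(2)[of True] p(2)[of False] by (intro that[of p]) (auto simp: fs_def)
 qed
 define S where "S = {q \<in> bx t. h t q ~= 0} Int {q. q $ 4 ~= 0}"
 have opS: "open S" unfolding S_def by (intro open_Int open_dom4_part t open_Collect_neq continuous_intros)
 have hd: "holo (%q. w' q - q $ 4 * v q) (bx t)" by (intro holo_diff holo_mult holo_nth w'(1) hv open_tbox)
 have "w' q - q $ 4 * v q = 0" if q: "q \<in> bx t" for q by (rule holo_identity_convex[OF hd convex_tbox opS, of q0])
   (use q0 q eq in \<open>auto simp: S_def\<close>)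
 then show False using w'(3) by fastforce
qed

end

section \<open>From integrability to closed forms\<close>

lemma multi_analytic_on_sub: "multi_analytic_on f B ==> z \<in> B ==> multi_analytic_on f {z}" by (simp add: multi_analytic_on_def)

lemma multi_analytic_on_imp_holo:
 fixes f :: "complex^'n => complex"
 assumes "multi_analytic_on f B" "open B"
 shows "holo f B"
proof (rule holo_local[OF assms(2)])
 fix p assume p: "p \<in> B"
 obtain r where "r > 0" "holo f (ball p r)" using multi_analytic_imp_holo[OF multi_analytic_on_sub[OF assms(1) p]] by blast
 then show "\<exists>B. p \<in> B & holo f B" by (intro exI[of _ "ball p r"]) simp
qed

text \<open>By the identity theorem a smaller ball still contains a non-zero of the denominator; at
  such points the quotient is analytic in the power series sense.\<close>

lemma meromorphic_local:
 fixes f :: "complex^'n => complex"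
 assumes "multi_meromorphic_on f U" "a \<in> U"
 shows "\<exists>r>0. \<exists>A h. ball a r \<subseteq> U & holo A (ball a r) & holo h (ball a r) & (\<exists>z\<in>ball a r. h z ~= 0) &
  (\<forall>z\<in>ball a r. h z ~= 0 --> h z * f z = A z & multi_analytic_on f {z})"
proof -
 obtain B g h where *: "open B & connected B & a \<in> B & B \<subseteq> U &
    multi_analytic_on g B & multi_analytic_on h B & (\<exists>z\<in>B. h z ~= 0) &
    (\<forall>z\<in>B. h z ~= 0 --> f z = g z / h z)"
  using bspec[OF assms(1)[unfolded multi_meromorphic_on_def] assms(2)] by (elim exE) (rule that)
 have B: "open B" "connected B" "a \<in> B" "B \<subseteq> U" and gh: "multi_analytic_on g B" "multi_analytic_on h B"
  and nz: "\<exists>z\<in>B. h z ~= 0" using * by simp_all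
 have f: "f z = g z / h z" if "z \<in> B" "h z ~= 0" for z using * that by simp
 have hg: "holo g B" "holo h B" by (rule multi_analytic_on_imp_holo[OF gh(1) B(1)], rule multi_analytic_on_imp_holo[OF gh(2) B(1)])
 obtain r where r: "r > 0" "ball a r \<subseteq> B" using openE[OF B(1,3)] by blast
 have nz': "\<exists>z\<in>ball a r. h z ~= 0"
 proof (rule ccontr)
  assume *: "~ ?thesis"
  have **: "h z = 0" if "z \<in> B" for z by (rule holo_identity[OF hg(2) B(2) open_ball _ r(2) _ that, of a]) (use * r in simp_all)
  from nz obtain z where "z \<in> B" "h z ~= 0" by (elim bexE)
  then show False using ** by simp
 qed
 have op: "open (B Int h -` (- {0}))" by (rule continuous_open_preimage[OF holo_cont[OF hg(2)] B(1)]) (simp add: open_Compl)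
 have an: "multi_analytic_on f {z}" if z: "z \<in> ball a r" "h z ~= 0" for z
 proof -
  have zB: "z \<in> B" using z r by (simp add: subset_iff)
  have "multi_analytic_on (%z. g z / h z) {z}"
   by (rule multi_analytic_divide[OF multi_analytic_on_sub[OF gh(1) zB] multi_analytic_on_sub[OF gh(2) zB] z(2)])
  then show ?thesis by (rule multi_analytic_cong[OF _ op]) (use zB z f in simp_all)
 qed
 have "h z * f z = g z" if "z \<in> ball a r" "h z ~= 0" for z using f[of z] that r(2) by (simp add: subset_iff)
 then show ?thesis using r(1) subset_trans[OF r(2) B(4)] holo_subset[OF hg(1) open_ball r(2)] holo_subset[OF hg(2) open_ball r(2)] an nz'
  by (intro exI[of _ r] conjI exI[of _ g] exI[of _ h] ballI impI)
qed

text \<open>The product of the denominators serves all members of the family; it is non-zero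
  somewhere because two non-trivial holomorphic functions have a common non-zero in any
  ball.\<close>

lemma meromorphic_family_local:
 fixes f :: "'i => complex^'n => complex"
 assumes "finite I" "!!i. i \<in> I ==> multi_meromorphic_on (f i) U" "a \<in> U" "open U"
 shows "\<exists>r>0. \<exists>A h. ball a r \<subseteq> U & (\<forall>i\<in>I. holo (A i) (ball a r)) & holo h (ball a r) & (\<exists>z\<in>ball a r. h z ~= 0) &
  (\<forall>z\<in>ball a r. h z ~= 0 --> (\<forall>i\<in>I. h z * f i z = A i z & multi_analytic_on (f i) {z}))" using assms(1,2)
proof (induction I rule: finite_induct)
 case empty
 obtain r where "r > 0" "ball a r \<subseteq> U" using assms openE by blast
 then show ?case by (intro exI[of _ r] conjI exI[of _ "%_ _. 0"] exI[of _ "%_. 1"]) (use holo_const[OF open_ball] in \<open>auto intro!: exI[of _ a]\<close>)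
next
 case (insert j I)
 obtain r A h where r: "r > 0" and *: "ball a r \<subseteq> U & (\<forall>i\<in>I. holo (A i) (ball a r)) & holo h (ball a r) & (\<exists>z\<in>ball a r. h z ~= 0) &
  (\<forall>z\<in>ball a r. h z ~= 0 --> (\<forall>i\<in>I. h z * f i z = A i z & multi_analytic_on (f i) {z}))"
  using insert.IH[OF insert.prems[OF insertI2], simplified] by (elim exE conjE) (rule that, assumption, intro conjI)
 have r': "ball a r \<subseteq> U" and A: "!!i. i \<in> I ==> holo (A i) (ball a r)" "holo h (ball a r)"
  "\<exists>z\<in>ball a r. h z ~= 0" using * by simp_all
 have f: "h z * f i z = A i z & multi_analytic_on (f i) {z}" if "z \<in> ball a r" "h z ~= 0" "i \<in> I" for z i using * that by simp
 obtain s B k where s: "s > 0" and **: "ball a s \<subseteq> U & holo B (ball a s) & holo k (ball a s) & (\<exists>z\<in>ball a s. k z ~= 0) &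
  (\<forall>z\<in>ball a s. k z ~= 0 --> k z * f j z = B z & multi_analytic_on (f j) {z})"
  using meromorphic_local[OF insert.prems[OF insertI1] assms(3)] by (elim exE conjE) (rule that, assumption, intro conjI)
 have s': "ball a s \<subseteq> U" and B: "holo B (ball a s)" "holo k (ball a s)" "\<exists>z\<in>ball a s. k z ~= 0" using ** by simp_all
 have g: "k z * f j z = B z & multi_analytic_on (f j) {z}" if "z \<in> ball a s" "k z ~= 0" for z using ** that by simp
 define m where "m = min r s"
 have m: "m > 0" "ball a m \<subseteq> ball a r" "ball a m \<subseteq> ball a s" using r s by (auto simp: m_def)
 define fs where "fs b = (if b then h else k)" for b
 have "\<exists>p\<in>ball a m. \<forall>b\<in>UNIV. fs b p ~= 0"
 proof (rule holo_common_nonzero)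
  show hol: "holo (fs b) (ball a m)" for b using holo_subset[OF A(2) open_ball m(2)] holo_subset[OF B(2) open_ball m(3)] by (simp add: fs_def)
  show "\<exists>p\<in>ball a m. fs b p ~= 0" for b
  proof (rule ccontr)
   assume *: "~ ?thesis"
   define t where "t = (if b then r else s)"
   have hb: "holo (fs b) (ball a t)" using A B by (auto simp: fs_def t_def)
   have "fs b z = 0" if "z \<in> ball a t" for z
    by (rule holo_identity_convex[OF hb convex_ball, where B = "ball a m" and b = a]) (use that * m r s in \<open>auto simp: t_def m_def\<close>)
   then show False using A(3) B(3) by (cases b) (auto simp: fs_def t_def)
  qed
 qed (use m in auto)
 then obtain p where p: "p \<in> ball a m" "h p ~= 0" "k p ~= 0" by (metis UNIV_I fs_def)
 have hm: "holo h (ball a m)" and km: "holo k (ball a m)" and bm: "holo B (ball a m)"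
  using holo_subset[OF A(2) open_ball m(2)] holo_subset[OF B(2) open_ball m(3)] holo_subset[OF B(1) open_ball m(3)] by auto
 have am: "holo (A i) (ball a m)" if "i \<in> I" for i by (rule holo_subset[OF A(1)[OF that] open_ball m(2)])
 show ?case
 proof (intro exI[of _ m] conjI exI[of _ "%i z. if i = j then h z * B z else k z * A i z"] exI[of _ "%z. h z * k z"] ballI impI)
  show "holo (%z. if i = j then h z * B z else k z * A i z) (ball a m)" if "i \<in> insert j I" for i
  proof (cases "i = j")
   case True
   then show ?thesis using holo_mult[OF hm bm] by simp
  next
   case False
   then show ?thesis using that holo_mult[OF km am] by simp
  qed
  show "holo (%z. h z * k z) (ball a m)" by (rule holo_mult[OF hm km])
  show "\<exists>z\<in>ball a m. h z * k z ~= 0" using p by auto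
  show "h z * k z * f i z = (if i = j then h z * B z else k z * A i z)" "multi_analytic_on (f i) {z}"
   if "z \<in> ball a m" "h z * k z ~= 0" "i \<in> insert j I" for z i using that f[of z i] g[of z] m by (auto simp: mult_ac)
 qed (use m r' in auto)
qed

section \<open>Vector algebra in three dimensions and the dual coframe\<close>

definition crs :: "complex^3 => complex^3 => complex^3" where
 "crs a b = vector [a $ 2 * b $ 3 - a $ 3 * b $ 2, a $ 3 * b $ 1 - a $ 1 * b $ 3, a $ 1 * b $ 2 - a $ 2 * b $ 1]"

definition d3 :: "complex^3 => complex^3 => complex^3 => complex" where
 "d3 a b c = bdot a (crs b c)"

lemma bdot3: "bdot (a::complex^3) b = a $ 1 * b $ 1 + a $ 2 * b $ 2 + a $ 3 * (b $ 3 :: complex)" by (simp add: bdot_def sum_3)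

lemma crs_nth: "crs a b $ 1 = a $ 2 * b $ 3 - a $ 3 * b $ 2" "crs a b $ 2 = a $ 3 * b $ 1 - a $ 1 * b $ 3"
 "crs a b $ 3 = a $ 1 * b $ 2 - a $ 2 * b $ 1" by (simp_all add: crs_def)

text \<open>Cramer's rule without division: if the determinant is not 0, a vector orthogonal to the
  three cross products is 0.\<close>

lemma crs_expansion:
 "d3 a b c *s v = bdot v (crs b c) *s a + bdot v (crs c a) *s b + bdot v (crs a b) *s c"
 by (simp add: vec_eq_iff forall_3 d3_def bdot3 crs_nth algebra_simps)

lemma lin_indep_imp_d3:
 assumes "lin_indep_family 3 v"
 shows "d3 (v 0) (v 1) (v 2) ~= 0"
proof
 assume z: "d3 (v 0) (v 1) (v 2) = 0"
 define M :: "complex^3^3" where "M = (\<chi> i j. v (if j = 1 then 0 else if j = 2 then 1 else 2) $ i)"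
 have "det M = d3 (v 0) (v 1) (v 2)" by (simp add: det_3 M_def d3_def bdot3 crs_nth algebra_simps)
 then have "~ invertible M" using z by (simp add: invertible_det_nz)
 then have "~ (\<forall>x. M *v x = 0 --> x = 0)" using invertible_left_inverse matrix_left_invertible_ker by blast
 then obtain x where x: "M *v x = 0" "x ~= 0" by blast
 define c where "c j = (if j = 0 then x $ 1 else if j = 1 then x $ 2 else x $ 3)" for j :: nat
 have "(\<Sum>j<3. c j *s v j) = M *v x" by (simp add: vec_eq_iff matrix_vector_mult_def M_def sum_3 c_def numeral_3_eq_3 numeral_2_eq_2 mult_ac)
 then have "\<forall>j<3. c j = 0" using assms x(1) unfolding lin_indep_family_def by metis
 then have "c 0 = 0" "c 1 = 0" "c 2 = 0" by auto
 then have "x = 0" by (simp add: c_def vec_eq_iff forall_3)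
 then show False using x by simp
qed

lemma not_negligible_point:
 fixes B :: "'a::euclidean_space set"
 assumes "negligible {p\<in>U. ~ Q p}" "open B" "B ~= {}" "B \<subseteq> U"
 shows "\<exists>z\<in>B. Q z"
proof (rule ccontr)
 assume "~ ?thesis"
 then have "B \<subseteq> {p\<in>U. ~ Q p}" using assms by auto
 then have "negligible B" using assms(1) negligible_subset by blast
 then show False using open_not_negligible assms by blast
qed

definition form_good :: "(complex^(3 option)) set => (complex^(3 option) => complex^3) =>
  (complex^(3 option) => complex^3) => complex^(3 option) => bool" where
 "form_good E f \<omega> z \<longleftrightarrow> (\<forall>k. \<exists>G. has_cgrad (%p. \<omega> p $ k) G z) &
  (\<forall>k l. pd (%p. \<omega> p $ k) (Some l) z = pd (%p. \<omega> p $ l) (Some k) z) &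
  (z \<in> E --> bdot (\<omega> z) (f z) = 0)"

lemma has_cgrad_quotient:
 assumes "holo A B" "holo h B" "z \<in> B" "h z ~= 0" and "!!w. w \<in> B ==> h w ~= 0 ==> h w * f w = A w"
 shows "\<exists>G. has_cgrad f G z"
proof -
 let ?B = "B Int h -` (- {0})"
 have op: "open ?B" using assms holo_open by (intro continuous_open_preimage holo_cont) auto
 have "holo (%w. A w / h w) ?B" by (rule holo_divide[OF holo_subset[OF assms(1) op] holo_subset[OF assms(2) op]]) auto
 then have "holo f ?B" by (rule holo_cong) (use assms(5) in \<open>auto simp: field_simps\<close>)
 then show ?thesis using assms(3,4) by (auto simp: holo_def)
qed

lemma partial_deriv_at:
 assumes "\<exists>G. has_cgrad f G z"
 shows "((%s. f (z + axis i s)) has_field_derivative pd f i z) (at 0)"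
proof -
 obtain G where "has_cgrad f G z" using assms by (elim exE) (rule that)
 from has_cgrad_partial[OF this, of i] show ?thesis unfolding partial_deriv_def using DERIV_imp_deriv by (metis (no_types))
qed

text \<open>Cartan's formula: on two of the fields, the exterior derivative of
  \<open>\<omega>\<close> consists of derivatives of the constants obtained by pairing
  \<open>\<omega>\<close> with the fields and of \<open>\<omega>\<close> applied to their bracket,
  all zero. Three independent fields leave no component of it.\<close>

lemma coframe_closed:
 fixes g :: "nat => complex^(3 option) => complex^3"
 assumes dg: "!!j k. \<exists>G. has_cgrad (%p. g j p $ k) G z"
  and d\<omega>: "!!k. \<exists>G. has_cgrad (%p. \<omega> p $ k) G z"
  and const: "!!j. j < 3 ==> \<exists>c. \<forall>\<^sub>F p in nhds z. bdot (\<omega> p) (g j p) = c"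
  and br: "!!i j. i < 3 ==> j < 3 ==> state_bracket (g i) (g j) z = 0"
  and nz: "d3 (g 0 z) (g 1 z) (g 2 z) ~= 0" shows "pd (%p. \<omega> p $ k) (Some l) z = pd (%p. \<omega> p $ l) (Some k) z"
proof -
 define a where "a l i = pd (%p. \<omega> p $ i) (Some l) z" for l i :: 3
 define b where "b j l i = pd (%p. g j p $ i) (Some l) z" for j and l i :: 3
 have rel: "(\<Sum>i\<in>UNIV. a l i * g j z $ i + \<omega> z $ i * b j l i) = 0" if j: "j < 3" for j l
 proof -
  obtain c where c: "\<forall>\<^sub>F p in nhds z. bdot (\<omega> p) (g j p) = c" using const[OF j] by (elim exE) (rule that)
  have D: "((%s. \<omega> (z + axis (Some l) s) $ i) has_field_derivative a l i) (at 0)"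
   "((%s. g j (z + axis (Some l) s) $ i) has_field_derivative b j l i) (at 0)" for i
   unfolding a_def b_def using partial_deriv_at[OF d\<omega>[of i]] partial_deriv_at[OF dg[of j i]] by simp_all
  have "((%s. \<Sum>i\<in>UNIV. \<omega> (z + axis (Some l) s) $ i * g j (z + axis (Some l) s) $ i) has_field_derivative
    (\<Sum>i\<in>UNIV. a l i * g j z $ i + b j l i * \<omega> z $ i)) (at 0)" by (rule DERIV_sum) (use DERIV_mult[OF D] in simp)
  then have 1: "((%s. bdot (\<omega> (z + axis (Some l) s)) (g j (z + axis (Some l) s))) has_field_derivative
    (\<Sum>i\<in>UNIV. a l i * g j z $ i + b j l i * \<omega> z $ i)) (at 0)" by (simp add: bdot_def)
  have lim: "((%s. z + axis (Some l) (s - 0)) \<longlongrightarrow> z + axis (Some l) (0 - 0)) (nhds (0::complex))"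
   using continuous_axis_shift[where p = z and i = "Some l" and c = 0 and ?z0.0 = 0]
    tendsto_at_iff_tendsto_nhds[of "%s. z + axis (Some l) (s - 0)" "0::complex"] unfolding isCont_def by (rule iffD1[rotated])
  then have "filterlim (%s. z + axis (Some l) s) (nhds z) (nhds (0::complex))" by simp
  then have "\<forall>\<^sub>F s in nhds (0::complex). bdot (\<omega> (z + axis (Some l) s)) (g j (z + axis (Some l) s)) = c"
   by (rule eventually_compose_filterlim[OF c])
  then have "deriv (%s. bdot (\<omega> (z + axis (Some l) s)) (g j (z + axis (Some l) s))) 0 = deriv (%s. c) (0::complex)"
   by (intro deriv_cong_ev) auto
  then show ?thesis using DERIV_imp_deriv[OF 1] by (simp add: mult.commute)
 qed
 have key: "(\<Sum>l\<in>UNIV. \<Sum>i\<in>UNIV. (a l i - a i l) * g j z $ l * g m z $ i) = 0" if jm: "j < 3" "m < 3" for j m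
 proof -
  have r1: "(\<Sum>l\<in>UNIV. g j z $ l * (\<Sum>i\<in>UNIV. a l i * g m z $ i + \<omega> z $ i * b m l i)) = 0" using rel[OF jm(2)] by simp
  have r2: "(\<Sum>l\<in>UNIV. g m z $ l * (\<Sum>i\<in>UNIV. a l i * g j z $ i + \<omega> z $ i * b j l i)) = 0" using rel[OF jm(1)] by simp
  have "(\<Sum>l\<in>UNIV. b m l i * g j z $ l) - (\<Sum>l\<in>UNIV. b j l i * g m z $ l) = 0" for i
  proof -
   have "state_bracket (g j) (g m) z $ i = 0" using br[OF jm] by simp
   then show ?thesis by (simp add: state_bracket_def state_grad_def bdot_def b_def)
  qed
  then have r3: "(\<Sum>i\<in>UNIV. \<omega> z $ i * ((\<Sum>l\<in>UNIV. b m l i * g j z $ l) - (\<Sum>l\<in>UNIV. b j l i * g m z $ l))) = 0" by simp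
  have "(\<Sum>l\<in>UNIV. \<Sum>i\<in>UNIV. (a l i - a i l) * g j z $ l * g m z $ i) =
    (\<Sum>l\<in>UNIV. g j z $ l * (\<Sum>i\<in>UNIV. a l i * g m z $ i + \<omega> z $ i * b m l i)) -
    (\<Sum>l\<in>UNIV. g m z $ l * (\<Sum>i\<in>UNIV. a l i * g j z $ i + \<omega> z $ i * b j l i)) -
    (\<Sum>i\<in>UNIV. \<omega> z $ i * ((\<Sum>l\<in>UNIV. b m l i * g j z $ l) - (\<Sum>l\<in>UNIV. b j l i * g m z $ l)))"
   unfolding sum_3 by (simp only: algebra_simps)
  then show ?thesis unfolding r1 r2 r3 by simp
 qed
 \<comment> \<open>The curl of \<open>\<omega>\<close>; its product with
   \<open>crs (g j z) (g m z)\<close> is the exterior derivative on the two fields.\<close>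
 define v :: "complex^3" where "v = vector [a 2 3 - a 3 2, a 3 1 - a 1 3, a 1 2 - a 2 1]"
 have "bdot v (crs (g j z) (g m z)) = 0" if "j < 3" "m < 3" for j m
  using key[OF that] unfolding sum_3 by (simp add: v_def bdot3 crs_nth algebra_simps)
 then have "d3 (g 0 z) (g 1 z) (g 2 z) *s v = 0" unfolding crs_expansion by simp
 then have "v = 0" using nz by (simp add: vector_mul_eq_0)
 then have "a 2 3 = a 3 2" "a 3 1 = a 1 3" "a 1 2 = a 2 1" by (simp_all add: v_def vec_eq_iff forall_3)
 then have "\<forall>k l. a l k = a k l" unfolding forall_3 by simp
 then show ?thesis unfolding a_def by blast
qed

lemma crs_scale: "crs (x *s a) (y *s b) = (x * y) *s crs a b" by (simp add: vec_eq_iff forall_3 crs_nth algebra_simps)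

lemma d3_scale: "d3 (x *s a) (x *s b) (x *s c) = x ^ 3 * d3 a b c" by (simp add: d3_def bdot3 crs_nth power3_eq_cube algebra_simps)

lemma crs_crs: "crs (crs c a) (crs a b) = d3 a b c *s a" by (simp add: vec_eq_iff forall_3 d3_def bdot3 crs_nth algebra_simps)

lemma bdot_crs_self: "bdot a (crs a b) = 0" "bdot b (crs a b) = 0" "bdot (crs a b) a = 0" "bdot (crs a b) b = 0"
 by (simp_all add: bdot3 crs_nth algebra_simps)

lemma d3_rot: "bdot (crs c a) b = d3 a b c" by (simp add: d3_def bdot3 crs_nth algebra_simps)

lemma d3_cyclic: "d3 b c a = d3 a b c" by (simp add: d3_def bdot3 crs_nth algebra_simps)

lemma d3_same: "d3 a a b = 0" "d3 a b a = 0" "d3 a b b = 0" by (simp_all add: d3_def bdot3 crs_nth algebra_simps)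

lemma crs_0 [simp]: "crs 0 a = 0" "crs a 0 = 0" by (simp_all add: vec_eq_iff forall_3 crs_nth)

lemma holo_crs:
 assumes "!!k. holo (%z. a z $ k) S" "!!k. holo (%z. b z $ k) S"
 shows "holo (%z. crs (a z) (b z) $ k) S"
proof -
 have "\<forall>k. holo (%z. crs (a z) (b z) $ k) S"
  unfolding forall_3 crs_nth using holo_diff[OF holo_mult[OF assms(1) assms(2)] holo_mult[OF assms(1) assms(2)]] by simp
 then show ?thesis by simp
qed

lemma holo_d3:
 assumes "!!k. holo (%z. a z $ k) S" "!!k. holo (%z. b z $ k) S" "!!k. holo (%z. c z $ k) S"
 shows "holo (%z. d3 (a z) (b z) (c z)) S" unfolding d3_def bdot3
 using holo_add[OF holo_add[OF holo_mult[OF assms(1)[of 1] holo_crs[OF assms(2,3)]] holo_mult[OF assms(1)[of 2] holo_crs[OF assms(2,3)]]]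
   holo_mult[OF assms(1)[of 3] holo_crs[OF assms(2,3)]]] by simp

lemma partial_deriv_periodic:
 fixes F :: "complex^'n => complex"
 assumes "open U" "p \<in> U" "!!p. p \<in> U ==> F (p + w) = F p"
 shows "pd F i (p + w) = pd F i p"
proof -
 have "pd F i (p + w) = pd (%p. F (p + w)) i p" by (simp add: partial_deriv_def add.assoc add.commute[of w])
 also have "\<dots> = pd F i p" by (rule partial_deriv_cong[OF assms(1,2)]) (use assms(3) in simp)
 finally show ?thesis .
qed

lemma holo_nonvanishing_set:
 assumes "holo h B"
 shows "open (B Int h -` (- {0}))" using continuous_open_preimage[OF holo_cont[OF assms] holo_open[OF assms], of "- {0}"] by (simp add: open_Compl)

definition frame_local :: "bool => (complex^(3 option)) set => (complex^(3 option) => complex^3) =>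
  (nat => complex^(3 option) => complex^3) => complex^(3 option) => bool" where
 "frame_local ex E f W z \<longleftrightarrow> (\<forall>j k. \<exists>G. has_cgrad (%p. W j p $ k) G z) & form_good E f (W 1) z & form_good E f (W 2) z &
   (ex --> W 1 z = state_grad (%p. W 3 p $ 1) z)"

text \<open>\<open>W 0\<close> is the continued vector field, \<open>W 1\<close> and \<open>W 2\<close> are closed 1-forms annihilating it; if \<open>ex\<close>, then \<open>W 1\<close> is the differential of the components of \<open>W 3\<close>, otherwise \<open>W 1\<close>, \<open>W 2\<close> are the dual coframe of three commuting fields.\<close>
definition frame_pack :: "bool => complex^3 => (complex^(3 option)) set => (complex^(3 option) => complex^3) =>
  (complex^(3 option)) set => (nat => complex^(3 option) => complex^3) => bool" where
 "frame_pack ex w E f U W \<longleftrightarrow> open U & (\<forall>p. p + with_param w 0 \<in> U \<longleftrightarrow> p \<in> U) &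
  (\<forall>j. \<forall>p\<in>U. W j (p + with_param w 0) = W j p) & (\<forall>p\<in>U Int E. W 0 p = f p) &
  (\<forall>a\<in>U. \<exists>r>0. \<exists>A h. ball a r \<subseteq> U & (\<forall>j k. holo (%z. A j z $ k) (ball a r)) & holo h (ball a r) &
    (\<exists>z\<in>ball a r. h z ~= 0) &
    (\<forall>z\<in>ball a r. h z ~= 0 --> (\<forall>j. h z *s W j z = A j z) & frame_local ex E f W z)) &
  (\<forall>B. open B & B ~= {} & B \<subseteq> U --> (\<exists>z\<in>B. if ex then W 1 z ~= 0 else crs (W 1 z) (W 2 z) ~= 0))"

text \<open>The gradient of a first integral serves as both \<open>W 1\<close> and
  \<open>W 2\<close>; \<open>W 3\<close> stores the integral itself in every component.\<close>

lemma frame_pack_exact: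
 assumes U: "open U" and per: "!!p. p + with_param w 0 \<in> U \<longleftrightarrow> p \<in> U"
  and g: "!!i. multi_meromorphic_on (%p. g p $ i) U" "!!p. p \<in> U ==> g (p + with_param w 0) = g p"
  and F: "multi_meromorphic_on F U" "!!p. p \<in> U ==> F (p + with_param w 0) = F p"
  and gf: "!!p. p \<in> U ==> p \<in> E ==> g p = f p"
  and neg: "negligible {p\<in>U. ~ state_grad F p ~= 0}"
  and ann: "!!p. p \<in> U ==> field_analytic_at g p ==> multi_analytic_on F {p} ==> bdot (state_grad F p) (g p) = 0"
 shows "frame_pack True w E f U (%j. if j = 0 then g else if j = 1 | j = 2 then state_grad F else (%p. \<chi> i. F p))"
  (is "frame_pack True w E f U ?W") unfolding frame_pack_def
proof (intro conjI ballI allI impI)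
 show "open U" "!!p. p + with_param w 0 \<in> U \<longleftrightarrow> p \<in> U" by fact+
 show "?W j (p + with_param w 0) = ?W j p" if p: "p \<in> U" for j p
 proof -
  have "state_grad F (p + with_param w 0) = state_grad F p"
   unfolding state_grad_def using partial_deriv_periodic[of U p F "with_param w 0", OF U p F(2)] by simp
  then show ?thesis using g(2)[OF p] F(2)[OF p] by simp
 qed
 show "?W 0 p = f p" if "p \<in> U Int E" for p using gf that by simp
 show "\<exists>z\<in>B. if True then ?W 1 z ~= 0 else crs (?W 1 z) (?W 2 z) ~= 0" if "open B & B ~= {} & B \<subseteq> U" for B
  using not_negligible_point[OF neg] that by simp
next
 fix a assume a: "a \<in> U"
 define fam where "fam k = (case k of None => F | Some i => (%p. g p $ i))" for k :: "3 option"
 have fam: "multi_meromorphic_on (fam k) U" for k using g(1) F(1) by (cases k) (simp_all add: fam_def)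
 obtain r A h where r: "r > 0" and *: "ball a r \<subseteq> U & (\<forall>i\<in>UNIV. holo (A i) (ball a r)) & holo h (ball a r) & (\<exists>z\<in>ball a r. h z ~= 0) &
  (\<forall>z\<in>ball a r. h z ~= 0 --> (\<forall>i\<in>UNIV. h z * fam i z = A i z & multi_analytic_on (fam i) {z}))"
  using meromorphic_family_local[where f = fam and I = UNIV, OF finite fam a U] by (elim exE conjE) (rule that, assumption, intro conjI)
 have rU: "ball a r \<subseteq> U" and A: "!!i. holo (A i) (ball a r)" and h: "holo h (ball a r)" "\<exists>z\<in>ball a r. h z ~= 0"
  using * by simp_all
 have eq: "h z * fam i z = A i z" and an: "multi_analytic_on (fam i) {z}" if "z \<in> ball a r" "h z ~= 0" for z i using * that by simp_all
 let ?N = "ball a r Int h -` (- {0})"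
 have N: "open ?N" by (rule holo_nonvanishing_set[OF h(1)])
 have hN: "holo h ?N" by (rule holo_subset[OF h(1) N]) simp
 have AN: "holo (A i) ?N" for i by (rule holo_subset[OF A N]) simp
 have FN: "holo F ?N"
 proof (rule holo_cong[OF holo_divide[OF AN[of None] hN]])
  fix p assume "p \<in> ?N"
  then show "A None p / h p = F p" using eq[of p None] by (auto simp: fam_def field_simps)
 qed simp
 \<comment> \<open>The numerator of the derivative of the quotient \<open>A None / h\<close>, over
   the denominator \<open>h * h\<close>.\<close>
 define Bv where "Bv k z = pd (A None) (Some k) z * h z - A None z * pd h (Some k) z" for k z
 have hB: "holo (Bv k) (ball a r)" for k unfolding Bv_def
  by (rule holo_diff[OF holo_mult[OF holo_partial_deriv[OF A] h(1)] holo_mult[OF A holo_partial_deriv[OF h(1)]]])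
 have BF: "h z * h z * pd F (Some k) z = Bv k z" if z: "z \<in> ?N" for k z
 proof -
  have d: "((%s. F (z + axis (Some k) s)) has_field_derivative pd F (Some k) z) (at 0)"
    "((%s. h (z + axis (Some k) s)) has_field_derivative pd h (Some k) z) (at 0)"
   using holo_slice_deriv[OF FN, of z "Some k" 0] holo_slice_deriv[OF hN, of z "Some k" 0] z by simp_all
  have "pd (A None) (Some k) z = pd (%p. h p * F p) (Some k) z"
   by (rule partial_deriv_cong[OF N z]) (use eq[of _ None] in \<open>auto simp: fam_def\<close>)
  also have "\<dots> = h z * pd F (Some k) z + pd h (Some k) z * F z"
   using DERIV_imp_deriv[OF DERIV_mult[OF d(2,1)]] by (simp add: partial_deriv_def[of "%p. h p * F p"])
  finally have "Bv k z = (h z * pd F (Some k) z + pd h (Some k) z * F z) * h z - (h z * F z) * pd h (Some k) z"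
   using eq[of z None] z by (simp add: Bv_def fam_def)
  then show ?thesis by (simp add: algebra_simps)
 qed
 define A' where "A' j z = (if j = 0 then (\<chi> i. h z * A (Some i) z) else if j = 1 | j = 2 then (\<chi> i. Bv i z) else (\<chi> i. h z * A None z))"
  for j :: nat and z
 have hA': "holo (%z. A' j z $ k) (ball a r)" for j k
  unfolding A'_def using holo_mult[OF h(1) A] hB by (cases "j = 0"; cases "j = 1"; cases "j = 2"; simp)
 have main: "(h z * h z) *s ?W j z = A' j z" if z: "z \<in> ?N" for j z using eq[of z None] eq[of z "Some _"] BF[OF z] z unfolding A'_def
  by (simp add: vec_eq_iff fam_def state_grad_def)
 have loc: "frame_local True E f ?W z" if z: "z \<in> ?N" for z
 proof -
  have cg: "\<exists>G. has_cgrad (%p. ?W j p $ k) G z" for j k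
  proof (rule has_cgrad_quotient[OF hA' holo_mult[OF h(1) h(1)]])
   show "z \<in> ball a r" "h z * h z ~= 0" using z by auto
   show "h w * h w * ?W j w $ k = A' j w $ k" if "w \<in> ball a r" "h w * h w ~= 0" for w using main[of w j] that by (auto simp: vec_eq_iff)
  qed
  have fg: "form_good E f (state_grad F) z" unfolding form_good_def
  proof (intro conjI allI impI)
   show "\<exists>G. has_cgrad (%p. state_grad F p $ k) G z" for k using cg[of 1 k] by simp
   show "pd (%p. state_grad F p $ k) (Some l) z = pd (%p. state_grad F p $ l) (Some k) z" for k l
    unfolding state_grad_def using partial_deriv_commute[OF FN z] by simp
   assume "z \<in> E"
   moreover have "field_analytic_at g z" unfolding field_analytic_at_def
   proof
    fix i show "multi_analytic_on (%p. g p $ i) {z}" using an[of z "Some i"] z by (simp add: fam_def)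
   qed
   moreover have "multi_analytic_on F {z}" using an[of z None] z by (simp add: fam_def)
   ultimately show "bdot (state_grad F z) (f z) = 0" using ann[of z] gf[of z] z rU by auto
  qed
  show ?thesis unfolding frame_local_def using cg fg by simp
 qed
 have "\<forall>z\<in>ball a r. h z * h z ~= 0 --> (\<forall>j. (h z * h z) *s ?W j z = A' j z) & frame_local True E f ?W z" using main loc by auto
 moreover have "\<exists>z\<in>ball a r. h z * h z ~= 0" using h(2) by auto
 ultimately show "\<exists>r>0. \<exists>A h. ball a r \<subseteq> U & (\<forall>j k. holo (%z. A j z $ k) (ball a r)) & holo h (ball a r) &
    (\<exists>z\<in>ball a r. h z ~= 0) &
    (\<forall>z\<in>ball a r. h z ~= 0 --> (\<forall>j. h z *s ?W j z = A j z) & frame_local True E f ?W z)"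
  using r rU hA' holo_mult[OF h(1) h(1)] by (intro exI[of _ r] conjI exI[of _ A'] exI[of _ "%z. h z * h z"]) simp_all
qed

text \<open>By Cramer's rule \<open>W 1\<close> and \<open>W 2\<close> are the covectors belonging
  to \<open>g 1\<close> and \<open>g 2\<close> in the coframe dual to the three fields. Both
  annihilate \<open>g 0\<close>, they are closed because the fields commute, and their cross product
  is \<open>g 0\<close> divided by the determinant.\<close>

lemma frame_pack_coframe:
 fixes g :: "nat => complex^(3 option) => complex^3"
 assumes U: "open U" and per: "!!p. p + with_param w 0 \<in> U \<longleftrightarrow> p \<in> U"
  and g: "!!j i. j < 3 ==> multi_meromorphic_on (%p. g j p $ i) U" "!!j p. j < 3 ==> p \<in> U ==> g j (p + with_param w 0) = g j p"
  and gf: "!!p. p \<in> U ==> p \<in> E ==> g 0 p = f p"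
  and neg: "negligible {p\<in>U. ~ lin_indep_family 3 (%j. g j p)}"
  and br: "!!j k p. j < 3 ==> k < 3 ==> p \<in> U ==> field_analytic_at (g j) p ==> field_analytic_at (g k) p ==> state_bracket (g j) (g k) p = 0"
 shows "frame_pack False w E f U (%j. if j = 0 then g 0 else if j = 1 then (%p. (1 / d3 (g 0 p) (g 1 p) (g 2 p)) *s crs (g 2 p) (g 0 p))
  else if j = 2 then (%p. (1 / d3 (g 0 p) (g 1 p) (g 2 p)) *s crs (g 0 p) (g 1 p)) else (%p. 0))"
  (is "frame_pack False w E f U ?W") unfolding frame_pack_def
proof (intro conjI ballI allI impI)
 show "open U" "!!p. p + with_param w 0 \<in> U \<longleftrightarrow> p \<in> U" by fact+
 show "?W j (p + with_param w 0) = ?W j p" if p: "p \<in> U" for j p using g(2)[OF _ p, of 0] g(2)[OF _ p, of 1] g(2)[OF _ p, of 2] by simp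
 show "?W 0 p = f p" if "p \<in> U Int E" for p using gf that by simp
 show "\<exists>z\<in>B. if False then ?W 1 z ~= 0 else crs (?W 1 z) (?W 2 z) ~= 0" if B: "open B & B ~= {} & B \<subseteq> U" for B
 proof -
  obtain z where z: "z \<in> B" "lin_indep_family 3 (%j. g j z)" using not_negligible_point[OF neg, of B] B by blast
  have d: "d3 (g 0 z) (g 1 z) (g 2 z) ~= 0" by (rule lin_indep_imp_d3[OF z(2)])
  then have "g 0 z ~= 0" by (auto simp: d3_def bdot3)
  then have "crs (?W 1 z) (?W 2 z) ~= 0" using d by (simp add: crs_scale crs_crs vector_mul_eq_0)
  then show ?thesis using z(1) by auto
 qed
next
 fix a assume a: "a \<in> U"
 define fam where "fam k = (%p. g (if fst k < 3 then fst k else 0) p $ snd k)" for k :: "nat \<times> 3"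
 have fam: "multi_meromorphic_on (fam k) U" for k using g(1) by (simp add: fam_def)
 have fin: "finite ({..<3::nat} \<times> (UNIV::3 set))" by simp
 obtain r A0 h where r: "r > 0" and *: "ball a r \<subseteq> U & (\<forall>i\<in>{..<3} \<times> UNIV. holo (A0 i) (ball a r)) & holo h (ball a r) & (\<exists>z\<in>ball a r. h z ~= 0) &
  (\<forall>z\<in>ball a r. h z ~= 0 --> (\<forall>i\<in>{..<3} \<times> UNIV. h z * fam i z = A0 i z & multi_analytic_on (fam i) {z}))"
  using meromorphic_family_local[where f = fam, OF fin fam a U] by (elim exE conjE) (rule that, assumption, intro conjI)
 define A where "A j z = (\<chi> k. A0 (j, k) z)" for j z
 have rU: "ball a r \<subseteq> U" and A: "!!j k. j < 3 ==> holo (%z. A j z $ k) (ball a r)" and h: "holo h (ball a r)" "\<exists>z\<in>ball a r. h z ~= 0"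
  using * by (simp_all add: A_def)
 have A012: "holo (%z. A 0 z $ k) (ball a r)" "holo (%z. A 1 z $ k) (ball a r)" "holo (%z. A 2 z $ k) (ball a r)" for k using A by simp_all
 have eq: "h z *s g j z = A j z" and an: "field_analytic_at (g j) z" if "z \<in> ball a r" "h z ~= 0" "j < 3" for z j
  using * that by (simp_all add: vec_eq_iff A_def fam_def field_analytic_at_def)
 define D where "D z = d3 (A 0 z) (A 1 z) (A 2 z)" for z
 have hD: "holo D (ball a r)" unfolding D_def by (rule holo_d3[OF A012])
 have Deq: "D z = h z ^ 3 * d3 (g 0 z) (g 1 z) (g 2 z)" if "z \<in> ball a r" "h z ~= 0" for z
  unfolding D_def using eq[OF that, symmetric] by (simp add: d3_scale)
 define h' where "h' z = h z * D z" for z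
 have hh': "holo h' (ball a r)" unfolding h'_def by (rule holo_mult[OF h(1) hD])
 have nz: "\<exists>z\<in>ball a r. h' z ~= 0"
 proof -
  let ?N = "ball a r Int h -` (- {0})"
  have "open ?N" by (rule holo_nonvanishing_set[OF h(1)])
  moreover have "?N ~= {}" "?N \<subseteq> U" using h(2) rU by auto
  ultimately obtain z where z: "z \<in> ?N" "lin_indep_family 3 (%j. g j z)" using not_negligible_point[OF neg] by blast
  then show ?thesis using lin_indep_imp_d3[OF z(2)] Deq[of z] by (auto simp: h'_def)
 qed
 define A' where "A' j z = (if j = 0 then D z *s A 0 z else if j = 1 then (h z * h z) *s crs (A 2 z) (A 0 z)
  else if j = 2 then (h z * h z) *s crs (A 0 z) (A 1 z) else 0)" for j :: nat and z
 have hA': "holo (%z. A' j z $ k) (ball a r)" for j k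
  unfolding A'_def using holo_mult[OF hD A012(1)] holo_mult[OF holo_mult[OF h(1) h(1)] holo_crs[OF A012(3,1)]]
   holo_mult[OF holo_mult[OF h(1) h(1)] holo_crs[OF A012(1,2)]] holo_const[OF open_ball] by (cases "j = 0"; cases "j = 1"; cases "j = 2"; simp)
 have main: "h' z *s ?W j z = A' j z" if z: "z \<in> ball a r" "h' z ~= 0" for j z
 proof -
  have hz: "h z ~= 0" "D z ~= 0" using z by (auto simp: h'_def)
  note e = eq[OF z(1) hz(1), symmetric]
  have d: "d3 (g 0 z) (g 1 z) (g 2 z) ~= 0" using Deq[OF z(1) hz(1)] hz by auto
  have "h z * D z * (1 / d3 (g 0 z) (g 1 z) (g 2 z)) = h z * h z * (h z * h z)" using Deq[OF z(1) hz(1)] d by (simp add: field_simps power3_eq_cube)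
  then show ?thesis using e[of 0] e[of 1] e[of 2] by (simp add: A'_def h'_def crs_scale mult_ac)
 qed
 have loc: "frame_local False E f ?W z" if z: "z \<in> ball a r" "h' z ~= 0" for z
 proof -
  have hz: "h z ~= 0" "D z ~= 0" using z by (auto simp: h'_def)
  have d: "d3 (g 0 z) (g 1 z) (g 2 z) ~= 0" using Deq[OF z(1) hz(1)] hz by auto
  have cg: "\<exists>G. has_cgrad (%p. ?W j p $ k) G z" for j k
  proof (rule has_cgrad_quotient[OF hA' hh' z])
   show "h' w * ?W j w $ k = A' j w $ k" if "w \<in> ball a r" "h' w ~= 0" for w using main[of w j] that by (auto simp: vec_eq_iff)
  qed
  define g' where "g' j = (if j < 3 then g j else (%p. 0))" for j
  have cgg: "\<exists>G. has_cgrad (%p. g' j p $ k) G z" for j k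
  proof (cases "j < 3")
   case True
   have "\<exists>G. has_cgrad (%p. g j p $ k) G z"
   proof (rule has_cgrad_quotient[OF A[OF True] h(1) z(1) hz(1)])
    show "h w * g j w $ k = A j w $ k" if "w \<in> ball a r" "h w ~= 0" for w using eq[of w j] that True by (auto simp: vec_eq_iff)
   qed
   then show ?thesis using True by (simp add: g'_def)
  next
   case False
   then show ?thesis using has_cgrad_const[of 0 z] by (auto simp: g'_def)
  qed
  have brz: "state_bracket (g' i) (g' j) z = 0" if "i < 3" "j < 3" for i j using br[OF that] an[OF z(1) hz(1)] that z rU by (auto simp: g'_def)
  have ev: "\<forall>\<^sub>F p in nhds z. d3 (g 0 p) (g 1 p) (g 2 p) ~= 0"
  proof -
   have "\<forall>\<^sub>F p in nhds z. p \<in> ball a r Int h' -` (- {0})"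
    by (rule eventually_nhds_in_open[OF holo_nonvanishing_set[OF hh']]) (use z in auto)
   then show ?thesis by eventually_elim (use Deq in \<open>auto simp: h'_def\<close>)
  qed
  have c1: "\<exists>c. \<forall>\<^sub>F p in nhds z. bdot (?W i p) (g' j p) = c" if "j < 3" "i = 1 | i = 2" for j i
  proof -
   have "j = 0 | j = 1 | j = 2" using that(1) by auto
   then show ?thesis using that(2) by (intro exI[of _ "if i = j then 1 else 0"] eventually_mono[OF ev])
     (auto simp: g'_def bdot_scale_left d3_rot d3_same d3_cyclic[of _ _ "g 0 _"])
  qed
  have fg: "form_good E f (?W i) z" if i: "i = 1 | i = 2" for i unfolding form_good_def
  proof (intro conjI allI impI)
   show "\<exists>G. has_cgrad (%p. ?W i p $ k) G z" for k by (rule cg)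
   show "pd (%p. ?W i p $ k) (Some l) z = pd (%p. ?W i p $ l) (Some k) z" for k l
    by (rule coframe_closed[of g', OF cgg cg c1[OF _ i] brz]) (use d in \<open>simp_all add: g'_def\<close>)
   show "bdot (?W i z) (f z) = 0" if "z \<in> E" using gf[of z] that z rU i by (auto simp: bdot_scale_left bdot_crs_self subset_iff)
  qed
  show ?thesis unfolding frame_local_def using cg fg[of 1] fg[of 2] by simp
 qed
 show "\<exists>r>0. \<exists>A h. ball a r \<subseteq> U & (\<forall>j k. holo (%z. A j z $ k) (ball a r)) & holo h (ball a r) &
    (\<exists>z\<in>ball a r. h z ~= 0) &
    (\<forall>z\<in>ball a r. h z ~= 0 --> (\<forall>j. h z *s ?W j z = A j z) & frame_local False E f ?W z)" using r rU hA' hh' nz main loc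
  by (intro exI[of _ r] conjI exI[of _ A'] exI[of _ h'] allI ballI impI)
qed

text \<open>For \<open>q = 3\<close> there are three commuting fields and the dual coframe is taken;
  for \<open>q \<le> 2\<close> there is a first integral \<open>F 0\<close>, whose gradient is not 0
  almost everywhere.\<close>

lemma integrable_frame_pack:
 fixes f :: "complex^(3 option) => complex^3"
 assumes "meromorphically_integrable_near w E f S"
 obtains ex U W where "frame_pack ex w E f U W" "!!y. y \<in> S ==> with_param y 0 \<in> U"
proof -
 obtain q U g F where q: "q \<in> {1..CARD(3)}" and *: "open U & (\<forall>y\<in>S. with_param y 0 \<in> U) &
    (\<forall>p. p + with_param w 0 \<in> U \<longleftrightarrow> p \<in> U) &
    (\<forall>j<q. (\<forall>i. multi_meromorphic_on (%p. g j p $ i) U) &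
       (\<forall>p\<in>U. g j (p + with_param w 0) = g j p)) &
    (\<forall>k<CARD(3) - q. multi_meromorphic_on (F k) U &
       (\<forall>p\<in>U. F k (p + with_param w 0) = F k p)) &
    (\<forall>p\<in>U Int E. g 0 p = f p) &
    negligible {p\<in>U. ~ lin_indep_family q (%j. g j p)} &
    (\<forall>j<q. \<forall>k<q. \<forall>p\<in>U. field_analytic_at (g j) p & field_analytic_at (g k) p -->
       state_bracket (g j) (g k) p = 0) &
    negligible {p\<in>U. ~ lin_indep_family (CARD(3) - q) (%k. state_grad (F k) p)} &
    (\<forall>j<q. \<forall>k<CARD(3) - q. \<forall>p\<in>U.
       field_analytic_at (g j) p & multi_analytic_on (F k) {p} -->
       bdot (state_grad (F k) p) (g j p) = 0)" using assms unfolding meromorphically_integrable_near_def by (elim exE bexE) (rule that)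
 have SU: "!!y. y \<in> S ==> with_param y 0 \<in> U" and U: "open U" and per: "!!p. p + with_param w 0 \<in> U \<longleftrightarrow> p \<in> U"
  using * by simp_all
 show thesis
 proof (cases "q = 3")
  case True
  show ?thesis
  proof (rule that[OF _ SU], rule frame_pack_coframe[OF U per, of g])
   show "!!j i. j < 3 ==> multi_meromorphic_on (%p. g j p $ i) U" using * True by simp
   show "!!j p. j < 3 ==> p \<in> U ==> g j (p + with_param w 0) = g j p" using * True by simp
   show "!!p. p \<in> U ==> p \<in> E ==> g 0 p = f p" using * by simp
   show "negligible {p \<in> U. ~ lin_indep_family 3 (%j. g j p)}" using * True by simp
   show "!!j k p. j < 3 ==> k < 3 ==> p \<in> U ==> field_analytic_at (g j) p ==> field_analytic_at (g k) p ==> state_bracket (g j) (g k) p = 0"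
    using * True by simp
  qed
 next
  case False
  then have q0: "0 < q" "0 < CARD(3) - q" using q by auto
  have li: "state_grad (F 0) p ~= 0" if "lin_indep_family (CARD(3) - q) (%k. state_grad (F k) p)" for p
  proof
   assume z: "state_grad (F 0) p = 0"
   have "(\<Sum>j<CARD(3) - q. (if j = 0 then 1 else 0) *s state_grad (F j) p) = 0" by (rule sum.neutral) (use z in auto)
   then have all0: "\<forall>j<CARD(3) - q. (if j = 0 then 1 else 0) = (0::complex)"
    using that[unfolded lin_indep_family_def, THEN spec[of _ "%j. if j = 0 then 1 else 0"]] by (rule mp[rotated])
   from all0[rule_format, of 0] q0 show False by simp
  qed
  show ?thesis
  proof (rule that[OF _ SU], rule frame_pack_exact[OF U per, of "g 0" "F 0"])
   show "!!i. multi_meromorphic_on (%p. g 0 p $ i) U" using * q0 by blast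
   show "!!p. p \<in> U ==> g 0 (p + with_param w 0) = g 0 p" using * q0 by blast
   show "multi_meromorphic_on (F 0) U" using * q0 by blast
   show "!!p. p \<in> U ==> F 0 (p + with_param w 0) = F 0 p" using * q0 by blast
   show "!!p. p \<in> U ==> p \<in> E ==> g 0 p = f p" using * by simp
   have "negligible {p\<in>U. ~ lin_indep_family (CARD(3) - q) (%k. state_grad (F k) p)}" using * by blast
   then show "negligible {p \<in> U. ~ state_grad (F 0) p ~= 0}" by (rule negligible_subset) (use li in auto)
   show "!!p. p \<in> U ==> field_analytic_at (g 0) p ==> multi_analytic_on (F 0) {p} ==> bdot (state_grad (F 0) p) (g 0 p) = 0"
    using * q0 by blast
  qed
 qed
qed

section \<open>Flow coordinates\<close>

lemma with_param_nth [simp]: "with_param y e $ None = e" "with_param y e $ Some i = y $ i" by (simp_all add: with_param_def)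

lemma point_nth [simp]: "point x a $ 1 = x $ 1" "point x a $ 2 = x $ 2" "point x a $ 3 = (a::'a::zero)" by (simp_all add: point_def)

lemma state_with_param [simp]: "state (with_param y e) = y" by (simp add: state_def vec_eq_iff)

lemma param_with_param [simp]: "param (with_param y e) = e" by (simp add: param_def)

lemma position_point [simp]: "position (point x a) = (x :: 'a::zero^2)" by (simp add: position_def vec_eq_iff forall_2)

lemma all_option3: "(\<forall>k::3 option. P k) \<longleftrightarrow> P None & P (Some 1) & P (Some 2) & P (Some 3)"
 by (metis (full_types) option.exhaust exhaust_3)

lemma sum_option3: "(\<Sum>k\<in>(UNIV::3 option set). f k) = f None + f (Some 1) + f (Some 2) + (f (Some 3) :: 'a::comm_monoid_add)"
proof -
 have "sum f UNIV = f None + sum f (range (Some :: 3 => 3 option))" unfolding UNIV_option_conv by (subst sum.insert) auto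
 also have "sum f (Some ` UNIV) = sum (f \<circ> Some) (UNIV::3 set)" by (rule sum.reindex) simp
 finally show ?thesis by (simp add: sum_3 add.assoc)
qed

lemma crs_eq_0_imp:
 assumes "crs u v = 0"
 obtains a b where "a ~= 0 | b ~= 0" "a *s u + b *s v = 0"
proof (cases "u = 0")
 case True
 then show thesis using that[of 1 0] by simp
next
 case False
 then obtain i where i: "u $ i ~= 0" by (auto simp: vec_eq_iff)
 have "crs u v $ 1 = 0 & crs u v $ 2 = 0 & crs u v $ 3 = 0" using assms by simp
 then have e: "u $ 2 * v $ 3 = u $ 3 * v $ 2" "u $ 3 * v $ 1 = u $ 1 * v $ 3" "u $ 1 * v $ 2 = u $ 2 * v $ 1" unfolding crs_nth by simp_all
 have "\<forall>j. v $ j * u $ k = u $ j * v $ k" for k using exhaust_3[of k] e unfolding forall_3 by (auto simp: mult.commute)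
 then have "v $ i *s u + (- u $ i) *s v = 0" by (simp add: vec_eq_iff)
 then show thesis using that[of "v $ i" "- u $ i"] i by simp
qed

lemma continuous_on_vec_components:
 fixes f :: "'a::topological_space => complex^'n"
 assumes "!!i. continuous_on S (%x. f x $ i)"
 shows "continuous_on S f" using continuous_on_vec_lambda[where f = "%i x. f x $ i", OF assms] by simp

locale chart =
 fixes Xv :: "complex^2 => complex^2" and S2 :: "(complex^2) set" and \<nu> \<phi> :: complex
 assumes openS2: "open S2" and holoX: "holo (%q. Xv q $ i) S2"
begin

definition Om :: "(complex^4) set" where "Om = {p. vector [p $ 1, p $ 2] \<in> S2}"

definition Phi :: "complex^4 => complex^(3 option)" where
 "Phi p = with_param (point (Xv (vector [p $ 1, p $ 2])) (\<nu> * p $ 2 + \<phi> + p $ 3)) (p $ 4)"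

definition X1 :: "complex^2 => complex^2" where "X1 q = (\<chi> i. pd (%q. Xv q $ i) 1 q)"
definition X2 :: "complex^2 => complex^2" where "X2 q = (\<chi> i. pd (%q. Xv q $ i) 2 q)"
definition jac :: "complex^2 => complex" where "jac q = X1 q $ 1 * X2 q $ 2 - X1 q $ 2 * X2 q $ 1"

definition dPhi :: "3 option => 4 => complex^4 => complex" where
 "dPhi k i p = pd (%p. Phi p $ k) i p"

text \<open>Components of the pull-back under \<open>Phi\<close> of a form on the state space; the
  sum omits \<open>None\<close> because the form has no component along the parameter.\<close>

definition pbf :: "(complex^(3 option) => complex^3) => 4 => complex^4 => complex" where
 "pbf \<omega> i p = (\<Sum>k\<in>UNIV. \<omega> (Phi p) $ k * dPhi (Some k) i p)"

lemma holo_X1: "holo (%q. X1 q $ i) S2" and holo_X2: "holo (%q. X2 q $ i) S2" unfolding X1_def X2_def using holo_partial_deriv[OF holoX] by simp_all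

lemma holo_jac: "holo jac S2" unfolding jac_def by (rule holo_diff[OF holo_mult[OF holo_X1 holo_X2] holo_mult[OF holo_X1 holo_X2]])

lemma holo_fst2: "open S ==> holo (%p::complex^4. vector [p $ 1, p $ 2] $ i) S" for i :: 2
proof -
 assume "open S"
 then have "\<forall>i. holo (%p::complex^4. (vector [p $ 1, p $ 2] :: complex^2) $ i) S" unfolding forall_2 by (simp add: holo_nth)
 then show ?thesis by simp
qed

lemma open_Om [simp]: "open Om"
proof -
 have "continuous_on UNIV (%p::complex^4. (vector [p $ 1, p $ 2] :: complex^2))"
 proof (rule continuous_on_vec_components)
  show "continuous_on UNIV (%p::complex^4. (vector [p $ 1, p $ 2] :: complex^2) $ i)" for i by (rule holo_cont[OF holo_fst2[OF open_UNIV]])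
 qed
 then have "open ((%p::complex^4. (vector [p $ 1, p $ 2] :: complex^2)) -` S2)" using openS2 open_vimage by blast
 then show ?thesis by (simp add: Om_def vimage_def)
qed

lemma holo_lift: "holo f S2 ==> holo (%p. f (vector [p $ 1, p $ 2])) Om"
 by (rule holo_compose[OF _ open_Om holo_fst2[OF open_Om]]) (auto simp: Om_def)

lemma Phi_nth: "Phi p $ None = p $ 4" "Phi p $ Some 1 = Xv (vector [p $ 1, p $ 2]) $ 1"
 "Phi p $ Some 2 = Xv (vector [p $ 1, p $ 2]) $ 2" "Phi p $ Some 3 = \<nu> * p $ 2 + \<phi> + p $ 3" by (simp_all add: Phi_def)

lemma holo_Phi: "holo (%p. Phi p $ k) Om"
proof -
 have "\<forall>k. holo (%p. Phi p $ k) Om" unfolding all_option3 Phi_nth by (intro conjI holo_nth[OF open_Om] holo_lift[OF holoX]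
   holo_add[OF holo_add[OF holo_mult[OF holo_const[OF open_Om] holo_nth[OF open_Om]] holo_const[OF open_Om]] holo_nth[OF open_Om]])
 then show ?thesis by simp
qed

lemma continuous_Phi: "continuous_on Om Phi" by (rule continuous_on_vec_components) (rule holo_cont[OF holo_Phi])

lemma vector_axis: "vector [(p + axis 1 s) $ 1, (p + axis 1 s) $ 2] = (vector [p $ 1, p $ 2] :: complex^2) + axis 1 s"
 "vector [(p + axis 2 s) $ 1, (p + axis 2 s) $ 2] = (vector [p $ 1, p $ 2] :: complex^2) + axis 2 s"
 "vector [(p + axis 3 s) $ 1, (p + axis 3 s) $ 2] = (vector [p $ 1, p $ 2] :: complex^2)"
 "vector [(p + axis 4 s) $ 1, (p + axis 4 s) $ 2] = (vector [p $ 1, p $ 2] :: complex^2)" for p :: "complex^4"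
 by (simp_all add: vec_eq_iff forall_2 axis_def)

lemma dPhi_simps:
 "dPhi None 1 p = 0" "dPhi None 2 p = 0" "dPhi None 3 p = 0" "dPhi None 4 p = 1"
 "dPhi (Some 1) 1 p = X1 (vector [p $ 1, p $ 2]) $ 1" "dPhi (Some 2) 1 p = X1 (vector [p $ 1, p $ 2]) $ 2" "dPhi (Some 3) 1 p = 0"
 "dPhi (Some 1) 2 p = X2 (vector [p $ 1, p $ 2]) $ 1" "dPhi (Some 2) 2 p = X2 (vector [p $ 1, p $ 2]) $ 2" "dPhi (Some 3) 2 p = \<nu>"
 "dPhi (Some 1) 3 p = 0" "dPhi (Some 2) 3 p = 0" "dPhi (Some 3) 3 p = 1"
 "dPhi (Some 1) 4 p = 0" "dPhi (Some 2) 4 p = 0" "dPhi (Some 3) 4 p = 0"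
proof -
 have "deriv (%s. \<nu> * (p $ 2 + s) + \<phi> + p $ 3) 0 = \<nu>" by (rule DERIV_imp_deriv) (auto intro!: derivative_eq_intros)
 then show "dPhi (Some 3) 2 p = \<nu>" by (simp add: dPhi_def partial_deriv_def Phi_nth axis_def)
 have "deriv (%s. \<nu> * p $ 2 + \<phi> + (p $ 3 + s)) 0 = 1" "deriv (%s. p $ 4 + s) 0 = 1"
  by (rule DERIV_imp_deriv; auto intro!: derivative_eq_intros)+
 then show "dPhi (Some 3) 3 p = 1" "dPhi None 4 p = 1" by (simp_all add: dPhi_def partial_deriv_def Phi_nth axis_def)
qed (simp_all only: dPhi_def partial_deriv_def Phi_nth vector_axis X1_def X2_def vec_lambda_beta, simp_all add: axis_def)

lemma Phi_cgrad: "p \<in> Om ==> has_cgrad (%p. Phi p $ k) (\<chi> i. dPhi k i p) p"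
 using holo_has_cgrad[OF holo_Phi, of p k] by (simp add: grad_def dPhi_def)

lemma holo_dPhi: "holo (dPhi k i) Om" unfolding dPhi_def[abs_def] by (rule holo_partial_deriv[OF holo_Phi])

lemma pbf_simps:
 "pbf \<omega> 1 p = \<omega> (Phi p) $ 1 * X1 (vector [p $ 1, p $ 2]) $ 1 + \<omega> (Phi p) $ 2 * X1 (vector [p $ 1, p $ 2]) $ 2"
 "pbf \<omega> 2 p = \<omega> (Phi p) $ 1 * X2 (vector [p $ 1, p $ 2]) $ 1 + \<omega> (Phi p) $ 2 * X2 (vector [p $ 1, p $ 2]) $ 2 + \<omega> (Phi p) $ 3 * \<nu>"
 "pbf \<omega> 3 p = \<omega> (Phi p) $ 3" by (simp_all add: pbf_def sum_3 dPhi_simps)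

lemma partial_compose_Phi:
 assumes p: "p \<in> Om" and F: "\<exists>G. has_cgrad F G (Phi p)" and i: "i ~= 4"
 shows "((%s. F (Phi (p + axis i s))) has_field_derivative (\<Sum>k\<in>UNIV. pd F (Some k) (Phi p) * dPhi (Some k) i p)) (at 0)"
proof -
 obtain G where G: "has_cgrad F G (Phi p)" using F by (elim exE) (rule that)
 have Gk: "G $ k = pd F k (Phi p)" for k using has_cgrad_partial(2)[OF G, of k] by simp
 have "dPhi None i p = 0" using i exhaust_4[of i] dPhi_simps by auto
 then show ?thesis using has_cgrad_partial(1)[OF has_cgrad_compose[where \<Phi> = Phi, OF G Phi_cgrad[OF p]], of i]
  by (simp add: sum_option3 sum_3 Gk)
qed

text \<open>Pull-back commutes with the exterior derivative: the second derivatives of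
  \<open>Phi\<close> cancel by symmetry, the rest by closedness. Direction 4 is excluded, since
  closedness is meant at a fixed parameter.\<close>

lemma pbf_closed:
 assumes p: "p \<in> Om" and ij: "i ~= 4" "j ~= 4" and \<omega>: "form_good E f \<omega> (Phi p)"
 shows "pd (pbf \<omega> i) j p = pd (pbf \<omega> j) i p"
proof -
 define a where "a k l = pd (%z. \<omega> z $ k) (Some l) (Phi p)" for k l
 have sym: "a k l = a l k" for k l using \<omega> by (simp add: a_def form_good_def)
 have d\<omega>: "\<exists>G. has_cgrad (%z. \<omega> z $ k) G (Phi p)" for k using \<omega> by (simp add: form_good_def)
 have main: "pd (pbf \<omega> i) j p = (\<Sum>k\<in>UNIV. (\<Sum>l\<in>UNIV. a k l * dPhi (Some l) j p) * dPhi (Some k) i p +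
   \<omega> (Phi p) $ k * pd (dPhi (Some k) i) j p)" if ij: "i ~= 4" "j ~= 4" for i j
 proof -
  have "((%s. \<omega> (Phi (p + axis j s)) $ k * dPhi (Some k) i (p + axis j s)) has_field_derivative
   (\<Sum>l\<in>UNIV. a k l * dPhi (Some l) j p) * dPhi (Some k) i (p + axis j 0) + pd (dPhi (Some k) i) j p * \<omega> (Phi (p + axis j 0)) $ k) (at 0)" for k
   unfolding a_def by (rule DERIV_mult[OF partial_compose_Phi[where F = "%z. \<omega> z $ k", OF p d\<omega> ij(2)]])
    (use holo_slice_deriv[OF holo_dPhi, of p j 0 "Some k" i] p in simp)
  then have "((%s. pbf \<omega> i (p + axis j s)) has_field_derivative (\<Sum>k\<in>UNIV. (\<Sum>l\<in>UNIV. a k l * dPhi (Some l) j p) * dPhi (Some k) i p +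
   pd (dPhi (Some k) i) j p * \<omega> (Phi p) $ k)) (at 0)" unfolding pbf_def by (intro DERIV_sum) simp
  then show ?thesis using DERIV_imp_deriv by (simp add: partial_deriv_def[of "pbf \<omega> i"] mult.commute)
 qed
 have "pd (dPhi (Some k) i) j p = pd (dPhi (Some k) j) i p" for k unfolding dPhi_def[abs_def] by (rule partial_deriv_commute[OF holo_Phi p])
 then show ?thesis unfolding main[OF ij] main[OF ij(2,1)] using sym[of 1 2] sym[of 1 3] sym[of 2 3] by (simp add: sum_3 algebra_simps)
qed

lemma pbf_lin_indep:
 assumes "jac (vector [p $ 1, p $ 2]) ~= 0" "pbf \<omega> 1 p = 0" "pbf \<omega> 2 p = 0" "pbf \<omega> 3 p = 0"
 shows "\<omega> (Phi p) = 0"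
proof -
 let ?q = "vector [p $ 1, p $ 2] :: complex^2"
 have w3: "\<omega> (Phi p) $ 3 = 0" using assms(4) by (simp add: pbf_simps)
 have e: "\<omega> (Phi p) $ 1 * X1 ?q $ 1 + \<omega> (Phi p) $ 2 * X1 ?q $ 2 = 0" "\<omega> (Phi p) $ 1 * X2 ?q $ 1 + \<omega> (Phi p) $ 2 * X2 ?q $ 2 = 0"
  using assms(2,3) w3 by (simp_all add: pbf_simps)
 have "\<omega> (Phi p) $ 1 * jac ?q = (\<omega> (Phi p) $ 1 * X1 ?q $ 1 + \<omega> (Phi p) $ 2 * X1 ?q $ 2) * X2 ?q $ 2 -
   (\<omega> (Phi p) $ 1 * X2 ?q $ 1 + \<omega> (Phi p) $ 2 * X2 ?q $ 2) * X1 ?q $ 2" by (simp add: jac_def algebra_simps)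
 moreover have "\<omega> (Phi p) $ 2 * jac ?q = (\<omega> (Phi p) $ 1 * X2 ?q $ 1 + \<omega> (Phi p) $ 2 * X2 ?q $ 2) * X1 ?q $ 1 -
   (\<omega> (Phi p) $ 1 * X1 ?q $ 1 + \<omega> (Phi p) $ 2 * X1 ?q $ 2) * X2 ?q $ 1" by (simp add: jac_def algebra_simps)
 ultimately have "\<omega> (Phi p) $ 1 * jac ?q = 0" "\<omega> (Phi p) $ 2 * jac ?q = 0" unfolding e by simp_all
 then show ?thesis using w3 assms(1) by (simp add: vec_eq_iff forall_3)
qed

lemma pbf_crs:
 assumes j: "jac (vector [p $ 1, p $ 2]) ~= 0" and c: "crs (\<omega> (Phi p)) (\<eta> (Phi p)) ~= 0"
 shows "crs (vector [pbf \<omega> 1 p, pbf \<omega> 2 p, pbf \<omega> 3 p]) (vector [pbf \<eta> 1 p, pbf \<eta> 2 p, pbf \<eta> 3 p]) ~= 0"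
proof
 assume "crs (vector [pbf \<omega> 1 p, pbf \<omega> 2 p, pbf \<omega> 3 p]) (vector [pbf \<eta> 1 p, pbf \<eta> 2 p, pbf \<eta> 3 p]) = 0"
 then obtain a b where ab: "a ~= 0 | b ~= 0"
  "a *s vector [pbf \<omega> 1 p, pbf \<omega> 2 p, pbf \<omega> 3 p] + b *s vector [pbf \<eta> 1 p, pbf \<eta> 2 p, pbf \<eta> 3 p] = (0::complex^3)"
  by (rule crs_eq_0_imp)
 define \<theta> where "\<theta> z = a *s \<omega> z + b *s \<eta> z" for z
 have "pbf \<theta> i p = a * pbf \<omega> i p + b * pbf \<eta> i p" for i by (simp add: pbf_def \<theta>_def sum_3 algebra_simps)
 then have "\<theta> (Phi p) = 0" using ab(2) by (intro pbf_lin_indep[OF j]) (simp_all add: vec_eq_iff forall_3)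
 then have t: "a * \<omega> (Phi p) $ k + b * \<eta> (Phi p) $ k = 0" for k by (simp add: \<theta>_def vec_eq_iff)
 have "a *s crs (\<omega> (Phi p)) (\<eta> (Phi p)) = 0 & b *s crs (\<omega> (Phi p)) (\<eta> (Phi p)) = 0"
 proof -
  have "a * (\<omega> (Phi p) $ k * \<eta> (Phi p) $ l - \<omega> (Phi p) $ l * \<eta> (Phi p) $ k) =
    (a * \<omega> (Phi p) $ k + b * \<eta> (Phi p) $ k) * \<eta> (Phi p) $ l - (a * \<omega> (Phi p) $ l + b * \<eta> (Phi p) $ l) * \<eta> (Phi p) $ k"
   "b * (\<omega> (Phi p) $ k * \<eta> (Phi p) $ l - \<omega> (Phi p) $ l * \<eta> (Phi p) $ k) =
    (a * \<omega> (Phi p) $ l + b * \<eta> (Phi p) $ l) * \<omega> (Phi p) $ k - (a * \<omega> (Phi p) $ k + b * \<eta> (Phi p) $ k) * \<omega> (Phi p) $ l" for k l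
   by (simp_all add: algebra_simps)
  then have z: "a * (\<omega> (Phi p) $ k * \<eta> (Phi p) $ l - \<omega> (Phi p) $ l * \<eta> (Phi p) $ k) = 0"
   "b * (\<omega> (Phi p) $ k * \<eta> (Phi p) $ l - \<omega> (Phi p) $ l * \<eta> (Phi p) $ k) = 0" for k l unfolding t by simp_all
  show ?thesis using z(1)[of 2 3] z(1)[of 3 1] z(1)[of 1 2] z(2)[of 2 3] z(2)[of 3 1] z(2)[of 1 2]
   by (simp only: vec_eq_iff forall_3 crs_nth vector_smult_component zero_index simp_thms)
 qed
 then show False using ab(1) c by (simp add: vector_mul_eq_0)
qed

text \<open>The derivative of \<open>Phi\<close> has the right inverse \<open>g'\<close>, found by
  Cramer's rule in the first two coordinates; an open mapping theorem then gives an interior point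
  of the image.\<close>

lemma Phi_open_image:
 assumes p: "p \<in> B" "open B" "B \<subseteq> Om" and j: "jac (vector [p $ 1, p $ 2]) ~= 0"
 obtains B' where "open B'" "Phi p \<in> B'" "B' \<subseteq> Phi ` B"
proof -
 let ?q = "vector [p $ 1, p $ 2] :: complex^2"
 define f' where "f' v = (\<chi> k. bdot (\<chi> i. dPhi k i p) v)" for v :: "complex^4"
 have pO: "p \<in> Om" using p by auto
 have D: "(Phi has_derivative f') (at p)"
  by (rule has_derivative_vec_componentwise) (use Phi_cgrad[OF pO] in \<open>simp add: has_cgrad_def f'_def\<close>)
 define g' where "g' y = (let h1 = (y $ Some 1 * X2 ?q $ 2 - y $ Some 2 * X2 ?q $ 1) / jac ?q;
   h2 = (y $ Some 2 * X1 ?q $ 1 - y $ Some 1 * X1 ?q $ 2) / jac ?q in pt h1 h2 (y $ Some 3 - \<nu> * h2) (y $ None))" for y :: "complex^(3 option)"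
 have f'_nth: "f' v $ Some 1 = X1 ?q $ 1 * v $ 1 + X2 ?q $ 1 * v $ 2" "f' v $ Some 2 = X1 ?q $ 2 * v $ 1 + X2 ?q $ 2 * v $ 2"
  "f' v $ Some 3 = \<nu> * v $ 2 + v $ 3" "f' v $ None = v $ 4" for v by (simp_all add: f'_def bdot_def sum_4 dPhi_simps)
 have "linear g'"
 proof (rule linearI)
  show "g' (x + y) = g' x + g' y" for x y by (simp add: g'_def Let_def vec_eq_iff forall_4 add_divide_distrib diff_divide_distrib algebra_simps)
  show "g' (c *\<^sub>R x) = c *\<^sub>R g' x" for c x
   by (simp add: g'_def Let_def vec_eq_iff forall_4 vector_scaleR_component) (simp add: scaleR_conv_of_real diff_divide_distrib algebra_simps)
 qed
 then have bl: "bounded_linear g'" by (rule linear_conv_bounded_linear[THEN iffD1])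
 have "f' (g' y) $ k = y $ k" for y k
 proof -
  have "f' (g' y) $ Some 1 = y $ Some 1 * (jac ?q / jac ?q)" "f' (g' y) $ Some 2 = y $ Some 2 * (jac ?q / jac ?q)"
   unfolding f'_nth g'_def Let_def pt_nth using j by (simp_all add: field_simps) (simp_all add: jac_def algebra_simps)
  then have "f' (g' y) $ Some 1 = y $ Some 1" "f' (g' y) $ Some 2 = y $ Some 2" using j by simp_all
  moreover have "f' (g' y) $ Some 3 = y $ Some 3" "f' (g' y) $ None = y $ None" unfolding f'_nth g'_def Let_def pt_nth by simp_all
  ultimately have "\<forall>k. f' (g' y) $ k = y $ k" unfolding all_option3 by simp
  then show ?thesis by simp
 qed
 then have "f' \<circ> g' = id" by (simp add: fun_eq_iff vec_eq_iff)
 then have "Phi p \<in> interior (Phi ` B)"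
  by (rule sussmann_open_mapping[OF open_Om continuous_Phi pO D bl _ p(3)]) (use p in \<open>simp add: interior_open\<close>)
 then show thesis using that[of "interior (Phi ` B)"] interior_subset by blast
qed

text \<open>In flow coordinates the perturbation is \<open>fa\<close> times the
  \<open>b\<close>-direction plus \<open>fb\<close> times the time direction. Speeding time up by
  \<open>fb\<close> would also advance the angle, whose rate has to remain \<nu>; the component
  \<open>- \<nu> * fb\<close> in \<open>s\<close> compensates.\<close>

lemma annihilation:
 assumes \<omega>: "bdot (\<omega> (Phi p)) (vector [X2 q $ 1 + p $ 4 * v $ 1, X2 q $ 2 + p $ 4 * v $ 2, \<nu>]) = 0"
  and q: "q = vector [p $ 1, p $ 2]" and j: "jac q ~= 0"
  and fa: "fa = (v $ 1 * X2 q $ 2 - v $ 2 * X2 q $ 1) / jac q" and fb: "fb = (X1 q $ 1 * v $ 2 - X1 q $ 2 * v $ 1) / jac q"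
 shows "pbf \<omega> 2 p + p $ 4 * (fa * pbf \<omega> 1 p + fb * pbf \<omega> 2 p + (- \<nu> * fb) * pbf \<omega> 3 p) = 0"
proof -
 have v1: "v $ 1 = fa * X1 q $ 1 + fb * X2 q $ 1" and v2: "v $ 2 = fa * X1 q $ 2 + fb * X2 q $ 2"
  unfolding fa fb using j by (simp_all add: field_simps) (simp_all add: jac_def algebra_simps)
 show ?thesis using \<omega> unfolding pbf_simps bdot3 v1 v2 vector_3 q[symmetric] by (simp add: algebra_simps)
qed

end

section \<open>The system in flow coordinates along the tube\<close>

context tube_region
begin

text \<open>Divisibility by a power of the parameter spreads from \<open>N0\<close> to all times:
  while a power is left, the function vanishes at parameter 0 near \<open>N0\<close>, hence
  everywhere, and one factor is divided out. Of \<open>g\<close> only continuity is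
  required.\<close>

lemma trep_order:
 assumes X: "trep A X" and N0: "open N0" "N0 ~= {}" "N0 \<subseteq> N"
  and g: "!!b s \<tau>. reg b s ==> \<tau> \<in> N0 ==> isCont g (pt b \<tau> s 0)"
  and Xg: "!!p. p \<in> dom4 ==> p $ 4 ~= 0 ==> p $ 2 \<in> N0 ==> norm (p $ 1) < rho ==> norm (p $ 3 - s0) < rho ==> X p = p $ 4 ^ k * g p"
 shows "\<exists>A' X'. trep A' X' & (\<forall>p. p $ 4 ~= 0 --> X p = p $ 4 ^ k * X' p)" using X Xg
proof (induction k arbitrary: A X)
 case 0
 then show ?case by (intro exI[of _ A] exI[of _ X]) simp
next
 case (Suc k)
 have z: "X (pt b \<tau> s 0) = 0" if bs: "reg b s" "\<tau> \<in> good b s" "\<tau> \<in> N0" for b s \<tau>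
 proof -
  let ?c = "%e. pt b \<tau> s e"
  have p: "?c 0 \<in> dom4" by (rule reg_dom4[OF bs(1,2)])
  have cX: "isCont (%e. X (?c e)) 0" by (rule DERIV_isCont[OF pt_slice_deriv(4)[OF trep_holo[OF Suc.prems(1)] p]])
  have "continuous_on UNIV ?c" by (intro continuous_intros)
   then have cc: "isCont ?c 0" using continuous_on_eq_continuous_at[OF open_UNIV] by blast
  have "isCont (%e. g (?c e)) 0" using isCont_o2[OF cc g[OF bs(1,3)]] by simp
  then have "isCont (%e. X (?c e) - e ^ Suc k * g (?c e)) 0" using cX by (intro continuous_intros)
  then have lim: "((%e. X (?c e) - e ^ Suc k * g (?c e)) \<longlongrightarrow> X (?c 0)) (at 0)" by (simp add: isCont_def)
  have "\<forall>\<^sub>F e in at 0. ?c e \<in> dom4" using cc open_dom4 p unfolding isCont_def by (rule topological_tendstoD)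
  then have "\<forall>\<^sub>F e in at 0. X (?c e) - e ^ Suc k * g (?c e) = 0" using eventually_neq_at_within[of 0 0]
  proof eventually_elim
   case (elim e)
   then show ?case using Suc.prems(2)[of "?c e"] bs by (simp add: reg_def)
  qed
  then have "((%e. X (?c e) - e ^ Suc k * g (?c e)) \<longlongrightarrow> 0) (at 0)" by (rule tendsto_eventually)
  then show ?thesis using tendsto_unique[OF _ lim] by simp
 qed
 have "A t p = 0" if "t \<in> C" "p \<in> tbox t (R t) r" "p $ 4 = 0" for t p by (rule trep_vanish[OF Suc.prems(1) N0 z that])
 then obtain A' X' where X': "trep A' X'" "!!p. p \<in> dom4 | p $ 4 ~= 0 ==> X p = p $ 4 * X' p"
  using trep_divide[OF Suc.prems(1)] by (metis (no_types))
 have eq: "X' p = p $ 4 ^ k * g p" if "p \<in> dom4" "p $ 4 ~= 0" "p $ 2 \<in> N0" "norm (p $ 1) < rho" "norm (p $ 3 - s0) < rho" for p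
  using Suc.prems(2)[OF that] X'(2)[of p] that by simp
 have "\<exists>A'' X''. trep A'' X'' & (\<forall>p. p $ 4 ~= 0 --> X' p = p $ 4 ^ k * X'' p)" by (rule Suc.IH[OF X'(1)]) (rule eq)
 then obtain A'' X'' where X'': "trep A'' X''" "\<forall>p. p $ 4 ~= 0 --> X' p = p $ 4 ^ k * X'' p" by (elim exE conjE) (rule that)
 then show ?case using X'(2) by (intro exI[of _ A''] exI[of _ X'']) simp
qed

end

context chart
begin

text \<open>The forms are pulled back, while the vector field \<open>W 0\<close> and the integral
  \<open>W 3\<close> are only composed with \<open>Phi\<close>; kept in one family they share the
  same denominators.\<close>

definition GG :: "(nat => complex^(3 option) => complex^3) => nat => complex^4 => complex^3" where
 "GG W j p = (if j = 1 | j = 2 then vector [pbf (W j) 1 p, pbf (W j) 2 p, pbf (W j) 3 p] else W j (Phi p))"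

end

text \<open>\<open>N0\<close> plays the part of a neighbourhood of time 0 and \<open>N1\<close> of a
  neighbourhood of the loop. Over these two the chart stays inside \<open>E\<close>, where the
  system is given explicitly; in between it stays inside \<open>U\<close>, where the system is known
  through its continuation \<open>W 0\<close>.\<close>

locale tube_chart = chart Xv S2 "complex_of_real \<nu>" \<phi> + tube_region C R r h N s0 rho \<sigma> J D
 for Xv :: "complex^2 => complex^2" and S2 and \<nu> :: real and \<phi> C R r h N s0 rho \<sigma> J D +
 fixes Hc :: "complex^2 => complex" and Wh and uc :: "complex^3 => complex^2" and V
  and E U :: "(complex^(3 option)) set" and ex :: bool and W :: "nat => complex^(3 option) => complex^3"
  and m :: nat and Ag :: "complex => nat => complex^4 => complex^3"
  and \<gamma> \<gamma>' :: "real => complex" and N0 N1 :: "complex set" and T d :: "real => real" and \<delta> :: real and l :: nat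
 assumes frame: "frame_pack ex angle_period E (perturbed_field Hc uc \<nu>) U W"
  and E_def: "E = {p. position (state p) \<in> Wh & state p \<in> V}"
  and Hc: "holo Hc Wh" and uc: "holo (%y. uc y $ i) V"
  and box: "t \<in> C ==> p \<in> tbox t (R t) r ==> p \<in> Om & Phi p \<in> U"
  and holo_Ag: "t \<in> C ==> holo (%p. Ag t j p $ k) (tbox t (R t) r)"
  and rep: "t \<in> C ==> p \<in> tbox t (R t) r ==> p $ 4 ~= 0 ==> h t p ~= 0 ==>
    frame_local ex E (perturbed_field Hc uc \<nu>) W (Phi p) & (\<forall>j. h t p *s (p $ 4 ^ m *s GG W j p) = Ag t j p)"
  and N0: "open N0" "N0 ~= {}" "N0 \<subseteq> N" and N1: "open N1" "N1 \<subseteq> N"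
  and inE: "norm b < r ==> norm s < r ==> \<tau> \<in> N0 Un N1 ==> Phi (pt b \<tau> s e) \<in> E"
  and ode0: "norm b < r ==> \<tau> \<in> N0 ==> X2 (vector [b, \<tau>]) = Jmat *v grad Hc (Xv (vector [b, \<tau>]))"
  and jac: "norm b < r ==> \<tau> \<in> N ==> jac (vector [b, \<tau>]) = jac (vector [b, 0])"
   "norm b < r ==> jac (vector [b, 0]) ~= 0"
  and loop: "valid_path \<gamma>" "pathfinish \<gamma> = pathstart \<gamma>" "path_image \<gamma> \<subseteq> N1"
   "!!u. u \<in> {0..1} ==> (\<gamma> has_vector_derivative \<gamma>' u) (at u)" "continuous_on {0..1} \<gamma>'"
  and mel: "norm b < r ==> norm s < r ==> contour_integral \<gamma> (%\<tau>. bdot (grad Hc (Xv (vector [b, \<tau>])))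
    (uc (point (Xv (vector [b, \<tau>])) (of_real \<nu> * \<tau> + \<phi> + s)))) ~= 0"
  and \<delta>: "\<delta> > 0" and real_N: "!!t. \<bar>t\<bar> < \<delta> ==> of_real t \<in> N"
   "!!t x. \<bar>t\<bar> < \<delta> ==> 0 < x ==> x < r ==> of_real (t + T x) \<in> N"
  and period: "!!t x. \<bar>t\<bar> < \<delta> ==> 0 < x ==> x < r ==>
    Xv (vector [of_real x, of_real (t + T x)]) = Xv (vector [of_real x, of_real t]) &
    X2 (vector [of_real x, of_real (t + T x)]) = X2 (vector [of_real x, of_real t]) &
    X1 (vector [of_real x, of_real (t + T x)]) = X1 (vector [of_real x, of_real t]) - of_real (d x) *s X2 (vector [of_real x, of_real t])"
  and T: "!!x. 0 < x ==> x < r ==> (T has_real_derivative d x) (at x)"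
   "!!x. 0 < x ==> x < r ==> \<nu> * T x ~= 2 * pi * l" "((%x. \<nu> * T x) \<longlongrightarrow> 2 * pi * l) (at_right 0)"
begin

abbreviation "ff \<equiv> perturbed_field Hc uc \<nu>"

lemma frame': "open U" "!!p. p + with_param angle_period 0 \<in> U \<longleftrightarrow> p \<in> U"
 "!!j p. p \<in> U ==> W j (p + with_param angle_period 0) = W j p" "!!p. p \<in> U ==> p \<in> E ==> W 0 p = ff p"
 using frame unfolding frame_pack_def by simp_all

lemma frame_nd: "open B ==> B ~= {} ==> B \<subseteq> U ==> \<exists>z\<in>B. if ex then W 1 z ~= 0 else crs (W 1 z) (W 2 z) ~= 0"
 using frame unfolding frame_pack_def by simp

lemma rho_le: "rho <= r" using rho_r norm_ge_zero[of s0] by linarith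

lemma s_small: "norm (s - s0) < rho ==> norm s < r" using rho_r norm_triangle_ineq[of "s - s0" s0] by simp

lemma N_box: "\<tau> \<in> N ==> norm b < r ==> norm s < r ==> norm e < r ==> pt b \<tau> s e \<in> Om & Phi (pt b \<tau> s e) \<in> U"
 using box by (auto simp: N_eq dist_norm norm_minus_commute)

lemma N_S2: "\<tau> \<in> N ==> norm b < r ==> vector [b, \<tau>] \<in> S2" using N_box[of \<tau> b 0 0] r_pos by (simp add: Om_def)

lemma dom4_box: "p \<in> dom4 ==> p \<in> Om & Phi p \<in> U" using box by (auto simp: dom4_def)

lemma dom4_local: "p \<in> dom4 ==> p $ 4 ~= 0 ==> frame_local ex E ff W (Phi p)" using rep by (auto simp: dom4_def)

lemma trep_GG:
 obtains A X where "trep A X" "!!p. p $ 4 ~= 0 ==> X p = p $ 4 ^ m * GG W j p $ k"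
proof (rule trep_extend[of "%t p. Ag t j p $ k" "%p. p $ 4 ^ m * GG W j p $ k"])
 show "holo (%p. Ag t j p $ k) (tbox t (R t) r)" if "t \<in> C" for t by (rule holo_Ag[OF that])
 show "h t p * (p $ 4 ^ m * GG W j p $ k) = Ag t j p $ k"
  if "t \<in> C" "p \<in> tbox t (R t) r" "p $ 4 ~= 0" "h t p ~= 0" for t p
 proof -
  have "h t p *s (p $ 4 ^ m *s GG W j p) = Ag t j p" using rep[OF that] by simp
  then show ?thesis by (auto simp: vec_eq_iff mult.assoc)
 qed
qed (rule that)

lemma E_simps: "Phi p \<in> E \<longleftrightarrow> Xv (vector [p $ 1, p $ 2]) \<in> Wh & point (Xv (vector [p $ 1, p $ 2])) (of_real \<nu> * p $ 2 + \<phi> + p $ 3) \<in> V"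
 by (simp add: E_def Phi_def)

definition uu :: "complex^4 => complex^2" where "uu p = uc (state (Phi p))"
definition hh :: "complex^2 => complex^2" where "hh q = Jmat *v grad Hc (Xv q)"

lemma ff_Phi: "ff (Phi p) = vector [hh (vector [p $ 1, p $ 2]) $ 1 + p $ 4 * uu p $ 1, hh (vector [p $ 1, p $ 2]) $ 2 + p $ 4 * uu p $ 2, of_real \<nu>]"
 by (simp add: perturbed_field_def hh_def uu_def Phi_def vec_eq_iff forall_3)

definition Q4 :: "(complex^4) set" where
 "Q4 = {p. norm (p $ 1) < r & p $ 2 \<in> N0 Un N1 & norm (p $ 3) < r}"

lemma open_Q4: "open Q4"
proof -
 have "Q4 = {p. norm (p $ 1) < r & norm (p $ 3) < r} Int (%p. p $ 2) -` (N0 Un N1)" by (auto simp: Q4_def)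
 moreover have "open {p::complex^4. norm (p $ 1) < r & norm (p $ 3) < r}" by (intro open_Collect_conj open_Collect_less continuous_intros)
 moreover have "open ((%p::complex^4. p $ 2) -` (N0 Un N1))" using N0 N1 by (intro open_vimage continuous_intros) auto
 ultimately show ?thesis by auto
qed

lemma Q4_E: "p \<in> Q4 ==> Phi p \<in> E" using inE[of "p $ 1" "p $ 3" "p $ 2" "p $ 4"] by (simp add: Q4_def)

lemma Q4_Om: "p \<in> Q4 ==> p \<in> Om" using N_S2[of "p $ 2" "p $ 1"] N0 N1 by (auto simp: Q4_def Om_def)

lemma holo_uu: "holo (%p. uu p $ i) Q4" unfolding uu_def
proof (rule holo_compose[OF uc open_Q4])
 have "holo (%p. Phi p $ k) Q4" for k by (rule holo_subset[OF holo_Phi open_Q4]) (use Q4_Om in auto)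
 then show "holo (%p. state (Phi p) $ i) Q4" for i by (simp add: state_def)
 show "state (Phi p) \<in> V" if "p \<in> Q4" for p using Q4_E[OF that] by (simp add: E_def)
qed

definition S1 :: "(complex^2) set" where "S1 = {q. norm (q $ 1) < r & q $ 2 \<in> N1}"

lemma open_S1: "open S1"
proof -
 have "S1 = {q. norm (q $ 1) < r} Int (%q. q $ 2) -` N1" by (auto simp: S1_def)
 moreover have "open {q::complex^2. norm (q $ 1) < r}" by (intro open_Collect_less continuous_intros)
 moreover have "open ((%q::complex^2. q $ 2) -` N1)" using N1 by (intro open_vimage continuous_intros) auto
 ultimately show ?thesis by auto
qed

lemma vector2_eta: "vector [q $ 1, q $ 2] = (q :: complex^2)" by (simp add: vec_eq_iff forall_2)

lemma S1_S2: "S1 \<subseteq> S2"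
proof
 fix q assume "q \<in> S1"
 then show "q \<in> S2" using N_S2[of "q $ 2" "q $ 1"] N1 by (auto simp: S1_def vector2_eta)
qed

lemma holo_grad_Xv: "holo (%q. pd Hc k (Xv q)) S1"
proof (rule holo_compose[OF holo_partial_deriv[OF Hc] open_S1])
 show "holo (%q. Xv q $ i) S1" for i by (rule holo_subset[OF holoX open_S1 S1_S2])
 show "Xv q \<in> Wh" if "q \<in> S1" for q using inE[of "q $ 1" 0 "q $ 2" 0] that r_pos by (simp add: S1_def E_simps vector2_eta)
qed

lemma hh_nth: "hh q $ 1 = pd Hc 2 (Xv q)" "hh q $ 2 = - pd Hc 1 (Xv q)" by (simp_all add: hh_def Jmat_def matrix_vector_mult_def sum_2 grad_def)

lemma holo_hh: "holo (%q. hh q $ i) S1"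
proof -
 have "\<forall>i. holo (%q. hh q $ i) S1" unfolding forall_2 hh_nth using holo_grad_Xv holo_uminus[OF holo_grad_Xv] by simp
 then show ?thesis by simp
qed

lemma isCont_uu: "p \<in> Q4 ==> isCont (%p. uu p $ i) p" using holo_cont[OF holo_uu] open_Q4 continuous_on_eq_continuous_at by blast

lemma reg_Q4: "reg b s ==> \<tau> \<in> N0 Un N1 ==> pt b \<tau> s e \<in> Q4" using reg_small[of b s] by (simp add: Q4_def)

text \<open>Between \<open>N0\<close> and \<open>N1\<close> the right-hand side \<open>hh\<close>
  may leave its domain, so the velocity is compared with \<open>W 0\<close>, which is meromorphic
  all along. Their difference has order 1 in the parameter over \<open>N0\<close>, hence everywhere;
  over \<open>N1\<close>, where \<open>W 0\<close> is explicit again, letting the parameter tend to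
  0 gives the equation.\<close>

lemma ode1:
 assumes b: "norm b < rho" and \<tau>: "\<tau> \<in> N1"
 shows "X2 (vector [b, \<tau>]) = hh (vector [b, \<tau>])"
proof -
 have "X2 (vector [b, \<tau>]) $ i = hh (vector [b, \<tau>]) $ i" for i
 proof -
  \<comment> \<open>The coordinate \<open>i\<close> of the position, as one of the three state
    coordinates.\<close>
  obtain i3 :: 3 where i3: "!!p. ff (Phi p) $ i3 = hh (vector [p $ 1, p $ 2]) $ i + p $ 4 * uu p $ i"
  proof (cases "i = 1")
   case True then show thesis using that[of 1] by (simp add: ff_Phi)
  next
   case False then have "i = 2" using exhaust_2[of i] by simp
   then show thesis using that[of 2] by (simp add: ff_Phi)
  qed
  let ?x = "%p. X2 (vector [p $ 1, p $ 2]) $ i"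
  have hx: "holo ?x (tbox t (R t) r)" if "t \<in> C" for t by (rule holo_subset[OF holo_lift[OF holo_X2]]) (use box[OF that] in auto)
  define B where "B t p = Ag t 0 p $ i3 - h t p * (p $ 4 ^ m * ?x p)" for t p
  obtain Y where Y: "trep B Y" "!!p. p $ 4 ~= 0 ==> Y p = p $ 4 ^ m * (W 0 (Phi p) $ i3 - ?x p)"
  proof (rule trep_extend[of B "%p. p $ 4 ^ m * (W 0 (Phi p) $ i3 - ?x p)"])
   show "holo (B t) (tbox t (R t) r)" if t: "t \<in> C" for t unfolding B_def
    by (rule holo_diff[OF holo_Ag[OF t] holo_mult[OF holo_h[OF t] holo_mult[OF holo_power[OF holo_nth[OF open_tbox]] hx[OF t]]]])
   show "h t p * (p $ 4 ^ m * (W 0 (Phi p) $ i3 - ?x p)) = B t p"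
    if "t \<in> C" "p \<in> tbox t (R t) r" "p $ 4 ~= 0" "h t p ~= 0" for t p
   proof -
    have "h t p *s (p $ 4 ^ m *s GG W 0 p) = Ag t 0 p" using rep[OF that] by simp
    then have "h t p * (p $ 4 ^ m * W 0 (Phi p) $ i3) = Ag t 0 p $ i3" by (auto simp: vec_eq_iff GG_def mult.assoc)
    then show ?thesis by (simp add: B_def algebra_simps)
   qed
  qed (rule that)
  \<comment> \<open>Over \<open>N0\<close> the unperturbed equation is known, so only the
    perturbation term remains of \<open>W 0\<close> minus the velocity.\<close>
  have N0Y: "Y p = p $ 4 ^ Suc m * uu p $ i" if p: "p \<in> dom4" "p $ 4 ~= 0" "p $ 2 \<in> N0" "norm (p $ 1) < rho" "norm (p $ 3 - s0) < rho" for p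
  proof -
   have "p \<in> Q4" using p rho_le s_small[OF p(5)] by (simp add: Q4_def)
   then have "W 0 (Phi p) $ i3 = ff (Phi p) $ i3" using frame'(4) Q4_E dom4_box[OF p(1)] by simp
   moreover have "?x p = hh (vector [p $ 1, p $ 2]) $ i" using ode0[OF _ p(3), of "p $ 1"] p rho_le by (simp add: hh_def)
   ultimately show ?thesis using Y(2)[OF p(2)] by (simp add: i3)
  qed
  have "\<exists>A' X'. trep A' X' & (\<forall>p. p $ 4 ~= 0 --> Y p = p $ 4 ^ Suc m * X' p)"
   by (rule trep_order[OF Y(1) N0, where g = "%p. uu p $ i", OF isCont_uu N0Y]) (use reg_Q4 in auto)
  then obtain A' X' where X': "trep A' X'" "\<forall>p. p $ 4 ~= 0 --> Y p = p $ 4 ^ Suc m * X' p" by (elim exE conjE) (rule that)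
  define Fq where "Fq q = hh q $ i - X2 q $ i" for q
  have hF: "holo Fq S1" unfolding Fq_def by (rule holo_diff[OF holo_hh holo_subset[OF holo_X2 open_S1 S1_S2]])
  have good0: "Fq (vector [b, \<tau>]) = 0" if bs: "reg b s0" "\<tau> \<in> good b s0" "\<tau> \<in> N1" for b \<tau>
  proof -
   let ?c = "%e. pt b \<tau> s0 e"
   have p: "?c 0 \<in> dom4" by (rule reg_dom4[OF bs(1,2)])
   have cX: "isCont (%e. X' (?c e)) 0" by (rule DERIV_isCont[OF pt_slice_deriv(4)[OF trep_holo[OF X'(1)] p]])
   have "continuous_on UNIV ?c" by (intro continuous_intros)
   then have cc: "isCont ?c 0" using continuous_on_eq_continuous_at[OF open_UNIV] by blast
   have "?c 0 \<in> Q4" using reg_Q4[OF bs(1)] bs(3) by simp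
   then have cu: "isCont (%e. uu (?c e) $ i) 0" using isCont_o2[OF cc isCont_uu] by simp
   have "isCont (%e. e * (X' (?c e) - uu (?c e) $ i)) 0" by (intro continuous_mult continuous_diff continuous_ident cX cu)
   then have lim: "((%e. e * (X' (?c e) - uu (?c e) $ i)) \<longlongrightarrow> 0) (at 0)" by (simp add: isCont_def)
   have "\<forall>\<^sub>F e in at 0. ?c e \<in> dom4" using cc open_dom4 p unfolding isCont_def by (rule topological_tendstoD)
   then have "\<forall>\<^sub>F e in at 0. e * (X' (?c e) - uu (?c e) $ i) = Fq (vector [b, \<tau>])" using eventually_neq_at_within[of 0 0]
   proof eventually_elim
    case (elim e)
    have q: "?c e \<in> Q4" using reg_Q4[OF bs(1)] bs(3) by simp
    have "W 0 (Phi (?c e)) = ff (Phi (?c e))" using frame'(4) Q4_E[OF q] dom4_box[OF elim(1)] by simp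
    then have "e ^ m * (hh (vector [b, \<tau>]) $ i + e * uu (?c e) $ i - X2 (vector [b, \<tau>]) $ i) = e ^ Suc m * X' (?c e)"
     using Y(2)[of "?c e"] X'(2) elim(2) i3[of "?c e"] by simp
    then have "e ^ m * (hh (vector [b, \<tau>]) $ i + e * uu (?c e) $ i - X2 (vector [b, \<tau>]) $ i) = e ^ m * (e * X' (?c e))"
     by (simp add: mult_ac)
    then have "hh (vector [b, \<tau>]) $ i + e * uu (?c e) $ i - X2 (vector [b, \<tau>]) $ i = e * X' (?c e)" using elim(2) by simp
    then show ?case by (simp add: Fq_def algebra_simps)
   qed
   then have "((%e. e * (X' (?c e) - uu (?c e) $ i)) \<longlongrightarrow> Fq (vector [b, \<tau>])) (at 0)" by (rule tendsto_eventually)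
   then show ?thesis using tendsto_unique[OF _ lim] by simp
  qed
  \<comment> \<open>Regular times are dense in \<open>N1\<close>, so by continuity no time near the
    loop is excepted; \<open>b = 0\<close> is reached by continuity afterwards.\<close>
  have punct: "Fq (vector [b, \<tau>]) = 0" if b: "b ~= 0" "norm b < rho" and \<tau>: "\<tau> \<in> N1" for b \<tau>
  proof (rule ccontr)
   assume nz: "Fq (vector [b, \<tau>]) ~= 0"
   have rg: "reg b s0" using b rho_pos by (simp add: reg_def)
   define M where "M = N1 Int (%\<tau>. Fq (vector [b, \<tau>])) -` (- {0})"
   have "(%z. Fq (vector [b, z])) holomorphic_on N1"
   proof (rule holo_slice[OF hF N1(1)])
    show "(%z. vector [b, z] $ k) holomorphic_on N1" for k :: 2 using exhaust_2[of k] by (auto intro!: holomorphic_intros)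
    show "vector [b, z] \<in> S1" if "z \<in> N1" for z using that b rho_le by (simp add: S1_def)
   qed
   then have "open M" unfolding M_def by (intro continuous_open_preimage holomorphic_on_imp_continuous_on N1) auto
   moreover have "M ~= {}" "M \<subseteq> N" using nz \<tau> N1 by (auto simp: M_def)
   ultimately have "good b s0 Int M ~= {}" by (rule good_dense[OF rg])
   then show False using good0[OF rg] by (auto simp: M_def)
  qed
  let ?S = "{q. norm (q $ 1) < rho & q $ 2 \<in> N1} :: (complex^2) set"
  have "open ?S"
  proof -
   have "?S = {q. norm (q $ 1) < rho} Int (%q. q $ 2) -` N1" by auto
   moreover have "open {q::complex^2. norm (q $ 1) < rho}" by (intro open_Collect_less continuous_intros)
   moreover have "open ((%q::complex^2. q $ 2) -` N1)" using N1 by (intro open_vimage continuous_intros) auto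
   ultimately show ?thesis by auto
  qed
  then have "Fq (vector [b, \<tau>]) = 0"
  proof (rule holo_zero_dense)
   show "continuous_on ?S Fq" by (rule continuous_on_subset[OF holo_cont[OF hF]]) (use rho_le in \<open>auto simp: S1_def\<close>)
   show "Fq q = 0" if "q \<in> ?S" "q $ 1 ~= 0" for q using punct[OF that(2)] that(1) by (metis (mono_tags, lifting) mem_Collect_eq vector2_eta)
  qed (use b \<tau> in simp)
  then show ?thesis by (simp add: Fq_def)
 qed
 then show ?thesis by (simp add: vec_eq_iff)
qed

end

section \<open>The pulled-back forms and the contradiction\<close>

context tube_chart
begin

definition fa :: "complex^4 => complex" where
 "fa p = (uu p $ 1 * X2 (vector [p $ 1, p $ 2]) $ 2 - uu p $ 2 * X2 (vector [p $ 1, p $ 2]) $ 1) / jac (vector [p $ 1, p $ 2])"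
definition fb :: "complex^4 => complex" where
 "fb p = (X1 (vector [p $ 1, p $ 2]) $ 1 * uu p $ 2 - X1 (vector [p $ 1, p $ 2]) $ 2 * uu p $ 1) / jac (vector [p $ 1, p $ 2])"
definition fe :: "complex^4 => complex" where "fe p = - of_real \<nu> * fb p"
definition Q5 :: "(complex^4) set" where "Q5 = Q4 Int {p. norm (p $ 1) < rho}"

lemma open_Q5: "open Q5" unfolding Q5_def by (intro open_Int open_Q4 open_Collect_less continuous_intros)

lemma jac_nz: "p $ 2 \<in> N ==> norm (p $ 1) < r ==> jac (vector [p $ 1, p $ 2]) ~= 0" using jac by metis

lemma Q5_jac: "p \<in> Q5 ==> jac (vector [p $ 1, p $ 2]) ~= 0" using jac_nz[of p] N0 N1 by (auto simp: Q5_def Q4_def)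

lemma holo_f: "holo fa Q5" "holo fb Q5" "holo fe Q5"
proof -
 have sub: "Q5 \<subseteq> Om" using Q4_Om by (auto simp: Q5_def)
 have u: "holo (%p. uu p $ i) Q5" for i by (rule holo_subset[OF holo_uu open_Q5]) (simp add: Q5_def)
 have x: "holo (%p. X1 (vector [p $ 1, p $ 2]) $ i) Q5" "holo (%p. X2 (vector [p $ 1, p $ 2]) $ i) Q5" for i
  by (rule holo_subset[OF holo_lift[OF holo_X1] open_Q5 sub], rule holo_subset[OF holo_lift[OF holo_X2] open_Q5 sub])
 have j: "holo (%p. jac (vector [p $ 1, p $ 2])) Q5" by (rule holo_subset[OF holo_lift[OF holo_jac] open_Q5 sub])
 show "holo fa Q5" unfolding fa_def by (rule holo_divide[OF holo_diff[OF holo_mult[OF u x(2)] holo_mult[OF u x(2)]] j Q5_jac])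
 show fb: "holo fb Q5" unfolding fb_def by (rule holo_divide[OF holo_diff[OF holo_mult[OF x(1) u] holo_mult[OF x(1) u]] j Q5_jac])
 show "holo fe Q5" unfolding fe_def by (rule holo_mult[OF holo_const[OF open_Q5] fb])
qed

text \<open>On the loop the velocity is the Hamiltonian field, so \<open>fa\<close> is minus the
  Melnikov integrand divided by \<open>jac\<close>, which is constant in time and comes out of the
  integral.\<close>

lemma M_nz:
 assumes b: "norm b < rho" and s: "norm (s - s0) < rho"
 shows "contour_integral \<gamma> (%\<tau>. fa (pt b \<tau> s 0)) ~= 0"
proof
 assume z: "contour_integral \<gamma> (%\<tau>. fa (pt b \<tau> s 0)) = 0"
 have b': "norm b < r" and s': "norm s < r" using b s rho_le s_small by auto
 have "(%\<tau>. fa (pt b \<tau> s 0)) holomorphic_on N1"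
  by (rule holomorphic_pt[OF holo_f(1) N1(1)]) (use b b' s' in \<open>auto simp: Q5_def Q4_def\<close>)
 then have int: "(%\<tau>. fa (pt b \<tau> s 0)) contour_integrable_on \<gamma>"
  by (rule contour_integrable_holomorphic_simple[OF _ N1(1) loop(1,3)])
 have "contour_integral \<gamma> (%\<tau>. bdot (grad Hc (Xv (vector [b, \<tau>]))) (uc (point (Xv (vector [b, \<tau>])) (of_real \<nu> * \<tau> + \<phi> + s)))) =
   contour_integral \<gamma> (%\<tau>. - jac (vector [b, 0]) * fa (pt b \<tau> s 0))"
 proof (rule contour_integral_eq)
  fix \<tau> assume "\<tau> \<in> path_image \<gamma>"
  then have \<tau>: "\<tau> \<in> N1" "\<tau> \<in> N" using loop(3) N1 by auto
  have u: "uc (point (Xv (vector [b, \<tau>])) (of_real \<nu> * \<tau> + \<phi> + s)) = uu (pt b \<tau> s 0)" by (simp add: uu_def Phi_def)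
  have "jac (vector [b, 0]) * fa (pt b \<tau> s 0) = uu (pt b \<tau> s 0) $ 1 * X2 (vector [b, \<tau>]) $ 2 - uu (pt b \<tau> s 0) $ 2 * X2 (vector [b, \<tau>]) $ 1"
   using jac(1)[OF b' \<tau>(2)] jac(2)[OF b'] by (simp add: fa_def)
  also have "\<dots> = - bdot (grad Hc (Xv (vector [b, \<tau>]))) (uu (pt b \<tau> s 0))"
   unfolding ode1[OF b \<tau>(1)] hh_nth by (simp add: bdot_def sum_2 grad_def)
  finally show "bdot (grad Hc (Xv (vector [b, \<tau>]))) (uc (point (Xv (vector [b, \<tau>])) (of_real \<nu> * \<tau> + \<phi> + s))) =
   - jac (vector [b, 0]) * fa (pt b \<tau> s 0)" unfolding u by simp
 qed
 also have "\<dots> = - jac (vector [b, 0]) * contour_integral \<gamma> (%\<tau>. fa (pt b \<tau> s 0))" by (rule contour_integral_lmul[OF int])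
 finally show False using mel[OF b' s'] z by simp
qed

text \<open>The excess of the angle over \<open>l\<close> full turns during the time
  \<open>T x\<close>.\<close>

definition cc :: "real => real" where "cc x = \<nu> * T x - 2 * pi * l"

sublocale mt: melnikov_tube C R r h N s0 rho \<sigma> J D fa fb fe Q5 N0 N1 \<gamma> \<gamma>' cc "%x. \<nu> * d x" d T \<delta>
proof unfold_locales
 show "holo fa Q5" "holo fb Q5" "holo fe Q5" by (fact holo_f)+
 show "open N0" "N0 ~= {}" "N0 \<subseteq> N" "open N1" "N1 \<subseteq> N" by (fact N0 N1)+
 show "pt b \<tau> s 0 \<in> Q5" if "reg b s" "\<tau> \<in> N0" for b \<tau> s using reg_Q4[OF that(1)] that by (simp add: Q5_def reg_def)
 show "pt b \<tau> s 0 \<in> Q5" if "norm b < rho" "norm (s - s0) < rho" "\<tau> \<in> N1" for b \<tau> s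
  using that rho_le s_small[OF that(2)] by (simp add: Q5_def Q4_def)
 show "valid_path \<gamma>" "pathfinish \<gamma> = pathstart \<gamma>" "path_image \<gamma> \<subseteq> N1"
   "!!u. u \<in> {0..1} ==> (\<gamma> has_vector_derivative \<gamma>' u) (at u)" "continuous_on {0..1} \<gamma>'" by (fact loop)+
 show "contour_integral \<gamma> (%\<tau>. fa (pt b \<tau> s 0)) ~= 0" if "norm b < rho" "norm (s - s0) < rho" for b s by (rule M_nz[OF that])
 show "cc x ~= 0" if "0 < x" "x < rho" for x using T(2)[of x] that rho_le by (simp add: cc_def)
 show "(cc \<longlongrightarrow> 0) (at_right 0)" unfolding cc_def using tendsto_diff[OF T(3) tendsto_const[of "2 * pi * l"]] by simp
 show "(cc has_real_derivative \<nu> * d x) (at x)" if "0 < x" "x < rho" for x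
  unfolding cc_def using T(1)[of x] that rho_le by (auto intro!: derivative_eq_intros)
 show "\<delta> > 0" by (rule \<delta>)
 show "of_real t \<in> N" if "\<bar>t\<bar> < \<delta>" for t using real_N(1)[OF that] .
 show "of_real (t + T x) \<in> N" if "\<bar>t\<bar> < \<delta>" "0 < x" "x < rho" for t x using real_N(2)[OF that(1,2)] that rho_le by simp
qed

lemma W_shift: "z \<in> U ==> z + of_nat k *s with_param angle_period 0 \<in> U & W j (z + of_nat k *s with_param angle_period 0) = W j z"
proof (induction k)
 case (Suc k)
 have "z + of_nat (Suc k) *s with_param angle_period 0 = (z + of_nat k *s with_param angle_period 0) + with_param angle_period 0"
  by (simp add: vec_eq_iff algebra_simps)
 then show ?case using Suc frame'(2,3) by metis
qed simp

text \<open>After the time \<open>T x\<close> the position is back and the angle has advanced by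
  \<open>2 * pi * l + cc x\<close>. The full turns are absorbed by the periodicity of
  \<open>W j\<close>, the rest is a shift of \<open>s\<close>.\<close>

lemma monodromy:
 assumes x: "0 < x" "x < rho" and s: "norm (s - s0) < rho" "norm (s + of_real (cc x) - s0) < rho"
  and t: "\<bar>t\<bar> < \<delta>" and e: "norm \<epsilon> < r"
 defines "p \<equiv> pt (of_real x) (of_real (t + T x)) s \<epsilon>" and "p' \<equiv> pt (of_real x) (of_real t) (s + of_real (cc x)) \<epsilon>"
 shows "pbf (W j) 3 p = pbf (W j) 3 p'"
  "pbf (W j) 1 p = pbf (W j) 1 p' + of_real (\<nu> * d x) * pbf (W j) 3 p' - of_real (d x) * pbf (W j) 2 p'"
proof -
 have xr: "x < r" using x rho_le by simp
 note per = period[OF t x(1) xr]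
 have U: "Phi p' \<in> U" unfolding p'_def using N_box[OF real_N(1)[OF t]] x xr s_small[OF s(2)] e by simp
 have "Phi p = Phi p' + of_nat l *s with_param angle_period 0"
 proof -
  have "Phi p $ k = (Phi p' + of_nat l *s with_param angle_period 0) $ k" for k
  proof -
   have "\<forall>k. Phi p $ k = (Phi p' + of_nat l *s with_param angle_period 0) $ k" unfolding all_option3 using per
    by (simp add: Phi_nth p_def p'_def angle_period_def axis_def del: of_real_add) (simp add: cc_def algebra_simps)
   then show ?thesis by simp
  qed
  then show ?thesis by (simp add: vec_eq_iff)
 qed
 then have W: "W j (Phi p) = W j (Phi p')" using W_shift[OF U] by simp
 show "pbf (W j) 3 p = pbf (W j) 3 p'" by (simp add: pbf_simps W)
 have p12: "p $ 1 = of_real x" "p $ 2 = of_real (t + T x)" "p' $ 1 = of_real x" "p' $ 2 = of_real t" by (simp_all add: p_def p'_def)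
 show "pbf (W j) 1 p = pbf (W j) 1 p' + of_real (\<nu> * d x) * pbf (W j) 3 p' - of_real (d x) * pbf (W j) 2 p'"
  unfolding pbf_simps W p12 per[THEN conjunct2, THEN conjunct2] by (simp add: algebra_simps del: of_real_add)
qed

definition em :: "4 => 3" where "em i = (if i = 1 then 1 else if i = 2 then 2 else 3)"

lemma GG_em: "j = 1 | j = 2 ==> i \<in> {1,2,3} ==> GG W j p $ em i = pbf (W j) i p" by (auto simp: GG_def em_def)

text \<open>The factor \<open>p $ 4 ^ m\<close> clears the poles at parameter 0. It leaves
  closedness, annihilation and monodromy intact because the parameter is constant in all of
  them.\<close>

lemma form_exists:
 assumes j: "j = 1 | j = 2"
 obtains A X where "mt.is_form A X" "!!i p. i \<in> {1,2,3} ==> p $ 4 ~= 0 ==> X i p = p $ 4 ^ m * pbf (W j) i p"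
proof -
 have "\<forall>i. \<exists>A X. trep A X & (\<forall>p. p $ 4 ~= 0 --> X p = p $ 4 ^ m * GG W j p $ em i)"
 proof
  fix i
  obtain A X where "trep A X" "!!p. p $ 4 ~= 0 ==> X p = p $ 4 ^ m * GG W j p $ em i" by (rule trep_GG[where j = j and k = "em i"]) (rule that)
  then show "\<exists>A X. trep A X & (\<forall>p. p $ 4 ~= 0 --> X p = p $ 4 ^ m * GG W j p $ em i)" by (intro exI conjI allI impI)
 qed
 then obtain A where "\<forall>i. \<exists>X. trep (A i) X & (\<forall>p. p $ 4 ~= 0 --> X p = p $ 4 ^ m * GG W j p $ em i)"
  by (rule choice[THEN exE]) (rule that)
 then obtain X where AX: "\<forall>i. trep (A i) (X i) & (\<forall>p. p $ 4 ~= 0 --> X i p = p $ 4 ^ m * GG W j p $ em i)"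
  by (rule choice[THEN exE]) (rule that)
 have tr: "trep (A i) (X i)" for i using AX by simp
 have Xe: "X i p = p $ 4 ^ m * pbf (W j) i p" if "i \<in> {1,2,3}" "p $ 4 ~= 0" for i p using AX GG_em[OF j that(1)] that by simp
 have pd: "pd (X i) k p = p $ 4 ^ m * pd (pbf (W j) i) k p"
  if i: "i \<in> {1,2,3}" and k: "k ~= 4" and p: "p \<in> dom4" "p $ 4 ~= 0" for i k p
 proof -
  have sl: "(p + axis k s) $ 4 = p $ 4" for s using k by (simp add: axis_def)
  have "((%s. X i (p + axis k s)) has_field_derivative pd (X i) k p) (at 0)" using holo_slice_deriv[OF trep_holo[OF tr], of p k 0 i] p by simp
  then have "((%s. X i (p + axis k s) / p $ 4 ^ m) has_field_derivative pd (X i) k p / p $ 4 ^ m) (at 0)" by (rule DERIV_cdivide)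
  moreover have "X i (p + axis k s) / p $ 4 ^ m = pbf (W j) i (p + axis k s)" for s using Xe[OF i, of "p + axis k s"] p sl by simp
  ultimately have "((%s. pbf (W j) i (p + axis k s)) has_field_derivative pd (X i) k p / p $ 4 ^ m) (at 0)" by simp
  then have "pd (pbf (W j) i) k p = pd (X i) k p / p $ 4 ^ m" unfolding partial_deriv_def[of "pbf (W j) i"] by (rule DERIV_imp_deriv)
  then show ?thesis using p by simp
 qed
 have fg: "form_good E ff (W j) (Phi p)" if "p \<in> dom4" "p $ 4 ~= 0" for p using dom4_local[OF that] j by (auto simp: frame_local_def)
 have "mt.is_form A X" unfolding mt.is_form_def
 proof (intro conjI ballI allI impI)
  show "trep (A i) (X i)" for i by (rule tr)
  show "pd (X i) k p = pd (X k) i p"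
   if p: "p \<in> dom4" "p $ 4 ~= 0" and i: "i \<in> {1, 2, 3}" and k: "k \<in> {1, 2, 3}" for i k p
  proof -
   have ne: "i ~= 4" "k ~= 4" using i k by auto
   show ?thesis unfolding pd[OF i ne(2) p] pd[OF k ne(1) p] pbf_closed[OF dom4_box[OF p(1), THEN conjunct1] ne fg[OF p]] ..
  qed
  show "X 2 p + p $ 4 * (fa p * X 1 p + fb p * X 2 p + fe p * X 3 p) = 0" if p: "p \<in> dom4 Int Q5" "p $ 4 ~= 0" for p
  proof -
   let ?q = "vector [p $ 1, p $ 2] :: complex^2"
   have pE: "Phi p \<in> E" using Q4_E p by (simp add: Q5_def)
   have "X2 ?q = hh ?q" using p ode0[of "p $ 1" "p $ 2"] ode1[of "p $ 1" "p $ 2"] rho_le by (auto simp: Q5_def Q4_def hh_def)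
   then have ffe: "ff (Phi p) = vector [X2 ?q $ 1 + p $ 4 * uu p $ 1, X2 ?q $ 2 + p $ 4 * uu p $ 2, of_real \<nu>]" by (simp add: ff_Phi)
   have "bdot (W j (Phi p)) (ff (Phi p)) = 0" using fg[of p] p pE by (simp add: form_good_def)
   then have "pbf (W j) 2 p + p $ 4 * (fa p * pbf (W j) 1 p + fb p * pbf (W j) 2 p + (- of_real \<nu> * fb p) * pbf (W j) 3 p) = 0"
    unfolding ffe by (rule annihilation[OF _ refl]) (use Q5_jac p in \<open>auto simp: fa_def fb_def\<close>)
   then have "p $ 4 ^ m * (pbf (W j) 2 p + p $ 4 * (fa p * pbf (W j) 1 p + fb p * pbf (W j) 2 p + (- of_real \<nu> * fb p) * pbf (W j) 3 p)) = 0"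
    by simp
   then show ?thesis using Xe[of 1 p] Xe[of 2 p] Xe[of 3 p] p by (simp add: fe_def algebra_simps)
  qed
  fix x s t \<epsilon> assume a: "0 < x" "x < rho" "norm (s - s0) < rho" "norm (s + of_real (cc x) - s0) < rho" "\<bar>t\<bar> < \<delta>"
   "\<epsilon> ~= (0::complex)" "norm \<epsilon> < r"
  note mono = monodromy[OF a(1-5,7), of j]
  show "X 3 (pt (of_real x) (of_real (t + T x)) s \<epsilon>) = X 3 (pt (of_real x) (of_real t) (s + of_real (cc x)) \<epsilon>)"
   using Xe[of 3 "pt (of_real x) (of_real (t + T x)) s \<epsilon>"] Xe[of 3 "pt (of_real x) (of_real t) (s + of_real (cc x)) \<epsilon>"] mono(1) a(6)
   by (simp del: of_real_add)
  show "X 1 (pt (of_real x) (of_real (t + T x)) s \<epsilon>) = X 1 (pt (of_real x) (of_real t) (s + of_real (cc x)) \<epsilon>) +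
     of_real (\<nu> * d x) * X 3 (pt (of_real x) (of_real t) (s + of_real (cc x)) \<epsilon>) -
     of_real (d x) * X 2 (pt (of_real x) (of_real t) (s + of_real (cc x)) \<epsilon>)"
   using Xe[of 1 "pt (of_real x) (of_real (t + T x)) s \<epsilon>"] Xe[of 1 "pt (of_real x) (of_real t) (s + of_real (cc x)) \<epsilon>"]
    Xe[of 2 "pt (of_real x) (of_real t) (s + of_real (cc x)) \<epsilon>"] Xe[of 3 "pt (of_real x) (of_real t) (s + of_real (cc x)) \<epsilon>"] mono(2) a(6)
   by (simp add: algebra_simps del: of_real_add)
 qed
 then show thesis using that[of A X] Xe by simp
qed

text \<open>Nondegenerate states are dense in \<open>U\<close>. Since \<open>Phi\<close> maps open
  parts of a box onto sets with interior, some point of the box is sent to such a state.\<close>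

lemma nondegenerate_point:
 obtains t p where "t \<in> C" "p \<in> tbox t (R t) r" "p $ 4 ~= 0" "h t p ~= 0" "jac (vector [p $ 1, p $ 2]) ~= 0"
  "if ex then W 1 (Phi p) ~= 0 else crs (W 1 (Phi p)) (W 2 (Phi p)) ~= 0"
proof -
 obtain t where t: "t \<in> C" using C_ne by blast
 let ?B = "{p \<in> tbox t (R t) r. h t p ~= 0} Int {p. p $ 4 ~= 0}"
 have jn: "jac (vector [p $ 1, p $ 2]) ~= 0" if "p \<in> tbox t (R t) r" for p using jac_nz[of p] in_N[OF t, of "p $ 2"] that by (simp add: tbox_def)
 have "open {p::complex^4. p $ 4 ~= 0}" by (intro open_Collect_neq continuous_intros)
 then have op: "open ?B" using open_dom4_part[OF t] by (rule open_Int[rotated])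
 obtain p0 where p0: "p0 \<in> ?B"
 proof -
  have "\<exists>p\<in>tbox t (R t) r. p $ 4 ~= 0 & h t p ~= 0"
  proof (rule ccontr)
   assume *: "~ ?thesis"
   have z: "h t p = 0" if "p \<in> tbox t (R t) r" for p by (rule dom4_zero_dense[OF holo_h[OF t] _ that]) (use * in blast)
   show False using h_nz[OF t] z by auto
  qed
  then show thesis using that by auto
 qed
 obtain B' where B': "open B'" "Phi p0 \<in> B'" "B' \<subseteq> Phi ` ?B" by (rule Phi_open_image[OF p0 op]) (use box[OF t] jn p0 in auto)
 have "\<exists>z\<in>B'. if ex then W 1 z ~= 0 else crs (W 1 z) (W 2 z) ~= 0" by (rule frame_nd[OF B'(1)]) (use B' box[OF t] in auto)
 then obtain p where "p \<in> ?B" "if ex then W 1 (Phi p) ~= 0 else crs (W 1 (Phi p)) (W 2 (Phi p)) ~= 0" using B'(3) by blast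
 then show thesis using that[OF t, of p] jn by simp
qed

theorem contradiction: False
proof -
 obtain A X where A: "mt.is_form A X" "!!i p. i \<in> {1,2,3} ==> p $ 4 ~= 0 ==> X i p = p $ 4 ^ m * pbf (W 1) i p"
  using form_exists[of 1] by (metis (no_types, lifting))
 obtain B Z where B: "mt.is_form B Z" "!!i p. i \<in> {1,2,3} ==> p $ 4 ~= 0 ==> Z i p = p $ 4 ^ m * pbf (W 2) i p"
  using form_exists[of 2] by (metis (no_types, lifting))
 obtain t p where p: "t \<in> C" "p \<in> tbox t (R t) r" "p $ 4 ~= 0" "h t p ~= 0" "jac (vector [p $ 1, p $ 2]) ~= 0"
  and nd: "if ex then W 1 (Phi p) ~= 0 else crs (W 1 (Phi p)) (W 2 (Phi p)) ~= 0" by (rule nondegenerate_point)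
 have hA: "h t p * X i p = A i t p" and hB: "h t p * Z i p = B i t p" if i: "i \<in> {1,2,3}" for i
  using mt.is_form_trep[OF A(1) i] mt.is_form_trep[OF B(1) i] p(1,2,4) by (auto simp: trep_def)
 have Ap: "A i t p = h t p * (p $ 4 ^ m * pbf (W 1) i p)" and Bp: "B i t p = h t p * (p $ 4 ^ m * pbf (W 2) i p)" if i: "i \<in> {1,2,3}" for i
  unfolding hA[OF i, symmetric] hB[OF i, symmetric] A(2)[OF i p(3)] B(2)[OF i p(3)] by (rule refl)+
 show False
 proof (cases ex)
  case True
  have "~ (pbf (W 1) 1 p = 0 & pbf (W 1) 2 p = 0 & pbf (W 1) 3 p = 0)" using pbf_lin_indep[OF p(5), of "W 1"] nd True by auto
  then obtain i0 where i0: "i0 \<in> {1,2,3}" "pbf (W 1) i0 p ~= 0" by blast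
  have nz: "A i0 t p ~= 0" using Ap[OF i0(1)] i0(2) p by simp
  \<comment> \<open>The first integral in flow coordinates supplies the primitive of the
    form.\<close>
  obtain A3 F where F: "trep A3 F" "!!p. p $ 4 ~= 0 ==> F p = p $ 4 ^ m * GG W 3 p $ 1" by (rule trep_GG[where j = 3 and k = 1]) (rule that)
  have F': "F p = p $ 4 ^ m * W 3 (Phi p) $ 1" if "p $ 4 ~= 0" for p using F(2)[OF that] by (simp add: GG_def)
  have dF: "pd F 2 p = p $ 4 ^ 0 * X 2 p" if q: "p \<in> dom4" "p $ 4 ~= 0" for p
  proof -
   have sl: "(p + axis 2 s) $ 4 = p $ 4" for s by (simp add: axis_def)
   have loc: "frame_local ex E ff W (Phi p)" by (rule dom4_local[OF q])
   have "((%s. W 3 (Phi (p + axis 2 s)) $ 1) has_field_derivative (\<Sum>k\<in>UNIV. pd (%z. W 3 z $ 1) (Some k) (Phi p) * dPhi (Some k) 2 p)) (at 0)"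
    by (rule partial_compose_Phi) (use dom4_box[OF q(1)] loc in \<open>auto simp: frame_local_def\<close>)
   then have "((%s. p $ 4 ^ m * W 3 (Phi (p + axis 2 s)) $ 1) has_field_derivative p $ 4 ^ m * (\<Sum>k\<in>UNIV. pd (%z. W 3 z $ 1) (Some k) (Phi p) * dPhi (Some k) 2 p)) (at 0)"
    by (rule DERIV_cmult)
   moreover have "(%s. p $ 4 ^ m * W 3 (Phi (p + axis 2 s)) $ 1) = (%s. F (p + axis 2 s))" using F' q(2) sl by (simp add: fun_eq_iff)
   ultimately have "pd F 2 p = p $ 4 ^ m * (\<Sum>k\<in>UNIV. pd (%z. W 3 z $ 1) (Some k) (Phi p) * dPhi (Some k) 2 p)"
    unfolding partial_deriv_def[of F] by (intro DERIV_imp_deriv) simp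
   also have "\<dots> = p $ 4 ^ m * pbf (W 1) 2 p" using loc True by (simp add: pbf_def frame_local_def state_grad_def)
   finally show ?thesis using A(2)[of 2 p] q(2) by simp
  qed
  show False by (rule mt.no_exact_form[OF A(1) p(1) i0(1) p(2) nz trep_holo[OF F(1)] dF])
 next
  case False
  have "crs (vector [pbf (W 1) 1 p, pbf (W 1) 2 p, pbf (W 1) 3 p]) (vector [pbf (W 2) 1 p, pbf (W 2) 2 p, pbf (W 2) 3 p]) ~= 0"
   by (rule pbf_crs[OF p(5)]) (use nd False in simp)
  then have "\<exists>i\<in>{1,2,3}. \<exists>j\<in>{1,2,3}. pbf (W 1) i p * pbf (W 2) j p - pbf (W 1) j p * pbf (W 2) i p ~= 0"
   by (auto simp: vec_eq_iff forall_3 crs_nth)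
  then obtain i j where ij: "i \<in> {1,2,3}" "j \<in> {1,2,3}" "pbf (W 1) i p * pbf (W 2) j p - pbf (W 1) j p * pbf (W 2) i p ~= 0" by blast
  have "A i t p * B j t p - A j t p * B i t p = (h t p * p $ 4 ^ m) ^ 2 * (pbf (W 1) i p * pbf (W 2) j p - pbf (W 1) j p * pbf (W 2) i p)"
   unfolding Ap[OF ij(1)] Ap[OF ij(2)] Bp[OF ij(1)] Bp[OF ij(2)] by (simp add: power2_eq_square algebra_simps)
  then have nz: "A i t p * B j t p - A j t p * B i t p ~= 0" using ij(3) p by simp
  show False by (rule mt.no_two_forms[OF A(1) B(1) p(1) ij(1,2) p(2) nz])
 qed
qed

end

section \<open>The family of periodic orbits\<close>

text \<open>The equation determines all derivatives at \<open>z0\<close> from the initial value by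
  induction, so every Taylor coefficient is 0; the rest is continuation from \<open>B\<close> to
  \<open>S\<close>.\<close>

lemma linear_ode_unique:
 fixes y :: "2 => complex => complex" and a :: "2 => 2 => complex => complex"
 assumes S: "open S" "connected S" and B: "open B" "z0 \<in> B" "B \<subseteq> S"
  and y: "!!i. y i holomorphic_on S" and a: "!!i j. a i j holomorphic_on B"
  and ode: "!!i z. z \<in> B ==> deriv (y i) z = a i 1 z * y 1 z + a i 2 z * y 2 z"
  and y0: "!!i. y i z0 = 0" and z: "z \<in> S" shows "y i z = 0"
proof -
 have yB: "y i holomorphic_on B" for i using y B(3) holomorphic_on_subset by blast
 have "\<forall>i. (deriv ^^ n) (y i) z0 = 0" for n
 proof (induction n rule: less_induct)
  case (less n)
  show ?case
  proof (cases n)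
   case 0
   then show ?thesis using y0 by simp
  next
   case (Suc k)
   show ?thesis
   proof
    fix i
    have prod0: "(deriv ^^ k) (%w. a i j w * y j w) z0 = 0" for j
    proof -
     have "(deriv ^^ (k - m)) (y j) z0 = 0" for m using less.IH[of "k - m"] Suc by simp
     then show ?thesis by (subst higher_deriv_mult[OF a yB B(1,2)]) simp
    qed
    have "(deriv ^^ n) (y i) z0 = (deriv ^^ k) (deriv (y i)) z0" unfolding Suc funpow_Suc_right by simp
    also have "\<dots> = (deriv ^^ k) (%z. a i 1 z * y 1 z + a i 2 z * y 2 z) z0"
     by (rule higher_deriv_transform_within_open[OF holomorphic_deriv[OF yB B(1)] _ B(1,2) ode])
      (intro holomorphic_intros a yB)
    also have "\<dots> = (deriv ^^ k) (%z. a i 1 z * y 1 z) z0 + (deriv ^^ k) (%z. a i 2 z * y 2 z) z0"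
     by (rule higher_deriv_add[OF _ _ B(1,2)]; intro holomorphic_intros a yB)
    finally show "(deriv ^^ n) (y i) z0 = 0" using prod0 by simp
   qed
  qed
 qed
 then show ?thesis using holomorphic_fun_eq_0_on_connected[OF y S, of i z0 z] B z by auto
qed

lemma holomorphic_real_zero:
 assumes f: "f holomorphic_on ball 0 r" and r: "r > 0" and z: "!!t. \<bar>t\<bar> < r ==> f (complex_of_real t) = 0" and w: "w \<in> ball 0 r"
 shows "f w = 0"
proof (rule analytic_continuation[OF f open_ball _ _ _ _ _ w])
 show "connected (ball (0::complex) r)" by simp
 show "complex_of_real ` {-r<..<r} \<subseteq> ball 0 r" by (auto simp: dist_norm)
 show "(0::complex) \<in> ball 0 r" using r by simp
 show "0 islimpt complex_of_real ` {-r<..<r}" unfolding islimpt_approachable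
 proof (intro allI impI)
  fix e :: real assume "e > 0"
  then show "\<exists>x'\<in>complex_of_real ` {-r<..<r}. x' ~= 0 & dist x' 0 < e"
   using r by (intro bexI[OF _ imageI[of "min r e / 2"]]) (auto simp: min_def)
 qed
 show "f z = 0" if "z \<in> complex_of_real ` {-r<..<r}" for z using that z by auto
qed

lemma holo_real_zero:
 fixes f :: "complex^2 => complex"
 assumes f: "holo f (pol r 0 r)" and r: "r > 0"
  and z: "!!x t. \<bar>x\<bar> < r ==> \<bar>t\<bar> < r ==> f (vector [of_real x, of_real t]) = 0" and q: "q \<in> pol r 0 r" shows "f q = 0"
proof -
 have h1: "(%w. f (vector [a, w])) holomorphic_on ball 0 r" if "norm a < r" for a
 proof (rule holo_slice[OF f open_ball])
  show "(%w. vector [a, w] $ i) holomorphic_on ball 0 r" for i :: 2 using exhaust_2[of i] by (auto intro!: holomorphic_intros)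
  show "vector [a, w] \<in> pol r 0 r" if "w \<in> ball 0 r" for w using that \<open>norm a < r\<close> by (simp add: pol_def)
 qed
 have h2: "(%a. f (vector [a, w])) holomorphic_on ball 0 r" if "norm w < r" for w
 proof (rule holo_slice[OF f open_ball])
  show "(%a. vector [a, w] $ i) holomorphic_on ball 0 r" for i :: 2 using exhaust_2[of i] by (auto intro!: holomorphic_intros)
  show "vector [a, w] \<in> pol r 0 r" if "a \<in> ball 0 r" for a using that \<open>norm w < r\<close> by (simp add: pol_def)
 qed
 have q': "norm (q $ 1) < r" "norm (q $ 2) < r" using q by (simp_all add: pol_def)
 have real: "f (vector [of_real x, w]) = 0" if "\<bar>x\<bar> < r" "w \<in> ball 0 r" for x w
  by (rule holomorphic_real_zero[OF h1 r z[OF that(1)] that(2)]) (use that in auto)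
 have "f (vector [q $ 1, q $ 2]) = 0" by (rule holomorphic_real_zero[OF h2[OF q'(2)] r real]) (use q' in auto)
 moreover have "vector [q $ 1, q $ 2] = q" by (simp add: vec_eq_iff forall_2)
 ultimately show ?thesis by simp
qed

lemma complex_deriv_along_reals:
 assumes f: "(f has_field_derivative D) (at (complex_of_real t))"
  and g: "\<forall>\<^sub>F s in nhds t. f (of_real s) = of_real (g s)" shows "(g has_real_derivative Re D) (at t)" "D = of_real (Re D)"
proof -
 have "(complex_of_real has_vector_derivative 1) (at t)"
  unfolding has_vector_derivative_def by (auto intro!: derivative_eq_intros simp: scaleR_conv_of_real)
 then have "((%s. f (of_real s)) has_vector_derivative 1 * D) (at t)"
  using field_vector_diff_chain_at[of complex_of_real 1 t f D] f by (simp add: o_def)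
 then have v: "((%s. complex_of_real (g s)) has_vector_derivative D) (at t)" unfolding has_vector_derivative_def mult_1
  by (rule has_derivative_transform_eventually) (use g eventually_nhds_x_imp_x[OF g] in \<open>auto simp: eventually_nhds_conv_at\<close>)
 have "((%s. Re (complex_of_real (g s))) has_vector_derivative Re D) (at t)" by (rule bounded_linear.has_vector_derivative[OF bounded_linear_Re v])
 then show "(g has_real_derivative Re D) (at t)" by (simp add: has_real_derivative_iff_has_vector_derivative)
 have "((%s. Im (complex_of_real (g s))) has_vector_derivative Im D) (at t)" by (rule bounded_linear.has_vector_derivative[OF bounded_linear_Im v])
 then have "((%s. 0::real) has_vector_derivative Im D) (at t)" by simp
 then have "Im D = 0" using vector_derivative_unique_at has_vector_derivative_const by blast
 then show "D = of_real (Re D)" by (simp add: complex_eq_iff)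
qed

text \<open>A pole would make the values along the real axis unbounded, against continuity. The
  limit at the removable singularity is also the limit along the reals, so it is the actual
  value.\<close>

lemma meromorphic_real_continuous_imp_analytic:
 assumes f: "f meromorphic_on A" "complex_of_real t \<in> A" and g: "isCont g t" "!!s. f (of_real s) = g s"
 shows "f analytic_on {of_real t}"
proof -
 have iso: "isolated_singularity_at f (of_real t)" and ne: "not_essential f (of_real t)"
  using f meromorphic_on_isolated_singularity meromorphic_on_not_essential meromorphic_on_subset by blast+
 have fl: "filterlim complex_of_real (at (of_real t)) (at t)" by (rule filterlim_atI) (auto intro!: tendsto_intros simp: eventually_at_filter)
 have "~ is_pole f (of_real t)"
 proof
  assume "is_pole f (of_real t)"
  then have "filterlim (%s. f (of_real s)) at_infinity (at t)" unfolding is_pole_def using fl by (rule filterlim_compose)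
  then show False using g not_tendsto_and_filterlim_at_infinity[of "at t" g "g t"] by (simp add: isCont_def)
 qed
 then obtain c where c: "f \<midarrow>of_real t\<rightarrow> c" using ne by (auto simp: not_essential_def)
 have "((%s. f (of_real s)) \<longlongrightarrow> c) (at t)" using c fl by (rule filterlim_compose)
 then have ct: "c = f (of_real t)" using g tendsto_unique[of "at t" g c "g t"] by (simp add: isCont_def)
 have an: "remove_sings f analytic_on {of_real t}" by (rule remove_sings_analytic_at[OF iso c])
 have "\<forall>\<^sub>F w in nhds (of_real t). remove_sings f w = f w"
  using eventually_remove_sings_eq_at[OF iso] remove_sings_eqI[OF c] ct by (auto simp: eventually_nhds_conv_at)
 then show ?thesis using an analytic_at_cong by blast
qed

text \<open>A polynomial loop close enough to the given one has the same integrals of holomorphic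
  functions, and its derivative is continuous, as differentiation of loop integrals in parameters
  requires.\<close>

lemma smooth_loop:
 assumes \<gamma>: "valid_path \<gamma>" "pathfinish \<gamma> = pathstart \<gamma>" "path_image \<gamma> \<subseteq> S" "open S"
 obtains p p' where "valid_path p" "pathfinish p = pathstart p" "path_image p \<subseteq> S"
  "!!u. (p has_vector_derivative p' u) (at u)" "continuous_on UNIV p'"
  "!!f. f holomorphic_on S ==> contour_integral p f = contour_integral \<gamma> f"
proof -
 have pg: "path \<gamma>" by (rule valid_path_imp_path[OF \<gamma>(1)])
 obtain d where d: "d > 0" "\<forall>g h. valid_path g & valid_path h &
      (\<forall>t \<in> {0..1}. norm (g t - \<gamma> t) < d & norm (h t - \<gamma> t) < d) &
      pathstart h = pathstart g & pathfinish h = pathfinish g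
      --> path_image g \<subseteq> S & path_image h \<subseteq> S &
        (\<forall>f. f holomorphic_on S --> contour_integral h f = contour_integral g f)"
  using contour_integral_nearby_ends[OF \<gamma>(4) pg \<gamma>(3)] by blast
 obtain p where p: "polynomial_function p" "pathstart p = pathstart \<gamma>" "pathfinish p = pathfinish \<gamma>"
   "!!t. t \<in> {0..1} ==> norm (p t - \<gamma> t) < d" by (rule path_approx_polynomial_function[OF pg d(1)]) (rule that)
 have vp: "valid_path p" by (rule valid_path_polynomial_function[OF p(1)])
 have k: "path_image \<gamma> \<subseteq> S & path_image p \<subseteq> S & (\<forall>f. f holomorphic_on S --> contour_integral p f = contour_integral \<gamma> f)"
  using d(2)[rule_format, of \<gamma> p] vp \<gamma>(1) p d(1) by simp
 obtain p' where p': "polynomial_function p'" "!!x. (p has_vector_derivative (p' x)) (at x)"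
  by (rule has_vector_derivative_polynomial_function[OF p(1)]) (rule that)
 show thesis by (rule that[OF vp _ _ p'(2)]) (use k p \<gamma>(2) p'(1) in \<open>auto intro: continuous_on_polymonial_function\<close>)
qed

text \<open>Monodromy needs the derivative of the period at nearby parameters, whereas
  differentiability is given at the resonant one. \<open>T\<close> is a solution of
  \<open>G = 0\<close> continuous at 0, and \<open>G\<close> has a non-zero derivative in its second
  variable there; this makes \<open>T\<close> Lipschitz near 0 and then differentiable.\<close>

lemma implicit_real_deriv:
 fixes G :: "complex^2 => complex" and T :: "real => real"
 assumes G: "holo G S" and S: "vector [0, of_real (T 0)] \<in> S" and D: "pd G 2 (vector [0, of_real (T 0)]) ~= 0"
  and T: "isCont T 0" and x0: "x0 > 0" and Z: "!!x. \<bar>x\<bar> < x0 ==> vector [of_real x, of_real (T x)] \<in> S ==> G (vector [of_real x, of_real (T x)]) = 0"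
 shows "\<exists>e>0. \<forall>x. \<bar>x\<bar> < e --> (\<exists>d. (T has_real_derivative d) (at x))"
proof -
 let ?P = "complex_of_real (T 0)"
 let ?a = "pd G 2 (vector [0, ?P])"
 define v :: "complex => complex => complex^2" where "v b t = vector [b, t]" for b t
 have v_nth [simp]: "v b t $ 1 = b" "v b t $ 2 = t" for b t by (simp_all add: v_def)
 have opS: "open S" by (rule holo_open[OF G])
 have h1: "holo (pd G 1) S" and h2: "holo (pd G 2) S" using holo_partial_deriv[OF G] by auto
 have "isCont (pd G 2) (v 0 ?P)" "isCont (pd G 1) (v 0 ?P)"
  using holo_cont[OF h1] holo_cont[OF h2] opS S continuous_on_eq_continuous_at unfolding v_def by blast+
 then have "\<forall>\<^sub>F q in nhds (v 0 ?P). q \<in> S & dist (pd G 2 q) ?a < norm ?a / 2 &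
   dist (pd G 1 q) (pd G 1 (v 0 ?P)) < 1" using opS S D unfolding v_def isCont_def tendsto_at_iff_tendsto_nhds
  by (intro eventually_conj eventually_nhds_in_open tendstoD) auto
 then obtain e where e: "e > 0" "!!q. dist q (v 0 ?P) < e ==> q \<in> S & dist (pd G 2 q) ?a < norm ?a / 2 &
   dist (pd G 1 q) (pd G 1 (v 0 ?P)) < 1" unfolding eventually_nhds_metric by blast
 define M where "M = norm (pd G 1 (v 0 ?P)) + 1"
 have near: "dist (v b t) (v 0 ?P) < e" if "norm b < e / 2" "norm (t - ?P) < e / 2" for b t
 proof -
  have "norm (v b t - v 0 ?P) <= norm b + norm (t - ?P)" unfolding norm_vec_def by (rule order_trans[OF L2_set_le_sum]) (simp_all add: sum_2)
  then show ?thesis using that by (simp add: dist_norm)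
 qed
 note e' = e(2)[OF near]
 have d1: "((%b. G (v b t)) has_field_derivative pd G 1 (v b t)) (at b)"
  and d2: "((%t. G (v b t)) has_field_derivative pd G 2 (v b t)) (at t)" if "norm b < e / 2" "norm (t - ?P) < e / 2" for b t
 proof -
  have vs: "v 0 t + axis 1 b = v b t" "v b 0 + axis 2 t = v b t" for b t by (simp_all add: vec_eq_iff forall_2 axis_def)
  show "((%b. G (v b t)) has_field_derivative pd G 1 (v b t)) (at b)" using holo_slice_deriv[OF G, of "v 0 t" 1 b] e'[OF that] unfolding vs by simp
  show "((%t. G (v b t)) has_field_derivative pd G 2 (v b t)) (at t)" using holo_slice_deriv[OF G, of "v b 0" 2 t] e'[OF that] unfolding vs by simp
 qed
 \<comment> \<open>In the second variable \<open>G\<close> expands by at least half of its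
   derivative at the base point, because that derivative varies by at most half of its size.\<close>
 have low: "norm ?a / 2 * norm (t - t') <= norm (G (v b t) - G (v b t'))"
  if b: "norm b < e / 2" and t: "norm (t - ?P) < e / 2" "norm (t' - ?P) < e / 2" for b t t'
 proof -
  have "norm ((G (v b t) - ?a * t) - (G (v b t') - ?a * t')) <= norm ?a / 2 * norm (t - t')"
  proof (rule field_differentiable_bound[where S = "ball ?P (e / 2)" and f' = "%t. pd G 2 (v b t) - ?a"])
   fix z assume "z \<in> ball ?P (e / 2)"
   then have z: "norm (z - ?P) < e / 2" by (simp add: dist_norm norm_minus_commute)
   show "((%t. G (v b t) - ?a * t) has_field_derivative pd G 2 (v b z) - ?a) (at z within ball ?P (e / 2))"
    by (rule DERIV_subset[where s = UNIV]) (use DERIV_diff[OF d2[OF b z] DERIV_cmult_Id[of ?a z]] in \<open>auto simp: mult.commute\<close>)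
   show "norm (pd G 2 (v b z) - ?a) <= norm ?a / 2" using e'[OF b z] by (simp add: dist_norm)
  qed (use t in \<open>auto simp: dist_norm norm_minus_commute\<close>)
  moreover have "norm (?a * (t - t')) <= norm (G (v b t) - G (v b t')) + norm ((G (v b t) - ?a * t) - (G (v b t') - ?a * t'))"
   using norm_triangle_ineq4[of "G (v b t) - G (v b t')" "(G (v b t) - ?a * t) - (G (v b t') - ?a * t')"] by (simp add: algebra_simps)
  ultimately show ?thesis by (simp add: norm_mult)
 qed
 have up: "norm (G (v b t) - G (v b' t)) <= M * norm (b - b')"
  if t: "norm (t - ?P) < e / 2" and b: "norm b < e / 2" "norm b' < e / 2" for b b' t
 proof (rule field_differentiable_bound[where S = "ball 0 (e / 2)" and f' = "%b. pd G 1 (v b t)"])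
  fix z :: complex assume "z \<in> ball 0 (e / 2)"
  then have z: "norm z < e / 2" by simp
  show "((%b. G (v b t)) has_field_derivative pd G 1 (v z t)) (at z within ball 0 (e / 2))"
   by (rule DERIV_subset[where s = UNIV]) (use d1[OF z t] in auto)
  have "norm (pd G 1 (v z t)) <= norm (pd G 1 (v 0 ?P)) + norm (pd G 1 (v z t) - pd G 1 (v 0 ?P))"
   using norm_triangle_ineq[of "pd G 1 (v 0 ?P)" "pd G 1 (v z t) - pd G 1 (v 0 ?P)"] by simp
  then show "norm (pd G 1 (v z t)) <= M" using e'[OF z t] by (simp add: dist_norm M_def)
 qed (use b in auto)
 obtain e1 where e1: "e1 > 0" "!!x. \<bar>x\<bar> < e1 ==> \<bar>T x - T 0\<bar> < e / 2"
  using T e(1) unfolding continuous_at_eps_delta by (metis diff_0_right dist_norm half_gt_zero real_norm_def)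
 define e2 where "e2 = min e1 (min x0 (e / 2))"
 have e2: "e2 > 0" using e1 x0 e by (simp add: e2_def)
 have in2: "norm (complex_of_real x) < e / 2" "norm (complex_of_real (T x) - ?P) < e / 2" "G (v (of_real x) (of_real (T x))) = 0"
  if "\<bar>x\<bar> < e2" for x
 proof -
  have "norm (complex_of_real (T x - T 0)) < e / 2" using e1(2)[of x] that by (simp add: e2_def del: of_real_diff)
  then show 1: "norm (complex_of_real (T x) - ?P) < e / 2" by simp
  show 2: "norm (complex_of_real x) < e / 2" using that by (simp add: e2_def)
  show "G (v (of_real x) (of_real (T x))) = 0" using Z[of x] e'[OF 2 1] that by (simp add: v_def e2_def)
 qed
 have lip: "\<bar>T x - T y\<bar> <= 2 * M / norm ?a * \<bar>x - y\<bar>" if "\<bar>x\<bar> < e2" "\<bar>y\<bar> < e2" for x y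
 proof -
  have "norm ?a / 2 * norm (complex_of_real (T x) - of_real (T y)) <= norm (G (v (of_real x) (of_real (T x))) - G (v (of_real x) (of_real (T y))))"
   by (rule low[OF in2(1)[OF that(1)] in2(2)[OF that(1)] in2(2)[OF that(2)]])
  also have "\<dots> = norm (G (v (of_real x) (of_real (T y))) - G (v (of_real y) (of_real (T y))))"
   using in2(3)[OF that(1)] in2(3)[OF that(2)] by simp
  also have "\<dots> <= M * norm (complex_of_real x - of_real y)" by (rule up[OF in2(2)[OF that(2)] in2(1)[OF that(1)] in2(1)[OF that(2)]])
  finally have "norm ?a / 2 * \<bar>T x - T y\<bar> <= M * \<bar>x - y\<bar>" by (simp only: of_real_diff[symmetric] norm_of_real)
  then show ?thesis using D by (simp add: field_simps)
 qed
 have "\<exists>d. (T has_real_derivative d) (at x)" if x: "\<bar>x\<bar> < e2" for x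
 proof -
  let ?q = "%y. v (of_real y) (of_real (T y))"
  let ?D1 = "pd G 1 (?q x)" and ?D2 = "pd G 2 (?q x)"
  have qS: "?q x \<in> S" "dist ?D2 ?a < norm ?a / 2" using e'[OF in2(1,2)[OF x]] by auto
  have D2: "?D2 ~= 0" using qS(2) D by auto
  define L where "L = 1 + 2 * M / norm ?a"
  have M0: "M > 0" by (simp add: M_def add_nonneg_pos)
  have Lq: "norm (?q y - ?q x) <= L * \<bar>y - x\<bar>" if "\<bar>y\<bar> < e2" for y
  proof -
   have "norm (?q y - ?q x) <= norm (complex_of_real (y - x)) + norm (complex_of_real (T y - T x))"
    unfolding norm_vec_def by (rule order_trans[OF L2_set_le_sum]) (simp_all add: sum_2)
   also have "\<dots> <= \<bar>y - x\<bar> + 2 * M / norm ?a * \<bar>y - x\<bar>" unfolding norm_of_real using lip[OF that x] by simp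
   finally show ?thesis by (simp add: L_def algebra_simps)
  qed
  \<comment> \<open>The relative error of the linearisation of \<open>G\<close> at a point of the
    graph; the Lipschitz bound \<open>L\<close> turns it into an error of the difference quotient of
    \<open>T\<close>.\<close>
  define E where "E q = (G q - G (?q x) - bdot (grad G (?q x)) (q - ?q x)) /\<^sub>R norm (q - ?q x)" for q
  have "(G has_derivative bdot (grad G (?q x))) (at (?q x))" using holo_has_cgrad[OF G qS(1)] by (simp add: has_cgrad_def)
  then have "(E \<longlongrightarrow> 0) (at (?q x))" unfolding E_def has_derivative_at_within by simp
  then have E0: "\<forall>\<^sub>F q in at (?q x). norm (E q) < \<epsilon>" if "\<epsilon> > 0" for \<epsilon> using that by (auto dest: tendstoD)
  have near_x: "\<forall>\<^sub>F y in at x. \<bar>y\<bar> < e2 & y ~= x"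
  proof -
   have "\<forall>\<^sub>F y in at x. y \<in> {-e2<..<e2}" by (rule eventually_at_in_open') (use x in auto)
   then show ?thesis using eventually_neq_at_within[of x x UNIV] by eventually_elim auto
  qed
  have qlim: "(?q \<longlongrightarrow> ?q x) (at x)"
  proof (rule LIM_zero_cancel, rule Lim_null_comparison)
   show "\<forall>\<^sub>F y in at x. norm (?q y - ?q x) <= L * \<bar>y - x\<bar>" using near_x by eventually_elim (use Lq in auto)
   show "((%y. L * \<bar>y - x\<bar>) \<longlongrightarrow> 0) (at x)" by (auto intro!: tendsto_eq_intros)
  qed
  have qne: "?q y ~= ?q x" if "y ~= x" for y using that by (metis of_real_eq_iff v_nth(1))
  have fq: "filterlim ?q (at (?q x)) (at x)"
   by (rule filterlim_atI[OF qlim]) (use eventually_neq_at_within[of x x UNIV] qne in \<open>auto elim: eventually_mono\<close>)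
  have Elim: "((%y. E (?q y)) \<longlongrightarrow> 0) (at x)"
   using \<open>(E \<longlongrightarrow> 0) (at (?q x))\<close> fq by (rule filterlim_compose)
  have "((%y. complex_of_real ((T y - T x) / (y - x)) * ?D2 + ?D1) \<longlongrightarrow> 0) (at x)"
  proof (rule Lim_null_comparison)
   show "\<forall>\<^sub>F y in at x. norm (complex_of_real ((T y - T x) / (y - x)) * ?D2 + ?D1) <= L * norm (E (?q y))" using near_x
   proof eventually_elim
    case (elim y)
    have "G (?q y) - G (?q x) - bdot (grad G (?q x)) (?q y - ?q x) = norm (?q y - ?q x) *\<^sub>R E (?q y)"
     using qne[of y] elim by (simp add: E_def)
    then have m: "?D1 * of_real (y - x) + ?D2 * of_real (T y - T x) = - (norm (?q y - ?q x) *\<^sub>R E (?q y))"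
     using in2(3)[OF x] in2(3)[of y] elim by (simp add: bdot_def sum_2 grad_def minus_equation_iff algebra_simps)
    have e: "complex_of_real ((T y - T x) / (y - x)) * ?D2 + ?D1 = (?D1 * of_real (y - x) + ?D2 * of_real (T y - T x)) / of_real (y - x)"
     using elim by (simp add: field_simps)
    have "norm (complex_of_real ((T y - T x) / (y - x)) * ?D2 + ?D1) = norm (?q y - ?q x) * norm (E (?q y)) / \<bar>y - x\<bar>"
     unfolding e m norm_divide norm_of_real norm_minus_cancel norm_scaleR abs_norm_cancel by (rule refl)
    also have "\<dots> <= L * \<bar>y - x\<bar> * norm (E (?q y)) / \<bar>y - x\<bar>"
     using Lq[of y] elim by (intro divide_right_mono mult_right_mono) auto
    finally show ?case using elim by simp
   qed
   show "((%y. L * norm (E (?q y))) \<longlongrightarrow> 0) (at x)" using tendsto_mult[OF tendsto_const[of L] tendsto_norm[OF Elim]] by simp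
  qed
  then have "((%y. (complex_of_real ((T y - T x) / (y - x)) * ?D2 + ?D1 - ?D1) / ?D2) \<longlongrightarrow> (0 - ?D1) / ?D2) (at x)"
   by (intro tendsto_intros D2)
  then have "((%y. complex_of_real ((T y - T x) / (y - x))) \<longlongrightarrow> - ?D1 / ?D2) (at x)" using D2 by simp
  then have "((%y. Re (complex_of_real ((T y - T x) / (y - x)))) \<longlongrightarrow> Re (- ?D1 / ?D2)) (at x)" by (rule tendsto_Re)
  then show ?thesis by (intro exI[of _ "Re (- ?D1 / ?D2)"]) (simp add: has_field_derivative_iff)
 qed
 then show ?thesis using e2 by blast
qed

section \<open>Local quotient representations pulled back to the chart\<close>

context chart
begin

lemma pbf_scale: "c *s \<omega> (Phi p) = \<eta> (Phi p) ==> c * pbf \<omega> i p = pbf \<eta> i p"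
 by (simp add: pbf_def vec_eq_iff sum_distrib_left mult.assoc[symmetric])

lemma GG_scale: "(!!j. c *s W j (Phi p) = A j (Phi p)) ==> c *s GG W j p = GG A j p"
 using pbf_scale[of c "W j" p "A j"] by (auto simp: GG_def vec_eq_iff forall_3)

lemma holo_GG:
 assumes A: "!!j k. holo (%z. A j z $ k) B" and Q: "open Q" "Q \<subseteq> Om" "!!p. p \<in> Q ==> Phi p \<in> B"
 shows "holo (%p. GG A j p $ k) Q"
proof -
 have P: "holo (%p. Phi p $ i) Q" for i by (rule holo_subset[OF holo_Phi Q(1,2)])
 have AP: "holo (%p. A j (Phi p) $ k) Q" for j k by (rule holo_compose[OF A Q(1) P Q(3)])
 have dP: "holo (dPhi k i) Q" for k i by (rule holo_subset[OF holo_dPhi Q(1,2)])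
 have "holo (pbf (A j) i) Q" for i unfolding pbf_def[abs_def] by (rule holo_sum[OF Q(1) holo_mult[OF AP dP]])
 then have "\<forall>k. holo (%p. (vector [pbf (A j) 1 p, pbf (A j) 2 p, pbf (A j) 3 p] :: complex^3) $ k) Q" unfolding forall_3 by simp
 then show ?thesis using AP by (cases "j = 1 | j = 2") (simp_all add: GG_def)
qed

text \<open>Composed with \<open>Phi\<close> the denominator cannot vanish on a whole box: the image
  of the box contains an open set, and the denominator would be identically zero.\<close>

lemma frame_box:
 assumes frame: "frame_pack ex w E f U W" and t: "vector [0, t] \<in> S2" "Phi (pt 0 t 0 0) \<in> U" "jac (vector [0, t]) ~= 0"
 shows "\<exists>rho>0. \<exists>A h. tbox t rho rho \<subseteq> Om Int Phi -` U & (\<forall>j i. holo (%p. A j p $ i) (tbox t rho rho)) &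
    holo h (tbox t rho rho) & (\<exists>p\<in>tbox t rho rho. h p ~= 0) &
    (\<forall>p\<in>tbox t rho rho. h p ~= 0 --> (\<forall>j. h p *s GG W j p = A j p) & frame_local ex E f W (Phi p))"
proof -
 let ?p0 = "pt 0 t 0 0"
 have loc: "\<forall>a\<in>U. \<exists>r>0. \<exists>A h. ball a r \<subseteq> U & (\<forall>j k. holo (%z. A j z $ k) (ball a r)) & holo h (ball a r) &
    (\<exists>z\<in>ball a r. h z ~= 0) &
    (\<forall>z\<in>ball a r. h z ~= 0 --> (\<forall>j. h z *s W j z = A j z) & frame_local ex E f W z)" using frame by (simp add: frame_pack_def)
 obtain r A h where r: "r > 0" and *: "ball (Phi ?p0) r \<subseteq> U & (\<forall>j k. holo (%z. A j z $ k) (ball (Phi ?p0) r)) & holo h (ball (Phi ?p0) r) &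
    (\<exists>z\<in>ball (Phi ?p0) r. h z ~= 0) &
    (\<forall>z\<in>ball (Phi ?p0) r. h z ~= 0 --> (\<forall>j. h z *s W j z = A j z) & frame_local ex E f W z)"
  using bspec[OF loc t(2)] by (elim exE conjE) (rule that, assumption, intro conjI)
 let ?b = "ball (Phi ?p0) r"
 have rU: "?b \<subseteq> U" and A: "!!j k. holo (%z. A j z $ k) ?b" and h: "holo h ?b" "\<exists>z\<in>?b. h z ~= 0" using * by simp_all
 have eq: "(\<forall>j. h z *s W j z = A j z) & frame_local ex E f W z" if "z \<in> ?b" "h z ~= 0" for z using * that by simp
 have "open (Om Int Phi -` ?b)" by (rule continuous_open_preimage[OF continuous_Phi open_Om open_ball])
 moreover have "?p0 \<in> Om Int Phi -` ?b" using t(1) r by (simp add: Om_def)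
 ultimately obtain e where e: "e > 0" "ball ?p0 e \<subseteq> Om Int Phi -` ?b" by (rule openE)
 \<comment> \<open>Four coordinates of size below \<open>e / 4\<close> add up to less than
   \<open>e\<close>.\<close>
 define rho where "rho = e / 4"
 have rho: "rho > 0" using e by (simp add: rho_def)
 have sub: "tbox t rho rho \<subseteq> Om Int Phi -` ?b"
 proof
  fix p assume p: "p \<in> tbox t rho rho"
  have "norm (p - ?p0) <= (\<Sum>i\<in>UNIV. norm ((p - ?p0) $ i))" unfolding norm_vec_def by (rule L2_set_le_sum) simp
  also have "\<dots> < e" using p by (simp add: sum_4 tbox_def rho_def)
  finally show "p \<in> Om Int Phi -` ?b" using e(2) by (auto simp: dist_norm norm_minus_commute)
 qed
 have hP: "holo (%p. h (Phi p)) (tbox t rho rho)" by (rule holo_compose[OF h(1) open_tbox holo_subset[OF holo_Phi open_tbox]]) (use sub in auto)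
 have nz: "\<exists>p\<in>tbox t rho rho. h (Phi p) ~= 0"
 proof (rule ccontr)
  assume n: "~ ?thesis"
  have p0: "?p0 \<in> tbox t rho rho" using rho by simp
  obtain B' where B': "open B'" "Phi ?p0 \<in> B'" "B' \<subseteq> Phi ` tbox t rho rho"
   by (rule Phi_open_image[OF p0 open_tbox]) (use sub t(3) in auto)
  have "h z = 0" if "z \<in> ?b" for z by (rule holo_identity_convex[OF h(1) convex_ball B'(1,2) _ _ that]) (use B'(3) sub n in auto)
  then show False using h(2) by blast
 qed
 have "\<forall>p\<in>tbox t rho rho. h (Phi p) ~= 0 --> (\<forall>j. h (Phi p) *s GG W j p = GG A j p) & frame_local ex E f W (Phi p)"
 proof (intro ballI impI)
  fix p assume "p \<in> tbox t rho rho" "h (Phi p) ~= 0"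
  then have "(\<forall>j. h (Phi p) *s W j (Phi p) = A j (Phi p)) & frame_local ex E f W (Phi p)" using eq sub by auto
  then show "(\<forall>j. h (Phi p) *s GG W j p = GG A j p) & frame_local ex E f W (Phi p)" using GG_scale[where c = "h (Phi p)" and p = p and W = W and A = A] by simp
 qed
 moreover have "holo (%p. GG A j p $ i) (tbox t rho rho)" for j i by (rule holo_GG[OF A open_tbox]) (use sub in auto)
 moreover have "tbox t rho rho \<subseteq> Om Int Phi -` U" using sub rU by auto
 ultimately show ?thesis using rho hP nz by (intro exI[of _ rho] conjI exI[of _ "GG A"] exI[of _ "%p. h (Phi p)"] allI)
qed

end

lemma vec2_add_axis: "vector [a, b] + axis 1 z = (vector [a + z, b] :: complex^2)" "vector [a, b] + axis 2 z = (vector [a, b + z] :: complex^2)"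
 by (simp_all add: vec_eq_iff forall_2 axis_def)

lemma holo_vec2_deriv:
 fixes f :: "complex^2 => complex"
 assumes "holo f S" "vector [a, b] \<in> S"
 shows "((%z. f (vector [z, b])) has_field_derivative pd f 1 (vector [a, b])) (at a)"
  "((%z. f (vector [a, z])) has_field_derivative pd f 2 (vector [a, b])) (at b)"
 using holo_slice_deriv[OF assms(1), of "vector [0, b]" 1 a] holo_slice_deriv[OF assms(1), of "vector [a, 0]" 2 b] assms(2)
 by (simp_all add: vec2_add_axis)

lemma open_vec2_vimage: "open S ==> open {z. vector [a, z] \<in> (S :: (complex^2) set)}" "open S ==> open {z. vector [z, a] \<in> (S :: (complex^2) set)}"
proof -
 have "continuous_on UNIV (%z::complex. (vector [a, z] :: complex^2) $ i)" "continuous_on UNIV (%z::complex. (vector [z, a] :: complex^2) $ i)" for i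
  using exhaust_2[of i] by (auto intro: continuous_intros)
 then have "continuous_on UNIV (%z::complex. vector [a, z] :: complex^2)" "continuous_on UNIV (%z::complex. vector [z, a] :: complex^2)"
  by (auto intro: continuous_on_vec_components)
 then show "open S ==> open {z. vector [a, z] \<in> (S :: (complex^2) set)}" "open S ==> open {z. vector [z, a] \<in> (S :: (complex^2) set)}"
  using open_vimage[of S] by (auto simp: vimage_def)
qed

lemma holo_vec2_slice:
 fixes f :: "complex^2 => complex"
 assumes "holo f S"
 shows "(%z. f (vector [a, z])) holomorphic_on {z. vector [a, z] \<in> S}"
proof (rule holo_slice[OF assms open_vec2_vimage(1)[OF holo_open[OF assms]]])
 show "(%z. vector [a, z] $ i) holomorphic_on {z. vector [a, z] \<in> S}" for i :: 2 using exhaust_2[of i] by (auto intro!: holomorphic_intros)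
qed simp

section \<open>The continued family of orbits near the resonant one\<close>

locale resonance =
 fixes \<nu> :: real
  and H :: "real^2 => real"
  and x :: "real => real => real^2" and T :: "real => real"
  and \<alpha>1 \<alpha>2 \<alpha>s T' P :: real and l n :: nat
  and W :: "(complex^2) set" and Hc :: "complex^2 => complex"
  and \<Theta> :: "complex set" and xc :: "complex => complex => complex^2"
  and xs :: "complex => complex^2"
 assumes \<nu>: "\<nu> > 0"
  and contH: "analytic_continuation W Hc H"
  and sol: "!!\<alpha> t. \<alpha> \<in> {\<alpha>1<..<\<alpha>2} ==>
     (x \<alpha> has_vector_derivative Jmat *v grad H (x \<alpha> t)) (at t)"
  and T_pos: "!!\<alpha>. \<alpha> \<in> {\<alpha>1<..<\<alpha>2} ==> T \<alpha> > 0"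
  and per: "!!\<alpha> t. \<alpha> \<in> {\<alpha>1<..<\<alpha>2} ==> x \<alpha> (t + T \<alpha>) = x \<alpha> t"
  and ln: "l > 0" "n > 0"
  and \<alpha>s: "\<alpha>s \<in> {\<alpha>1<..<\<alpha>2}"
  and res: "2 * pi / T \<alpha>s = real n / real l * \<nu>"
  and T': "(T has_real_derivative T') (at \<alpha>s)" "T' ~= 0"
  and P_def: "P = 2 * pi * real l / \<nu>"
  and \<Theta>: "open \<Theta>" "connected \<Theta>" "range complex_of_real \<subseteq> \<Theta>"
  and xc: "!!\<alpha> t. \<alpha> \<in> {\<alpha>1<..<\<alpha>2} ==> xc (of_real \<alpha>) (of_real t) = complexify (x \<alpha> t)"
  and xs_def: "xs = xc (of_real \<alpha>s)"
  and mero: "!!i. (%\<tau>. xs \<tau> $ i) meromorphic_on \<Theta>"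
  and ana: "!!\<tau> i. \<tau> \<in> \<Theta> ==> finite_at xs \<tau> ==>
     multi_analytic_on (%a::complex^2. xc (a $ 1) (a $ 2) $ i) {vector [of_real \<alpha>s, \<tau>]}"
begin

definition Xv :: "complex^2 => complex^2" where "Xv q = xc (of_real \<alpha>s + q $ 1) (q $ 2)"
text \<open>The largest open set on which the continued family is holomorphic jointly in parameter
  and time.\<close>

definition S2 :: "(complex^2) set" where "S2 = \<Union>{B. open B & (\<forall>i. holo (%q. Xv q $ i) B)}"
text \<open>At resonance \<open>n\<close> periods of the orbit last as long as \<open>l\<close>
  turns of the angle, so the \<open>n\<close>-fold period is the return time.\<close>

definition TT :: "real => real" where "TT b = real n * T (\<alpha>s + b)"
definition hh :: "complex^2 => complex^2" where "hh q = Jmat *v grad Hc (Xv q)"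

lemma open_S2: "open S2" unfolding S2_def by (rule open_Union) simp

lemma holo_Xv: "holo (%q. Xv q $ i) S2" by (rule holo_local[OF open_S2]) (auto simp: S2_def)

sublocale c: chart Xv S2 "of_real \<nu>" 0 by unfold_locales (rule open_S2, rule holo_Xv)

lemma finite_real: "complex_of_real t \<in> \<Theta> & finite_at xs (of_real t)"
proof
 show *: "complex_of_real t \<in> \<Theta>" using \<Theta>(3) by blast
 show "finite_at xs (of_real t)" unfolding finite_at_def
 proof
  fix i
  have "isCont (x \<alpha>s) t" using sol[OF \<alpha>s] has_vector_derivative_continuous by blast
  then have "isCont (%s. complex_of_real (x \<alpha>s s $ i)) t" by (intro continuous_intros)
  then show "(%z. xs z $ i) analytic_on {complex_of_real t}"
   by (rule meromorphic_real_continuous_imp_analytic[OF mero *]) (simp add: xs_def xc[OF \<alpha>s] complexify_def)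
 qed
qed

lemma finite_S2:
 assumes "\<tau> \<in> \<Theta>" "finite_at xs \<tau>"
 shows "vector [0, \<tau>] \<in> S2"
proof -
 let ?a = "vector [of_real \<alpha>s, \<tau>] :: complex^2" and ?f = "%i (a::complex^2). xc (a $ 1) (a $ 2) $ i"
 obtain r1 where r1: "r1 > 0" "holo (?f 1) (ball ?a r1)" using multi_analytic_imp_holo[OF ana[OF assms, of 1]] by blast
 obtain r2 where r2: "r2 > 0" "holo (?f 2) (ball ?a r2)" using multi_analytic_imp_holo[OF ana[OF assms, of 2]] by blast
 define r where "r = min r1 r2"
 have r: "r > 0" using r1 r2 by (simp add: r_def)
 have "holo (?f 1) (ball ?a r)" by (rule holo_subset[OF r1(2) open_ball subset_ball]) (simp add: r_def)
 moreover have "holo (?f 2) (ball ?a r)" by (rule holo_subset[OF r2(2) open_ball subset_ball]) (simp add: r_def)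
 ultimately have "\<forall>i. holo (?f i) (ball ?a r)" unfolding forall_2 by simp
 then have hi: "holo (?f i) (ball ?a r)" for i by simp
 let ?s = "vector [of_real \<alpha>s, 0] :: complex^2"
 have "holo (%q. ?f i (q + ?s)) (ball (vector [0, \<tau>]) r)" for i
 proof (rule holo_translate[OF hi open_ball])
  fix p :: "complex^2" assume "p \<in> ball (vector [0, \<tau>]) r"
  moreover have "?a - (p + ?s) = vector [0, \<tau>] - p" by (simp add: vec_eq_iff forall_2)
  ultimately show "p + ?s \<in> ball ?a r" by (simp only: mem_ball dist_norm)
 qed
 then have "holo (%q. Xv q $ i) (ball (vector [0, \<tau>]) r)" for i by (simp add: Xv_def add.commute)
 then show ?thesis unfolding S2_def using r by (intro UnionI[of "ball (vector [0, \<tau>]) r"]) auto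
qed

lemma real_S2: "vector [0, complex_of_real t] \<in> S2" using finite_S2 finite_real by blast

abbreviation "I \<equiv> {b. \<alpha>s + b \<in> {\<alpha>1<..<\<alpha>2}}"

lemma Xv_real: "b \<in> I ==> Xv (vector [of_real b, of_real t]) = complexify (x (\<alpha>s + b) t)"
 using xc[of "\<alpha>s + b" t] by (simp add: Xv_def)

lemma X2_real:
 assumes b: "b \<in> I" and S: "vector [of_real b, of_real t] \<in> S2"
 shows "c.X2 (vector [of_real b, of_real t]) = complexify (Jmat *v grad H (x (\<alpha>s + b) t))"
proof -
 have "c.X2 (vector [of_real b, of_real t]) $ i = of_real ((Jmat *v grad H (x (\<alpha>s + b) t)) $ i)" for i
 proof -
  let ?D = "c.X2 (vector [of_real b, of_real t]) $ i"
  have D: "((%z. Xv (vector [of_real b, z]) $ i) has_field_derivative ?D) (at (of_real t))"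
   using holo_vec2_deriv(2)[OF holo_Xv S] by (simp add: c.X2_def)
  have e: "\<forall>\<^sub>F s in nhds t. Xv (vector [of_real b, of_real s]) $ i = of_real (x (\<alpha>s + b) s $ i)"
   using Xv_real[OF b] by (simp add: complexify_def)
  have "((%s. x (\<alpha>s + b) s $ i) has_vector_derivative (Jmat *v grad H (x (\<alpha>s + b) t)) $ i) (at t)"
   using b by (intro bounded_linear.has_vector_derivative[OF bounded_linear_vec_nth sol]) simp
  then have "((%s. x (\<alpha>s + b) s $ i) has_real_derivative (Jmat *v grad H (x (\<alpha>s + b) t)) $ i) (at t)"
   by (simp add: has_real_derivative_iff_has_vector_derivative)
  then have "Re ?D = (Jmat *v grad H (x (\<alpha>s + b) t)) $ i" using complex_deriv_along_reals(1)[OF D e] DERIV_unique by blast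
  then show ?thesis using complex_deriv_along_reals(2)[OF D e] by simp
 qed
 then show ?thesis by (simp add: vec_eq_iff complexify_def)
qed

lemma W: "open W" "multi_analytic_on Hc W" "complexify y \<in> W" "Hc (complexify y) = of_real (H y)"
 using contH by (simp_all add: analytic_continuation_def)

lemma holo_Hc: "holo Hc W" by (rule multi_analytic_on_imp_holo[OF W(2,1)])

lemma grad_Hc_real: "grad Hc (complexify y) = complexify (grad H y)"
proof -
 have "pd Hc k (complexify y) = of_real (pd H k y)" for k
 proof -
  let ?D = "pd Hc k (complexify y)"
  have D: "((%z. Hc (complexify y + axis k z)) has_field_derivative ?D) (at (of_real 0))"
   using holo_slice_deriv[OF holo_Hc, of "complexify y" k 0] W(3) by simp
  have a: "complexify y + axis k (of_real s) = complexify (y + axis k s)" for s by (simp add: vec_eq_iff complexify_def axis_def)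
  have e: "\<forall>\<^sub>F s in nhds 0. Hc (complexify y + axis k (of_real s)) = of_real (H (y + axis k s))" unfolding a W(4) by simp
  have "pd H k y = Re ?D" unfolding partial_deriv_def[of H] by (rule DERIV_imp_deriv[OF complex_deriv_along_reals(1)[OF D e]])
  then show ?thesis using complex_deriv_along_reals(2)[OF D e] by simp
 qed
 then show ?thesis by (simp add: vec_eq_iff grad_def complexify_def)
qed

lemma hh_nth: "hh q $ 1 = pd Hc 2 (Xv q)" "hh q $ 2 = - pd Hc 1 (Xv q)" by (simp_all add: hh_def Jmat_def matrix_vector_mult_def sum_2 grad_def)

lemma X2_hh_real:
 assumes b: "b \<in> I" and S: "vector [of_real b, of_real t] \<in> S2"
 shows "c.X2 (vector [of_real b, of_real t]) = hh (vector [of_real b, of_real t])" unfolding X2_real[OF assms] hh_def Xv_real[OF b] grad_Hc_real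
 by (simp add: vec_eq_iff forall_2 complexify_def Jmat_def matrix_vector_mult_def sum_2)

definition gg :: "2 => complex^2 => complex" where
 "gg i y = (if i = 1 then pd Hc 2 y else - pd Hc 1 y)"

lemma holo_gg: "holo (gg i) W" unfolding gg_def[abs_def] using holo_partial_deriv[OF holo_Hc] holo_uminus[OF holo_partial_deriv[OF holo_Hc]]
 by (cases "i = 1") simp_all

lemma hh_gg: "hh q $ i = gg i (Xv q)" using exhaust_2[of i] by (auto simp: gg_def hh_nth)

lemma pol_open_exists:
 assumes "open S" "0 \<in> S"
 obtains r where "r > 0" "pol r 0 r \<subseteq> S"
proof -
 obtain e where e: "e > 0" "ball 0 e \<subseteq> S" using assms openE by blast
 have "pol (e / 2) 0 (e / 2) \<subseteq> ball 0 e"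
 proof
  fix q :: "complex^2" assume q: "q \<in> pol (e / 2) 0 (e / 2)"
  have "norm q <= norm (q $ 1) + norm (q $ 2)" unfolding norm_vec_def by (rule order_trans[OF L2_set_le_sum]) (simp_all add: sum_2)
  then show "q \<in> ball 0 e" using q by (simp add: pol_def)
 qed
 then show thesis using that[of "e / 2"] e by auto
qed

lemma vec2_0: "vector [0, 0] = (0 :: complex^2)" by (simp add: vec_eq_iff forall_2)

text \<open>Both sides of the equation are holomorphic near the origin and agree at real
  arguments.\<close>

lemma ode_near_0:
 obtains r0 where "r0 > 0" "pol r0 0 r0 \<subseteq> S2" "!!q. q \<in> pol r0 0 r0 ==> Xv q \<in> W"
  "!!q. q \<in> pol r0 0 r0 ==> c.X2 q = hh q" "!!b. \<bar>b\<bar> < r0 ==> b \<in> I"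
proof -
 have cX: "continuous_on S2 Xv" by (rule continuous_on_vec_components) (rule holo_cont[OF holo_Xv])
 have op: "open (S2 Int Xv -` W)" by (rule continuous_open_preimage[OF cX open_S2 W(1)])
 have "b0 \<in> I" if "b0 = 0" for b0 using \<alpha>s that by simp
 then have "Xv (vector [of_real 0, of_real 0]) = complexify (x (\<alpha>s + 0) 0)" by (intro Xv_real) simp
 then have "0 \<in> S2 Int Xv -` W" using real_S2[of 0] W(3) by (simp add: vec2_0)
 then obtain r1 where r1: "r1 > 0" "pol r1 0 r1 \<subseteq> S2 Int Xv -` W" by (rule pol_open_exists[OF op])
 define r0 where "r0 = min r1 (min (\<alpha>s - \<alpha>1) (\<alpha>2 - \<alpha>s))"
 have r0: "r0 > 0" using r1 \<alpha>s by (simp add: r0_def)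
 have sub: "pol r0 0 r0 \<subseteq> S2 Int Xv -` W" using r1(2) by (auto simp: pol_def r0_def)
 have bI: "b \<in> I" if "\<bar>b\<bar> < r0" for b using that by (auto simp: r0_def)
 have "c.X2 q $ i - hh q $ i = 0" if q: "q \<in> pol r0 0 r0" for q i
 proof (rule holo_real_zero[OF _ r0 _ q])
  have hg: "holo (%q. gg i (Xv q)) (pol r0 0 r0)" by (rule holo_compose[OF holo_gg open_pol holo_subset[OF holo_Xv open_pol]]) (use sub in auto)
  show "holo (%q. c.X2 q $ i - hh q $ i) (pol r0 0 r0)"
   unfolding hh_gg by (rule holo_diff[OF holo_subset[OF c.holo_X2 open_pol] hg]) (use sub in auto)
  show "c.X2 (vector [of_real b, of_real t]) $ i - hh (vector [of_real b, of_real t]) $ i = 0" if "\<bar>b\<bar> < r0" "\<bar>t\<bar> < r0" for b t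
  proof -
   have "vector [of_real b, of_real t] \<in> pol r0 0 r0" using that by (simp add: pol_def)
   then have "vector [of_real b, of_real t] \<in> S2" using sub by blast
   then show ?thesis using X2_hh_real[OF bI[OF that(1)], of t] by simp
  qed
 qed
 then have "c.X2 q = hh q" if "q \<in> pol r0 0 r0" for q using that by (simp add: vec_eq_iff)
 then show thesis using that[OF r0] sub bI by auto
qed

lemma compose_Xv_partial:
 assumes g: "holo g W" and q: "q \<in> S2" "Xv q \<in> W"
 shows "pd (%q. g (Xv q)) k q = (\<Sum>m\<in>UNIV. pd g m (Xv q) * pd (%q. Xv q $ m) k q)"
proof -
 have "has_cgrad (%q. g (Xv q)) (\<Sum>m\<in>UNIV. grad g (Xv q) $ m *s grad (%q. Xv q $ m) q) q"
  by (rule has_cgrad_compose[OF holo_has_cgrad[OF g q(2)] holo_has_cgrad[OF holo_Xv q(1)]])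
 from has_cgrad_partial(2)[OF this, of k] show ?thesis by (simp add: grad_def sum_2)
qed

text \<open>The variational equation, obtained by differentiating the Hamiltonian equation in either
  variable of \<open>Xv\<close>.\<close>

lemma X_linear_ode:
 assumes r0: "pol r0 0 r0 \<subseteq> S2" "!!q. q \<in> pol r0 0 r0 ==> Xv q \<in> W" "!!q. q \<in> pol r0 0 r0 ==> c.X2 q = hh q"
  and q: "q \<in> pol r0 0 r0" shows "pd (%q. c.X2 q $ i) 2 q = pd (gg i) 1 (Xv q) * c.X2 q $ 1 + pd (gg i) 2 (Xv q) * c.X2 q $ 2"
  "pd (%q. c.X1 q $ i) 2 q = pd (gg i) 1 (Xv q) * c.X1 q $ 1 + pd (gg i) 2 (Xv q) * c.X1 q $ 2"
proof -
 have qS: "q \<in> S2" using q r0(1) by blast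
 have *: "pd (%q. c.X2 q $ i) k q = pd (%q. gg i (Xv q)) k q" for k by (rule partial_deriv_cong[OF open_pol q]) (use r0(3) hh_gg in simp)
 show "pd (%q. c.X2 q $ i) 2 q = pd (gg i) 1 (Xv q) * c.X2 q $ 1 + pd (gg i) 2 (Xv q) * c.X2 q $ 2"
  unfolding * compose_Xv_partial[OF holo_gg qS r0(2)[OF q]] by (simp add: sum_2 c.X2_def)
 have "pd (%q. c.X1 q $ i) 2 q = pd (%q. c.X2 q $ i) 1 q" unfolding c.X1_def c.X2_def using partial_deriv_commute[OF holo_Xv qS] by simp
 then show "pd (%q. c.X1 q $ i) 2 q = pd (gg i) 1 (Xv q) * c.X1 q $ 1 + pd (gg i) 2 (Xv q) * c.X1 q $ 2"
  unfolding * compose_Xv_partial[OF holo_gg qS r0(2)[OF q]] by (simp add: sum_2 c.X1_def)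
qed

text \<open>Along the family \<open>H\<close> has \<open>b\<close>-derivative \<open>- jac\<close>
  and time derivative 0; interchanging the two derivatives shows that \<open>jac\<close> does not
  depend on time.\<close>

lemma jac_const_near_0:
 assumes r0: "r0 > 0" "pol r0 0 r0 \<subseteq> S2" "!!q. q \<in> pol r0 0 r0 ==> Xv q \<in> W" "!!q. q \<in> pol r0 0 r0 ==> c.X2 q = hh q"
  and b: "norm b < r0" and \<tau>: "norm \<tau> < r0" shows "c.jac (vector [b, \<tau>]) = c.jac (vector [b, 0])"
proof -
 let ?B = "pol r0 0 r0"
 have hF: "holo (%q. Hc (Xv q)) ?B" by (rule holo_compose[OF holo_Hc open_pol holo_subset[OF holo_Xv open_pol r0(2)] r0(3)])
 have p1: "pd (%q. Hc (Xv q)) 1 q = - c.jac q" and p2: "pd (%q. Hc (Xv q)) 2 q = 0" if q: "q \<in> ?B" for q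
 proof -
  have *: "pd (%q. Hc (Xv q)) k q = (\<Sum>m\<in>UNIV. pd Hc m (Xv q) * pd (%q. Xv q $ m) k q)" for k
   using compose_Xv_partial[OF holo_Hc _ r0(3)[OF q]] q r0(2) by blast
  have X2: "c.X2 q $ 1 = pd Hc 2 (Xv q)" "c.X2 q $ 2 = - pd Hc 1 (Xv q)" using r0(4)[OF q] hh_nth by simp_all
  show "pd (%q. Hc (Xv q)) 1 q = - c.jac q" unfolding * c.jac_def X2 by (simp add: sum_2 c.X1_def algebra_simps)
  have "pd (%q. Hc (Xv q)) 2 q = pd Hc 1 (Xv q) * c.X2 q $ 1 + pd Hc 2 (Xv q) * c.X2 q $ 2" unfolding * by (simp add: sum_2 c.X2_def)
  then show "pd (%q. Hc (Xv q)) 2 q = 0" unfolding X2 by simp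
 qed
 have hj: "holo c.jac ?B" by (rule holo_subset[OF c.holo_jac open_pol r0(2)])
 have dj: "pd c.jac 2 q = 0" if q: "q \<in> ?B" for q
 proof -
  have "pd c.jac 2 q = pd (%q. - pd (%q. Hc (Xv q)) 1 q) 2 q" by (rule partial_deriv_cong[OF open_pol q]) (use p1 in simp)
  also have "\<dots> = - pd (%q. pd (%q. Hc (Xv q)) 1 q) 2 q"
   unfolding partial_deriv_def[of "%q. - pd (%q. Hc (Xv q)) 1 q"] partial_deriv_def[of "%q. pd (%q. Hc (Xv q)) 1 q"]
   by (rule DERIV_imp_deriv, rule DERIV_minus, rule DERIV_deriv_iff_field_differentiable[THEN iffD2])
    (use holo_slice_deriv[OF holo_partial_deriv[OF hF], of q 2 0] q in \<open>auto simp: field_differentiable_def\<close>)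
  also have "pd (%q. pd (%q. Hc (Xv q)) 1 q) 2 q = pd (%q. pd (%q. Hc (Xv q)) 2 q) 1 q" by (rule partial_deriv_commute[OF hF q])
  also have "\<dots> = pd (%q. 0) 1 q" by (rule partial_deriv_cong[OF open_pol q]) (use p2 in simp)
  finally show ?thesis by (simp add: partial_deriv_def)
 qed
 have "\<exists>c. \<forall>\<tau>\<in>ball 0 r0. c.jac (vector [b, \<tau>]) = c"
 proof (rule has_field_derivative_zero_constant[OF convex_ball])
  fix \<tau> :: complex assume "\<tau> \<in> ball 0 r0"
  then have "vector [b, \<tau>] \<in> ?B" using b by (simp add: pol_def)
  from holo_vec2_deriv(2)[OF hj this] dj[OF this]
  show "((%\<tau>. c.jac (vector [b, \<tau>])) has_field_derivative 0) (at \<tau> within ball 0 r0)" by (simp add: has_field_derivative_at_within)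
 qed
 then show ?thesis using \<tau> r0(1) by auto
qed

lemma TT_0: "TT 0 = P" using res ln \<nu> T_pos[OF \<alpha>s] by (simp add: TT_def P_def field_simps)

lemma x_period: "b \<in> I ==> x (\<alpha>s + b) (t + TT b) = x (\<alpha>s + b) t"
proof -
 assume b: "b \<in> I"
 have "x (\<alpha>s + b) (t + real k * T (\<alpha>s + b)) = x (\<alpha>s + b) t" for k
 proof (induction k)
  case (Suc k)
  have "x (\<alpha>s + b) (t + real (Suc k) * T (\<alpha>s + b)) = x (\<alpha>s + b) ((t + real k * T (\<alpha>s + b)) + T (\<alpha>s + b))"
   by (simp add: algebra_simps)
  then show ?case using per[of "\<alpha>s + b"] b Suc by simp
 qed simp
 then show ?thesis by (simp add: TT_def)
qed

lemma Xv_period: "b \<in> I ==> Xv (vector [of_real b, of_real (t + TT b)]) = Xv (vector [of_real b, of_real t])"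
 using Xv_real[of b t] Xv_real[of b "t + TT b"] x_period[of b t] by (simp del: of_real_add)

lemma X2_period:
 assumes "b \<in> I" "vector [of_real b, of_real (t + TT b)] \<in> S2" "vector [of_real b, of_real t] \<in> S2"
 shows "c.X2 (vector [of_real b, of_real (t + TT b)]) = c.X2 (vector [of_real b, of_real t])"
 using X2_real[OF assms(1,2)] X2_real[OF assms(1,3)] x_period[OF assms(1), of t] by simp

text \<open>Differentiating the periodicity relation in \<open>b\<close> also differentiates the
  return time, which contributes the multiple of the velocity.\<close>

lemma X1_period:
 assumes b: "b \<in> I" and S: "vector [of_real b, of_real (t + TT b)] \<in> S2" "vector [of_real b, of_real t] \<in> S2"
  and d: "(TT has_real_derivative d) (at b)"
 shows "c.X1 (vector [of_real b, of_real (t + TT b)]) = c.X1 (vector [of_real b, of_real t]) - of_real d *s c.X2 (vector [of_real b, of_real t])"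
proof -
 have curve: "((%s. Xv (vector [of_real s, of_real (\<tau> s)]) $ i) has_vector_derivative
   c.X1 (vector [of_real b, of_real (\<tau> b)]) $ i + of_real e * c.X2 (vector [of_real b, of_real (\<tau> b)]) $ i) (at b)"
  if \<tau>: "(\<tau> has_real_derivative e) (at b)" and S: "vector [of_real b, of_real (\<tau> b)] \<in> S2" for \<tau> e i
 proof -
  let ?c = "%s. vector [of_real s, of_real (\<tau> s)] :: complex^2"
  have "((%s. Xv (?c s) $ i) has_derivative (%h. bdot (grad (%q. Xv q $ i) (?c b)) (vector [of_real h, of_real (h * e)]))) (at b)"
  proof (rule diff_chain_at[unfolded o_def, where f = ?c and g = "%q. Xv q $ i"])
   show "((%q. Xv q $ i) has_derivative bdot (grad (%q. Xv q $ i) (?c b))) (at (?c b))"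
    using holo_has_cgrad[OF holo_Xv S] by (simp add: has_cgrad_def)
   show "(?c has_derivative (%h. vector [of_real h, of_real (h * e)])) (at b)"
   proof (rule has_derivative_vec_componentwise)
    have 1: "((%s. complex_of_real s) has_derivative (%h. of_real h)) (at b)" by (rule has_derivative_of_real) simp
    have 2: "((%s. complex_of_real (\<tau> s)) has_derivative (%h. of_real (h * e))) (at b)"
     by (rule has_derivative_of_real) (use \<tau> in \<open>simp add: has_field_derivative_def mult_commute_abs\<close>)
    show "((%s. ?c s $ k) has_derivative (%h. (vector [of_real h, of_real (h * e)] :: complex^2) $ k)) (at b)" for k
     using exhaust_2[of k] 1 2 by auto
   qed
  qed
  then show ?thesis unfolding has_vector_derivative_def
   by (rule has_derivative_eq_rhs) (simp add: fun_eq_iff bdot_def sum_2 c.X1_def c.X2_def grad_def scaleR_conv_of_real algebra_simps)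
 qed
 have "c.X1 (vector [of_real b, of_real (t + TT b)]) $ i + of_real d * c.X2 (vector [of_real b, of_real (t + TT b)]) $ i =
   c.X1 (vector [of_real b, of_real t]) $ i" for i
 proof -
  have 1: "((%s. Xv (vector [of_real s, of_real (t + TT s)]) $ i) has_vector_derivative
   c.X1 (vector [of_real b, of_real (t + TT b)]) $ i + of_real d * c.X2 (vector [of_real b, of_real (t + TT b)]) $ i) (at b)"
   by (rule curve[where \<tau> = "%s. t + TT s", OF _ S(1)]) (use d in \<open>auto intro!: derivative_eq_intros\<close>)
  have 2: "((%s. Xv (vector [of_real s, of_real t]) $ i) has_vector_derivative
   c.X1 (vector [of_real b, of_real t]) $ i + of_real 0 * c.X2 (vector [of_real b, of_real t]) $ i) (at b)"
   by (rule curve[where \<tau> = "%s. t", OF _ S(2)]) simp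
  have "I = {\<alpha>1 - \<alpha>s<..<\<alpha>2 - \<alpha>s}" by auto
  then have oI: "open I" by simp
  have "((%s. Xv (vector [of_real s, of_real t]) $ i) has_vector_derivative
   c.X1 (vector [of_real b, of_real (t + TT b)]) $ i + of_real d * c.X2 (vector [of_real b, of_real (t + TT b)]) $ i) (at b)"
   by (rule has_vector_derivative_transform_within_open[OF 1 oI b]) (use Xv_period in simp)
  then show ?thesis using vector_derivative_unique_at[OF 2] by simp
 qed
 then show ?thesis using X2_period[OF b S] by (simp add: vec_eq_iff eq_diff_eq)
qed

lemma TT_deriv_0: "(TT has_real_derivative real n * T') (at 0)"
proof -
 have "((%b. T (\<alpha>s + b)) has_real_derivative T') (at 0)" using DERIV_shift[of T T' 0 \<alpha>s] T'(1) by (simp add: add.commute)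
 then show ?thesis unfolding TT_def[abs_def] by (rule DERIV_cmult)
qed

lemma TT_ne: "\<exists>e>0. \<forall>b. b ~= 0 --> \<bar>b\<bar> < e --> TT b ~= P"
proof -
 have "((%b. (TT b - TT 0) / (b - 0)) \<longlongrightarrow> real n * T') (at 0)" using TT_deriv_0 by (simp add: has_field_derivative_iff)
 moreover have "real n * T' ~= 0" using ln T' by simp
 ultimately have "\<forall>\<^sub>F b in at 0. (TT b - TT 0) / (b - 0) ~= 0" by (rule tendsto_imp_eventually_ne)
 then obtain e where "e > 0" "\<forall>b. b ~= 0 & dist b 0 < e --> (TT b - TT 0) / (b - 0) ~= 0" unfolding eventually_at by auto
 then show ?thesis unfolding TT_0 by (intro exI[of _ e]) auto
qed

section \<open>Nondegeneracy of the chart and differentiability of the return time\<close>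

lemma identity_component:
 assumes f: "f holomorphic_on {\<tau>. vector [0, \<tau>] \<in> S2}" and r: "r > 0" "!!\<tau>. norm \<tau> < r ==> f \<tau> = 0"
  and K: "connected K" "0 \<in> K" "!!\<tau>. \<tau> \<in> K ==> vector [0, \<tau>] \<in> S2" and \<tau>: "\<tau> \<in> K" shows "f \<tau> = 0"
proof -
 let ?Z = "{\<tau>. vector [0, \<tau>] \<in> S2}"
 let ?C = "connected_component_set ?Z 0"
 have oZ: "open ?Z" by (rule open_vec2_vimage(1)[OF open_S2])
 have KC: "K \<subseteq> ?C" by (rule connected_component_maximal[OF K(2,1)]) (use K(3) in auto)
 show ?thesis
 proof (rule analytic_continuation_open[of "ball 0 r Int ?C" ?C f "%_. 0"])
  show "open (ball 0 r Int ?C)" "open ?C" using open_connected_component[OF oZ] by auto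
  show "connected ?C" by (rule connected_connected_component)
  have "0 \<in> ball 0 r Int ?C" using r(1) K(2) KC by auto
  then show "ball 0 r Int ?C ~= {}" by blast
  show "f holomorphic_on ?C" by (rule holomorphic_on_subset[OF f connected_component_subset])
 qed (use r KC \<tau> in auto)
qed

lemma variation_zero:
 assumes r0: "r0 > 0" "pol r0 0 r0 \<subseteq> S2" "!!q. q \<in> pol r0 0 r0 ==> Xv q \<in> W" "!!q. q \<in> pol r0 0 r0 ==> c.X2 q = hh q"
  and z0: "!!k. s * c.X1 0 $ k + t * c.X2 0 $ k = 0" and \<tau>: "norm \<tau> < r0"
 shows "s * c.X1 (vector [0, \<tau>]) $ k + t * c.X2 (vector [0, \<tau>]) $ k = 0"
proof -
 define y where "y k \<tau> = s * c.X1 (vector [0, \<tau>]) $ k + t * c.X2 (vector [0, \<tau>]) $ k" for k \<tau>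
 define a where "a k m \<tau> = pd (gg k) m (Xv (vector [0, \<tau>]))" for k m \<tau>
 have inp: "vector [0, \<tau>] \<in> pol r0 0 r0" if "\<tau> \<in> ball 0 r0" for \<tau> using that r0(1) by (simp add: pol_def)
 have sub: "ball 0 r0 \<subseteq> {\<tau>. vector [0, \<tau>] \<in> S2}" using inp r0(2) by blast
 have hy: "y k holomorphic_on {\<tau>. vector [0, \<tau>] \<in> S2}" for k
  unfolding y_def[abs_def] using holo_vec2_slice[OF c.holo_X1, of 0 k] holo_vec2_slice[OF c.holo_X2, of 0 k] by (intro holomorphic_intros)
 have "y k \<tau> = 0"
 proof (rule linear_ode_unique[where S = "ball 0 r0" and B = "ball 0 r0" and y = y and a = a and ?z0.0 = 0])
  show "y i holomorphic_on ball 0 r0" for i by (rule holomorphic_on_subset[OF hy sub])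
  show "a i j holomorphic_on ball 0 r0" for i j
  proof -
   have "holo (%q. pd (gg i) j (Xv q)) (pol r0 0 r0)"
    by (rule holo_compose[OF holo_partial_deriv[OF holo_gg] open_pol holo_subset[OF holo_Xv open_pol r0(2)] r0(3)])
   from holo_vec2_slice[OF this, of 0] show ?thesis unfolding a_def[abs_def] by (rule holomorphic_on_subset) (use inp in auto)
  qed
  show "deriv (y i) z = a i 1 z * y 1 z + a i 2 z * y 2 z" if z: "z \<in> ball 0 r0" for i z
  proof -
   have S: "vector [0, z] \<in> S2" using sub z by auto
   have "(y i has_field_derivative s * pd (%q. c.X1 q $ i) 2 (vector [0, z]) + t * pd (%q. c.X2 q $ i) 2 (vector [0, z])) (at z)"
    unfolding y_def[abs_def]
    by (rule DERIV_add[OF DERIV_cmult[OF holo_vec2_deriv(2)[OF c.holo_X1 S]] DERIV_cmult[OF holo_vec2_deriv(2)[OF c.holo_X2 S]]])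
   note d = DERIV_imp_deriv[OF this]
   show ?thesis unfolding d by (simp add: X_linear_ode[OF r0(2-4) inp[OF z]]) (simp add: y_def a_def algebra_simps)
  qed
  show "y i 0 = 0" for i using z0[of i] by (simp add: y_def vec2_0)
 qed (use \<tau> r0 in auto)
 then show ?thesis by (simp add: y_def)
qed

text \<open>If \<open>jac\<close> were 0, \<open>X1\<close> would be a multiple of the velocity at
  time 0, and then along the real line because both solve the variational equation. Yet after the
  time \<open>P\<close> it has changed by \<open>n * T'\<close> times the velocity, and
  \<open>T' \<noteq> 0\<close>.\<close>

lemma jac_nonzero:
 assumes X2: "c.X2 0 ~= 0"
 shows "c.jac 0 ~= 0"
proof
 assume j: "c.jac 0 = 0"
 obtain r0 where r0: "r0 > 0" "pol r0 0 r0 \<subseteq> S2" "!!q. q \<in> pol r0 0 r0 ==> Xv q \<in> W"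
  "!!q. q \<in> pol r0 0 r0 ==> c.X2 q = hh q" "!!b. \<bar>b\<bar> < r0 ==> b \<in> I" by (rule ode_near_0) (rule that)
 obtain i where i: "c.X2 0 $ i ~= 0" using X2 by (auto simp: vec_eq_iff)
 define \<kappa> where "\<kappa> = c.X1 0 $ i / c.X2 0 $ i"
 have e: "c.X1 0 $ 1 * c.X2 0 $ 2 = c.X1 0 $ 2 * c.X2 0 $ 1" using j by (simp add: c.jac_def)
 have z0: "c.X1 0 $ k - \<kappa> * c.X2 0 $ k = 0" for k using exhaust_2[of i] exhaust_2[of k] i e by (auto simp: \<kappa>_def field_simps)
 define y where "y k \<tau> = c.X1 (vector [0, \<tau>]) $ k - \<kappa> * c.X2 (vector [0, \<tau>]) $ k" for k \<tau>
 have hy: "y k holomorphic_on {\<tau>. vector [0, \<tau>] \<in> S2}" for k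
  unfolding y_def[abs_def] using holo_vec2_slice[OF c.holo_X1, of 0 k] holo_vec2_slice[OF c.holo_X2, of 0 k] by (intro holomorphic_intros)
 have z: "y k \<tau> = 0" if "norm \<tau> < r0" for k \<tau>
  using variation_zero[OF r0(1-4), of 1 "- \<kappa>" \<tau> k] z0 that by (simp add: y_def)
 have eqP: "y k (of_real P) = 0" for k
 proof (rule identity_component[OF hy r0(1) z, of "range complex_of_real"])
  show "connected (range complex_of_real)" by (rule connected_continuous_image) (auto intro: continuous_intros)
 qed (use real_S2 in auto)
 have I0: "0 \<in> I" using \<alpha>s by simp
 have XP: "c.X1 (vector [0, of_real P]) = c.X1 0 - of_real (real n * T') *s c.X2 0" "c.X2 (vector [0, of_real P]) = c.X2 0"
  using X1_period[OF I0, of 0, OF _ _ TT_deriv_0] X2_period[OF I0, of 0] real_S2[of P] real_S2[of 0] by (simp_all add: TT_0 vec2_0)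
 have "y i (of_real P) = (c.X1 0 $ i - \<kappa> * c.X2 0 $ i) - of_real (real n * T') * c.X2 0 $ i" unfolding y_def XP by simp
 then show False using eqP[of i] z0[of i] i ln T' by simp
qed

text \<open>A vanishing velocity makes the continued orbit an equilibrium, where the gradient of
  \<open>H\<close>, and with it the Melnikov integrand, is zero.\<close>

lemma X2_nonzero:
 assumes mel: "melnikov_integral Hc uc \<nu> xs \<phi> \<gamma> ~= 0" and K: "connected K" "0 \<in> K" "!!\<tau>. \<tau> \<in> K ==> \<tau> \<in> \<Theta> & finite_at xs \<tau>"
  and \<gamma>: "path_image \<gamma> \<subseteq> K" shows "c.X2 0 ~= 0"
proof
 assume z0: "c.X2 0 = 0"
 obtain r0 where r0: "r0 > 0" "pol r0 0 r0 \<subseteq> S2" "!!q. q \<in> pol r0 0 r0 ==> Xv q \<in> W"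
  "!!q. q \<in> pol r0 0 r0 ==> c.X2 q = hh q" "!!b. \<bar>b\<bar> < r0 ==> b \<in> I" by (rule ode_near_0) (rule that)
 have inp: "vector [0, \<tau>] \<in> pol r0 0 r0" if "\<tau> \<in> ball 0 r0" for \<tau> using that r0(1) by (simp add: pol_def)
 have sub: "ball 0 r0 \<subseteq> {\<tau>. vector [0, \<tau>] \<in> S2}" using inp r0(2) by blast
 have KS: "vector [0, \<tau>] \<in> S2" if "\<tau> \<in> K" for \<tau> using finite_S2 K(3)[OF that] by blast
 define y where "y k \<tau> = c.X2 (vector [0, \<tau>]) $ k" for k \<tau>
 have z: "y k \<tau> = 0" if "norm \<tau> < r0" for k \<tau> using variation_zero[OF r0(1-4), of 0 1 \<tau> k] z0 that by (simp add: y_def)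
 define f where "f k \<tau> = Xv (vector [0, \<tau>]) $ k - Xv 0 $ k" for k \<tau>
 have hf: "f k holomorphic_on {\<tau>. vector [0, \<tau>] \<in> S2}" for k
  unfolding f_def[abs_def] using holo_vec2_slice[OF holo_Xv, of 0 k] by (intro holomorphic_intros)
 have fz: "f k \<tau> = 0" if "norm \<tau> < r0" for k \<tau>
 proof -
  have "\<exists>c. \<forall>\<tau>\<in>ball 0 r0. f k \<tau> = c"
  proof (rule has_field_derivative_zero_constant[OF convex_ball])
   fix \<tau> :: complex assume \<tau>: "\<tau> \<in> ball 0 r0"
   have "((%\<tau>. Xv (vector [0, \<tau>]) $ k - Xv 0 $ k) has_field_derivative y k \<tau> - 0) (at \<tau>)"
    unfolding y_def c.X2_def vec_lambda_beta by (rule DERIV_diff[OF holo_vec2_deriv(2)[OF holo_Xv] DERIV_const]) (use sub \<tau> in auto)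
   then show "(f k has_field_derivative 0) (at \<tau> within ball 0 r0)"
    unfolding f_def[abs_def] using z \<tau> by (simp add: has_field_derivative_at_within)
  qed
  moreover have "f k 0 = 0" by (simp add: f_def vec2_0)
  ultimately show ?thesis using that r0(1) by auto
 qed
 have const: "xs \<tau> = Xv 0" if "\<tau> \<in> K" for \<tau>
 proof -
  have "f k \<tau> = 0" for k by (rule identity_component[OF hf r0(1) fz K(1,2) KS that])
  then have "Xv (vector [0, \<tau>]) = Xv 0" by (simp add: f_def vec_eq_iff)
  then show ?thesis by (simp add: xs_def Xv_def)
 qed
 have "0 \<in> pol r0 0 r0" using r0(1) by (simp add: pol_def)
 then have "hh 0 = 0" using r0(4) z0 by metis
 then have "hh 0 $ 1 = 0" "hh 0 $ 2 = 0" by simp_all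
 then have "grad Hc (Xv 0) = 0" unfolding hh_nth by (simp add: vec_eq_iff forall_2 grad_def)
 then have "contour_integral \<gamma> (%\<tau>. bdot (grad Hc (xs \<tau>)) (uc (point (xs \<tau>) (of_real \<nu> * \<tau> + of_real \<phi>)))) = contour_integral \<gamma> (%\<tau>. 0)"
  by (intro contour_integral_eq) (use const \<gamma> in \<open>auto simp: bdot_def\<close>)
 then show False using mel by (simp add: melnikov_integral_def)
qed

text \<open>The return time is an implicit function: a component of the position takes at that time
  its value at time 0, and its time derivative there is a non-zero component of the
  velocity.\<close>

lemma TT_differentiable:
 assumes X2: "c.X2 0 ~= 0"
 shows "\<exists>e>0. \<forall>b. \<bar>b\<bar> < e --> (\<exists>d. (TT has_real_derivative d) (at b))"
proof -
 have I0: "0 \<in> I" using \<alpha>s by simp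
 obtain i where i: "c.X2 0 $ i ~= 0" using X2 by (auto simp: vec_eq_iff)
 define S where "S = S2 Int {q. vector [q $ 1, 0] \<in> S2}"
 have hv: "holo (%q::complex^2. (vector [q $ 1, 0] :: complex^2) $ k) UNIV" for k
  using exhaust_2[of k] holo_nth[OF open_UNIV, of 1] holo_const[OF open_UNIV] by auto
 have "continuous_on UNIV (%q::complex^2. vector [q $ 1, 0] :: complex^2)" by (rule continuous_on_vec_components) (rule holo_cont[OF hv])
 then have "open ((%q::complex^2. vector [q $ 1, 0] :: complex^2) -` S2)" by (rule open_vimage[OF open_S2])
 then have opS: "open S" unfolding S_def using open_S2 by (auto simp: vimage_def)
 define G where "G q = Xv q $ i - Xv (vector [q $ 1, 0]) $ i" for q
 have h0: "holo (%q. Xv (vector [q $ 1, 0]) $ i) S" by (rule holo_compose[OF holo_Xv opS holo_subset[OF hv opS]]) (auto simp: S_def)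
 have hG: "holo G S" unfolding G_def[abs_def] by (rule holo_diff[OF holo_subset[OF holo_Xv opS] h0]) (auto simp: S_def)
 have PS: "vector [0, of_real (TT 0)] \<in> S" using real_S2[of "TT 0"] real_S2[of 0] by (simp add: S_def)
 have "pd G 2 (vector [0, of_real (TT 0)]) = c.X2 (vector [0, of_real (TT 0)]) $ i"
 proof -
  have "((%z. Xv (vector [0, z]) $ i - Xv (vector [0, 0]) $ i) has_field_derivative c.X2 (vector [0, of_real (TT 0)]) $ i - 0) (at (of_real (TT 0)))"
   unfolding c.X2_def vec_lambda_beta by (rule DERIV_diff[OF holo_vec2_deriv(2)[OF holo_Xv real_S2] DERIV_const])
  then show ?thesis using DERIV_unique[OF holo_vec2_deriv(2)[OF hG PS]] by (simp add: G_def)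
 qed
 also have "\<dots> = c.X2 0 $ i" using X2_period[OF I0, of 0] real_S2[of "TT 0"] real_S2[of 0] by (simp add: vec2_0)
 finally have D: "pd G 2 (vector [0, of_real (TT 0)]) ~= 0" using i by simp
 define x0 where "x0 = min (\<alpha>s - \<alpha>1) (\<alpha>2 - \<alpha>s)"
 show ?thesis
 proof (rule implicit_real_deriv[where G = G and S = S and T = TT and ?x0.0 = x0])
  show "holo G S" "vector [0, of_real (TT 0)] \<in> S" "pd G 2 (vector [0, of_real (TT 0)]) ~= 0" by (fact hG PS D)+
  show "isCont TT 0" using DERIV_isCont[OF TT_deriv_0] .
  show "x0 > 0" using \<alpha>s by (simp add: x0_def)
  show "G (vector [of_real b, of_real (TT b)]) = 0" if "\<bar>b\<bar> < x0" for b
  proof -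
   have "b \<in> I" using that by (auto simp: x0_def)
   from Xv_period[OF this, of 0] show ?thesis by (simp add: G_def)
  qed
 qed
qed

end

section \<open>Construction of the tube around the orbit\<close>

lemma norm_pt_le: "norm (pt a b c d) <= norm a + norm b + norm c + norm d"
 unfolding norm_vec_def by (rule order_trans[OF L2_set_le_sum]) (simp_all add: sum_4)

lemma pt_diff: "pt a b c d - pt a' b' c' d' = pt (a - a') (b - b') (c - c') (d - d')" by (simp add: vec_eq_iff forall_4)

context resonance
begin

text \<open>A tube is built along a compact connected set of times through 0, \<open>P\<close> and
  the loop. Compactness turns the open conditions of \<open>tube_chart\<close> along it into
  finitely many positive radii, of which the least is taken.\<close>

lemma no_frame:
 fixes \<phi>0 :: real and U E :: "(complex^(3 option)) set" and uc :: "complex^3 => complex^2" and u :: "real^3 => real^2"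
  and V :: "(complex^3) set" and \<gamma> :: "real => complex"
 assumes contU: "!!i. analytic_continuation V (%y. uc y $ i) (%y. u y $ i)"
  and E_def: "E = {p. position (state p) \<in> W & state p \<in> V}"
  and frame: "frame_pack ex angle_period E (perturbed_field Hc uc \<nu>) U Wf"
  and K: "compact K" "connected K" "0 \<in> K" "of_real P \<in> K" "!!\<tau>. \<tau> \<in> K ==> \<tau> \<in> \<Theta> & finite_at xs \<tau>"
  and KU: "!!\<tau>. \<tau> \<in> K ==> with_param (point (xs \<tau>) (of_real \<nu> * \<tau> + of_real \<phi>0)) 0 \<in> U"
  and \<gamma>: "valid_path \<gamma>" "pathfinish \<gamma> = pathstart \<gamma>" "path_image \<gamma> \<subseteq> K"
  and \<gamma>E: "!!\<tau>. \<tau> \<in> path_image \<gamma> ==> xs \<tau> \<in> W & point (xs \<tau>) (of_real \<nu> * \<tau> + of_real \<phi>0) \<in> V"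
  and mel: "melnikov_integral Hc uc \<nu> xs \<phi>0 \<gamma> ~= 0" shows False
proof -
 interpret ch: chart Xv S2 "of_real \<nu>" "of_real \<phi>0" by unfold_locales
 have V: "open V" "!!i. holo (%y. uc y $ i) V" "!!y. complexify y \<in> V"
  using contU multi_analytic_on_imp_holo unfolding analytic_continuation_def by blast+
 have Uo: "open U" using frame by (simp add: frame_pack_def)
 have X20: "c.X2 0 ~= 0" by (rule X2_nonzero[OF mel K(2,3,5) \<gamma>(3)])
 have j0: "c.jac 0 ~= 0" by (rule jac_nonzero[OF X20])
 have xsX: "xs \<tau> = Xv (vector [0, \<tau>])" for \<tau> by (simp add: xs_def Xv_def)
 obtain r0 where r0: "r0 > 0" "pol r0 0 r0 \<subseteq> S2" "!!q. q \<in> pol r0 0 r0 ==> Xv q \<in> W"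
  "!!q. q \<in> pol r0 0 r0 ==> c.X2 q = hh q" "!!b. \<bar>b\<bar> < r0 ==> b \<in> I" by (rule ode_near_0) (rule that)
 let ?pt = "%\<tau>. pt 0 \<tau> 0 0"
 have cpt: "continuous_on UNIV ?pt" by (intro continuous_intros)
 have PhiU: "open (ch.Om Int ch.Phi -` U)" by (rule continuous_open_preimage[OF ch.continuous_Phi ch.open_Om Uo])
 define O1 where "O1 = ?pt -` (ch.Om Int ch.Phi -` U)"
 have oO1: "open O1" unfolding O1_def by (rule open_vimage[OF PhiU cpt])
 have Kpt: "?pt \<tau> \<in> ch.Om" if "\<tau> \<in> K" for \<tau> using finite_S2 K(5)[OF that] by (simp add: ch.Om_def)
 have "K \<subseteq> O1" unfolding O1_def using Kpt KU by (auto simp: ch.Phi_def xsX)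
 then obtain \<kappa> where \<kappa>: "\<kappa> > 0" "(\<Union>a\<in>K. cball a \<kappa>) \<subseteq> O1"
  using compact_subset_open_imp_cball_epsilon_subset[OF K(1) oO1] by blast
 \<comment> \<open>A thickening of \<open>K\<close>: still compact and connected, and it contains
   discs around 0, \<open>P\<close> and every point of the loop.\<close>
 define K' where "K' = (%(a, b). a + b) ` (K \<times> cball 0 \<kappa>)"
 have ca: "continuous_on (K \<times> cball 0 \<kappa>) (%(a, b). a + b :: complex)" unfolding case_prod_unfold by (intro continuous_intros)
 have K'c: "compact K'" unfolding K'_def by (rule compact_continuous_image[OF ca compact_Times[OF K(1) compact_cball]])
 have K'conn: "connected K'" unfolding K'_def by (rule connected_continuous_image[OF ca connected_Times[OF K(2)]]) simp
 have in_K': "b \<in> K'" if "a \<in> K" "norm (b - a) <= \<kappa>" for a b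
  unfolding K'_def by (rule image_eqI[of _ _ "(a, b - a)"]) (use that in \<open>auto simp: dist_norm norm_minus_commute\<close>)
 have K'O1: "K' \<subseteq> O1"
 proof
  fix \<tau> assume "\<tau> \<in> K'"
  then obtain a b where ab: "a \<in> K" "norm b <= \<kappa>" "\<tau> = a + b" by (auto simp: K'_def)
  then have "\<tau> \<in> cball a \<kappa>" by (simp add: dist_norm)
  then show "\<tau> \<in> O1" using \<kappa>(2) ab(1) by blast
 qed
 have K'pt: "vector [0, \<tau>] \<in> S2" "ch.Phi (?pt \<tau>) \<in> U" if "\<tau> \<in> K'" for \<tau>
  using K'O1 that by (auto simp: O1_def ch.Om_def)
 have K0: "0 \<in> K'" using in_K'[OF K(3), of 0] \<kappa>(1) by simp
 have jK: "c.jac (vector [0, \<tau>]) = c.jac 0" if "\<tau> \<in> K'" for \<tau>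
 proof -
  have "c.jac (vector [0, \<tau>]) - c.jac 0 = 0"
  proof (rule identity_component[OF _ r0(1) _ K'conn K0 K'pt(1) that])
   show "(%\<tau>. c.jac (vector [0, \<tau>]) - c.jac 0) holomorphic_on {\<tau>. vector [0, \<tau>] \<in> S2}"
    using holo_vec2_slice[OF c.holo_jac, of 0] by (intro holomorphic_intros)
   show "c.jac (vector [0, \<tau>]) - c.jac 0 = 0" if "norm \<tau> < r0" for \<tau>
    using jac_const_near_0[OF r0(1-4), of 0 \<tau>] that r0(1) by (simp add: vec2_0)
  qed
  then show ?thesis by simp
 qed
 define Q where "Q = {p \<in> ch.Om. ch.Phi p \<in> E}"
 have oQ: "open Q"
 proof -
  have c1: "continuous_on ch.Om (%p. Xv (vector [p $ 1, p $ 2]))"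
   by (rule continuous_on_vec_components) (rule holo_cont[OF ch.holo_lift[OF holo_Xv]])
  have c2: "continuous_on ch.Om (%p. state (ch.Phi p))" by (rule continuous_on_vec_components) (simp add: state_def holo_cont[OF ch.holo_Phi])
  have "Q = (ch.Om Int (%p. Xv (vector [p $ 1, p $ 2])) -` W) Int (ch.Om Int (%p. state (ch.Phi p)) -` V)" by (auto simp: Q_def E_def ch.Phi_def)
  then show ?thesis using continuous_open_preimage[OF c1 ch.open_Om W(1)] continuous_open_preimage[OF c2 ch.open_Om V(1)] by auto
 qed
 have Qe: "pt b \<tau> s e \<in> Q \<longleftrightarrow> pt b \<tau> s 0 \<in> Q" for b \<tau> s e by (simp add: Q_def E_def ch.Om_def ch.Phi_def)
 \<comment> \<open>Time 0 is added to the loop so that one radius serves the neighbourhoods of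
   both.\<close>
 define G0 where "G0 = path_image \<gamma> Un {0}"
 have cG: "compact (?pt ` G0)"
  unfolding G0_def using compact_valid_path_image[OF \<gamma>(1)] by (intro compact_continuous_image continuous_on_subset[OF cpt]) auto
 have GQ: "?pt ` G0 \<subseteq> Q"
 proof
  fix p assume "p \<in> ?pt ` G0"
  then obtain \<tau> where \<tau>: "\<tau> \<in> G0" "p = ?pt \<tau>" by blast
  have \<tau>K: "\<tau> \<in> K" using \<tau>(1) \<gamma>(3) K(3) by (auto simp: G0_def)
  have "xs \<tau> \<in> W & point (xs \<tau>) (of_real \<nu> * \<tau> + of_real \<phi>0) \<in> V"
  proof (cases "\<tau> \<in> path_image \<gamma>")
   case True
   then show ?thesis by (rule \<gamma>E)
  next
   case False
   then have "\<tau> = 0" using \<tau>(1) by (simp add: G0_def)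
   moreover have "xs 0 = complexify (x \<alpha>s 0)" using xc[OF \<alpha>s, of 0] by (simp add: xs_def)
   moreover have "point (complexify (x \<alpha>s 0)) (of_real \<phi>0) = complexify (point (x \<alpha>s 0) \<phi>0)"
    by (simp add: vec_eq_iff forall_3 complexify_def)
   ultimately show ?thesis using W(3) V(3) by simp
  qed
  then show "p \<in> Q" using Kpt[OF \<tau>K] \<tau>(2) by (simp add: Q_def E_def ch.Phi_def xsX)
 qed
 obtain \<eta>0 where \<eta>0: "\<eta>0 > 0" "(\<Union>p\<in>?pt ` G0. ball p \<eta>0) \<subseteq> Q"
  by (rule compact_subset_open_imp_ball_epsilon_subset[OF cG oQ GQ]) (rule that)
 \<comment> \<open>Three coordinates of size below \<open>\<eta>0 / 3\<close> keep a point within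
   \<open>\<eta>0\<close>.\<close>
 define \<eta> where "\<eta> = min \<kappa> (\<eta>0 / 3)"
 have \<eta>: "\<eta> > 0" "\<eta> <= \<kappa>" using \<eta>0 \<kappa> by (simp_all add: \<eta>_def)
 have nearQ: "pt b \<tau> s e \<in> Q" if "norm b < \<eta>" "norm s < \<eta>" "\<tau>' \<in> G0" "norm (\<tau> - \<tau>') < \<eta>" for b \<tau> s e \<tau>'
 proof -
  have "norm (pt b \<tau> s 0 - ?pt \<tau>') < \<eta>0" using norm_pt_le[of b "\<tau> - \<tau>'" s 0] that by (simp add: pt_diff \<eta>_def)
  then have "pt b \<tau> s 0 \<in> ball (?pt \<tau>') \<eta>0" by (simp add: dist_norm norm_minus_commute)
  then show ?thesis using \<eta>0(2) that(3) Qe[of b \<tau> s e] by blast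
 qed
 define N1 where "N1 = (\<Union>\<tau>\<in>path_image \<gamma>. ball \<tau> \<eta>)"
 have oN1: "open N1" unfolding N1_def by (intro open_UN ballI open_ball)
 have N1Q: "pt b \<tau> s e \<in> Q" if "norm b < \<eta>" "norm s < \<eta>" "\<tau> \<in> N1" for b \<tau> s e
  using that nearQ[OF that(1,2)] by (auto simp: N1_def G0_def dist_norm norm_minus_commute)
 have N1K: "N1 \<subseteq> K'"
 proof
  fix \<tau> assume "\<tau> \<in> N1"
  then obtain a where "a \<in> path_image \<gamma>" "norm (\<tau> - a) < \<eta>" by (auto simp: N1_def dist_norm norm_minus_commute)
  then show "\<tau> \<in> K'" using in_K'[of a \<tau>] \<gamma>(3) \<eta>(2) by auto
 qed
 define F where "F p = bdot (grad Hc (Xv (vector [p $ 1, p $ 2]))) (uc (state (ch.Phi p)))" for p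
 have hF: "holo F Q"
 proof -
  have QO: "Q \<subseteq> ch.Om" by (auto simp: Q_def)
  have hX: "holo (%p. Xv (vector [p $ 1, p $ 2]) $ i) Q" for i by (rule holo_subset[OF ch.holo_lift[OF holo_Xv] oQ QO])
  have hP: "holo (%p. state (ch.Phi p) $ i) Q" for i using holo_subset[OF ch.holo_Phi oQ QO] by (simp add: state_def)
  have g: "holo (%p. pd Hc k (Xv (vector [p $ 1, p $ 2]))) Q" for k
   by (rule holo_compose[OF holo_partial_deriv[OF holo_Hc] oQ hX]) (auto simp: Q_def E_def ch.Phi_def)
  have v: "holo (%p. uc (state (ch.Phi p)) $ k) Q" for k by (rule holo_compose[OF V(2) oQ hP]) (auto simp: Q_def E_def)
  show ?thesis unfolding F_def[abs_def] bdot_def grad_def vec_lambda_beta by (rule holo_sum[OF oQ holo_mult[OF g v]])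
 qed
 have Fpt: "F (pt b \<tau> s e) = bdot (grad Hc (Xv (vector [b, \<tau>]))) (uc (point (Xv (vector [b, \<tau>])) (of_real \<nu> * \<tau> + of_real \<phi>0 + s)))" for b \<tau> s e
  by (simp add: F_def ch.Phi_def)
 have \<gamma>N1: "path_image \<gamma> \<subseteq> N1" using \<eta>(1) by (auto simp: N1_def)
 obtain g g' where g: "valid_path g" "pathfinish g = pathstart g" "path_image g \<subseteq> N1"
  "!!u. (g has_vector_derivative g' u) (at u)" "continuous_on UNIV g'"
  and gi: "!!f. f holomorphic_on N1 ==> contour_integral g f = contour_integral \<gamma> f"
  by (rule smooth_loop[OF \<gamma>(1,2) \<gamma>N1 oN1]) (rule that)
 have gN1: "g u \<in> N1" if "u \<in> {0..1}" for u using g(3) that by (auto simp: path_image_def)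
 have cint: "contour_integral g f = integral {0..1} (%u. f (g u) * g' u)" for f
  unfolding contour_integral_integral by (rule integral_cong) (simp add: vector_derivative_at[OF g(4)])
 \<comment> \<open>The Melnikov integral as a function of the shifts of \<open>b\<close> and
   \<open>s\<close>; being continuous it stays non-zero near the origin.\<close>
 define M where "M z = integral {0..1} (%u. F (pt (fst z) (g u) (snd z) 0) * g' u)" for z :: "complex \<times> complex"
 let ?Z = "ball 0 \<eta> \<times> ball 0 \<eta> :: (complex \<times> complex) set"
 have cM: "continuous_on ?Z M"
 proof -
  have cg: "continuous_on {0..1} g" using valid_path_imp_path[OF g(1)] by (simp add: path_def)
  have "continuous_on (?Z \<times> {0..1}) (%y. F (pt (fst (fst y)) (g (snd y)) (snd (fst y)) 0) * g' (snd y))"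
   by (intro continuous_intros continuous_on_compose2[OF holo_cont[OF hF]] continuous_on_compose2[OF cg] continuous_on_compose2[OF g(5)])
    (use N1Q gN1 in auto)
  then have "continuous_on (?Z \<times> cbox 0 1) (%(z, u). F (pt (fst z) (g u) (snd z) 0) * g' u)" by (simp add: case_prod_unfold)
  then have "continuous_on ?Z (%z. integral (cbox 0 1) (%u. F (pt (fst z) (g u) (snd z) 0) * g' u))" by (rule integral_continuous_on_param)
  then show ?thesis by (simp add: M_def[abs_def])
 qed
 have M0: "M (0, 0) ~= 0"
 proof -
  have hol: "(%\<tau>. F (pt 0 \<tau> 0 0)) holomorphic_on N1"
   by (rule holomorphic_pt[OF hF oN1]) (use N1Q[of 0 0] \<eta>(1) in \<open>auto intro: holomorphic_intros\<close>)
  have "M (0, 0) = contour_integral \<gamma> (%\<tau>. F (pt 0 \<tau> 0 0))" using gi[OF hol] by (simp add: M_def cint)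
  also have "\<dots> = melnikov_integral Hc uc \<nu> xs \<phi>0 \<gamma>" by (simp add: melnikov_integral_def Fpt xsX)
  finally show ?thesis using mel by simp
 qed
 obtain r2 where r2: "r2 > 0" "!!b s. norm b < r2 ==> norm s < r2 ==> M (b, s) ~= 0"
 proof -
  have "open (?Z Int M -` (- {0}))" using cM by (intro continuous_open_preimage open_Times) auto
  moreover have "(0, 0) \<in> ?Z Int M -` (- {0})" using M0 \<eta>(1) by simp
  ultimately obtain A B where AB: "open A" "open B" "(0, 0) \<in> A \<times> B" "A \<times> B \<subseteq> ?Z Int M -` (- {0})" by (rule open_prod_elim)
  obtain a where a: "a > 0" "ball 0 a \<subseteq> A" using AB openE by blast
  obtain b where b: "b > 0" "ball 0 b \<subseteq> B" using AB openE by blast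
  show thesis
  proof (rule that[of "min a b"])
   fix v w :: complex assume "norm v < min a b" "norm w < min a b"
   then have "v \<in> A" "w \<in> B" using a b by auto
   then have "(v, w) \<in> A \<times> B" by simp
   then show "M (v, w) ~= 0" using AB(4) by blast
  qed (use a b in auto)
 qed
 obtain r3 where r3: "r3 > 0" "!!b. norm b < r3 ==> c.jac (vector [b, 0]) ~= 0"
 proof -
  have "open (S2 Int c.jac -` (- {0}))" by (rule holo_nonvanishing_set[OF c.holo_jac])
  then have "open {b. vector [b, 0] \<in> S2 Int c.jac -` (- {0})}" by (rule open_vec2_vimage(2))
  moreover have "0 \<in> {b. vector [b, 0] \<in> S2 Int c.jac -` (- {0})}" using j0 real_S2[of 0] by (simp add: vec2_0)
  ultimately obtain a where "a > 0" "ball 0 a \<subseteq> {b. vector [b, 0] \<in> S2 Int c.jac -` (- {0})}" by (rule openE)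
  then show thesis using that[of a] by (auto simp: subset_iff)
 qed
 obtain e1 where e1: "e1 > 0" "!!b. \<bar>b\<bar> < e1 ==> \<exists>d. (TT has_real_derivative d) (at b)" using TT_differentiable[OF X20] by blast
 obtain e2 where e2: "e2 > 0" "!!b. b ~= 0 ==> \<bar>b\<bar> < e2 ==> TT b ~= P" using TT_ne by blast
 have cTT: "isCont TT 0" using DERIV_isCont[OF TT_deriv_0] .
 \<comment> \<open>Half of \<kappa> is reserved for the variation of the return time and half for
   \<open>t\<close>, so that \<open>t + TT b\<close> stays within \<kappa> of
   \<open>P\<close>.\<close>
 obtain e3 where e3: "e3 > 0" "!!b. \<bar>b\<bar> < e3 ==> \<bar>TT b - P\<bar> < \<kappa> / 2"
  using cTT \<kappa>(1) unfolding continuous_at_eps_delta TT_0 by (metis diff_0_right dist_norm half_gt_zero real_norm_def)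
 define r1 where "r1 = min r0 (min \<eta> (min r2 (min r3 (min e1 (min e2 e3)))))"
 have r1: "r1 > 0" "r1 <= r0" "r1 <= \<eta>" "r1 <= r2" "r1 <= r3" "r1 <= e1" "r1 <= e2" "r1 <= e3"
  using r0(1) \<eta>(1) r2(1) r3(1) e1(1) e2(1) e3(1) by (simp_all add: r1_def min_le_iff_disj)
 have K'ne: "K' ~= {}" using K0 by blast
 have box: "\<exists>rho>0. \<exists>A h. tbox t rho rho \<subseteq> ch.Om Int ch.Phi -` U & (\<forall>j i. holo (%p. A j p $ i) (tbox t rho rho)) &
    holo h (tbox t rho rho) & (\<exists>p\<in>tbox t rho rho. h p ~= 0) &
    (\<forall>p\<in>tbox t rho rho. h p ~= 0 --> (\<forall>j. h p *s ch.GG Wf j p = A j p) & frame_local ex E (perturbed_field Hc uc \<nu>) Wf (ch.Phi p))"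
  if "t \<in> K'" for t by (rule ch.frame_box[OF frame K'pt[OF that]]) (use jK[OF that] j0 in simp)
 obtain C R r m A h where CR: "finite C" "C \<subseteq> K'" "C ~= {}" "K' \<subseteq> (\<Union>t\<in>C. ball t (R t))" "0 < r" "r <= r1"
  "!!t. t \<in> C ==> R t > 0" "!!t. t \<in> C ==> tbox t (R t) r \<subseteq> ch.Om Int ch.Phi -` U"
  "!!t. t \<in> C ==> holo (h t) (tbox t (R t) r)" "!!t. t \<in> C ==> \<exists>p\<in>tbox t (R t) r. p $ 4 = 0 & h t p ~= 0"
  "!!t j i. t \<in> C ==> holo (%p. A t j p $ i) (tbox t (R t) r)"
  "!!t p. t \<in> C ==> p \<in> tbox t (R t) r ==> p $ 4 ~= 0 ==> h t p ~= 0 ==>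
   frame_local ex E (perturbed_field Hc uc \<nu>) Wf (ch.Phi p) & (\<forall>j. h t p *s (p $ 4 ^ m *s ch.GG Wf j p) = A t j p)"
  by (rule finite_boxes[where G = "ch.GG Wf" and Q = "%p. frame_local ex E (perturbed_field Hc uc \<nu>) Wf (ch.Phi p)", OF K'c K'ne r1(1) box])
   (assumption, rule that)
 define N where "N = (\<Union>t\<in>C. ball t (R t))"
 have K'N: "K' \<subseteq> N" using CR(4) by (simp add: N_def)
 have oN: "open N" unfolding N_def by (intro open_UN ballI open_ball)
 \<comment> \<open>Each ball is attached to the connected set \<open>K'\<close>, which contains its
   centre.\<close>
 have cN: "connected N"
 proof -
  have "N = (\<Union>t\<in>C. K' Un ball t (R t))" using K'N CR(3) by (auto simp: N_def)
  moreover have "connected (\<Union>t\<in>C. K' Un ball t (R t))"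
  proof (rule connected_Union)
   show "connected s" if s: "s \<in> (%t. K' Un ball t (R t)) ` C" for s
   proof -
    obtain t where t: "t \<in> C" "s = K' Un ball t (R t)" using s by blast
    have "t \<in> K' Int ball t (R t)" using CR(2,7) t(1) by auto
    then show ?thesis unfolding t(2) by (intro connected_Un K'conn connected_ball) auto
   qed
   show "\<Inter> ((%t. K' Un ball t (R t)) ` C) ~= {}" using K0 by blast
  qed
  ultimately show ?thesis by simp
 qed
 have NS: "vector [b, \<tau>] \<in> S2" if \<tau>N: "\<tau> \<in> N" and br: "norm b < r" for b \<tau>
 proof -
  obtain t where t0: "t \<in> C" "\<tau> \<in> ball t (R t)" using \<tau>N unfolding N_def by (elim UN_E) (rule that)
  then have t: "t \<in> C" "norm (\<tau> - t) < R t" by (simp_all add: dist_norm norm_minus_commute)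
  then have "pt b \<tau> 0 0 \<in> tbox t (R t) r" using br CR(5) by simp
  then have "pt b \<tau> 0 0 \<in> ch.Om" using CR(8)[OF t(1)] by blast
  then show ?thesis by (simp add: ch.Om_def)
 qed
 interpret tube C R r h N by unfold_locales (use CR N_def cN in auto)
 obtain s0 rho \<sigma> J D where reg: "tube_region C R r h N s0 rho \<sigma> J D" using region_exists by (elim exE) (rule that)
 interpret tube_region C R r h N s0 rho \<sigma> J D by (rule reg)
 define \<delta>0 where "\<delta>0 = min r0 \<eta>"
 have \<delta>0: "\<delta>0 > 0" using r0 \<eta> by (simp add: \<delta>0_def)
 have N0N: "ball 0 \<delta>0 \<subseteq> N"
 proof
  fix \<tau> :: complex assume "\<tau> \<in> ball 0 \<delta>0"
  then show "\<tau> \<in> N" using in_K'[OF K(3), of \<tau>] \<eta>(2) K'N by (auto simp: \<delta>0_def)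
 qed
 define d where "d b = deriv TT b" for b
 have dTT: "(TT has_real_derivative d b) (at b)" if b: "\<bar>b\<bar> < e1" for b
 proof -
  obtain d' where "(TT has_real_derivative d') (at b)" using e1(2)[OF b] by blast
  then show ?thesis using DERIV_imp_deriv by (metis d_def)
 qed
 have nuP: "\<nu> * P = 2 * pi * real l" using \<nu> by (simp add: P_def)
 have tN: "complex_of_real t \<in> N" if "\<bar>t\<bar> < \<kappa> / 2" for t using in_K'[OF K(3), of "of_real t"] that K'N by auto
 have tTN: "complex_of_real (t + TT b) \<in> N" if "\<bar>t\<bar> < \<kappa> / 2" "\<bar>b\<bar> < r" for t b
 proof -
  have "\<bar>TT b - P\<bar> < \<kappa> / 2" using e3(2)[of b] that(2) CR(6) r1(8) by simp
  then have "\<bar>t + TT b - P\<bar> <= \<kappa>" using that(1) by linarith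
  then have "norm (complex_of_real (t + TT b - P)) <= \<kappa>" by (simp only: norm_of_real)
  then have "norm (complex_of_real (t + TT b) - of_real P) <= \<kappa>" by simp
  then show ?thesis using in_K'[OF K(4)] K'N by blast
 qed
 have "tube_chart Xv S2 \<nu> (of_real \<phi>0) C R r h N s0 rho \<sigma> J D Hc W uc V E U ex Wf m A g g' (ball 0 \<delta>0) N1 TT d (\<kappa> / 2) l"
 proof unfold_locales
  show "frame_pack ex angle_period E (perturbed_field Hc uc \<nu>) U Wf" by (rule frame)
  show "E = {p. position (state p) \<in> W & state p \<in> V}" by (rule E_def)
  show "holo Hc W" by (rule holo_Hc)
  show "holo (%y. uc y $ i) V" for i by (rule V(2))
  show "p \<in> ch.Om & ch.Phi p \<in> U" if "t \<in> C" "p \<in> tbox t (R t) r" for t p using CR(8)[OF that(1)] that(2) by blast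
  show "holo (%p. A t j p $ k) (tbox t (R t) r)" if "t \<in> C" for t j k by (rule CR(11)[OF that])
  show "frame_local ex E (perturbed_field Hc uc \<nu>) Wf (ch.Phi p) & (\<forall>j. h t p *s (p $ 4 ^ m *s ch.GG Wf j p) = A t j p)"
   if "t \<in> C" "p \<in> tbox t (R t) r" "p $ 4 ~= 0" "h t p ~= 0" for t p by (rule CR(12)[OF that])
  show "open (ball (0::complex) \<delta>0)" "ball (0::complex) \<delta>0 ~= {}" using \<delta>0 by auto
  show "ball 0 \<delta>0 \<subseteq> N" by (rule N0N)
  show "open N1" by (rule oN1)
  show "N1 \<subseteq> N" using N1K K'N by blast
  show "ch.Phi (pt b \<tau> s e) \<in> E" if bs: "norm b < r" "norm s < r" and \<tau>: "\<tau> \<in> ball 0 \<delta>0 Un N1" for b s \<tau> e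
  proof -
   have bs': "norm b < \<eta>" "norm s < \<eta>" using bs CR(6) r1(3) by auto
   have "pt b \<tau> s e \<in> Q" using \<tau> N1Q[OF bs'] nearQ[OF bs', of 0 \<tau>] by (auto simp: G0_def \<delta>0_def)
   then show ?thesis by (simp add: Q_def)
  qed
  show "ch.X2 (vector [b, \<tau>]) = Jmat *v grad Hc (Xv (vector [b, \<tau>]))" if "norm b < r" "\<tau> \<in> ball 0 \<delta>0" for b \<tau>
  proof -
   have "vector [b, \<tau>] \<in> pol r0 0 r0" using that CR(6) r1(2) by (simp add: pol_def \<delta>0_def)
   from r0(4)[OF this] show ?thesis by (simp add: hh_def)
  qed
  \<comment> \<open>For fixed \<open>b\<close>, constancy near time 0 is continued through the
    connected set \<open>N\<close>, over which the chart is holomorphic.\<close>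
  show "ch.jac (vector [b, \<tau>]) = ch.jac (vector [b, 0])" if b: "norm b < r" and \<tau>: "\<tau> \<in> N" for b \<tau>
  proof (rule analytic_continuation_open[where s = "ball 0 \<delta>0" and s' = N and f = "%\<tau>. ch.jac (vector [b, \<tau>])" and g = "%\<tau>. ch.jac (vector [b, 0])" and z = \<tau>])
   show "(%\<tau>. ch.jac (vector [b, \<tau>])) holomorphic_on N"
    by (rule holomorphic_on_subset[OF holo_vec2_slice[OF c.holo_jac, of b]]) (use NS b in auto)
   show "ch.jac (vector [b, \<tau>]) = ch.jac (vector [b, 0])" if "\<tau> \<in> ball 0 \<delta>0" for \<tau>
    by (rule jac_const_near_0[OF r0(1-4)]) (use that b CR(6) r1(2) in \<open>auto simp: \<delta>0_def\<close>)
   show "ball (0::complex) \<delta>0 ~= {}" using \<delta>0 by auto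
  qed (use N0N oN cN \<tau> in auto)
  show "ch.jac (vector [b, 0]) ~= 0" if "norm b < r" for b using r3(2)[of b] that CR(6) r1(5) by simp
  show "valid_path g" "pathfinish g = pathstart g" "path_image g \<subseteq> N1" by (fact g(1,2,3))+
  show "(g has_vector_derivative g' u) (at u)" for u by (rule g(4))
  show "continuous_on {0..1} g'" by (rule continuous_on_subset[OF g(5)]) simp
  show "contour_integral g (%\<tau>. bdot (grad Hc (Xv (vector [b, \<tau>]))) (uc (point (Xv (vector [b, \<tau>])) (of_real \<nu> * \<tau> + of_real \<phi>0 + s)))) ~= 0"
   if "norm b < r" "norm s < r" for b s using r2(2)[of b s] that CR(6) r1(4) by (simp add: cint M_def Fpt)
  show "\<kappa> / 2 > 0" using \<kappa>(1) by simp
  show "complex_of_real t \<in> N" if "\<bar>t\<bar> < \<kappa> / 2" for t by (rule tN[OF that])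
  show "complex_of_real (t + TT b) \<in> N" if "\<bar>t\<bar> < \<kappa> / 2" "0 < b" "b < r" for t b by (rule tTN) (use that in auto)
  show "Xv (vector [of_real b, of_real (t + TT b)]) = Xv (vector [of_real b, of_real t]) &
    ch.X2 (vector [of_real b, of_real (t + TT b)]) = ch.X2 (vector [of_real b, of_real t]) &
    ch.X1 (vector [of_real b, of_real (t + TT b)]) = ch.X1 (vector [of_real b, of_real t]) - of_real (d b) *s ch.X2 (vector [of_real b, of_real t])"
   if t: "\<bar>t\<bar> < \<kappa> / 2" and b: "0 < b" "b < r" for t b
  proof -
   have br: "\<bar>b\<bar> < r" using b by simp
   have bI: "b \<in> I" by (rule r0(5)) (use br CR(6) r1(2) in simp)
   have S: "vector [of_real b, of_real (t + TT b)] \<in> S2" "vector [of_real b, of_real t] \<in> S2"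
    by (rule NS[OF tTN[OF t br]], use b in simp, rule NS[OF tN[OF t]], use b in simp)
   have db: "(TT has_real_derivative d b) (at b)" by (rule dTT) (use br CR(6) r1(6) in simp)
   show ?thesis using Xv_period[OF bI, of t] X2_period[OF bI S] X1_period[OF bI S db] by simp
  qed
  show "(TT has_real_derivative d b) (at b)" if "0 < b" "b < r" for b by (rule dTT) (use that CR(6) r1(6) in simp)
  show "\<nu> * TT b ~= 2 * pi * real l" if "0 < b" "b < r" for b
  proof -
   have "TT b ~= P" using e2(2)[of b] that CR(6) r1(7) by simp
   then show ?thesis using nuP \<nu> by (metis mult_left_cancel less_irrefl)
  qed
  have "((%b. \<nu> * TT b) \<longlongrightarrow> \<nu> * TT 0) (at 0)" using cTT unfolding isCont_def by (intro tendsto_intros)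
  then show "((%b. \<nu> * TT b) \<longlongrightarrow> 2 * pi * real l) (at_right 0)" unfolding TT_0 nuP by (rule filterlim_mono) (auto simp: at_le)
 qed
 then show False by (rule tube_chart.contradiction)
qed

end

section \<open>The resonant orbit\<close>

lemma open_analytic_points: "open {z. f analytic_on {z}}"
proof (subst open_subopen, intro ballI)
 fix z assume "z \<in> {z. f analytic_on {z}}"
 then obtain S where S: "open S" "z \<in> S" "f holomorphic_on S" unfolding mem_Collect_eq analytic_at by blast
 then have "S \<subseteq> {z. f analytic_on {z}}" unfolding analytic_at by blast
 then show "\<exists>T. open T & z \<in> T & T \<subseteq> {z. f analytic_on {z}}" using S by blast
qed

text \<open>Finitely many closed discs inside \<open>S\<close> cover \<open>L\<close>, and each is
  joined to one fixed point by a path in \<open>S\<close>.\<close>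

lemma compact_connected_superset:
 fixes S :: "complex set"
 assumes S: "open S" "connected S" and L: "compact L" "L ~= {}" "L \<subseteq> S"
 obtains K where "compact K" "connected K" "L \<subseteq> K" "K \<subseteq> S"
proof -
 obtain a where a: "a \<in> L" using L by blast
 have "\<forall>z\<in>S. \<exists>e>0. cball z e \<subseteq> S" using S(1) open_contains_cball by blast
 then obtain e where e: "!!z. z \<in> S ==> e z > 0 & cball z (e z) \<subseteq> S" by metis
 have pc: "path_connected S" using S connected_open_path_connected by blast
 have "\<forall>z\<in>S. \<exists>g. path g & path_image g \<subseteq> S & pathstart g = a & pathfinish g = z"
  using pc a L(3) unfolding path_connected_def by blast
 then obtain g where g: "!!z. z \<in> S ==> path (g z) & path_image (g z) \<subseteq> S & pathstart (g z) = a & pathfinish (g z) = z" by metis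
 obtain C where C: "C \<subseteq> L" "finite C" "L \<subseteq> (\<Union>z\<in>C. ball z (e z))"
 proof (rule compactE_image[OF L(1), of L "%z. ball z (e z)"])
  show "L \<subseteq> (\<Union>z\<in>L. ball z (e z))" using e L(3) by force
 qed (use that in auto)
 have Cne: "C ~= {}" using C(3) L(2) by auto
 define B where "B z = path_image (g z) Un cball z (e z)" for z
 have CS: "z \<in> S" if "z \<in> C" for z using C(1) L(3) that by blast
 have aB: "a \<in> B z" if "z \<in> C" for z using g[OF CS[OF that]] pathstart_in_path_image[of "g z"] by (auto simp: B_def)
 show thesis
 proof (rule that[of "\<Union>z\<in>C. B z"])
  show "compact (\<Union>z\<in>C. B z)" using g CS C(2) unfolding B_def by (intro compact_UN compact_Un compact_path_image compact_cball) auto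
  show "connected (\<Union>z\<in>C. B z)"
  proof (rule connected_Union)
   show "connected s" if s: "s \<in> B ` C" for s
   proof -
    obtain z where z: "z \<in> C" "s = B z" using s by blast
    have "z \<in> path_image (g z) Int cball z (e z)" using g[OF CS[OF z(1)]] pathfinish_in_path_image[of "g z"] e[OF CS[OF z(1)]] by auto
    then show ?thesis unfolding z(2) B_def using g[OF CS[OF z(1)]] by (intro connected_Un connected_path_image) auto
   qed
   show "\<Inter> (B ` C) ~= {}" using aB by blast
  qed
  have "ball z (e z) \<subseteq> B z" for z using ball_subset_cball by (auto simp: B_def)
  then show "L \<subseteq> (\<Union>z\<in>C. B z)" using C(3) by blast
  show "(\<Union>z\<in>C. B z) \<subseteq> S" using g CS e unfolding B_def by blast
 qed
qed

context resonance
begin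

text \<open>The singularities of a meromorphic function are sparse, hence countable, and removing
  them keeps the domain connected.\<close>

lemma finite_points:
 assumes G: "open G" "connected G" "G \<subseteq> \<Theta>"
 shows "open {\<tau>\<in>G. finite_at xs \<tau>}" "connected {\<tau>\<in>G. finite_at xs \<tau>}"
proof -
 have eq: "{\<tau>\<in>G. finite_at xs \<tau>} = G Int {z. (%\<tau>. xs \<tau> $ 1) analytic_on {z}} Int {z. (%\<tau>. xs \<tau> $ 2) analytic_on {z}}"
  unfolding finite_at_def forall_2 by auto
 show "open {\<tau>\<in>G. finite_at xs \<tau>}" unfolding eq by (intro open_Int G(1) open_analytic_points)
 have cnt: "countable {z\<in>G. ~ (%\<tau>. xs \<tau> $ i) analytic_on {z}}" for i
 proof -
  have m: "(%\<tau>. xs \<tau> $ i) meromorphic_on G" by (rule meromorphic_on_subset[OF mero G(3)])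
  have "{z. ~ (%\<tau>. xs \<tau> $ i) analytic_on {z}} sparse_in G"
   unfolding sparse_in_open[OF G(1)] using meromorphic_on_imp_not_islimpt_singularities[OF m] by blast
  then have "countable (G Int {z. ~ (%\<tau>. xs \<tau> $ i) analytic_on {z}})" by (rule sparse_imp_countable[OF G(1)])
  then show ?thesis by (simp add: Int_def)
 qed
 have "{\<tau>\<in>G. finite_at xs \<tau>} = G - ({z\<in>G. ~ (%\<tau>. xs \<tau> $ 1) analytic_on {z}} Un {z\<in>G. ~ (%\<tau>. xs \<tau> $ 2) analytic_on {z}})"
  unfolding eq by auto
 moreover have "connected (G - ({z\<in>G. ~ (%\<tau>. xs \<tau> $ 1) analytic_on {z}} Un {z\<in>G. ~ (%\<tau>. xs \<tau> $ 2) analytic_on {z}}))"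
  by (rule connected_open_diff_countable[OF _ G(1,2)]) (use cnt in auto)
 ultimately show "connected {\<tau>\<in>G. finite_at xs \<tau>}" by simp
qed

lemma finite_compact:
 assumes G: "periodic_domain P G" "G \<subseteq> \<Theta>" and L: "compact L" "L \<subseteq> {\<tau>\<in>G. finite_at xs \<tau>}"
 obtains K where "compact K" "connected K" "0 \<in> K" "of_real P \<in> K" "L \<subseteq> K" "K \<subseteq> {\<tau>\<in>G. finite_at xs \<tau>}"
proof -
 have G': "open G" "connected G" "range complex_of_real \<subseteq> G" using G(1) by (auto simp: periodic_domain_def)
 have "of_real t \<in> {\<tau>\<in>G. finite_at xs \<tau>}" for t using finite_real[of t] G'(3) by auto
 from this[of 0] this[of P] have LG: "L Un {0, of_real P} \<subseteq> {\<tau>\<in>G. finite_at xs \<tau>}" using L(2) by auto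
 have cL: "compact (L Un {0, of_real P})" using L(1) by (intro compact_Un) auto
 have ne: "L Un {0, of_real P} ~= {}" by blast
 obtain K where "compact K" "connected K" "L Un {0, of_real P} \<subseteq> K" "K \<subseteq> {\<tau>\<in>G. finite_at xs \<tau>}"
  by (rule compact_connected_superset[OF finite_points[OF G'(1,2) G(2)] cL ne LG]) (rule that)
 then show thesis using that[of K] by auto
qed

lemma continuous_orbit:
 assumes "open S" "!!\<tau>. \<tau> \<in> S ==> finite_at xs \<tau>"
 shows "continuous_on (S \<times> UNIV) (%z. with_param (point (xs (fst z)) (of_real \<nu> * fst z + of_real (snd z))) 0 :: complex^(3 option))"
proof (rule continuous_on_vec_components)
 fix k :: "3 option"
 have "continuous_on S (%\<tau>. xs \<tau> $ i)" for i
  using assms(2) analytic_at_imp_isCont unfolding finite_at_def by (intro continuous_at_imp_continuous_on) blast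
 then have "continuous_on (S \<times> UNIV) (%z::complex \<times> real. xs (fst z) $ i)" for i
  by (rule continuous_on_compose2[where f = fst]) (auto intro: continuous_intros)
 then have "\<forall>k. continuous_on (S \<times> UNIV) (%z. (with_param (point (xs (fst z)) (of_real \<nu> * fst z + of_real (snd z))) 0 :: complex^(3 option)) $ k)"
  unfolding all_option3 by (auto intro!: continuous_intros)
 then show "continuous_on (S \<times> UNIV) (%z. (with_param (point (xs (fst z)) (of_real \<nu> * fst z + of_real (snd z))) 0 :: complex^(3 option)) $ k)" ..
qed

lemma admissible_no_frame:
 assumes contU: "!!i. analytic_continuation V (%y. uc y $ i) (%y. u y $ i)"
  and E_def: "E = {p. position (state p) \<in> W & state p \<in> V}"
  and frame: "frame_pack ex angle_period E (perturbed_field Hc uc \<nu>) U Wf"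
  and K: "compact K" "connected K" "0 \<in> K" "of_real P \<in> K" "K \<subseteq> {\<tau>\<in>\<Theta>. finite_at xs \<tau>}"
  and KU: "!!\<tau>. \<tau> \<in> K ==> with_param (point (xs \<tau>) (of_real \<nu> * \<tau> + of_real \<phi>)) 0 \<in> U"
  and adm: "admissible_loop \<nu> P \<Theta> W V xs \<phi> \<gamma>" "path_image \<gamma> \<subseteq> K" and mel: "melnikov_integral Hc uc \<nu> xs \<phi> \<gamma> ~= 0"
 shows False
proof (rule no_frame[OF contU E_def frame K(1-4) _ KU _ _ adm(2) _ mel])
 show "\<tau> \<in> \<Theta> & finite_at xs \<tau>" if "\<tau> \<in> K" for \<tau> using K(5) that by blast
 show "valid_path \<gamma>" "pathfinish \<gamma> = pathstart \<gamma>" using adm(1) by (auto simp: admissible_loop_def)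
 show "xs \<tau> \<in> W & point (xs \<tau>) (of_real \<nu> * \<tau> + of_real \<phi>) \<in> V" if "\<tau> \<in> path_image \<gamma>" for \<tau>
  using adm(1) that by (simp add: admissible_loop_def)
qed

lemma not_integrable_near_orbits:
 assumes contU: "!!i. analytic_continuation V (%y. uc y $ i) (%y. u y $ i)"
  and E_def: "E = {p. position (state p) \<in> W & state p \<in> V}"
  and adm: "admissible_loop \<nu> P \<Theta> W V xs \<phi> \<gamma>" and mel: "melnikov_integral Hc uc \<nu> xs \<phi> \<gamma> ~= 0"
  and G: "periodic_domain P G" "G \<subseteq> \<Theta>" "path_image \<gamma> \<subseteq> G"
  and S: "complex_orbit \<nu> xs G \<phi> \<subseteq> S" shows "~ meromorphically_integrable_near angle_period E (perturbed_field Hc uc \<nu>) S"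
proof
 assume "meromorphically_integrable_near angle_period E (perturbed_field Hc uc \<nu>) S"
 then obtain ex U Wf where frame: "frame_pack ex angle_period E (perturbed_field Hc uc \<nu>) U Wf" and SU: "!!y. y \<in> S ==> with_param y 0 \<in> U"
  by (rule integrable_frame_pack) (rule that)
 have \<gamma>G: "path_image \<gamma> \<subseteq> {\<tau>\<in>G. finite_at xs \<tau>}" using adm G(3) by (auto simp: admissible_loop_def)
 have c\<gamma>: "compact (path_image \<gamma>)" using adm by (simp add: admissible_loop_def compact_valid_path_image)
 obtain K where K: "compact K" "connected K" "0 \<in> K" "of_real P \<in> K" "path_image \<gamma> \<subseteq> K" "K \<subseteq> {\<tau>\<in>G. finite_at xs \<tau>}"
  by (rule finite_compact[OF G(1,2) c\<gamma> \<gamma>G]) (rule that)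
 show False
 proof (rule admissible_no_frame[OF contU E_def frame K(1-4) _ _ adm K(5) mel])
  show "K \<subseteq> {\<tau>\<in>\<Theta>. finite_at xs \<tau>}" using K(6) G(2) by blast
  show "with_param (point (xs \<tau>) (of_real \<nu> * \<tau> + of_real \<phi>)) 0 \<in> U" if "\<tau> \<in> K" for \<tau>
  proof (rule SU[OF subsetD[OF S]])
   show "point (xs \<tau>) (of_real \<nu> * \<tau> + of_real \<phi>) \<in> complex_orbit \<nu> xs G \<phi>"
    unfolding complex_orbit_def using subsetD[OF K(6) that] by (intro CollectI exI[of _ \<tau>]) simp
  qed
 qed
qed

lemma dense_interval:
 fixes \<Delta> :: "real set"
 assumes "closure \<Delta> = UNIV" "e > 0"
 obtains \<phi> where "\<phi> \<in> \<Delta>" "\<bar>\<phi> - \<phi>0\<bar> < e"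
proof -
 have "\<phi>0 \<in> closure \<Delta>" using assms by simp
 then show thesis using assms(2) that unfolding closure_approachable dist_real_def by blast
qed

text \<open>The loops belong to phases near \<open>\<phi>0\<close>, not to \<open>\<phi>0\<close>
  itself. They lie in one compact set of times, along which a neighbourhood of the orbit also
  contains the orbits of all sufficiently close phases; density supplies a phase with a loop among
  them.\<close>

lemma not_integrable_near_torus_orbit:
 assumes contU: "!!i. analytic_continuation V (%y. uc y $ i) (%y. u y $ i)"
  and E_def: "E = {p. position (state p) \<in> W & state p \<in> V}"
  and dense: "closure \<Delta> = UNIV"
  and loops: "!!\<phi>. \<phi> \<in> \<Delta> ==> admissible_loop \<nu> P \<Theta> W V xs \<phi> (\<gamma> \<phi>) & melnikov_integral Hc uc \<nu> xs \<phi> (\<gamma> \<phi>) ~= 0"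
  and G: "periodic_domain P G" "G \<subseteq> \<Theta>"
  and K: "compact K" "K \<subseteq> {\<tau>\<in>G. finite_at xs \<tau>}" "\<eta> > 0" "!!\<phi>. \<phi> \<in> \<Delta> ==> \<bar>\<phi> - \<phi>0\<bar> < \<eta> ==> path_image (\<gamma> \<phi>) \<subseteq> K"
 shows "~ meromorphically_integrable_near angle_period E (perturbed_field Hc uc \<nu>) (complex_orbit \<nu> xs G \<phi>0)"
proof
 assume "meromorphically_integrable_near angle_period E (perturbed_field Hc uc \<nu>) (complex_orbit \<nu> xs G \<phi>0)"
 then obtain ex U Wf where frame: "frame_pack ex angle_period E (perturbed_field Hc uc \<nu>) U Wf"
  and SU: "!!y. y \<in> complex_orbit \<nu> xs G \<phi>0 ==> with_param y 0 \<in> U" by (rule integrable_frame_pack) (rule that)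
 obtain L where L: "compact L" "connected L" "0 \<in> L" "of_real P \<in> L" "K \<subseteq> L" "L \<subseteq> {\<tau>\<in>G. finite_at xs \<tau>}"
  by (rule finite_compact[OF G K(1,2)]) (rule that)
 let ?S = "{\<tau>\<in>G. finite_at xs \<tau>}"
 have oS: "open ?S" by (rule finite_points[OF _ _ G(2)]) (use G(1) in \<open>auto simp: periodic_domain_def\<close>)
 let ?f = "%z::complex \<times> real. with_param (point (xs (fst z)) (of_real \<nu> * fst z + of_real (snd z))) 0 :: complex^(3 option)"
 have "open U" using frame by (simp add: frame_pack_def)
 then have oV: "open ((?S \<times> UNIV) Int ?f -` U)" by (intro continuous_open_preimage[OF continuous_orbit] open_Times oS) auto
 have LV: "L \<times> {\<phi>0} \<subseteq> (?S \<times> UNIV) Int ?f -` U"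
 proof
  fix z assume "z \<in> L \<times> {\<phi>0}"
  then obtain \<tau> where z: "z = (\<tau>, \<phi>0)" "\<tau> \<in> L" by auto
  have \<tau>S: "\<tau> \<in> ?S" by (rule subsetD[OF L(6) z(2)])
  have "point (xs \<tau>) (of_real \<nu> * \<tau> + of_real \<phi>0) \<in> complex_orbit \<nu> xs G \<phi>0"
   unfolding complex_orbit_def using \<tau>S by (intro CollectI exI[of _ \<tau>]) simp
  from SU[OF this] show "z \<in> (?S \<times> UNIV) Int ?f -` U" using \<tau>S by (simp add: z(1))
 qed
 have cL: "compact (L \<times> {\<phi>0})" by (rule compact_Times[OF L(1) compact_sing])
 obtain e where e: "e > 0" "(\<Union>z\<in>L \<times> {\<phi>0}. ball z e) \<subseteq> (?S \<times> UNIV) Int ?f -` U"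
  by (rule compact_subset_open_imp_ball_epsilon_subset[OF cL oV LV]) (rule that)
 obtain \<phi> where \<phi>: "\<phi> \<in> \<Delta>" "\<bar>\<phi> - \<phi>0\<bar> < min \<eta> e"
  by (rule dense_interval[OF dense, of "min \<eta> e" \<phi>0]) (use K(3) e(1) in auto)
 have sub: "path_image (\<gamma> \<phi>) \<subseteq> L" using K(4)[OF \<phi>(1)] \<phi>(2) L(5) by auto
 show False
 proof (rule admissible_no_frame[OF contU E_def frame L(1-4) _ _ _ sub])
  show "L \<subseteq> {\<tau>\<in>\<Theta>. finite_at xs \<tau>}" using L(6) G(2) by blast
  show "with_param (point (xs \<tau>) (of_real \<nu> * \<tau> + of_real \<phi>)) 0 \<in> U" if "\<tau> \<in> L" for \<tau>
  proof -
   have "(\<tau>, \<phi>) \<in> ball (\<tau>, \<phi>0) e" using \<phi>(2) by (simp add: dist_Pair_Pair dist_real_def abs_minus_commute)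
   then have "(\<tau>, \<phi>) \<in> (\<Union>z\<in>L \<times> {\<phi>0}. ball z e)" using that by (intro UN_I[of "(\<tau>, \<phi>0)"]) auto
   then have "(\<tau>, \<phi>) \<in> (?S \<times> UNIV) Int ?f -` U" by (rule subsetD[OF e(2)])
   then show ?thesis by simp
  qed
 qed (use loops[OF \<phi>(1)] in auto)
qed

end

text \<open>In the second part \<open>\<phi>0\<close> may lie outside the dense set, and the loops
  of nearby phases could run off to the boundary of \<open>G\<close> or towards poles. Hence two
  forms of the conclusion: near the orbits of an arbitrarily short interval of phases around
  \<open>\<phi>0\<close>, and near the single orbit when the nearby loops stay in a compact set of
  finite points.\<close>

theorem theorem3p1:
  fixes \<nu> :: real
    and H :: "real^2 \<Rightarrow> real" and u :: "real^3 \<Rightarrow> real^2"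
    and x :: "real \<Rightarrow> real \<Rightarrow> real^2" and T :: "real \<Rightarrow> real"
    and \<alpha>1 \<alpha>2 \<alpha>s T' P :: real and l n :: nat
    and W :: "(complex^2) set" and Hc :: "complex^2 \<Rightarrow> complex"
    and V :: "(complex^3) set" and uc :: "complex^3 \<Rightarrow> complex^2"
    and \<Theta> :: "complex set" and xc :: "complex \<Rightarrow> complex \<Rightarrow> complex^2"
    and xs :: "complex \<Rightarrow> complex^2" and E :: "(complex^(3 option)) set"
  assumes "\<nu> > 0"
    \<comment> \<open>the real-analytic system\<close>
    and "multi_analytic_on H UNIV"
    and "\<And>i. multi_analytic_on (\<lambda>y. u y $ i) UNIV"
    and "\<And>y. u (y + angle_period) = u y"
    \<comment> \<open>the analytic continuations of \<open>H\<close> and \<open>u\<close>\<close>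
    and "analytic_continuation W Hc H"
    and "\<And>i. analytic_continuation V (\<lambda>y. uc y $ i) (\<lambda>y. u y $ i)"
    and "\<And>y. y + angle_period \<in> V \<longleftrightarrow> y \<in> V"
    and "\<And>y. y \<in> V \<Longrightarrow> uc (y + angle_period) = uc y"
    \<comment> \<open>the family of periodic orbits\<close>
    and "\<alpha>1 < \<alpha>2"
    and "\<And>\<alpha> t. \<alpha> \<in> {\<alpha>1<..<\<alpha>2} \<Longrightarrow>
           (x \<alpha> has_vector_derivative Jmat *v grad H (x \<alpha> t)) (at t)"
    and "\<And>\<alpha>. \<alpha> \<in> {\<alpha>1<..<\<alpha>2} \<Longrightarrow> T \<alpha> > 0"
    and "\<And>\<alpha> t. \<alpha> \<in> {\<alpha>1<..<\<alpha>2} \<Longrightarrow> x \<alpha> (t + T \<alpha>) = x \<alpha> t"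
    and "\<And>t i. multi_analytic_on (\<lambda>a::real^1. x (a $ 1) t $ i) {a. a $ 1 \<in> {\<alpha>1<..<\<alpha>2}}"
    \<comment> \<open>resonance\<close>
    and "l > 0" "n > 0" "coprime l n"
    and "\<alpha>s \<in> {\<alpha>1<..<\<alpha>2}"
    and "2 * pi / T \<alpha>s = real n / real l * \<nu>"
    and "(T has_real_derivative T') (at \<alpha>s)" "T' \<noteq> 0"
    and P_def: "P = 2 * pi * real l / \<nu>"
    \<comment> \<open>the analytic continuation of the family \<open>x\<close>, at the resonant parameter value\<close>
    and "open \<Theta>" "connected \<Theta>" "range complex_of_real \<subseteq> \<Theta>"
    and "\<And>\<alpha> t. \<alpha> \<in> {\<alpha>1<..<\<alpha>2} \<Longrightarrow> xc (of_real \<alpha>) (of_real t) = complexify (x \<alpha> t)"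
    and xs_def: "xs = xc (of_real \<alpha>s)"
    and "\<And>i. (\<lambda>\<tau>. xs \<tau> $ i) meromorphic_on \<Theta>"
    and "\<And>\<tau> i. \<tau> \<in> \<Theta> \<Longrightarrow> finite_at xs \<tau> \<Longrightarrow>
           multi_analytic_on (\<lambda>a::complex^2. xc (a $ 1) (a $ 2) $ i) {vector [of_real \<alpha>s, \<tau>]}"
    \<comment> \<open>the set of all \<open>(x, \<phi>, \<epsilon>)\<close> at which the continued system is given\<close>
    and E_def: "E = {p. position (state p) \<in> W \<and> state p \<in> V}"
  shows
    "(\<forall>\<phi>0 \<gamma> G.
        admissible_loop \<nu> P \<Theta> W V xs \<phi>0 \<gamma> \<and> melnikov_integral Hc uc \<nu> xs \<phi>0 \<gamma> \<noteq> 0 \<and>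
        periodic_domain P G \<and> G \<subseteq> \<Theta> \<and> path_image \<gamma> \<subseteq> G \<longrightarrow>
        \<not> meromorphically_integrable_near angle_period E (perturbed_field Hc uc \<nu>)
            (complex_orbit \<nu> xs G \<phi>0)) \<and>
     (\<forall>\<Delta> \<gamma> G.
        closure \<Delta> = UNIV \<and> (\<forall>\<phi>. \<phi> + 2 * pi \<in> \<Delta> \<longleftrightarrow> \<phi> \<in> \<Delta>) \<and>
        (\<forall>\<phi>\<in>\<Delta>. admissible_loop \<nu> P \<Theta> W V xs \<phi> (\<gamma> \<phi>) \<and>
                 melnikov_integral Hc uc \<nu> xs \<phi> (\<gamma> \<phi>) \<noteq> 0) \<and>
        periodic_domain P G \<and> G \<subseteq> \<Theta> \<and> (\<forall>\<phi>\<in>\<Delta>. path_image (\<gamma> \<phi>) \<subseteq> G) \<longrightarrow>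
        (\<forall>\<phi>0.
           (\<forall>\<delta>>0. \<not> meromorphically_integrable_near angle_period E (perturbed_field Hc uc \<nu>)
               (\<Union>\<phi>\<in>{\<phi>0 - \<delta><..<\<phi>0 + \<delta>}. complex_orbit \<nu> xs G \<phi>)) \<and>
           ((\<exists>K \<eta>. compact K \<and> K \<subseteq> {\<tau>\<in>G. finite_at xs \<tau>} \<and> \<eta> > 0 \<and>
                (\<forall>\<phi>\<in>\<Delta>. \<bar>\<phi> - \<phi>0\<bar> < \<eta> \<longrightarrow> path_image (\<gamma> \<phi>) \<subseteq> K)) \<longrightarrow>
            \<not> meromorphically_integrable_near angle_period E (perturbed_field Hc uc \<nu>)
                (complex_orbit \<nu> xs G \<phi>0))))"
  proof -
 interpret resonance \<nu> H x T \<alpha>1 \<alpha>2 \<alpha>s T' P l n W Hc \<Theta> xc xs by unfold_locales (fact assms)+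
 note contU = assms(6) and E = assms(29)
 show ?thesis
 proof (intro conjI allI impI)
  fix \<phi>0 \<gamma> G
  assume "admissible_loop \<nu> P \<Theta> W V xs \<phi>0 \<gamma> & melnikov_integral Hc uc \<nu> xs \<phi>0 \<gamma> ~= 0 &
    periodic_domain P G & G \<subseteq> \<Theta> & path_image \<gamma> \<subseteq> G"
  then show "~ meromorphically_integrable_near angle_period E (perturbed_field Hc uc \<nu>) (complex_orbit \<nu> xs G \<phi>0)"
   by (intro not_integrable_near_orbits[OF contU E, where \<phi> = \<phi>0 and \<gamma> = \<gamma> and G = G]) auto
 next
  fix \<Delta> :: "real set" and \<gamma> G and \<phi>0 \<delta> :: real
  assume *: "closure \<Delta> = UNIV & (\<forall>\<phi>. \<phi> + 2 * pi \<in> \<Delta> \<longleftrightarrow> \<phi> \<in> \<Delta>) &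
    (\<forall>\<phi>\<in>\<Delta>. admissible_loop \<nu> P \<Theta> W V xs \<phi> (\<gamma> \<phi>) &
        melnikov_integral Hc uc \<nu> xs \<phi> (\<gamma> \<phi>) ~= 0) &
    periodic_domain P G & G \<subseteq> \<Theta> & (\<forall>\<phi>\<in>\<Delta>. path_image (\<gamma> \<phi>) \<subseteq> G)" and \<delta>: "\<delta> > 0"
  \<comment> \<open>Some phase of the dense set lies in the interval, and its own orbit is part of
    the union.\<close>
  have "closure \<Delta> = UNIV" using * by blast
  then obtain \<phi> where \<phi>: "\<phi> \<in> \<Delta>" "\<bar>\<phi> - \<phi>0\<bar> < \<delta>"
   by (rule dense_interval[OF _ \<delta>]) (rule that)
  then have "\<phi> \<in> {\<phi>0 - \<delta><..<\<phi>0 + \<delta>}" by auto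
  then have "complex_orbit \<nu> xs G \<phi> \<subseteq> (\<Union>\<phi>\<in>{\<phi>0 - \<delta><..<\<phi>0 + \<delta>}. complex_orbit \<nu> xs G \<phi>)" by blast
  then show "~ meromorphically_integrable_near angle_period E (perturbed_field Hc uc \<nu>)
       (\<Union>\<phi>\<in>{\<phi>0 - \<delta><..<\<phi>0 + \<delta>}. complex_orbit \<nu> xs G \<phi>)"
   by (rule not_integrable_near_orbits[OF contU E, rotated -1]) (use * \<phi>(1) in auto)
 next
  fix \<Delta> :: "real set" and \<gamma> G and \<phi>0 :: real
  assume *: "closure \<Delta> = UNIV & (\<forall>\<phi>. \<phi> + 2 * pi \<in> \<Delta> \<longleftrightarrow> \<phi> \<in> \<Delta>) &
    (\<forall>\<phi>\<in>\<Delta>. admissible_loop \<nu> P \<Theta> W V xs \<phi> (\<gamma> \<phi>) &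
        melnikov_integral Hc uc \<nu> xs \<phi> (\<gamma> \<phi>) ~= 0) &
    periodic_domain P G & G \<subseteq> \<Theta> & (\<forall>\<phi>\<in>\<Delta>. path_image (\<gamma> \<phi>) \<subseteq> G)"
   and "\<exists>K \<eta>. compact K & K \<subseteq> {\<tau>\<in>G. finite_at xs \<tau>} & \<eta> > 0 &
        (\<forall>\<phi>\<in>\<Delta>. \<bar>\<phi> - \<phi>0\<bar> < \<eta> --> path_image (\<gamma> \<phi>) \<subseteq> K)"
  then obtain K \<eta> where K: "compact K" "K \<subseteq> {\<tau>\<in>G. finite_at xs \<tau>}" "\<eta> > 0"
   "\<forall>\<phi>\<in>\<Delta>. \<bar>\<phi> - \<phi>0\<bar> < \<eta> --> path_image (\<gamma> \<phi>) \<subseteq> K" by blast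
  show "~ meromorphically_integrable_near angle_period E (perturbed_field Hc uc \<nu>) (complex_orbit \<nu> xs G \<phi>0)"
   by (rule not_integrable_near_torus_orbit[OF contU E, where \<Delta> = \<Delta> and \<gamma> = \<gamma> and K = K and \<eta> = \<eta>]) (use * K in auto)
 qed
qed

end
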